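(* Let $n\ge3$, $m\in\mathbb N_0$, $0<\alpha<1$, let $\Omega\subset\mathbb R^n$ be a bounded connected domain with $C^{m+2,\alpha}$ boundary, and let $a_1,a_2\in C^{2m+1,\alpha}(\overline\Omega\times\mathbb R\times\mathbb R^n)$ be positive nonlinearities. Assume that the $a_j$ are independent of the $p$-variable, i.e. $a_j=a_j(x,z)$, $j=1,2$, that $$a_j\Big(x,\frac{|x|^2}{2}\Big)=1\quad\text{in }\Omega,$$ and that $$q_j:=\partial_za_j\Big(x,\frac{|x|^2}{2}\Big)\ge0\quad\text{in }\Omega.$$ Let $\Phi(x)=|x|^2/2$ and $\phi=\Phi|_{\partial\Omega}$. Assume that the nonlinear Cauchy data sets agree near the background, $$\mathscr C_{a_1}^{(\phi,\partial_\nu\Phi|_{\partial\Omega})}=\mathscr C_{a_2}^{(\phi,\partial_\nu\Phi|_{\partial\Omega})}.$$ Then, for every integer $k$ with $1\le k\le m+1$, $$\partial_z^ka_1\Big(x,\frac{|x|^2}{2}\Big)=\partial_z^ka_2\Big(x,\frac{|x|^2}{2}\Big)\quad\text{in }\Omega.$$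
   Context: Nonlinearities are written $a=a(x,z,p)$, $x\in\overline\Omega$, $z\in\mathbb R$, $p\in\mathbb R^n$. The function $\Phi(x)=|x|^2/2$ solves $\det D^2\Phi=1=a_j(x,\Phi)$ for $j=1,2$. $C^{k,\alpha}(\overline\Omega)$ is the usual Hölder space (norms required finite on unbounded sets); $C^{k,\alpha}(\partial\Omega)$ carries the quotient norm over extensions. $\nu$ is the exterior unit normal and $\partial_\nu$ the normal derivative. Nonlinear Cauchy data set: for $a=a_j$, local well-posedness provides $\delta>0$ and a neighbourhood $V$ of $\Phi$ in $C^{m+2,\alpha}(\overline\Omega)$ such that for every $\eta\in C^{m+2,\alpha}(\partial\Omega)$ with $\|\eta-\phi\|_{C^{m+2,\alpha}(\partial\Omega)}<\delta$ the problem $\det D^2u=a(x,u,\nabla u)$ in $\Omega$, $u=\eta$ on $\partial\Omega$ has a unique solution $u_\eta\in V$, and $\eta\mapsto u_\eta$ is of class $C^{m+1}$ (Fréchet, into $C^{m+2,\alpha}(\overline\Omega)$) near $\phi$ with $u_\phi=\Phi$. Then $$\mathscr C_a^{(\phi,\partial_\nu\Phi|_{\partial\Omega})}=\{(\eta,\partial_\nu u_\eta|_{\partial\Omega}):\ \|\eta-\phi\|_{C^{m+2,\alpha}(\partial\Omega)}<\delta\}\subset C^{m+2,\alpha}(\partial\Omega)\times C^{m+1,\alpha}(\partial\Omega).$$ *)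

theory Defs
  imports "HOL-Analysis.Analysis"
begin

section \<open>Hoelder spaces\<close>

text \<open>Multi-indices are lists of basis vectors; for functions of class C^k the order of the
  entries is immaterial.\<close>

fun pderivs :: "'a list \<Rightarrow> ('a::euclidean_space \<Rightarrow> real) \<Rightarrow> 'a \<Rightarrow> real" where
  "pderivs [] f = f"
| "pderivs (e # es) f = (\<lambda>x. frechet_derivative (pderivs es f) (at x) e)"

text \<open>For open D, this is membership in C^(k,alpha)(closure D). Derivatives are taken in D only;
  those of order at most k are bounded and extend continuously to the closure, and those of
  order k are uniformly alpha-Hoelder. Values of f outside the closure of D do not matter.\<close>

definition holder_on :: "nat \<Rightarrow> real \<Rightarrow> 'a::euclidean_space set \<Rightarrow> ('a \<Rightarrow> real) \<Rightarrow> bool" where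
  "holder_on k \<alpha> D f \<longleftrightarrow>
     continuous_on (closure D) f \<and>
     (\<forall>es. set es \<subseteq> Basis \<and> length es < k \<longrightarrow> (\<forall>x\<in>D. pderivs es f differentiable (at x))) \<and>
     (\<forall>es. set es \<subseteq> Basis \<and> length es \<le> k \<longrightarrow>
        (\<exists>g. continuous_on (closure D) g \<and> (\<forall>x\<in>D. g x = pderivs es f x)) \<and>
        bounded (pderivs es f ` D)) \<and>
     (\<forall>es. set es \<subseteq> Basis \<and> length es = k \<longrightarrow>
        (\<exists>C. \<forall>x\<in>D. \<forall>y\<in>D. \<bar>pderivs es f x - pderivs es f y\<bar> \<le> C * dist x y powr \<alpha>))"

text \<open>The suprema are finite, hence meaningful, for functions satisfying \<open>holder_on\<close>.\<close>

definition holder_norm :: "nat \<Rightarrow> real \<Rightarrow> 'a::euclidean_space set \<Rightarrow> ('a \<Rightarrow> real) \<Rightarrow> real" where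
  "holder_norm k \<alpha> D f =
     (\<Sum>es | set es \<subseteq> Basis \<and> length es \<le> k. SUP x\<in>D. \<bar>pderivs es f x\<bar>) +
     (\<Sum>es | set es \<subseteq> Basis \<and> length es = k.
        SUP (x, y)\<in>{(x, y). x \<in> D \<and> y \<in> D \<and> x \<noteq> y}.
          \<bar>pderivs es f x - pderivs es f y\<bar> / dist x y powr \<alpha>)"

text \<open>A function on a set S is represented by its extension by zero outside S, so that equality
  of functions on S is HOL equality and the function spaces are closed under pointwise
  operations.\<close>

definition on_set :: "'a set \<Rightarrow> ('a \<Rightarrow> real) \<Rightarrow> 'a \<Rightarrow> real" where
  "on_set S f = (\<lambda>x. if x \<in> S then f x else 0)"

definition holder_space :: "nat \<Rightarrow> real \<Rightarrow> 'a::euclidean_space set \<Rightarrow> ('a \<Rightarrow> real) set" where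
  "holder_space k \<alpha> D = {f. holder_on k \<alpha> D f \<and> (\<forall>x. x \<notin> closure D \<longrightarrow> f x = 0)}"

definition bdry_space :: "nat \<Rightarrow> real \<Rightarrow> 'a::euclidean_space set \<Rightarrow> ('a \<Rightarrow> real) set" where
  "bdry_space k \<alpha> D = on_set (frontier D) ` holder_space k \<alpha> D"

definition bdry_norm :: "nat \<Rightarrow> real \<Rightarrow> 'a::euclidean_space set \<Rightarrow> ('a \<Rightarrow> real) \<Rightarrow> real" where
  "bdry_norm k \<alpha> D g =
     Inf (holder_norm k \<alpha> D ` {f \<in> holder_space k \<alpha> D. on_set (frontier D) f = g})"

section \<open>Domains with Hoelder boundary, exterior normal\<close>

text \<open>Near each boundary point the domain is a strict epigraph over the hyperplane orthogonal to
  some unit vector e; a function on that hyperplane is a function on the whole space that is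
  constant in direction e.\<close>

definition holder_boundary :: "nat \<Rightarrow> real \<Rightarrow> 'a::euclidean_space set \<Rightarrow> bool" where
  "holder_boundary k \<alpha> \<Omega> \<longleftrightarrow>
     (\<forall>x0\<in>frontier \<Omega>. \<exists>r>0. \<exists>e \<gamma>. norm e = 1 \<and> holder_on k \<alpha> UNIV \<gamma> \<and>
        (\<forall>x t. \<gamma> (x + t *\<^sub>R e) = \<gamma> x) \<and>
        \<Omega> \<inter> ball x0 r = {x \<in> ball x0 r. \<gamma> x < x \<bullet> e})"

definition tangent_vectors :: "'a::real_normed_vector set \<Rightarrow> 'a \<Rightarrow> 'a set" where
  "tangent_vectors S x =
     {v. \<exists>c :: real \<Rightarrow> 'a. c 0 = x \<and> (\<forall>t. c t \<in> S) \<and> (c has_vector_derivative v) (at 0)}"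

definition ext_normal :: "'a::euclidean_space set \<Rightarrow> 'a \<Rightarrow> 'a" where
  "ext_normal \<Omega> x =
     (THE \<nu>. norm \<nu> = 1 \<and> (\<forall>v\<in>tangent_vectors (frontier \<Omega>) x. \<nu> \<bullet> v = 0) \<and>
        (\<exists>\<epsilon>>0. \<forall>t. 0 < t \<and> t < \<epsilon> \<longrightarrow> x + t *\<^sub>R \<nu> \<notin> closure \<Omega> \<and> x - t *\<^sub>R \<nu> \<in> \<Omega>))"

text \<open>The boundary value of the gradient is its continuous extension from the interior.\<close>

definition normal_deriv :: "'a::euclidean_space set \<Rightarrow> ('a \<Rightarrow> real) \<Rightarrow> 'a \<Rightarrow> real" where
  "normal_deriv \<Omega> u =
     on_set (frontier \<Omega>)
       (\<lambda>x. \<Sum>e\<in>Basis. (ext_normal \<Omega> x \<bullet> e) * Lim (at x within \<Omega>) (pderivs [e] u))"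

section \<open>Frechet differentiability between spaces of functions\<close>

definition bounded_multilinear ::
  "('a \<Rightarrow> real) set \<Rightarrow> (('a \<Rightarrow> real) \<Rightarrow> real) \<Rightarrow> ('b \<Rightarrow> real) set \<Rightarrow> (('b \<Rightarrow> real) \<Rightarrow> real) \<Rightarrow>
   nat \<Rightarrow> (('a \<Rightarrow> real) list \<Rightarrow> 'b \<Rightarrow> real) \<Rightarrow> bool" where
  "bounded_multilinear X NX Y NY j T \<longleftrightarrow>
     (\<forall>hs. set hs \<subseteq> X \<and> length hs = j \<longrightarrow> T hs \<in> Y) \<and>
     (\<forall>hs i f g b c. set hs \<subseteq> X \<and> length hs = j \<and> i < j \<and> f \<in> X \<and> g \<in> X \<longrightarrow>
        T (hs[i := (\<lambda>x. b * f x + c * g x)]) =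
          (\<lambda>y. b * T (hs[i := f]) y + c * T (hs[i := g]) y)) \<and>
     (\<exists>C. \<forall>hs. set hs \<subseteq> X \<and> length hs = j \<longrightarrow> NY (T hs) \<le> C * prod_list (map NX hs))"

text \<open>F is of class C^k on U, a subset of the normed space (X, NX) that is open in it, with values
  in the normed space (Y, NY). D j x is the j-th Frechet derivative of F at x, as a bounded
  j-linear map; the inequalities are convergence in the operator norm of j-linear maps.\<close>

definition frechet_Ck_on ::
  "nat \<Rightarrow> ('a \<Rightarrow> real) set \<Rightarrow> (('a \<Rightarrow> real) \<Rightarrow> real) \<Rightarrow> ('b \<Rightarrow> real) set \<Rightarrow> (('b \<Rightarrow> real) \<Rightarrow> real) \<Rightarrow>
   ('a \<Rightarrow> real) set \<Rightarrow> (('a \<Rightarrow> real) \<Rightarrow> 'b \<Rightarrow> real) \<Rightarrow> bool" where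
  "frechet_Ck_on k X NX Y NY U F \<longleftrightarrow>
     (\<exists>D :: nat \<Rightarrow> ('a \<Rightarrow> real) \<Rightarrow> ('a \<Rightarrow> real) list \<Rightarrow> 'b \<Rightarrow> real.
        (\<forall>x\<in>U. D 0 x [] = F x) \<and>
        (\<forall>j\<le>k. \<forall>x\<in>U. bounded_multilinear X NX Y NY j (D j x)) \<and>
        (\<forall>j<k. \<forall>x\<in>U. \<forall>\<epsilon>>0. \<exists>r>0. \<forall>h\<in>X. NX h < r \<and> (\<lambda>s. x s + h s) \<in> U \<longrightarrow>
           (\<forall>hs. set hs \<subseteq> X \<and> length hs = j \<longrightarrow>
              NY (\<lambda>y. D j (\<lambda>s. x s + h s) hs y - D j x hs y - D (Suc j) x (h # hs) y)
                \<le> \<epsilon> * NX h * prod_list (map NX hs))) \<and>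
        (\<forall>x\<in>U. \<forall>\<epsilon>>0. \<exists>r>0. \<forall>h\<in>X. NX h < r \<and> (\<lambda>s. x s + h s) \<in> U \<longrightarrow>
           (\<forall>hs. set hs \<subseteq> X \<and> length hs = k \<longrightarrow>
              NY (\<lambda>y. D k (\<lambda>s. x s + h s) hs y - D k x hs y) \<le> \<epsilon> * prod_list (map NX hs))))"

section \<open>The Dirichlet problem and its nonlinear Cauchy data\<close>

definition gradient :: "(real ^ 'n \<Rightarrow> real) \<Rightarrow> real ^ 'n \<Rightarrow> real ^ 'n" where
  "gradient u x = (\<chi> i. pderivs [axis i 1] u x)"

definition hessian :: "(real ^ 'n \<Rightarrow> real) \<Rightarrow> real ^ 'n \<Rightarrow> real ^ 'n ^ 'n" where
  "hessian u x = (\<chi> i j. pderivs [axis i 1, axis j 1] u x)"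

definition \<Phi> :: "real ^ 'n \<Rightarrow> real" where
  "\<Phi> x = (norm x)\<^sup>2 / 2"

definition MA_solves ::
  "(real ^ 'n) set \<Rightarrow> ((real ^ 'n) \<times> real \<times> (real ^ 'n) \<Rightarrow> real) \<Rightarrow>
   (real ^ 'n \<Rightarrow> real) \<Rightarrow> (real ^ 'n \<Rightarrow> real) \<Rightarrow> bool" where
  "MA_solves \<Omega> a \<eta> u \<longleftrightarrow>
     (\<forall>x\<in>\<Omega>. det (hessian u x) = a (x, u x, gradient u x)) \<and> (\<forall>x\<in>frontier \<Omega>. u x = \<eta> x)"

definition bdry_ball ::
  "nat \<Rightarrow> real \<Rightarrow> (real ^ 'n) set \<Rightarrow> real \<Rightarrow> (real ^ 'n \<Rightarrow> real) set" where
  "bdry_ball k \<alpha> \<Omega> \<delta> =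
     {\<eta> \<in> bdry_space k \<alpha> \<Omega>. bdry_norm k \<alpha> \<Omega> (\<lambda>x. \<eta> x - on_set (frontier \<Omega>) \<Phi> x) < \<delta>}"

definition MA_solution ::
  "(real ^ 'n) set \<Rightarrow> ((real ^ 'n) \<times> real \<times> (real ^ 'n) \<Rightarrow> real) \<Rightarrow> (real ^ 'n \<Rightarrow> real) set \<Rightarrow>
   (real ^ 'n \<Rightarrow> real) \<Rightarrow> real ^ 'n \<Rightarrow> real" where
  "MA_solution \<Omega> a V \<eta> = (THE u. u \<in> V \<and> MA_solves \<Omega> a \<eta> u)"

text \<open>\<open>\<delta>\<close> and \<open>V\<close> are admissible in the local well-posedness of the Dirichlet problem near
  \<open>\<Phi>\<close>: V is a neighbourhood of \<open>\<Phi>\<close>, not necessarily open.\<close>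

definition locally_wellposed ::
  "nat \<Rightarrow> real \<Rightarrow> (real ^ 'n) set \<Rightarrow> ((real ^ 'n) \<times> real \<times> (real ^ 'n) \<Rightarrow> real) \<Rightarrow>
   real \<Rightarrow> (real ^ 'n \<Rightarrow> real) set \<Rightarrow> bool" where
  "locally_wellposed m \<alpha> \<Omega> a \<delta> V \<longleftrightarrow>
     0 < \<delta> \<and>
     V \<subseteq> holder_space (m + 2) \<alpha> \<Omega> \<and>
     (\<exists>\<epsilon>>0. {u \<in> holder_space (m + 2) \<alpha> \<Omega>.
        holder_norm (m + 2) \<alpha> \<Omega> (\<lambda>x. u x - on_set (closure \<Omega>) \<Phi> x) < \<epsilon>} \<subseteq> V) \<and>
     (\<forall>\<eta>\<in>bdry_ball (m + 2) \<alpha> \<Omega> \<delta>. \<exists>!u. u \<in> V \<and> MA_solves \<Omega> a \<eta> u) \<and>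
     MA_solution \<Omega> a V (on_set (frontier \<Omega>) \<Phi>) = on_set (closure \<Omega>) \<Phi> \<and>
     (\<exists>\<epsilon>. 0 < \<epsilon> \<and> \<epsilon> \<le> \<delta> \<and>
        frechet_Ck_on (m + 1)
          (bdry_space (m + 2) \<alpha> \<Omega>) (bdry_norm (m + 2) \<alpha> \<Omega>)
          (holder_space (m + 2) \<alpha> \<Omega>) (holder_norm (m + 2) \<alpha> \<Omega>)
          (bdry_ball (m + 2) \<alpha> \<Omega> \<epsilon>) (MA_solution \<Omega> a V))"

definition cauchy_data ::
  "nat \<Rightarrow> real \<Rightarrow> (real ^ 'n) set \<Rightarrow> ((real ^ 'n) \<times> real \<times> (real ^ 'n) \<Rightarrow> real) \<Rightarrow>
   real \<Rightarrow> (real ^ 'n \<Rightarrow> real) set \<Rightarrow> ((real ^ 'n \<Rightarrow> real) \<times> (real ^ 'n \<Rightarrow> real)) set" where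
  "cauchy_data m \<alpha> \<Omega> a \<delta> V =
     (\<lambda>\<eta>. (\<eta>, normal_deriv \<Omega> (MA_solution \<Omega> a V \<eta>))) ` bdry_ball (m + 2) \<alpha> \<Omega> \<delta>"

end

theory Submission
  imports Defs
begin

text \<open>
  The k-th derivatives in t of the two solutions with boundary values \<open>\<phi> + t h\<close> have the same
  Cauchy data.  By induction the derivatives of lower order coincide, and the difference of those
  of order k solves \<open>\<Delta> u - q\<^sub>1 u = f w\<^sup>k\<close>, where f is the difference of the
  k-th z-derivatives of the nonlinearities at the background and w solves the linearised equation
  with boundary value h.  Integrating against solutions v of \<open>\<Delta> v = q\<^sub>1 v\<close>
  gives \<open>\<integral> f w\<^sup>k v = 0\<close>, and polarisation together with the density of products of
  solutions gives \<open>f = 0\<close>.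

  Density is proved with complex geometrical optics solutions
  \<open>exp (\<zeta> \<bullet> x) (1 + r)\<close> with \<open>\<zeta> \<bullet> \<zeta> = 0\<close>.  On a shifted lattice
  the symbol of \<open>\<Delta> + 2 \<zeta> \<bullet> \<nabla>\<close> is bounded below by a multiple of
  \<open>\<bar>\<zeta>\<bar>\<close> (Haehner), so that r can be chosen as a trigonometric polynomial solving the
  equation up to an arbitrarily small residual.  The true solution with the same boundary values is
  close to it in \<open>L\<^sup>2\<close> by the energy estimate, which needs \<open>q \<ge> 0\<close>; therefore no
  elliptic regularity theory is required.
\<close>

section \<open>Integration of bounded continuous functions\<close>

text \<open>The background has the identity as Hessian, so the determinant linearises to the
  Laplacian. The equation is never differentiated k times: differences of solutions are divided by
  powers of t, and only the first order that can differ is expanded. The dimension n >= 3 provides a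
  direction orthogonal both to the frequency under test and to the direction of growth; the latter
  is an integer vector, so that its products with the shifted frequencies are half-integer multiples
  of the lattice scale, never zero. Two choices make density work: the residual of an approximate
  solution is fixed after its exponential weight, which it therefore absorbs, and the energy
  constant depends on the domain alone. For k >= 2, density first gives \<open>f w^(k-1) = 0\<close>
  for every solution w. At each point f or w then vanishes, so \<open>f w v = 0\<close>, and a
  second use of density gives \<open>f = 0\<close> whatever the zeros of w are. Regularity of the
  boundary enters where the full boundary gradient is recovered from the normal derivative;
  integration by parts takes place on an arbitrary bounded open set, because all boundary terms
  involved are zero.\<close>

abbreviation lint :: "'a::euclidean_space set \<Rightarrow> ('a \<Rightarrow> 'b) \<Rightarrow> 'b::{banach, second_countable_topology}"
  where "lint S f \<equiv> integral\<^sup>L (restrict_space lborel S) f"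

text \<open>The class of integrands used throughout: over a bounded Borel set such functions are
  integrable, and the class is closed under algebraic operations, so integrability is discharged by
  introduction rules alone.\<close>

definition bcont :: "'a::topological_space set \<Rightarrow> ('a \<Rightarrow> 'b::real_normed_vector) \<Rightarrow> bool" where
  "bcont S f \<longleftrightarrow> continuous_on S f \<and> bounded (f ` S)"

lemma bcontI: "continuous_on S f \<Longrightarrow> (\<And>x. x \<in> S \<Longrightarrow> norm (f x) \<le> B) \<Longrightarrow> bcont S f"
  unfolding bcont_def bounded_iff by auto

lemma bcontE: assumes "bcont S f" obtains B where "0 < B" "\<And>x. x \<in> S \<Longrightarrow> norm (f x) \<le> B"
  using assms unfolding bcont_def bounded_pos by auto

lemma bcont_cong: "(\<And>x. x \<in> S \<Longrightarrow> f x = g x) \<Longrightarrow> bcont S f \<longleftrightarrow> bcont S g"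
  unfolding bcont_def by (metis continuous_on_cong image_cong)

lemma bcont_const [simp, intro]: "bcont S (\<lambda>x. c)"
  by (rule bcontI[of _ _ "norm c"]) auto

lemma bcont_add [intro]: "bcont S f \<Longrightarrow> bcont S g \<Longrightarrow> bcont S (\<lambda>x. f x + g x)"
  unfolding bcont_def by (auto intro!: continuous_intros bounded_plus_comp)

lemma bcont_minus [intro]: "bcont S f \<Longrightarrow> bcont S (\<lambda>x. - f x)"
  unfolding bcont_def bounded_iff by (auto intro!: continuous_intros)

lemma bcont_diff [intro]: "bcont S f \<Longrightarrow> bcont S g \<Longrightarrow> bcont S (\<lambda>x. f x - g x)"
  using bcont_add[of S f "\<lambda>x. - g x"] bcont_minus[of S g] by simp

lemma bcont_mult [intro]:
  fixes f g :: "'a::topological_space \<Rightarrow> 'b::real_normed_algebra"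
  assumes "bcont S f" "bcont S g" shows "bcont S (\<lambda>x. f x * g x)"
proof -
  obtain A where A: "0 < A" "\<And>x. x \<in> S \<Longrightarrow> norm (f x) \<le> A" using assms(1) by (rule bcontE) blast
  obtain B where B: "0 < B" "\<And>x. x \<in> S \<Longrightarrow> norm (g x) \<le> B" using assms(2) by (rule bcontE) blast
  show ?thesis
  proof (rule bcontI[of _ _ "A * B"])
    show "continuous_on S (\<lambda>x. f x * g x)" using assms by (auto simp: bcont_def intro!: continuous_intros)
    fix x assume "x \<in> S"
    then show "norm (f x * g x) \<le> A * B"
      using A B by (intro order_trans[OF norm_mult_ineq] mult_mono) auto
  qed
qed

lemma bcont_power [intro]:
  fixes f :: "'a::topological_space \<Rightarrow> 'b::real_normed_algebra_1"
  shows "bcont S f \<Longrightarrow> bcont S (\<lambda>x. f x ^ n)"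
  by (induction n) auto

lemma bcont_sum [intro]: "(\<And>i. i \<in> I \<Longrightarrow> bcont S (f i)) \<Longrightarrow> bcont S (\<lambda>x. \<Sum>i\<in>I. f i x)"
  by (induction I rule: infinite_finite_induct) auto

lemma bcont_bounded_linear: "bounded_linear L \<Longrightarrow> bcont S f \<Longrightarrow> bcont S (\<lambda>x. L (f x))"
  unfolding bcont_def
  by (metis bounded_linear.continuous_on bounded_linear_image image_image)

lemma bcont_Re [intro]: "bcont S f \<Longrightarrow> bcont S (\<lambda>x. Re (f x))"
  by (rule bcont_bounded_linear[OF bounded_linear_Re])

lemma bcont_Im [intro]: "bcont S f \<Longrightarrow> bcont S (\<lambda>x. Im (f x))"
  by (rule bcont_bounded_linear[OF bounded_linear_Im])

lemma bcont_of_real [intro]: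
  fixes f :: "'a::topological_space \<Rightarrow> real"
  shows "bcont S f \<Longrightarrow> bcont S (\<lambda>x. of_real (f x) :: complex)"
  by (rule bcont_bounded_linear[OF bounded_linear_of_real])

lemma bcont_norm [intro]: "bcont S f \<Longrightarrow> bcont S (\<lambda>x. norm (f x))"
  unfolding bcont_def bounded_iff by (auto intro!: continuous_intros)

lemma bcont_subset: "bcont T f \<Longrightarrow> S \<subseteq> T \<Longrightarrow> bcont S f"
  unfolding bcont_def by (meson bounded_subset continuous_on_subset image_mono)

lemma bcont_compact: "compact K \<Longrightarrow> continuous_on K f \<Longrightarrow> S \<subseteq> K \<Longrightarrow> bcont S f"
  by (rule bcont_subset[of K]) (auto simp: bcont_def compact_continuous_image compact_imp_bounded)

lemmas bcont_intros = bcont_const bcont_add bcont_diff bcont_minus bcont_mult bcont_power bcont_sum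
  bcont_Re bcont_Im bcont_of_real bcont_norm

section \<open>Integrals over bounded Borel sets\<close>

definition bounded_borel :: "'a::euclidean_space set \<Rightarrow> bool" where
  "bounded_borel S \<longleftrightarrow> S \<in> sets borel \<and> bounded S"

lemma space_lb [simp]: "space (restrict_space lborel S) = S"
  by (simp add: space_restrict_space)

lemma finite_measure_lb: assumes "bounded_borel S" shows "finite_measure (restrict_space lborel S)"
proof
  have "emeasure (restrict_space lborel S) S = emeasure lborel S"
    using assms by (intro emeasure_restrict_space) (auto simp: bounded_borel_def)
  also have "\<dots> < \<infinity>" using assms emeasure_bounded_finite by (auto simp: bounded_borel_def)
  finally show "emeasure (restrict_space lborel S) (space (restrict_space lborel S)) \<noteq> \<infinity>" by simp
qed

lemma measurable_lb: "continuous_on S f \<Longrightarrow> f \<in> borel_measurable (restrict_space lborel S)"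
  using borel_measurable_continuous_on_restrict[of S f]
  unfolding measurable_cong_sets[OF sets_restrict_space_cong[OF sets_lborel] refl] .

lemma integrable_lb [intro]:
  fixes f :: "'a::euclidean_space \<Rightarrow> 'b::{banach, second_countable_topology}"
  assumes "bounded_borel S" "bcont S f" shows "integrable (restrict_space lborel S) f"
proof -
  obtain A where A: "\<And>x. x \<in> S \<Longrightarrow> norm (f x) \<le> A" using assms(2) by (rule bcontE) blast
  show ?thesis
  proof (rule finite_measure.integrable_const_bound[OF finite_measure_lb[OF assms(1)], of _ A])
    show "AE x in restrict_space lborel S. norm (f x) \<le> A" by (rule AE_I2) (simp add: A)
    show "f \<in> borel_measurable (restrict_space lborel S)"
      using assms(2) by (intro measurable_lb) (simp add: bcont_def)
  qed
qed

lemma lint_cong: "(\<And>x. x \<in> S \<Longrightarrow> f x = g x) \<Longrightarrow> lint S f = lint S g"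
  by (rule Bochner_Integration.integral_cong) auto

lemma lint_add:
  fixes f g :: "'a::euclidean_space \<Rightarrow> 'b::{banach, second_countable_topology}"
  assumes "bounded_borel S" "bcont S f" "bcont S g"
  shows "lint S (\<lambda>x. f x + g x) = lint S f + lint S g"
  using assms by (intro Bochner_Integration.integral_add) auto

lemma lint_diff:
  fixes f g :: "'a::euclidean_space \<Rightarrow> 'b::{banach, second_countable_topology}"
  assumes "bounded_borel S" "bcont S f" "bcont S g"
  shows "lint S (\<lambda>x. f x - g x) = lint S f - lint S g"
  using assms by (intro Bochner_Integration.integral_diff) auto

lemma lint_cmult: fixes c :: "'b::{real_normed_field, banach, second_countable_topology}"
  shows "lint S (\<lambda>x. c * f x) = c * lint S f"
  by (rule integral_mult_right_zero)

lemma lint_sum: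
  fixes f :: "'i \<Rightarrow> 'a::euclidean_space \<Rightarrow> 'b::{banach, second_countable_topology}"
  assumes "bounded_borel S" "\<And>i. i \<in> I \<Longrightarrow> bcont S (f i)"
  shows "lint S (\<lambda>x. \<Sum>i\<in>I. f i x) = (\<Sum>i\<in>I. lint S (f i))"
  using assms by (intro Bochner_Integration.integral_sum) auto

lemma lint_mono:
  fixes f g :: "'a::euclidean_space \<Rightarrow> real"
  assumes "bounded_borel S" "bcont S f" "bcont S g" "\<And>x. x \<in> S \<Longrightarrow> f x \<le> g x"
  shows "lint S f \<le> lint S g"
  using assms by (intro integral_mono) auto

lemma lint_nonneg:
  fixes f :: "'a::euclidean_space \<Rightarrow> real"
  assumes "\<And>x. x \<in> S \<Longrightarrow> 0 \<le> f x"
  shows "0 \<le> lint S f"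
  using assms by (intro integral_nonneg_AE AE_I2) auto

lemma lint_norm_le:
  fixes f :: "'a::euclidean_space \<Rightarrow> 'b::{banach, second_countable_topology}"
  shows "norm (lint S f) \<le> lint S (\<lambda>x. norm (f x))"
  by (rule integral_norm_bound)

text \<open>The quadratic \<open>t\<^sup>2 * A + 2 * t * B + C\<close> is the integral of a square,
  hence nonnegative for all t; its minimum gives the bound. For \<open>A = 0\<close> it degenerates
  to a line, which is why that case is separate.\<close>

lemma lint_Cauchy_Schwarz:
  fixes f g :: "'a::euclidean_space \<Rightarrow> real"
  assumes S: "bounded_borel S" and f: "bcont S f" and g: "bcont S g"
  shows "(lint S (\<lambda>x. f x * g x))\<^sup>2 \<le> lint S (\<lambda>x. (f x)\<^sup>2) * lint S (\<lambda>x. (g x)\<^sup>2)"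
proof -
  define A B C where "A = lint S (\<lambda>x. (f x)\<^sup>2)" and "B = lint S (\<lambda>x. f x * g x)" and "C = lint S (\<lambda>x. (g x)\<^sup>2)"
  have A0: "A \<ge> 0" and C0: "C \<ge> 0" unfolding A_def C_def by (auto intro: lint_nonneg)
  have *: "0 \<le> t\<^sup>2 * A + 2 * t * B + C" for t
  proof -
    have "0 \<le> lint S (\<lambda>x. (t * f x + g x)\<^sup>2)" by (rule lint_nonneg) auto
    also have "\<dots> = lint S (\<lambda>x. (t\<^sup>2 * (f x)\<^sup>2 + (2 * t) * (f x * g x)) + (g x)\<^sup>2)"
      by (rule lint_cong) (simp add: power2_eq_square algebra_simps)
    also have "\<dots> = t\<^sup>2 * A + 2 * t * B + C"
      unfolding A_def B_def C_def using f g by (simp add: lint_add[OF S] bcont_intros)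
    finally show ?thesis .
  qed
  show ?thesis
  proof (cases "A = 0")
    case True
    have "B = 0"
    proof (rule ccontr)
      assume "B \<noteq> 0"
      \<comment> \<open>At this t the linear function takes the value -1.\<close>
      have "0 \<le> 2 * (- (C + 1) / (2 * B)) * B + C" using *[of "- (C + 1) / (2 * B)"] True by simp
      then show False using \<open>B \<noteq> 0\<close> C0 by (simp add: field_simps)
    qed
    then show ?thesis using True A_def B_def by simp
  next
    case False
    then have "A > 0" using A0 by simp
    have "0 \<le> (- B / A)\<^sup>2 * A + 2 * (- B / A) * B + C" by (rule *)
    also have "\<dots> = C - B\<^sup>2 / A" using False by (simp add: field_simps power2_eq_square)
    finally have "B\<^sup>2 / A \<le> C" by simp
    then show ?thesis using \<open>A > 0\<close> unfolding A_def[symmetric] B_def[symmetric] C_def[symmetric]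
      by (simp add: field_simps)
  qed
qed

lemma lint_norm_mult_le:
  fixes f g :: "'a::euclidean_space \<Rightarrow> 'b::{real_normed_field, banach, second_countable_topology}"
  assumes S: "bounded_borel S" and f: "bcont S f" and g: "bcont S g"
    and F: "lint S (\<lambda>x. (norm (f x))\<^sup>2) \<le> F\<^sup>2" and G: "lint S (\<lambda>x. (norm (g x))\<^sup>2) \<le> G\<^sup>2"
    and "0 \<le> F" "0 \<le> G"
  shows "lint S (\<lambda>x. norm (f x) * norm (g x)) \<le> F * G"
proof (rule power2_le_imp_le)
  have "(lint S (\<lambda>x. norm (f x) * norm (g x)))\<^sup>2 \<le> lint S (\<lambda>x. (norm (f x))\<^sup>2) * lint S (\<lambda>x. (norm (g x))\<^sup>2)"
    by (rule lint_Cauchy_Schwarz) (use assms in auto)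
  also have "\<dots> \<le> F\<^sup>2 * G\<^sup>2" using F G by (intro mult_mono) (auto intro: lint_nonneg)
  finally show "(lint S (\<lambda>x. norm (f x) * norm (g x)))\<^sup>2 \<le> (F * G)\<^sup>2" by (simp add: power_mult_distrib)
qed (use assms in auto)

lemma lint_translate:
  fixes f :: "'a::euclidean_space \<Rightarrow> 'b::{banach, second_countable_topology}"
  assumes "f \<in> borel_measurable borel"
  shows "integral\<^sup>L lborel (\<lambda>x. f (x + a)) = integral\<^sup>L lborel f"
proof -
  have "integral\<^sup>L lborel f = integral\<^sup>L (distr lborel borel ((+) a)) f" by (simp add: lborel_distr_plus)
  also have "\<dots> = integral\<^sup>L lborel (\<lambda>x. f (a + x))" by (rule integral_distr) (use assms in auto)
  finally show ?thesis by (simp add: add.commute)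
qed

lemma lint_indicator:
  fixes f :: "'a::euclidean_space \<Rightarrow> 'b::{banach, second_countable_topology}"
  assumes "S \<in> sets borel"
  shows "lint S f = integral\<^sup>L lborel (\<lambda>x. indicat_real S x *\<^sub>R f x)"
  by (rule integral_restrict_space) (use assms in auto)

lemma integrable_translate:
  fixes f :: "'a::euclidean_space \<Rightarrow> 'b::{banach, second_countable_topology}"
  assumes "integrable lborel f"
  shows "integrable lborel (\<lambda>x. f (x + a))"
proof -
  have "integrable (distr lborel borel ((+) a)) f" using assms by (simp add: lborel_distr_plus)
  then have "integrable lborel (\<lambda>x. f (a + x))" by (rule integrable_distr[rotated]) simp
  then show ?thesis by (simp add: add.commute)
qed

section \<open>Integrals of directional derivatives\<close>

lemma has_real_derivative_along_line:
  fixes F :: "'a::real_normed_vector \<Rightarrow> real"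
  assumes "(F has_derivative D) (at (x + t *\<^sub>R e))"
  shows "((\<lambda>s. F (x + s *\<^sub>R e)) has_real_derivative D e) (at t)"
proof -
  have "((\<lambda>s. x + s *\<^sub>R e) has_derivative (\<lambda>r. r *\<^sub>R e)) (at t)"
    by (auto intro!: derivative_eq_intros)
  from has_derivative_compose[OF this, of F D] assms
  have "((\<lambda>s. F (x + s *\<^sub>R e)) has_derivative (\<lambda>r. D (r *\<^sub>R e))) (at t)" by simp
  moreover have "(\<lambda>r. D (r *\<^sub>R e)) = (*) (D e)"
    using linear_scale[OF has_derivative_linear[OF assms]] by (simp add: fun_eq_iff)
  ultimately show ?thesis by (simp add: has_field_derivative_def)
qed

text \<open>Mean value theorem on the segment up to the point of exit from the domain.\<close>
lemma exit_bound:
  fixes F :: "'a::euclidean_space \<Rightarrow> real"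
  assumes "open \<Omega>"
    and der: "\<And>x. x \<in> \<Omega> \<Longrightarrow> (F has_derivative DF x) (at x)"
    and L: "\<And>x. x \<in> \<Omega> \<Longrightarrow> \<bar>DF x e\<bar> \<le> L"
    and fr: "\<And>x. x \<in> frontier \<Omega> \<Longrightarrow> (F \<longlongrightarrow> 0) (at x within \<Omega>)"
    and x: "x \<in> \<Omega>" and y: "x + h *\<^sub>R e \<notin> \<Omega>" and "h > 0"
  shows "\<bar>F x\<bar> \<le> L * h"
proof -
  define Z where "Z = {t \<in> {0..h}. x + t *\<^sub>R e \<notin> \<Omega>}"
  have "closed Z"
  proof -
    have "closed ({0..h} \<inter> (\<lambda>t. x + t *\<^sub>R e) -` (- \<Omega>))"
      using \<open>open \<Omega>\<close> by (intro continuous_closed_preimage) (auto intro!: continuous_intros)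
    also have "({0..h} \<inter> (\<lambda>t. x + t *\<^sub>R e) -` (- \<Omega>)) = Z" by (auto simp: Z_def)
    finally show ?thesis .
  qed
  moreover have "Z \<noteq> {}" using y \<open>h > 0\<close> by (auto simp: Z_def intro!: exI[of _ h])
  moreover have bdd: "bdd_below Z" by (auto simp: Z_def bdd_below_def)
  ultimately have TZ: "Inf Z \<in> Z" by (intro closed_contains_Inf)
  \<comment> \<open>The first exit time: \<open>Z\<close> is closed, so the infimum is attained, and
    before it the segment lies in \<open>\<Omega>\<close>.\<close>
  define T where "T = Inf Z"
  have T: "0 \<le> T" "T \<le> h" "x + T *\<^sub>R e \<notin> \<Omega>" using TZ by (auto simp: Z_def T_def)
  have Tpos: "T > 0" using T x by (cases "T = 0") auto
  have inn: "x + t *\<^sub>R e \<in> \<Omega>" if "0 \<le> t" "t < T" for t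
  proof (rule ccontr)
    assume "\<not> ?thesis"
    then have "t \<in> Z" using that T by (auto simp: Z_def)
    then have "T \<le> t" unfolding T_def using bdd by (intro cInf_lower)
    then show False using that by simp
  qed
  have b: "\<bar>F x\<bar> \<le> L * T"
  proof -
    have frT: "x + T *\<^sub>R e \<in> frontier \<Omega>"
    proof -
      have "((\<lambda>t. x + t *\<^sub>R e) \<longlongrightarrow> x + T *\<^sub>R e) (at_left T)"
        by (intro tendsto_intros)
      moreover have "eventually (\<lambda>t. x + t *\<^sub>R e \<in> closure \<Omega>) (at_left T)"
        using eventually_at_left_real[OF Tpos] by eventually_elim (use inn closure_subset in force)
      ultimately have "x + T *\<^sub>R e \<in> closure \<Omega>"
        by (intro Lim_in_closed_set[of "closure \<Omega>" _ "at_left T"]) auto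
      then show ?thesis using T \<open>open \<Omega>\<close> by (simp add: frontier_def interior_open)
    qed
    have flt: "filterlim (\<lambda>t. x + t *\<^sub>R e) (at (x + T *\<^sub>R e) within \<Omega>) (at_left T)"
      unfolding filterlim_at
    proof
      show "\<forall>\<^sub>F t in at_left T. x + t *\<^sub>R e \<in> \<Omega> \<and> x + t *\<^sub>R e \<noteq> x + T *\<^sub>R e"
        using eventually_at_left_real[OF Tpos]
      proof eventually_elim
        case (elim t)
        then have "x + t *\<^sub>R e \<in> \<Omega>" by (intro inn) auto
        then show ?case using T by metis
      qed
      show "((\<lambda>t. x + t *\<^sub>R e) \<longlongrightarrow> x + T *\<^sub>R e) (at_left T)" by (intro tendsto_intros)
    qed
    have lim: "((\<lambda>t. F (x + t *\<^sub>R e)) \<longlongrightarrow> 0) (at_left T)"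
      by (rule filterlim_compose[OF fr[OF frT] flt])
    have mv: "\<bar>F (x + t *\<^sub>R e) - F x\<bar> \<le> L * t" if t: "0 < t" "t < T" for t
    proof -
      have "\<exists>s>0. s < t \<and> F (x + t *\<^sub>R e) - F (x + 0 *\<^sub>R e) = (t - 0) * DF (x + s *\<^sub>R e) e"
        using t by (intro MVT2 has_real_derivative_along_line der inn) auto
      then obtain s where s: "0 < s" "s < t" "F (x + t *\<^sub>R e) - F x = t * DF (x + s *\<^sub>R e) e" by auto
      show ?thesis using L[OF inn[of s]] s t by (simp add: abs_mult mult.commute mult_left_mono)
    qed
    have "\<bar>0 - F x\<bar> \<le> L * T"
    proof (rule tendsto_le[of "at_left T"])
      show "((\<lambda>t. L * t) \<longlongrightarrow> L * T) (at_left T)" by (intro tendsto_intros)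
      show "((\<lambda>t. \<bar>F (x + t *\<^sub>R e) - F x\<bar>) \<longlongrightarrow> \<bar>0 - F x\<bar>) (at_left T)" by (intro tendsto_intros lim)
      show "\<forall>\<^sub>F t in at_left T. \<bar>F (x + t *\<^sub>R e) - F x\<bar> \<le> L * t"
        using eventually_at_left_real[OF Tpos] by eventually_elim (use mv in auto)
    qed simp
    then show ?thesis by simp
  qed
  have "0 \<le> L" using L[OF x] by linarith
  then show ?thesis using b T(2) mult_left_mono[of T h L] by linarith
qed

text \<open>The integral of a difference quotient of the extension by zero vanishes by translation
  invariance; the points that are translated across the frontier contribute o(1).\<close>
lemma lint_directional_derivative_eq_0:
  fixes F :: "'a::euclidean_space \<Rightarrow> real"
  assumes \<Omega>: "open \<Omega>" "bounded \<Omega>"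
    and der: "\<And>x. x \<in> \<Omega> \<Longrightarrow> (F has_derivative DF x) (at x)"
    and cont: "bcont \<Omega> (\<lambda>x. DF x e)"
    and fr: "\<And>x. x \<in> frontier \<Omega> \<Longrightarrow> (F \<longlongrightarrow> 0) (at x within \<Omega>)"
  shows "lint \<Omega> (\<lambda>x. DF x e) = 0"
proof -
  obtain L where L0: "0 < L" and L: "\<And>x. x \<in> \<Omega> \<Longrightarrow> \<bar>DF x e\<bar> \<le> L"
    using cont by (rule bcontE) (auto simp: real_norm_def)
  show ?thesis
  proof (cases "e = 0")
    case True
    then show ?thesis using linear_0[OF has_derivative_linear[OF der]] lint_cong[of \<Omega> "\<lambda>x. DF x e" "\<lambda>_. 0"] by simp
  next
    case e0: False
    note [measurable] = borel_open[OF \<Omega>(1)]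
    have bounded_borel: "bounded_borel \<Omega>" using \<Omega> by (auto simp: bounded_borel_def)
    have Fcont: "continuous_on \<Omega> F"
      by (meson der has_derivative_continuous_on has_derivative_at_withinI)
    define G where "G = (\<lambda>x. indicat_real \<Omega> x * F x)"
    have G[measurable]: "G \<in> borel_measurable borel"
      using borel_measurable_continuous_on_indicator[OF _ Fcont] unfolding G_def by (simp add: borel_open \<Omega>)
    define h where "h = (\<lambda>n. inverse (real (Suc n)))"
    have h0: "h n > 0" for n by (simp add: h_def)
    have hlim: "h \<longlonglongrightarrow> 0" unfolding h_def by (rule LIMSEQ_inverse_real_of_nat)
    have eb: "\<bar>F x\<bar> \<le> L * t" if "x \<in> \<Omega>" "x + t *\<^sub>R e \<notin> \<Omega>" "t > 0" for x t
      by (rule exit_bound[OF \<Omega>(1) der L fr that])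
    have eb': "\<bar>F x\<bar> \<le> L * t" if "x \<in> \<Omega>" "x - t *\<^sub>R e \<notin> \<Omega>" "t > 0" for x t
    proof (rule exit_bound[OF \<Omega>(1) der _ fr, where e = "- e"])
      fix y assume "y \<in> \<Omega>"
      then show "\<bar>DF y (- e)\<bar> \<le> L" using L linear_neg[OF has_derivative_linear[OF der]] by auto
    qed (use that in auto)
    have Gb: "\<bar>G x\<bar> \<le> L * t" if "x + t *\<^sub>R e \<notin> \<Omega>" "t > 0" for x t
      using eb[of x t] that L0 by (cases "x \<in> \<Omega>") (auto simp: G_def)
    have Gb': "\<bar>G x\<bar> \<le> L * t" if "x - t *\<^sub>R e \<notin> \<Omega>" "t > 0" for x t
      using eb'[of x t] that L0 by (cases "x \<in> \<Omega>") (auto simp: G_def)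
    \<comment> \<open>If the segment stays inside, the mean value theorem gives
      \<open>L * t\<close>. Otherwise both endpoints reach a point outside within parameter length
      \<open>t\<close>, so each value is at most \<open>L * t\<close>; hence the factor 2.\<close>
    have lip: "\<bar>G (x + t *\<^sub>R e) - G x\<bar> \<le> 2 * L * t" if t: "t > 0" for x t
    proof (cases "\<forall>s\<in>{0..t}. x + s *\<^sub>R e \<in> \<Omega>")
      case True
      have "\<exists>s>0. s < t \<and> F (x + t *\<^sub>R e) - F (x + 0 *\<^sub>R e) = (t - 0) * DF (x + s *\<^sub>R e) e"
        using t True by (intro MVT2 has_real_derivative_along_line der) auto
      then obtain s where s: "0 < s" "s < t" "F (x + t *\<^sub>R e) - F x = t * DF (x + s *\<^sub>R e) e" by auto
      have "\<bar>F (x + t *\<^sub>R e) - F x\<bar> \<le> L * t"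
        using L[of "x + s *\<^sub>R e"] s True t by (simp add: abs_mult mult.commute mult_left_mono)
      moreover have "x \<in> \<Omega>" "x + t *\<^sub>R e \<in> \<Omega>" using True t bspec[OF True, of 0] by auto
      ultimately have "\<bar>G (x + t *\<^sub>R e) - G x\<bar> \<le> L * t" by (simp add: G_def)
      also have "\<dots> \<le> 2 * L * t" using L0 t by simp
      finally show ?thesis .
    next
      case False
      then obtain s where s: "0 \<le> s" "s \<le> t" "x + s *\<^sub>R e \<notin> \<Omega>" by auto
      have 1: "\<bar>G x\<bar> \<le> L * t"
      proof (cases "s = 0")
        case True
        then show ?thesis using s L0 t by (simp add: G_def)
      next
        case False
        then show ?thesis using Gb[OF s(3)] s mult_left_mono[OF s(2), of L] L0 by linarith
      qed
      have 2: "\<bar>G (x + t *\<^sub>R e)\<bar> \<le> L * t"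
      proof (cases "s = t")
        case True
        then show ?thesis using s L0 t by (simp add: G_def)
      next
        case False
        have "x + t *\<^sub>R e - (t - s) *\<^sub>R e = x + s *\<^sub>R e" by (simp add: algebra_simps)
        then have "x + t *\<^sub>R e - (t - s) *\<^sub>R e \<notin> \<Omega>" using s(3) by metis
        then have "\<bar>G (x + t *\<^sub>R e)\<bar> \<le> L * (t - s)" using Gb'[of "x + t *\<^sub>R e" "t - s"] s False by simp
        also have "\<dots> \<le> L * t" using L0 s by (intro mult_left_mono) auto
        finally show ?thesis .
      qed
      show ?thesis using 1 2 by linarith
    qed
    obtain R where R: "R > 0" "\<And>x. x \<in> \<Omega> \<Longrightarrow> norm x \<le> R" using \<Omega>(2) by (auto simp: bounded_pos)
    \<comment> \<open>A displacement of length \<open>2 * R + norm e\<close> leaves the ball of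
      radius \<open>R\<close> around the origin that contains \<open>\<Omega>\<close>, so the exit
      bound becomes a global bound for \<open>F\<close>, whose boundedness is not assumed.\<close>
    define M where "M = L * (2 * R / norm e + 1)"
    have M: "M > 0" "\<bar>G x\<bar> \<le> M" for x
    proof -
      show "M > 0" using L0 R by (auto simp: M_def intro!: mult_pos_pos add_nonneg_pos)
      show "\<bar>G x\<bar> \<le> M"
      proof (cases "x \<in> \<Omega>")
        case True
        have "x + (2 * R / norm e + 1) *\<^sub>R e \<notin> \<Omega>"
        proof
          assume "x + (2 * R / norm e + 1) *\<^sub>R e \<in> \<Omega>"
          then have "norm ((x + (2 * R / norm e + 1) *\<^sub>R e) - x) \<le> R + R"
            using R(2) True by (intro order_trans[OF norm_triangle_ineq4] add_mono) auto
          moreover have "(x + (2 * R / norm e + 1) *\<^sub>R e) - x = (2 * R / norm e + 1) *\<^sub>R e" by simp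
          moreover have "\<bar>2 * R / norm e + 1\<bar> = 2 * R / norm e + 1" using R(1) by simp
          then have "norm ((2 * R / norm e + 1) *\<^sub>R e) = 2 * R + norm e" using e0 by (simp add: distrib_right)
          ultimately show False using e0 by simp
        qed
        then show ?thesis unfolding M_def by (intro Gb) (use R in \<open>auto intro!: add_nonneg_pos\<close>)
      qed (use \<open>M > 0\<close> in \<open>auto simp: G_def\<close>)
    qed
    \<comment> \<open>\<open>A n\<close> is the difference quotient at points of
      \<open>\<Omega>\<close>; \<open>B n\<close> collects the points of \<open>\<Omega>\<close>
      whose backward translate lies outside. By translation invariance their integrals are opposite;
      \<open>A n\<close> tends to the derivative, and \<open>B n\<close> tends to 0 because
      \<open>\<Omega>\<close> is open.\<close>
    define A where "A = (\<lambda>n x. indicat_real \<Omega> x * ((G (x + h n *\<^sub>R e) - G x) / h n))"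
    define B where "B = (\<lambda>n x. indicat_real \<Omega> x * (indicat_real (- \<Omega>) (x - h n *\<^sub>R e) * (G x / h n)))"
    have Am[measurable]: "A n \<in> borel_measurable borel" for n unfolding A_def by measurable
    have Bm[measurable]: "B n \<in> borel_measurable borel" for n unfolding B_def by measurable
    have Di: "(\<lambda>x. indicat_real \<Omega> x * DF x e) \<in> borel_measurable borel"
      using borel_measurable_continuous_on_indicator[of \<Omega> "\<lambda>x. DF x e"] cont \<Omega>
      by (simp add: bcont_def borel_open)
    have fin: "integrable lborel (\<lambda>x. indicat_real \<Omega> x * c)" for c
      using emeasure_bounded_finite[OF \<Omega>(2)] by (auto intro!: integrable_real_indicator integrable_mult_left)
    have tiny: "(\<lambda>n. x + h n *\<^sub>R v) \<longlonglongrightarrow> x" for x v :: 'a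
    proof -
      have "(\<lambda>n. x + h n *\<^sub>R v) \<longlonglongrightarrow> x + 0 *\<^sub>R v" by (intro tendsto_intros hlim)
      then show ?thesis by simp
    qed
    have limA: "(\<lambda>n. integral\<^sup>L lborel (A n)) \<longlonglongrightarrow> integral\<^sup>L lborel (\<lambda>x. indicat_real \<Omega> x * DF x e)"
    proof (rule integral_dominated_convergence[where w = "\<lambda>x. indicat_real \<Omega> x * (2 * L)"])
      show "AE x in lborel. (\<lambda>n. A n x) \<longlonglongrightarrow> indicat_real \<Omega> x * DF x e"
      proof (rule AE_I2)
        fix x
        show "(\<lambda>n. A n x) \<longlonglongrightarrow> indicat_real \<Omega> x * DF x e"
        proof (cases "x \<in> \<Omega>")
          case True
          have "((\<lambda>t. F (x + t *\<^sub>R e)) has_field_derivative DF x e) (at 0)"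
            by (rule has_real_derivative_along_line) (use der[OF True] in simp)
          then have "((\<lambda>t. (F (x + t *\<^sub>R e) - F x) / t) \<longlongrightarrow> DF x e) (at 0)"
            by (simp add: DERIV_def)
          then have "(\<lambda>n. (F (x + h n *\<^sub>R e) - F x) / h n) \<longlonglongrightarrow> DF x e"
            by (rule filterlim_compose) (use hlim h0 in \<open>auto simp: filterlim_at less_imp_neq[THEN not_sym]\<close>)
          moreover have "\<forall>\<^sub>F n in sequentially. x + h n *\<^sub>R e \<in> \<Omega>"
            by (rule topological_tendstoD[OF tiny \<Omega>(1) True])
          then have "\<forall>\<^sub>F n in sequentially. (F (x + h n *\<^sub>R e) - F x) / h n = A n x"
            by eventually_elim (use True in \<open>simp add: A_def G_def\<close>)
          ultimately have "(\<lambda>n. A n x) \<longlonglongrightarrow> DF x e" by (rule Lim_transform_eventually)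
          then show ?thesis using True by simp
        qed (simp add: A_def)
      qed
      show "AE x in lborel. norm (A n x) \<le> indicat_real \<Omega> x * (2 * L)" for n
      proof (rule AE_I2)
        fix x
        show "norm (A n x) \<le> indicat_real \<Omega> x * (2 * L)"
          using lip[OF h0, of x n] h0[of n] by (auto simp: A_def indicator_def field_simps)
      qed
    qed (use fin Di in auto)
    have limB: "(\<lambda>n. integral\<^sup>L lborel (B n)) \<longlonglongrightarrow> integral\<^sup>L lborel (\<lambda>x::'a. 0::real)"
    proof (rule integral_dominated_convergence[where w = "\<lambda>x. indicat_real \<Omega> x * L"])
      show "AE x in lborel. (\<lambda>n. B n x) \<longlonglongrightarrow> 0"
      proof (rule AE_I2)
        fix x
        show "(\<lambda>n. B n x) \<longlonglongrightarrow> 0"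
        proof (cases "x \<in> \<Omega>")
          case True
          have "\<forall>\<^sub>F n in sequentially. x + h n *\<^sub>R (- e) \<in> \<Omega>"
            by (rule topological_tendstoD[OF tiny \<Omega>(1) True])
          then have "\<forall>\<^sub>F n in sequentially. B n x = 0"
            by eventually_elim (simp add: B_def)
          then show ?thesis by (rule tendsto_eventually)
        qed (simp add: B_def)
      qed
      show "AE x in lborel. norm (B n x) \<le> indicat_real \<Omega> x * L" for n
      proof (rule AE_I2)
        fix x
        show "norm (B n x) \<le> indicat_real \<Omega> x * L"
          using Gb'[OF _ h0, of x n] h0[of n] L0 by (auto simp: B_def indicator_def field_simps)
      qed
    qed (use fin in auto)
    have AB: "integral\<^sup>L lborel (A n) = - integral\<^sup>L lborel (B n)" for n
    proof -
      have Gint: "integrable lborel (\<lambda>y. c y * G y)"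
        if [measurable]: "c \<in> borel_measurable borel" and c: "\<And>y. \<bar>c y\<bar> \<le> 1" for c
      proof (rule Bochner_Integration.integrable_bound[OF fin[of M]])
        show "AE x in lborel. norm (c x * G x) \<le> norm (indicat_real \<Omega> x * M)"
        proof (rule AE_I2)
          fix x
          have "\<bar>c x * G x\<bar> \<le> 1 * \<bar>G x\<bar>" unfolding abs_mult by (intro mult_right_mono c) auto
          also have "\<dots> \<le> indicat_real \<Omega> x * M" using M(2)[of x] by (auto simp: G_def indicator_def)
          finally show "norm (c x * G x) \<le> norm (indicat_real \<Omega> x * M)" using M(1) by simp
        qed
      qed measurable
      have cm[measurable]: "(\<lambda>y. indicat_real S (y - h n *\<^sub>R e)) \<in> borel_measurable borel" if "S \<in> sets borel" for S
        using that by measurable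
      have "A n x = (indicat_real \<Omega> x * G (x + h n *\<^sub>R e)) / h n - G x / h n" for x
        by (auto simp: A_def G_def indicator_def diff_divide_distrib)
      then have "integral\<^sup>L lborel (A n) = integral\<^sup>L lborel (\<lambda>x. (indicat_real \<Omega> x * G (x + h n *\<^sub>R e)) / h n - G x / h n)"
        by presburger
      also have "\<dots> = integral\<^sup>L lborel (\<lambda>x. indicat_real \<Omega> x * G (x + h n *\<^sub>R e)) / h n - integral\<^sup>L lborel G / h n"
      proof (subst Bochner_Integration.integral_diff)
        have "integrable lborel (\<lambda>x. indicat_real \<Omega> (x + h n *\<^sub>R e - h n *\<^sub>R e) * G (x + h n *\<^sub>R e))"
          by (rule integrable_translate[where f = "\<lambda>y. indicat_real \<Omega> (y - h n *\<^sub>R e) * G y" and a = "h n *\<^sub>R e", OF Gint])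
            (auto simp: indicator_def)
        then show "integrable lborel (\<lambda>x. indicat_real \<Omega> x * G (x + h n *\<^sub>R e) / h n)" by simp
        show "integrable lborel (\<lambda>x. G x / h n)" using Gint[of "\<lambda>_. 1"] by simp
      qed simp
      also have "integral\<^sup>L lborel (\<lambda>x. indicat_real \<Omega> x * G (x + h n *\<^sub>R e)) =
          integral\<^sup>L lborel (\<lambda>y. indicat_real \<Omega> (y - h n *\<^sub>R e) * G y)"
        using lint_translate[of "\<lambda>y. indicat_real \<Omega> (y - h n *\<^sub>R e) * G y" "h n *\<^sub>R e"] by simp
      also have "integral\<^sup>L lborel G = integral\<^sup>L lborel (\<lambda>y. indicat_real \<Omega> (y - h n *\<^sub>R e) * G y + indicat_real (- \<Omega>) (y - h n *\<^sub>R e) * G y)"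
        by (rule Bochner_Integration.integral_cong) (auto simp: indicator_def)
      also have "\<dots> = integral\<^sup>L lborel (\<lambda>y. indicat_real \<Omega> (y - h n *\<^sub>R e) * G y) +
         integral\<^sup>L lborel (\<lambda>y. indicat_real (- \<Omega>) (y - h n *\<^sub>R e) * G y)"
        by (intro Bochner_Integration.integral_add Gint) (auto simp: indicator_def)
      also have "integral\<^sup>L lborel (\<lambda>y. indicat_real (- \<Omega>) (y - h n *\<^sub>R e) * G y) = h n * integral\<^sup>L lborel (B n)"
        using h0[of n] unfolding integral_mult_right_zero[symmetric]
        by (intro Bochner_Integration.integral_cong) (auto simp: B_def G_def indicator_def)
      finally show ?thesis using h0[of n] by (simp add: field_simps)
    qed
    have "integral\<^sup>L lborel (\<lambda>x. indicat_real \<Omega> x * DF x e) = 0"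
      using LIMSEQ_unique[OF limA] tendsto_minus[OF limB] by (simp add: AB)
    then show ?thesis by (subst lint_indicator) (use \<Omega> in \<open>auto simp: borel_open\<close>)
  qed
qed

section \<open>Functions with bounded derivatives, Green's identity and the energy estimate\<close>

lemma bcont_divide_const [intro]:
  fixes f :: "'a::topological_space \<Rightarrow> 'b::real_normed_field"
  shows "bcont S f \<Longrightarrow> bcont S (\<lambda>x. f x / c)"
  unfolding divide_inverse by (intro bcont_intros)

text \<open>Weaker than \<open>holder_on\<close>: no Hoelder seminorm and no extension to the
  closure. This is the regularity that integration by parts inside the domain consumes.\<close>

definition bounded_Ck :: "nat \<Rightarrow> 'a::euclidean_space set \<Rightarrow> ('a \<Rightarrow> real) \<Rightarrow> bool" where
  "bounded_Ck k \<Omega> u \<longleftrightarrow>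
     (\<forall>es. set es \<subseteq> Basis \<and> length es < k \<longrightarrow> (\<forall>x\<in>\<Omega>. pderivs es u differentiable (at x))) \<and>
     (\<forall>es. set es \<subseteq> Basis \<and> length es \<le> k \<longrightarrow> bcont \<Omega> (pderivs es u))"

definition laplacian :: "('a::euclidean_space \<Rightarrow> real) \<Rightarrow> 'a \<Rightarrow> real" where
  "laplacian u x = (\<Sum>e\<in>Basis. pderivs [e, e] u x)"

text \<open>A limit from inside, since derivatives carry information only in the open set.\<close>

definition vanishes_at_frontier :: "'a::topological_space set \<Rightarrow> ('a \<Rightarrow> real) \<Rightarrow> bool" where
  "vanishes_at_frontier \<Omega> u \<longleftrightarrow> (\<forall>x\<in>frontier \<Omega>. (u \<longlongrightarrow> 0) (at x within \<Omega>))"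

lemma holder_on_bounded_Ck: "holder_on k \<alpha> \<Omega> u \<Longrightarrow> bounded_Ck k \<Omega> u"
  unfolding holder_on_def bounded_Ck_def bcont_def
  by (metis closure_subset continuous_on_cong continuous_on_subset)

lemma bounded_Ck_mono: "bounded_Ck k \<Omega> u \<Longrightarrow> j \<le> k \<Longrightarrow> bounded_Ck j \<Omega> u"
  unfolding bounded_Ck_def by (meson dual_order.trans order_less_le_trans)

lemma bounded_Ck_bcont: "bounded_Ck k \<Omega> u \<Longrightarrow> set es \<subseteq> Basis \<Longrightarrow> length es \<le> k \<Longrightarrow> bcont \<Omega> (pderivs es u)"
  unfolding bounded_Ck_def by blast

lemma bounded_Ck_bcont0: "bounded_Ck k \<Omega> u \<Longrightarrow> bcont \<Omega> u"
  using bounded_Ck_bcont[of k \<Omega> u "[]"] by simp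

lemma bounded_Ck_has_derivative:
  "bounded_Ck k \<Omega> u \<Longrightarrow> set es \<subseteq> Basis \<Longrightarrow> length es < k \<Longrightarrow> x \<in> \<Omega> \<Longrightarrow>
   (pderivs es u has_derivative frechet_derivative (pderivs es u) (at x)) (at x)"
  unfolding bounded_Ck_def using frechet_derivative_works by blast

lemma frechet_derivative_cong_open:
  assumes "open S" "x \<in> S" "\<And>y. y \<in> S \<Longrightarrow> f y = g y"
  shows "frechet_derivative f (at x) = frechet_derivative g (at x)"
proof -
  have "(f has_derivative D) (at x) \<longleftrightarrow> (g has_derivative D) (at x)" for D
    using has_derivative_transform_within_open[OF _ assms(1,2)] assms(3) by metis
  then show ?thesis unfolding frechet_derivative_def by simp
qed

lemma pderivs_cong_open:
  assumes "open S" "\<And>y. y \<in> S \<Longrightarrow> f y = g y"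
  shows "x \<in> S \<Longrightarrow> pderivs es f x = pderivs es g x"
  using assms
proof (induction es arbitrary: x)
  case (Cons e es)
  then show ?case using frechet_derivative_cong_open[of S x "pderivs es f" "pderivs es g"] by auto
qed auto

lemma pderivs_linear_combination:
  assumes "open \<Omega>" "bounded_Ck k \<Omega> f" "bounded_Ck k \<Omega> g" "set es \<subseteq> Basis" "length es \<le> k" "x \<in> \<Omega>"
  shows "pderivs es (\<lambda>x. a * f x + b * g x) x = a * pderivs es f x + b * pderivs es g x"
  using assms(4-6)
proof (induction es arbitrary: x)
  case (Cons e es)
  have "frechet_derivative (pderivs es (\<lambda>x. a * f x + b * g x)) (at x) =
        frechet_derivative (\<lambda>x. a * pderivs es f x + b * pderivs es g x) (at x)"
    using Cons by (intro frechet_derivative_cong_open[OF assms(1)]) auto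
  also have "\<dots> = (\<lambda>h. a * frechet_derivative (pderivs es f) (at x) h + b * frechet_derivative (pderivs es g) (at x) h)"
  proof (rule frechet_derivative_at[symmetric])
    show "((\<lambda>x. a * pderivs es f x + b * pderivs es g x) has_derivative
      (\<lambda>h. a * frechet_derivative (pderivs es f) (at x) h + b * frechet_derivative (pderivs es g) (at x) h)) (at x)"
      using Cons.prems by (intro has_derivative_add has_derivative_mult_right bounded_Ck_has_derivative[OF assms(2)] bounded_Ck_has_derivative[OF assms(3)]) auto
  qed
  finally show ?case by simp
qed auto

lemma bounded_Ck_linear_combination:
  assumes "open \<Omega>" "bounded_Ck k \<Omega> f" "bounded_Ck k \<Omega> g"
  shows "bounded_Ck k \<Omega> (\<lambda>x. a * f x + b * g x)"
  unfolding bounded_Ck_def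
proof (intro conjI allI impI ballI)
  fix es :: "'a list" and x assume es: "set es \<subseteq> Basis \<and> length es < k" and x: "x \<in> \<Omega>"
  have "((\<lambda>x. a * pderivs es f x + b * pderivs es g x) has_derivative
      (\<lambda>h. a * frechet_derivative (pderivs es f) (at x) h + b * frechet_derivative (pderivs es g) (at x) h)) (at x)"
    using es x by (intro has_derivative_add has_derivative_mult_right bounded_Ck_has_derivative[OF assms(2)] bounded_Ck_has_derivative[OF assms(3)]) auto
  then have "(pderivs es (\<lambda>x. a * f x + b * g x) has_derivative
      (\<lambda>h. a * frechet_derivative (pderivs es f) (at x) h + b * frechet_derivative (pderivs es g) (at x) h)) (at x)"
    by (rule has_derivative_transform_within_open[OF _ assms(1) x])
       (use es in \<open>simp add: pderivs_linear_combination[OF assms]\<close>)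
  then show "pderivs es (\<lambda>x. a * f x + b * g x) differentiable at x" by (auto simp: differentiable_def)
next
  fix es :: "'a list" assume es: "set es \<subseteq> Basis \<and> length es \<le> k"
  have "bcont \<Omega> (\<lambda>x. a * pderivs es f x + b * pderivs es g x)"
    using es by (intro bcont_intros bounded_Ck_bcont[OF assms(2)] bounded_Ck_bcont[OF assms(3)]) auto
  then show "bcont \<Omega> (pderivs es (\<lambda>x. a * f x + b * g x))"
    using bcont_cong[of \<Omega> "pderivs es (\<lambda>x. a * f x + b * g x)"] es
    by (simp add: pderivs_linear_combination[OF assms])
qed

lemma laplacian_linear_combination:
  assumes "open \<Omega>" "bounded_Ck 2 \<Omega> f" "bounded_Ck 2 \<Omega> g" "x \<in> \<Omega>"
  shows "laplacian (\<lambda>x. a * f x + b * g x) x = a * laplacian f x + b * laplacian g x"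
  using assms by (simp add: laplacian_def pderivs_linear_combination sum.distrib sum_distrib_left
      del: pderivs.simps)

lemma bcont_laplacian: "bounded_Ck 2 \<Omega> u \<Longrightarrow> bcont \<Omega> (laplacian u)"
  unfolding laplacian_def by (intro bcont_sum bounded_Ck_bcont) auto

lemma bcont_mult_tendsto_0:
  fixes f g :: "'a::topological_space \<Rightarrow> real"
  assumes "bcont \<Omega> g" "(f \<longlongrightarrow> 0) (at x within \<Omega>)"
  shows "((\<lambda>x. g x * f x) \<longlongrightarrow> 0) (at x within \<Omega>)"
proof -
  obtain B where B: "\<And>x. x \<in> \<Omega> \<Longrightarrow> norm (g x) \<le> B" using assms(1) by (rule bcontE) blast
  show ?thesis
    by (rule tendsto_0_le[OF assms(2), of _ B])
      (auto simp: eventually_at_filter abs_mult mult.commute[of "\<bar>f _\<bar>"] intro!: always_eventually mult_right_mono B[simplified])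
qed

text \<open>Integrate the divergence of \<open>v * grad u - u * grad v\<close>, one coordinate at a
  time. Vanishing of \<open>u\<close> and of its first derivatives at the frontier kills the flux,
  while \<open>v\<close> and its derivatives merely stay bounded there.\<close>

lemma Green_identity_vanishing_Cauchy_data:
  assumes \<Omega>: "open \<Omega>" "bounded \<Omega>" and u: "bounded_Ck 2 \<Omega> u" and v: "bounded_Ck 2 \<Omega> v"
    and u0: "vanishes_at_frontier \<Omega> u" and u1: "\<And>e. e \<in> Basis \<Longrightarrow> vanishes_at_frontier \<Omega> (pderivs [e] u)"
  shows "lint \<Omega> (\<lambda>x. v x * laplacian u x) = lint \<Omega> (\<lambda>x. u x * laplacian v x)"
proof -
  have bounded_borel: "bounded_borel \<Omega>" using \<Omega> by (simp add: bounded_borel_def)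
  have *: "lint \<Omega> (\<lambda>x. v x * pderivs [e, e] u x - u x * pderivs [e, e] v x) = 0" if e: "e \<in> Basis" for e
  proof -
    define DF where "DF = (\<lambda>x h. (v x * frechet_derivative (pderivs [e] u) (at x) h
        + frechet_derivative (pderivs [] v) (at x) h * pderivs [e] u x)
      - (u x * frechet_derivative (pderivs [e] v) (at x) h
        + frechet_derivative (pderivs [] u) (at x) h * pderivs [e] v x))"
    have DFe: "DF x e = v x * pderivs [e, e] u x - u x * pderivs [e, e] v x" for x
      by (simp add: DF_def)
    have "lint \<Omega> (\<lambda>x. DF x e) = 0"
    proof (rule lint_directional_derivative_eq_0[OF \<Omega>, of "\<lambda>x. v x * pderivs [e] u x - u x * pderivs [e] v x"])
      fix x assume x: "x \<in> \<Omega>"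
      have 1: "(v has_derivative frechet_derivative (pderivs [] v) (at x)) (at x)"
        using bounded_Ck_has_derivative[OF v, of "[]" x] x by simp
      have 2: "(u has_derivative frechet_derivative (pderivs [] u) (at x)) (at x)"
        using bounded_Ck_has_derivative[OF u, of "[]" x] x by simp
      show "((\<lambda>x. v x * pderivs [e] u x - u x * pderivs [e] v x) has_derivative DF x) (at x)"
        unfolding DF_def
        by (intro has_derivative_diff has_derivative_mult 1 2 bounded_Ck_has_derivative[OF v] bounded_Ck_has_derivative[OF u])
           (use e x in auto)
    next
      show "bcont \<Omega> (\<lambda>x. DF x e)" unfolding DFe
        by (intro bcont_intros bounded_Ck_bcont0[OF u] bounded_Ck_bcont0[OF v] bounded_Ck_bcont[OF u] bounded_Ck_bcont[OF v]) (use e in auto)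
    next
      fix x assume x: "x \<in> frontier \<Omega>"
      have 1: "((\<lambda>x. v x * pderivs [e] u x) \<longlongrightarrow> 0) (at x within \<Omega>)"
        using u1[OF e] x by (intro bcont_mult_tendsto_0 bounded_Ck_bcont0[OF v]) (auto simp: vanishes_at_frontier_def)
      have 2: "((\<lambda>x. pderivs [e] v x * u x) \<longlongrightarrow> 0) (at x within \<Omega>)"
        using u0 x e by (intro bcont_mult_tendsto_0 bounded_Ck_bcont[OF v]) (auto simp: vanishes_at_frontier_def)
      show "((\<lambda>x. v x * pderivs [e] u x - u x * pderivs [e] v x) \<longlongrightarrow> 0) (at x within \<Omega>)"
        using tendsto_diff[OF 1 2] by (simp add: mult.commute)
    qed
    then show ?thesis by (simp only: DFe)
  qed
  have "lint \<Omega> (\<lambda>x. v x * laplacian u x) - lint \<Omega> (\<lambda>x. u x * laplacian v x) =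
        lint \<Omega> (\<lambda>x. v x * laplacian u x - u x * laplacian v x)"
    by (rule lint_diff[OF bounded_borel, symmetric]) (intro bcont_mult bcont_laplacian bounded_Ck_bcont0[OF u] bounded_Ck_bcont0[OF v] u v)+
  also have "\<dots> = lint \<Omega> (\<lambda>x. \<Sum>e\<in>Basis. v x * pderivs [e, e] u x - u x * pderivs [e, e] v x)"
    by (rule lint_cong) (simp add: laplacian_def sum_distrib_left sum_subtractf del: pderivs.simps)
  also have "\<dots> = (\<Sum>e\<in>Basis. lint \<Omega> (\<lambda>x. v x * pderivs [e, e] u x - u x * pderivs [e, e] v x))"
    by (rule lint_sum[OF bounded_borel]) (intro bcont_intros bounded_Ck_bcont0[OF u] bounded_Ck_bcont0[OF v] bounded_Ck_bcont[OF u] bounded_Ck_bcont[OF v]; simp)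
  also have "\<dots> = 0" by (simp add: * del: pderivs.simps)
  finally show ?thesis by simp
qed

section \<open>Vanishing square integrals and the energy estimate\<close>

lemma lint_square_eq_0:
  fixes f :: "'a::euclidean_space \<Rightarrow> real"
  assumes \<Omega>: "open \<Omega>" "bounded \<Omega>" and f: "bcont \<Omega> f" and 0: "lint \<Omega> (\<lambda>x. (f x)\<^sup>2) = 0" and x: "x \<in> \<Omega>"
  shows "f x = 0"
proof (rule ccontr)
  assume nz: "f x \<noteq> 0"
  have bounded_borel: "bounded_borel \<Omega>" using \<Omega> by (simp add: bounded_borel_def)
  have "AE y in restrict_space lborel \<Omega>. (f y)\<^sup>2 = 0"
    using 0 f by (subst integral_nonneg_eq_0_iff_AE[symmetric]) (auto intro!: integrable_lb bounded_borel bcont_intros)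
  then have AE: "AE y in lborel. y \<in> \<Omega> \<longrightarrow> f y = 0"
    using \<Omega> by (subst (asm) AE_restrict_space_iff) auto
  define U where "U = {y \<in> \<Omega>. f y \<noteq> 0}"
  have "open (\<Omega> \<inter> f -` (- {0}))"
    using f \<Omega> by (intro continuous_open_preimage) (auto simp: bcont_def)
  then have U: "open U" by (simp add: U_def Int_def vimage_def)
  have "emeasure lborel U = 0"
    using AE U AE_iff_measurable[of U lborel "\<lambda>y. y \<in> \<Omega> \<longrightarrow> f y = 0"] by (auto simp: U_def)
  moreover obtain r where r: "r > 0" "ball x r \<subseteq> U"
    using U x nz by (auto simp: open_contains_ball U_def)
  ultimately have "emeasure lborel (ball x r) = 0"
    using emeasure_mono[of "ball x r" U lborel] U by auto
  then show False using content_ball_pos[OF r(1), of x] by (simp add: measure_def)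
qed

text \<open>Multiply \<open>laplacian u - q u\<close> by \<open>u\<close> and integrate by parts:
  since \<open>q \<ge> 0\<close>, the zeroth-order term has a favourable sign and is dropped, and a
  Poincare inequality closes the estimate. The constant \<open>16 * R^4\<close> involves only the
  radius of a ball containing the domain, so one \<open>C\<close> serves every
  \<open>q\<close>.\<close>

lemma energy_estimate:
  assumes \<Omega>: "open \<Omega>" "bounded (\<Omega> :: 'a::euclidean_space set)"
  obtains C where "0 < C"
    "\<And>u q. bounded_Ck 2 \<Omega> u \<Longrightarrow> vanishes_at_frontier \<Omega> u \<Longrightarrow> bcont \<Omega> q \<Longrightarrow> (\<And>x. x \<in> \<Omega> \<Longrightarrow> 0 \<le> q x) \<Longrightarrow>
      lint \<Omega> (\<lambda>x. (u x)\<^sup>2) \<le> C * lint \<Omega> (\<lambda>x. (laplacian u x - q x * u x)\<^sup>2)"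
proof -
  have bounded_borel: "bounded_borel \<Omega>" using \<Omega> by (simp add: bounded_borel_def)
  obtain R where R: "R > 0" "\<And>x. x \<in> \<Omega> \<Longrightarrow> norm x \<le> R" using \<Omega>(2) by (auto simp: bounded_pos)
  obtain b :: 'a where b: "b \<in> Basis" using nonempty_Basis by blast
  have main: "lint \<Omega> (\<lambda>x. (u x)\<^sup>2) \<le> (16 * R^4) * lint \<Omega> (\<lambda>x. (laplacian u x - q x * u x)\<^sup>2)"
    if u: "bounded_Ck 2 \<Omega> u" and u0: "vanishes_at_frontier \<Omega> u" and q: "bcont \<Omega> q" and q0: "\<And>x. x \<in> \<Omega> \<Longrightarrow> 0 \<le> q x" for u q
  proof -
    have ub: "bcont \<Omega> u" by (rule bounded_Ck_bcont0[OF u])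
    have u1: "bcont \<Omega> (pderivs [e] u)" if "e \<in> Basis" for e by (rule bounded_Ck_bcont[OF u]) (use that in auto)
    have u2: "bcont \<Omega> (pderivs [e, e] u)" if "e \<in> Basis" for e by (rule bounded_Ck_bcont[OF u]) (use that in auto)
    have Lb: "bcont \<Omega> (laplacian u)" by (rule bcont_laplacian[OF u])
    have ud: "(u has_derivative frechet_derivative u (at x)) (at x)" if "x \<in> \<Omega>" for x
      using bounded_Ck_has_derivative[OF u, of "[]" x] that by simp
    have idb: "bcont \<Omega> (\<lambda>x. x \<bullet> b)"
      by (rule bcontI[of _ _ R]) (use R b in \<open>auto intro!: continuous_intros order_trans[OF Basis_le_norm]\<close>)
    note bi = ub u1 u2 Lb idb q bcont_intros
    define A where "A = lint \<Omega> (\<lambda>x. (u x)\<^sup>2)"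
    define G where "G = (\<lambda>e. lint \<Omega> (\<lambda>x. (pderivs [e] u x)\<^sup>2))"
    define N where "N = lint \<Omega> (\<lambda>x. (laplacian u x - q x * u x)\<^sup>2)"
    \<comment> \<open>Comes from the derivative of \<open>(x \<bullet> b) * u\<^sup>2\<close> in
      direction \<open>b\<close>, where \<open>x \<bullet> b\<close> is bounded by \<open>R\<close>;
      half of the integral of \<open>u\<^sup>2\<close> is absorbed on the left.\<close>
    have Poincare: "A \<le> 4 * R\<^sup>2 * G b"
    proof -
      define DF where "DF = (\<lambda>x h. (x \<bullet> b) * (u x * frechet_derivative u (at x) h + frechet_derivative u (at x) h * u x) + (h \<bullet> b) * (u x * u x))"
      have "lint \<Omega> (\<lambda>x. DF x b) = 0"
      proof (rule lint_directional_derivative_eq_0[OF \<Omega>, of "\<lambda>x. (x \<bullet> b) * (u x * u x)"])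
        fix x assume x: "x \<in> \<Omega>"
        show "((\<lambda>x. (x \<bullet> b) * (u x * u x)) has_derivative DF x) (at x)"
          unfolding DF_def by (intro has_derivative_mult ud[OF x] has_derivative_inner_left has_derivative_ident)
      next
        have "bcont \<Omega> (\<lambda>x. (x \<bullet> b) * (u x * pderivs [b] u x + pderivs [b] u x * u x) + (b \<bullet> b) * (u x * u x))"
          by (intro bi b)
        then show "bcont \<Omega> (\<lambda>x. DF x b)" by (simp add: DF_def)
      next
        fix x assume x: "x \<in> frontier \<Omega>"
        have "((\<lambda>x. ((x \<bullet> b) * u x) * u x) \<longlongrightarrow> 0) (at x within \<Omega>)"
          by (rule bcont_mult_tendsto_0) (use u0 x in \<open>auto simp: vanishes_at_frontier_def intro!: bi\<close>)
        then show "((\<lambda>x. (x \<bullet> b) * (u x * u x)) \<longlongrightarrow> 0) (at x within \<Omega>)" by (simp add: mult.assoc)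
      qed
      then have "0 = lint \<Omega> (\<lambda>x. (u x)\<^sup>2 + 2 * ((x \<bullet> b) * u x * pderivs [b] u x))"
        using b by (simp add: DF_def power2_eq_square algebra_simps)
      also have "\<dots> = A + lint \<Omega> (\<lambda>x. 2 * ((x \<bullet> b) * u x * pderivs [b] u x))"
        unfolding A_def by (intro lint_add bounded_borel bi b)
      also have "\<dots> \<ge> A + lint \<Omega> (\<lambda>x. - ((u x)\<^sup>2 / 2 + 2 * R\<^sup>2 * (pderivs [b] u x)\<^sup>2))"
      proof (intro add_left_mono lint_mono bounded_borel)
        show "bcont \<Omega> (\<lambda>x. - ((u x)\<^sup>2 / 2 + 2 * R\<^sup>2 * (pderivs [b] u x)\<^sup>2))"
          by (intro bi b bcont_divide_const)
        fix x assume x: "x \<in> \<Omega>"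
        define p where "p = pderivs [b] u x"
        have "(x \<bullet> b)\<^sup>2 \<le> R\<^sup>2"
          using Basis_le_norm[OF b, of x] R(2)[OF x] R(1) by (intro abs_le_square_iff[THEN iffD1]) auto
        then have "2 * ((x \<bullet> b)\<^sup>2 * p\<^sup>2) \<le> 2 * R\<^sup>2 * p\<^sup>2" by (simp add: mult_right_mono)
        moreover have "0 \<le> (u x + 2 * ((x \<bullet> b) * p))\<^sup>2" by simp
        then have "- (4 * ((x \<bullet> b) * u x * p)) \<le> (u x)\<^sup>2 + 4 * ((x \<bullet> b)\<^sup>2 * p\<^sup>2)"
          by (simp add: power2_eq_square algebra_simps)
        ultimately show "- ((u x)\<^sup>2 / 2 + 2 * R\<^sup>2 * (pderivs [b] u x)\<^sup>2) \<le> 2 * ((x \<bullet> b) * u x * pderivs [b] u x)"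
          unfolding p_def[symmetric] by linarith
      qed (intro bi b)
      also have "lint \<Omega> (\<lambda>x. - ((u x)\<^sup>2 / 2 + 2 * R\<^sup>2 * (pderivs [b] u x)\<^sup>2)) = - (A / 2 + 2 * R\<^sup>2 * G b)"
      proof -
        have "lint \<Omega> (\<lambda>x. inverse 2 * (u x)\<^sup>2 + 2 * R\<^sup>2 * (pderivs [b] u x)\<^sup>2) = inverse 2 * A + 2 * R\<^sup>2 * G b"
          unfolding A_def G_def by (subst lint_add[OF bounded_borel], (intro bi b)[1], (intro bi b)[1], simp only: lint_cmult)
        moreover have "lint \<Omega> (\<lambda>x. - ((u x)\<^sup>2 / 2 + 2 * R\<^sup>2 * (pderivs [b] u x)\<^sup>2)) =
            lint \<Omega> (\<lambda>x. (- 1) * (inverse 2 * (u x)\<^sup>2 + 2 * R\<^sup>2 * (pderivs [b] u x)\<^sup>2))"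
          by (rule lint_cong) (simp only: divide_inverse mult.commute[of _ "inverse 2"] mult_minus1)
        ultimately show ?thesis unfolding lint_cmult by simp
      qed
      finally show ?thesis by linarith
    qed
    have part: "lint \<Omega> (\<lambda>x. (pderivs [e] u x)\<^sup>2 + u x * pderivs [e, e] u x) = 0" if e: "e \<in> Basis" for e
    proof -
      define DF where "DF = (\<lambda>x h. u x * frechet_derivative (pderivs [e] u) (at x) h + frechet_derivative u (at x) h * pderivs [e] u x)"
      have "lint \<Omega> (\<lambda>x. DF x e) = 0"
      proof (rule lint_directional_derivative_eq_0[OF \<Omega>, of "\<lambda>x. u x * pderivs [e] u x"])
        fix x assume x: "x \<in> \<Omega>"
        show "((\<lambda>x. u x * pderivs [e] u x) has_derivative DF x) (at x)"
          unfolding DF_def using x e by (intro has_derivative_mult ud[OF x] bounded_Ck_has_derivative[OF u]) auto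
      next
        have "bcont \<Omega> (\<lambda>x. u x * pderivs [e, e] u x + pderivs [e] u x * pderivs [e] u x)"
          by (intro bi e)
        then show "bcont \<Omega> (\<lambda>x. DF x e)" by (simp add: DF_def)
      next
        fix x assume x: "x \<in> frontier \<Omega>"
        have "((\<lambda>x. pderivs [e] u x * u x) \<longlongrightarrow> 0) (at x within \<Omega>)"
          using u0 x by (intro bcont_mult_tendsto_0 bi e) (auto simp: vanishes_at_frontier_def)
        then show "((\<lambda>x. u x * pderivs [e] u x) \<longlongrightarrow> 0) (at x within \<Omega>)" by (simp add: mult.commute)
      qed
      then show ?thesis by (simp add: DF_def power2_eq_square add.commute)
    qed
    have "(\<Sum>e\<in>Basis. G e) + lint \<Omega> (\<lambda>x. u x * laplacian u x) = 0"
    proof -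
      have "0 = (\<Sum>e\<in>Basis. lint \<Omega> (\<lambda>x. (pderivs [e] u x)\<^sup>2 + u x * pderivs [e, e] u x))"
        using part by (simp del: pderivs.simps)
      also have "\<dots> = (\<Sum>e\<in>Basis. G e + lint \<Omega> (\<lambda>x. u x * pderivs [e, e] u x))"
        unfolding G_def by (intro sum.cong lint_add bounded_borel bi refl)
      also have "\<dots> = (\<Sum>e\<in>Basis. G e) + lint \<Omega> (\<lambda>x. \<Sum>e\<in>Basis. u x * pderivs [e, e] u x)"
        by (subst lint_sum[OF bounded_borel], (intro bi, assumption)[1], simp add: sum.distrib del: pderivs.simps)
      finally show ?thesis by (simp add: laplacian_def sum_distrib_left del: pderivs.simps)
    qed
    then have "(\<Sum>e\<in>Basis. G e) = lint \<Omega> (\<lambda>x. (- 1) * (u x * laplacian u x))" unfolding lint_cmult by simp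
    also have "\<dots> \<le> lint \<Omega> (\<lambda>x. inverse (8 * R\<^sup>2) * (u x)\<^sup>2 + (2 * R\<^sup>2) * (laplacian u x - q x * u x)\<^sup>2)"
    proof (intro lint_mono bounded_borel)
      fix x assume x: "x \<in> \<Omega>"
      define f where "f = laplacian u x - q x * u x"
      have "0 \<le> q x * (u x)\<^sup>2" using q0[OF x] by simp
      then have "- (u x * laplacian u x) \<le> - (u x * f)"
        by (simp add: f_def power2_eq_square algebra_simps)
      \<comment> \<open>Weighted Young inequality; the weight is such that, after multiplication by
        the Poincare constant \<open>4 * R\<^sup>2\<close>, the term in \<open>u\<close> is exactly
        \<open>A / 2\<close>.\<close>
      moreover have "0 \<le> inverse (8 * R\<^sup>2) * (u x + 4 * R\<^sup>2 * f)\<^sup>2" using R by simp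
      then have "- (u x * f) \<le> inverse (8 * R\<^sup>2) * (u x)\<^sup>2 + (2 * R\<^sup>2) * f\<^sup>2"
        using R by (simp add: power2_eq_square field_simps)
      ultimately show "(- 1) * (u x * laplacian u x) \<le> inverse (8 * R\<^sup>2) * (u x)\<^sup>2 + (2 * R\<^sup>2) * (laplacian u x - q x * u x)\<^sup>2"
        unfolding f_def[symmetric] by linarith
    qed (intro bi)+
    also have "\<dots> = inverse (8 * R\<^sup>2) * A + (2 * R\<^sup>2) * N"
      unfolding A_def N_def by (subst lint_add[OF bounded_borel], (intro bi)[1], (intro bi)[1], simp only: lint_cmult)
    finally have "(\<Sum>e\<in>Basis. G e) \<le> inverse (8 * R\<^sup>2) * A + (2 * R\<^sup>2) * N" .
    moreover have "G b \<le> (\<Sum>e\<in>Basis. G e)"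
      using b by (intro member_le_sum) (auto simp: G_def intro!: lint_nonneg simp del: pderivs.simps)
    ultimately have "4 * R\<^sup>2 * G b \<le> 4 * R\<^sup>2 * (inverse (8 * R\<^sup>2) * A + (2 * R\<^sup>2) * N)"
      by (intro mult_left_mono) auto
    also have "\<dots> = A / 2 + 8 * R^4 * N" using R by (simp add: field_simps power4_eq_xxxx power2_eq_square)
    finally have "A \<le> 16 * R^4 * N" using Poincare by linarith
    then show ?thesis by (simp add: A_def N_def)
  qed
  show ?thesis by (rule that[of "16 * R^4"]) (use R main in auto)
qed

section \<open>Trigonometric polynomials on a shifted lattice\<close>

definition int_vectors :: "(real ^ 'n) set" where "int_vectors = {k. \<forall>i. k $ i \<in> \<int>}"

text \<open>The shift multiplies all characters by one common unimodular factor: differences of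
  frequencies stay in the unshifted lattice, so orthogonality over \<open>cube l\<close> survives,
  while the frequencies themselves can be kept off a hyperplane.\<close>

definition lattice :: "real \<Rightarrow> real ^ 'n \<Rightarrow> (real ^ 'n) set" where
  "lattice l \<theta> = (\<lambda>k. l *\<^sub>R (k + \<theta>)) ` int_vectors"

text \<open>Half-open with side \<open>2 * pi / l\<close>, one exact period, so that the pieces of a
  translated cube reassemble without overlap.\<close>

definition cube :: "real \<Rightarrow> (real ^ 'n) set" where
  "cube l = {x. \<forall>i. - (pi / l) \<le> x $ i \<and> x $ i < pi / l}"

definition trig_sum :: "(real ^ 'n) set \<Rightarrow> (real ^ 'n \<Rightarrow> complex) \<Rightarrow> real ^ 'n \<Rightarrow> complex" where
  "trig_sum K c x = (\<Sum>\<kappa>\<in>K. c \<kappa> * cis (\<kappa> \<bullet> x))"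

lemma cube_subset_cbox: "cube l \<subseteq> cbox (\<chi> i. - (pi / l)) (\<chi> i. pi / l)"
  by (auto simp: cube_def mem_box_cart less_imp_le)

lemma bounded_borel_cube: "bounded_borel (cube l)"
proof -
  have "cube l = (\<Inter>i. {x. - (pi / l) \<le> x $ i} \<inter> {x. x $ i < pi / l})" by (auto simp: cube_def)
  also have "\<dots> \<in> sets borel"
    by (intro sets.finite_INT sets.Int borel_closed borel_open closed_Collect_le open_Collect_less continuous_intros) auto
  finally show ?thesis unfolding bounded_borel_def
    using bounded_subset[OF bounded_cbox cube_subset_cbox] by blast
qed

lemma bcont_cube: "continuous_on UNIV f \<Longrightarrow> bcont (cube l) f"
  by (rule bcont_compact[OF compact_cbox _ cube_subset_cbox]) (rule continuous_on_subset, auto)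

lemma continuous_on_cis_inner: "continuous_on S (\<lambda>x. cis (\<kappa> \<bullet> x))"
  unfolding cis_conv_exp by (intro continuous_intros)

lemma continuous_on_trig_sum: "continuous_on S (trig_sum K c)"
  unfolding trig_sum_def by (intro continuous_intros continuous_on_cis_inner)

lemma borel_measurable_continuous: "continuous_on UNIV f \<Longrightarrow> f \<in> borel_measurable borel"
  by (rule borel_measurable_continuous_onI)

lemma cis_int_2pi: assumes "z \<in> \<int>" shows "cis (2 * pi * z) = 1"
  using assms by (auto simp: cis_2pi elim!: Ints_cases)

text \<open>Translating by half a period in a direction in which the character is non-constant changes
  its sign, but not its integral over the cube.\<close>
lemma lint_cube_cis_eq_0:
  fixes k :: "real ^ 'n"
  assumes l: "l > 0" and k: "k \<in> int_vectors" "k \<noteq> 0"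
  shows "lint (cube l) (\<lambda>x. cis ((l *\<^sub>R k) \<bullet> x)) = 0"
proof -
  obtain j where j: "k $ j \<noteq> 0" using k(2) by (metis vec_eq_iff zero_index)
  have kj: "k $ j \<in> \<int>" using k by (auto simp: int_vectors_def)
  then have kj1: "\<bar>k $ j\<bar> \<ge> 1" using j by (metis Ints_nonzero_abs_ge1)
  define \<rho> where "\<rho> = pi / l"
  have \<rho>: "\<rho> > 0" using l by (simp add: \<rho>_def)
  \<comment> \<open>Half a period of the character in coordinate \<open>j\<close>; because
    \<open>\<bar>k $ j\<bar> \<ge> 1\<close> it does not exceed the side of the cube.\<close>
  define h where "h = \<rho> / \<bar>k $ j\<bar>"
  have h: "0 < h" "h \<le> 2 * \<rho>" using \<rho> kj1 by (auto simp: h_def field_simps)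
  define e :: "real ^ 'n" where "e = axis j 1"
  define Q :: "(real ^ 'n) set" where "Q = cube l"
  have Q: "x \<in> Q \<longleftrightarrow> (\<forall>i. - \<rho> \<le> x $ i \<and> x $ i < \<rho>)" for x by (simp add: Q_def cube_def \<rho>_def)
  have Q': "x \<in> Q \<longleftrightarrow> (\<forall>i. i \<noteq> j \<longrightarrow> - \<rho> \<le> x $ i \<and> x $ i < \<rho>) \<and> - \<rho> \<le> x $ j \<and> x $ j < \<rho>" for x
    unfolding Q by metis
  have ei: "e $ i = (if i = j then 1 else 0)" for i by (simp add: e_def axis_def)
  define F where "F = (\<lambda>x. cis ((l *\<^sub>R k) \<bullet> x))"
  have Fc: "continuous_on S F" for S unfolding F_def by (rule continuous_on_cis_inner)
  have [measurable]: "F \<in> borel_measurable borel" by (rule borel_measurable_continuous[OF Fc])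
  have Qm[measurable]: "Q \<in> sets borel" using bounded_borel_cube by (auto simp: Q_def bounded_borel_def)
  \<comment> \<open>The cube shifted by \<open>h\<close> consists of \<open>A\<close> and of
    \<open>B\<close> moved forward by one full period, which the character does not see.\<close>
  define A where "A = Q \<inter> {y. - \<rho> + h \<le> y $ j}"
  define B where "B = Q \<inter> {y. y $ j < - \<rho> + h}"
  have [measurable]: "A \<in> sets borel" unfolding A_def
    by (rule sets.Int[OF Qm borel_closed]) (intro closed_Collect_le continuous_intros)
  have [measurable]: "B \<in> sets borel" unfolding B_def
    by (rule sets.Int[OF Qm borel_open]) (intro open_Collect_less continuous_intros)
  have Fper: "F (x + (2 * \<rho>) *\<^sub>R e) = F x" for x
  proof -
    have "(l *\<^sub>R k) \<bullet> (x + (2 * \<rho>) *\<^sub>R e) = (l *\<^sub>R k) \<bullet> x + 2 * pi * k $ j"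
      using l by (simp add: e_def inner_axis inner_add_right \<rho>_def)
    then show ?thesis by (simp add: F_def cis_int_2pi[OF kj] flip: cis_mult)
  qed
  have Fper': "F (x - (2 * \<rho>) *\<^sub>R e) = F x" for x using Fper[of "x - (2 * \<rho>) *\<^sub>R e"] by simp
  have Fh: "F (x + h *\<^sub>R e) = - F x" for x
  proof -
    have "(l *\<^sub>R k) \<bullet> (x + h *\<^sub>R e) = (l *\<^sub>R k) \<bullet> x + pi * sgn (k $ j)"
      using l j by (simp add: e_def inner_axis inner_add_right \<rho>_def h_def sgn_if)
    moreover have "cis (pi * sgn (k $ j)) = - 1" using j by (cases "k $ j > 0") (auto simp: sgn_if complex_eq_iff)
    ultimately show ?thesis by (simp add: F_def flip: cis_mult)
  qed
  have int: "integrable lborel (\<lambda>y. indicat_real S y *\<^sub>R F y)" if "S \<subseteq> Q" and [measurable]: "S \<in> sets borel" for S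
  proof (rule Bochner_Integration.integrable_bound[of lborel "\<lambda>y. indicat_real Q y * 1"])
    have "bounded Q" using bounded_borel_cube by (auto simp: Q_def bounded_borel_def)
    then show "integrable lborel (\<lambda>y. indicat_real Q y * 1)"
      using emeasure_bounded_finite[of Q] by (auto intro!: integrable_real_indicator)
    show "(\<lambda>y. indicat_real S y *\<^sub>R F y) \<in> borel_measurable lborel" by measurable
    show "AE y in lborel. norm (indicat_real S y *\<^sub>R F y) \<le> norm (indicat_real Q y * 1)"
      by (rule AE_I2) (use that in \<open>auto simp: indicator_def F_def\<close>)
  qed
  have ind: "indicat_real Q (y - h *\<^sub>R e) = indicat_real A y + indicat_real B (y - (2 * \<rho>) *\<^sub>R e)" for y
  proof -
    have 1: "y - h *\<^sub>R e \<in> Q \<longleftrightarrow> (\<forall>i. i \<noteq> j \<longrightarrow> - \<rho> \<le> y $ i \<and> y $ i < \<rho>) \<and> - \<rho> + h \<le> y $ j \<and> y $ j < \<rho> + h"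
      by (auto simp: Q' ei)
    have 2: "y \<in> A \<longleftrightarrow> (\<forall>i. i \<noteq> j \<longrightarrow> - \<rho> \<le> y $ i \<and> y $ i < \<rho>) \<and> - \<rho> + h \<le> y $ j \<and> y $ j < \<rho>"
      using h by (auto simp: A_def Q')
    have 3: "y - (2 * \<rho>) *\<^sub>R e \<in> B \<longleftrightarrow> (\<forall>i. i \<noteq> j \<longrightarrow> - \<rho> \<le> y $ i \<and> y $ i < \<rho>) \<and> \<rho> \<le> y $ j \<and> y $ j < \<rho> + h"
      using h by (auto simp: B_def Q' ei)
    show ?thesis using 1 2 3 h by (auto simp: indicator_def)
  qed
  have tr: "integral\<^sup>L lborel (\<lambda>y. indicat_real B (y - (2 * \<rho>) *\<^sub>R e) *\<^sub>R F y) = integral\<^sup>L lborel (\<lambda>y. indicat_real B y *\<^sub>R F y)"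
    using lint_translate[of "\<lambda>y. indicat_real B y *\<^sub>R F y" "- (2 * \<rho>) *\<^sub>R e"] by (simp add: Fper')
  have trint: "integrable lborel (\<lambda>y. indicat_real B (y - (2 * \<rho>) *\<^sub>R e) *\<^sub>R F y)"
    using integrable_translate[OF int[of B], of "- (2 * \<rho>) *\<^sub>R e"] by (auto simp: Fper' B_def)
  have "- lint Q F = lint Q (\<lambda>x. F (x + h *\<^sub>R e))" by (simp add: Fh)
  also have "\<dots> = integral\<^sup>L lborel (\<lambda>x. indicat_real Q x *\<^sub>R F (x + h *\<^sub>R e))"
    by (rule lint_indicator) measurable
  also have "\<dots> = integral\<^sup>L lborel (\<lambda>y. indicat_real Q (y - h *\<^sub>R e) *\<^sub>R F y)"
    using lint_translate[of "\<lambda>y. indicat_real Q (y - h *\<^sub>R e) *\<^sub>R F y" "h *\<^sub>R e"] by simp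
  also have "\<dots> = integral\<^sup>L lborel (\<lambda>y. indicat_real A y *\<^sub>R F y + indicat_real B (y - (2 * \<rho>) *\<^sub>R e) *\<^sub>R F y)"
    by (simp add: ind scaleR_add_left)
  also have "\<dots> = integral\<^sup>L lborel (\<lambda>y. indicat_real A y *\<^sub>R F y) + integral\<^sup>L lborel (\<lambda>y. indicat_real B y *\<^sub>R F y)"
    by (subst Bochner_Integration.integral_add) (auto simp: tr trint A_def intro!: int)
  also have "\<dots> = integral\<^sup>L lborel (\<lambda>y. indicat_real A y *\<^sub>R F y + indicat_real B y *\<^sub>R F y)"
    by (rule Bochner_Integration.integral_add[symmetric]) (auto simp: A_def B_def intro!: int)
  also have "\<dots> = integral\<^sup>L lborel (\<lambda>y. indicat_real Q y *\<^sub>R F y)"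
    by (rule Bochner_Integration.integral_cong) (auto simp: A_def B_def indicator_def)
  also have "\<dots> = lint Q F" by (rule lint_indicator[symmetric]) measurable
  finally show ?thesis by (simp add: Q_def F_def)
qed

text \<open>Expand the square: cross terms are characters at differences of frequencies, in which
  the shift cancels; what remains is a nonzero multiple of an integer vector, with integral
  zero.\<close>

lemma trig_sum_Parseval:
  fixes \<theta> :: "real ^ 'n"
  assumes l: "l > 0" and K: "finite K" "K \<subseteq> lattice l \<theta>"
  shows "lint (cube l) (\<lambda>x. (norm (trig_sum K c x))\<^sup>2) = lint (cube l :: (real ^ 'n) set) (\<lambda>x. 1) * (\<Sum>\<kappa>\<in>K. (norm (c \<kappa>))\<^sup>2)"
proof -
  note bb = bounded_borel_cube[of l]
  have bc: "bcont (cube l) (\<lambda>x. cis (\<kappa> \<bullet> x))" for \<kappa> by (rule bcont_cube[OF continuous_on_cis_inner])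
  have bt: "bcont (cube l) (trig_sum K c)" by (rule bcont_cube[OF continuous_on_trig_sum])
  have orth: "lint (cube l) (\<lambda>x. cis ((\<kappa> - \<kappa>') \<bullet> x)) = (if \<kappa> = \<kappa>' then lint (cube l :: (real ^ 'n) set) (\<lambda>x. 1) else 0)"
    if kK: "\<kappa> \<in> K" "\<kappa>' \<in> K" for \<kappa> \<kappa>'
  proof (cases "\<kappa> = \<kappa>'")
    case False
    obtain k k' where k: "k \<in> int_vectors" "k' \<in> int_vectors" "\<kappa> = l *\<^sub>R (k + \<theta>)" "\<kappa>' = l *\<^sub>R (k' + \<theta>)"
      using subsetD[OF K(2) kK(1)] subsetD[OF K(2) kK(2)] unfolding lattice_def image_iff by blast
    have "\<kappa> - \<kappa>' = l *\<^sub>R (k - k')" by (simp add: k algebra_simps)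
    moreover have "k - k' \<in> int_vectors" using k by (simp add: int_vectors_def)
    ultimately show ?thesis using lint_cube_cis_eq_0[OF l, of "k - k'"] False k by auto
  qed simp
  have "of_real (lint (cube l) (\<lambda>x. (norm (trig_sum K c x))\<^sup>2)) = lint (cube l) (\<lambda>x. complex_of_real ((norm (trig_sum K c x))\<^sup>2))"
    by (rule integral_complex_of_real[symmetric])
  also have "\<dots> = lint (cube l) (\<lambda>x. \<Sum>\<kappa>\<in>K. \<Sum>\<kappa>'\<in>K. (c \<kappa> * cnj (c \<kappa>')) * cis ((\<kappa> - \<kappa>') \<bullet> x))"
  proof (rule lint_cong)
    fix x
    have "complex_of_real ((norm (trig_sum K c x))\<^sup>2) = trig_sum K c x * cnj (trig_sum K c x)" by (metis complex_norm_square)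
    also have "\<dots> = (\<Sum>\<kappa>\<in>K. \<Sum>\<kappa>'\<in>K. (c \<kappa> * cis (\<kappa> \<bullet> x)) * (cnj (c \<kappa>') * cis (- (\<kappa>' \<bullet> x))))"
      unfolding trig_sum_def cnj_sum sum_product by (simp add: cis_cnj)
    also have "\<dots> = (\<Sum>\<kappa>\<in>K. \<Sum>\<kappa>'\<in>K. (c \<kappa> * cnj (c \<kappa>')) * cis ((\<kappa> - \<kappa>') \<bullet> x))"
      by (intro sum.cong refl) (simp add: inner_diff_left cis_mult)
    finally show "complex_of_real ((norm (trig_sum K c x))\<^sup>2) = (\<Sum>\<kappa>\<in>K. \<Sum>\<kappa>'\<in>K. (c \<kappa> * cnj (c \<kappa>')) * cis ((\<kappa> - \<kappa>') \<bullet> x))" .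
  qed
  also have "\<dots> = (\<Sum>\<kappa>\<in>K. lint (cube l) (\<lambda>x. \<Sum>\<kappa>'\<in>K. (c \<kappa> * cnj (c \<kappa>')) * cis ((\<kappa> - \<kappa>') \<bullet> x)))"
    by (intro lint_sum bb bcont_sum bcont_mult bc bcont_const)
  also have "\<dots> = (\<Sum>\<kappa>\<in>K. \<Sum>\<kappa>'\<in>K. (c \<kappa> * cnj (c \<kappa>')) * lint (cube l) (\<lambda>x. cis ((\<kappa> - \<kappa>') \<bullet> x)))"
    by (intro sum.cong refl) (subst lint_sum[OF bb], (intro bcont_mult bc bcont_const)[1], simp only: lint_cmult)
  also have "\<dots> = (\<Sum>\<kappa>\<in>K. \<Sum>\<kappa>'\<in>K. (c \<kappa> * cnj (c \<kappa>')) * (if \<kappa> = \<kappa>' then lint (cube l :: (real ^ 'n) set) (\<lambda>x. 1) else 0))"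
    by (intro sum.cong refl) (simp only: orth)
  also have "\<dots> = (\<Sum>\<kappa>\<in>K. (c \<kappa> * cnj (c \<kappa>)) * lint (cube l :: (real ^ 'n) set) (\<lambda>x. 1))"
    using K(1) by (simp add: if_distrib[of "\<lambda>x. _ * x"] sum.delta cong: if_cong)
  also have "\<dots> = of_real (lint (cube l :: (real ^ 'n) set) (\<lambda>x. 1) * (\<Sum>\<kappa>\<in>K. (norm (c \<kappa>))\<^sup>2))"
  proof -
    have "lint (cube l :: (real ^ 'n) set) (\<lambda>x. 1 :: complex) = of_real (lint (cube l :: (real ^ 'n) set) (\<lambda>x. 1))"
      using integral_complex_of_real[of "restrict_space lborel (cube l :: (real ^ 'n) set)" "\<lambda>x. 1"] by simp
    then show ?thesis by (simp add: sum_distrib_left complex_norm_square mult.commute flip: of_real_power)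
  qed
  finally show ?thesis by (simp only: of_real_eq_iff)
qed

lemma trig_sum_extend: "finite K' \<Longrightarrow> K \<subseteq> K' \<Longrightarrow> trig_sum K c = trig_sum K' (\<lambda>\<kappa>. if \<kappa> \<in> K then c \<kappa> else 0)"
  unfolding trig_sum_def fun_eq_iff
  by (intro allI sum.mono_neutral_cong_left) auto

definition trig_poly :: "(real ^ 'n) set \<Rightarrow> (real ^ 'n \<Rightarrow> complex) \<Rightarrow> bool" where
  "trig_poly \<Lambda> f \<longleftrightarrow> (\<exists>K c. finite K \<and> K \<subseteq> \<Lambda> \<and> f = trig_sum K c)"

lemma trig_poly_cis: "\<kappa> \<in> \<Lambda> \<Longrightarrow> trig_poly \<Lambda> (\<lambda>x. a * cis (\<kappa> \<bullet> x))"
  unfolding trig_poly_def by (intro exI[of _ "{\<kappa>}"] exI[of _ "\<lambda>_. a"]) (auto simp: trig_sum_def)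

lemma trig_poly_0: "trig_poly \<Lambda> (\<lambda>x. 0)"
  unfolding trig_poly_def by (intro exI[of _ "{}"] exI[of _ "\<lambda>_. 0"]) (auto simp: trig_sum_def)

lemma trig_poly_add: assumes "trig_poly \<Lambda> f" "trig_poly \<Lambda> g" shows "trig_poly \<Lambda> (\<lambda>x. f x + g x)"
proof -
  obtain K c K' c' where K: "finite K" "K \<subseteq> \<Lambda>" "f = trig_sum K c" "finite K'" "K' \<subseteq> \<Lambda>" "g = trig_sum K' c'"
    using assms by (auto simp: trig_poly_def)
  have f: "f = trig_sum (K \<union> K') (\<lambda>\<kappa>. if \<kappa> \<in> K then c \<kappa> else 0)" unfolding K(3) by (rule trig_sum_extend) (use K in auto)
  have g: "g = trig_sum (K \<union> K') (\<lambda>\<kappa>. if \<kappa> \<in> K' then c' \<kappa> else 0)" unfolding K(6) by (rule trig_sum_extend) (use K in auto)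
  have "(\<lambda>x. f x + g x) = trig_sum (K \<union> K') (\<lambda>\<kappa>. (if \<kappa> \<in> K then c \<kappa> else 0) + (if \<kappa> \<in> K' then c' \<kappa> else 0))"
    by (subst f, subst g, rule ext) (simp only: trig_sum_def sum.distrib distrib_right)
  moreover have "finite (K \<union> K')" "K \<union> K' \<subseteq> \<Lambda>" using K by auto
  ultimately show ?thesis unfolding trig_poly_def by blast
qed

lemma trig_poly_sum: "(\<And>i. i \<in> I \<Longrightarrow> trig_poly \<Lambda> (f i)) \<Longrightarrow> trig_poly \<Lambda> (\<lambda>x. \<Sum>i\<in>I. f i x)"
  by (induction I rule: infinite_finite_induct) (auto simp: trig_poly_0 trig_poly_add)

lemma trig_poly_mult:
  assumes f: "trig_poly \<Lambda> f" and g: "trig_poly \<Lambda>' g" and S: "\<And>\<kappa> \<kappa>'. \<kappa> \<in> \<Lambda> \<Longrightarrow> \<kappa>' \<in> \<Lambda>' \<Longrightarrow> \<kappa> + \<kappa>' \<in> \<Lambda>''"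
  shows "trig_poly \<Lambda>'' (\<lambda>x. f x * g x)"
proof -
  obtain K c K' c' where K: "finite K" "K \<subseteq> \<Lambda>" "f = trig_sum K c" "finite K'" "K' \<subseteq> \<Lambda>'" "g = trig_sum K' c'"
    using assms by (auto simp: trig_poly_def)
  have "trig_poly \<Lambda>'' (\<lambda>x. \<Sum>\<kappa>\<in>K. \<Sum>\<kappa>'\<in>K'. (c \<kappa> * c' \<kappa>') * cis ((\<kappa> + \<kappa>') \<bullet> x))"
    by (intro trig_poly_sum trig_poly_cis S) (use K in auto)
  moreover have "(\<lambda>x. f x * g x) = (\<lambda>x. \<Sum>\<kappa>\<in>K. \<Sum>\<kappa>'\<in>K'. (c \<kappa> * c' \<kappa>') * cis ((\<kappa> + \<kappa>') \<bullet> x))"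
    unfolding K(3,6) trig_sum_def sum_product fun_eq_iff by (auto simp: inner_add_left cis_mult[symmetric] intro!: sum.cong)
  ultimately show ?thesis by simp
qed

lemma trig_poly_continuous: "trig_poly \<Lambda> f \<Longrightarrow> continuous_on S f"
  unfolding trig_poly_def using continuous_on_trig_sum by blast

lemma lattice_0_add: "\<kappa> \<in> lattice l 0 \<Longrightarrow> \<kappa>' \<in> lattice l \<theta> \<Longrightarrow> \<kappa> + \<kappa>' \<in> lattice l \<theta>"
proof -
  assume "\<kappa> \<in> lattice l 0" "\<kappa>' \<in> lattice l \<theta>"
  then obtain k k' where k: "k \<in> int_vectors" "k' \<in> int_vectors" "\<kappa> = l *\<^sub>R k" "\<kappa>' = l *\<^sub>R (k' + \<theta>)" by (auto simp: lattice_def)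
  have "\<kappa> + \<kappa>' = l *\<^sub>R ((k + k') + \<theta>)" by (simp add: k algebra_simps)
  moreover have "k + k' \<in> int_vectors" using k by (simp add: int_vectors_def)
  ultimately show ?thesis by (auto simp: lattice_def)
qed

section \<open>Uniform density of trigonometric polynomials\<close>

lemma cis_eq_in_period:
  assumes "\<bar>x\<bar> \<le> pi" "\<bar>y\<bar> \<le> pi" "cis x = cis y" shows "x = y \<or> \<bar>x\<bar> = pi \<and> \<bar>y\<bar> = pi"
proof -
  have "sin x = sin y \<and> cos x = cos y" using assms(3) by (simp add: complex_eq_iff)
  then obtain n where n: "x = y + 2 * pi * real_of_int n" by (auto simp: sin_cos_eq_iff)
  have "\<bar>2 * pi * real_of_int n\<bar> \<le> 2 * pi" using n assms by linarith
  then have "\<bar>real_of_int n\<bar> \<le> 1" by (simp add: abs_mult)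
  then have "n = 0 \<or> n = 1 \<or> n = -1" by linarith
  then show ?thesis using n assms by auto
qed

text \<open>Stone-Weierstrass on the torus, realised as the image of the closed cube under
  \<open>T\<close> in complex space. Since \<open>l * R < pi\<close>, \<open>h\<close> vanishes on
  the faces, the only points that \<open>T\<close> identifies, so it descends to a continuous
  function on the torus.\<close>

lemma trig_dense_real:
  fixes h :: "real ^ 'n \<Rightarrow> real"
  assumes l: "l > 0" and R: "l * R < pi" and h: "continuous_on UNIV h" and supp: "\<And>x. norm x > R \<Longrightarrow> h x = 0"
    and \<epsilon>: "\<epsilon> > 0"
  obtains f where "trig_poly (lattice l 0) f" "\<And>x. x \<in> cube l \<Longrightarrow> norm (complex_of_real (h x) - f x) < \<epsilon>"
proof -
  define \<rho> where "\<rho> = pi / l"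
  have R\<rho>: "R < \<rho>" using l R by (simp add: \<rho>_def field_simps)
  define C :: "(real ^ 'n) set" where "C = cbox (\<chi> i. - \<rho>) (\<chi> i. \<rho>)"
  have Ci: "x \<in> C \<Longrightarrow> \<bar>x $ i\<bar> \<le> \<rho>" for x i by (auto simp: C_def mem_box_cart abs_le_iff) (metis minus_le_iff)
  define T :: "real ^ 'n \<Rightarrow> complex ^ 'n" where "T = (\<lambda>x. \<chi> i. cis (l * x $ i))"
  have Tc: "continuous_on S T" for S
    unfolding T_def cis_conv_exp by (intro continuous_on_vec_lambda continuous_intros)
  have cC: "compact C" by (simp add: C_def)
  have cS: "compact (T ` C)" by (rule compact_continuous_image[OF Tc cC])
  have hT: "h x = h y" if "x \<in> C" "y \<in> C" "T x = T y" for x y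
  proof (cases "x = y")
    case False
    then obtain i where i: "x $ i \<noteq> y $ i" by (metis vec_eq_iff)
    have "cis (l * x $ i) = cis (l * y $ i)" using that(3) by (auto simp: T_def vec_eq_iff)
    moreover have "\<bar>l * x $ i\<bar> \<le> pi" "\<bar>l * y $ i\<bar> \<le> pi"
      using Ci[OF that(1), of i] Ci[OF that(2), of i] l by (auto simp: \<rho>_def abs_mult field_simps)
    ultimately have "\<bar>l * x $ i\<bar> = pi" "\<bar>l * y $ i\<bar> = pi" using cis_eq_in_period[of "l * x $ i" "l * y $ i"] i l by auto
    then have "\<bar>x $ i\<bar> = \<rho>" "\<bar>y $ i\<bar> = \<rho>" using l by (auto simp: \<rho>_def abs_mult field_simps)
    then have "norm x > R" "norm y > R"
      using R\<rho> component_le_norm_cart[of x i] component_le_norm_cart[of y i] by auto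
    then show ?thesis using supp by simp
  qed simp
  \<comment> \<open>The function induced by \<open>h\<close> on the torus; the choice of preimage is
    immaterial by \<open>hT\<close>.\<close>
  define g where "g = (\<lambda>z. h (SOME x. x \<in> C \<and> T x = z))"
  have gT: "g (T x) = h x" if "x \<in> C" for x
  proof -
    have "(SOME y. y \<in> C \<and> T y = T x) \<in> C \<and> T (SOME y. y \<in> C \<and> T y = T x) = T x"
      by (rule someI[of "\<lambda>y. y \<in> C \<and> T y = T x" x]) (use that in auto)
    then show ?thesis unfolding g_def using hT that by blast
  qed
  \<comment> \<open>By compactness \<open>T\<close> is a closed map on the cube: the preimage of a
    closed set under \<open>g\<close> is the image of a compact set.\<close>
  have gc: "continuous_on (T ` C) g"
    unfolding continuous_on_closed_vimage[OF compact_imp_closed[OF cS]]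
  proof (intro allI impI)
    fix D :: "real set" assume D: "closed D"
    have "closed (h -` D)" using h D continuous_closed_vimage[of D h] by (auto simp: continuous_on_eq_continuous_at)
    then have "compact (T ` (C \<inter> h -` D))" by (intro compact_continuous_image Tc compact_Int_closed cC)
    moreover have "g -` D \<inter> T ` C = T ` (C \<inter> h -` D)" using gT by force
    ultimately show "closed (g -` D \<inter> T ` C)" by (simp add: compact_imp_closed)
  qed
  define P where "P = (\<lambda>f. continuous_on (T ` C) f \<and> trig_poly (lattice l 0) (\<lambda>x. complex_of_real (f (T x))))"
  have axl: "axis i l \<in> lattice l 0" "- axis i l \<in> lattice l 0" for i
  proof -
    have "axis i l = l *\<^sub>R (axis i 1 + 0)" "- axis i l = l *\<^sub>R (- axis i 1 + 0)" by (auto simp: vec_eq_iff axis_def)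
    moreover have "axis i 1 \<in> int_vectors" "- axis i 1 \<in> int_vectors" by (auto simp: int_vectors_def axis_def)
    ultimately show "axis i l \<in> lattice l 0" "- axis i l \<in> lattice l 0" unfolding lattice_def by (metis imageI)+
  qed
  have PRe: "P (\<lambda>z. Re (z $ i))" for i
  proof -
    have "trig_poly (lattice l 0) (\<lambda>x. 1/2 * cis (axis i l \<bullet> x) + 1/2 * cis (- axis i l \<bullet> x))"
      by (intro trig_poly_add trig_poly_cis axl)
    moreover have "1/2 * cis (axis i l \<bullet> x) + 1/2 * cis (- axis i l \<bullet> x) = complex_of_real (Re (T x $ i))" for x
      by (simp add: T_def complex_eq_iff inner_axis' cis_conv_exp Re_exp Im_exp)
    ultimately show ?thesis unfolding P_def by (auto intro!: continuous_intros)
  qed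
  have PIm: "P (\<lambda>z. Im (z $ i))" for i
  proof -
    have "trig_poly (lattice l 0) (\<lambda>x. (- \<i>/2) * cis (axis i l \<bullet> x) + (\<i>/2) * cis (- axis i l \<bullet> x))"
      by (intro trig_poly_add trig_poly_cis axl)
    moreover have "(- \<i>/2) * cis (axis i l \<bullet> x) + (\<i>/2) * cis (- axis i l \<bullet> x) = complex_of_real (Im (T x $ i))" for x
      by (simp add: T_def complex_eq_iff inner_axis')
    ultimately show ?thesis unfolding P_def by (auto intro!: continuous_intros)
  qed
  have "\<exists>f. P f \<and> (\<forall>z\<in>T ` C. \<bar>g z - f z\<bar> < \<epsilon>)"
  proof (rule Stone_Weierstrass_HOL[OF cS _ _ _ _ _ gc \<epsilon>])
    fix c :: real
    have "0 \<in> lattice l (0 :: real ^ 'n)" by (auto simp: lattice_def int_vectors_def intro!: image_eqI[of _ _ 0])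
    from trig_poly_cis[OF this, of "complex_of_real c"] show "P (\<lambda>x. c)" by (simp add: P_def)
  next
    fix f assume "P f" then show "continuous_on (T ` C) f" by (simp add: P_def)
  next
    fix f1 f2 assume "P f1 \<and> P f2"
    then show "P (\<lambda>x. f1 x + f2 x)" by (auto simp: P_def intro!: continuous_intros trig_poly_add)
  next
    fix f1 f2 assume "P f1 \<and> P f2"
    then show "P (\<lambda>x. f1 x * f2 x)" by (auto simp: P_def intro!: continuous_intros trig_poly_mult lattice_0_add)
  next
    fix z w assume "z \<in> T ` C \<and> w \<in> T ` C \<and> z \<noteq> w"
    then obtain i where "z $ i \<noteq> w $ i" by (metis vec_eq_iff)
    then have "Re (z $ i) \<noteq> Re (w $ i) \<or> Im (z $ i) \<noteq> Im (w $ i)" by (simp add: complex_eq_iff)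
    then show "\<exists>f. P f \<and> f z \<noteq> f w" using PRe PIm by metis
  qed
  then obtain f where f: "P f" "\<And>z. z \<in> T ` C \<Longrightarrow> \<bar>g z - f z\<bar> < \<epsilon>" by blast
  show ?thesis
  proof (rule that)
    show "trig_poly (lattice l 0) (\<lambda>x. complex_of_real (f (T x)))" using f by (simp add: P_def)
    fix x :: "real ^ 'n" assume "x \<in> cube l"
    then have "x \<in> C" using cube_subset_cbox[of l] by (auto simp: C_def \<rho>_def)
    then have "\<bar>h x - f (T x)\<bar> < \<epsilon>" using f(2)[of "T x"] gT by auto
    then show "norm (complex_of_real (h x) - complex_of_real (f (T x))) < \<epsilon>"
      by (metis norm_of_real of_real_diff)
  qed
qed

text \<open>Multiplication by the conjugate character of the shift reduces to the unshifted lattice;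
  real and imaginary parts are approximated separately within \<open>\<epsilon> / 2\<close>.\<close>

lemma trig_dense:
  fixes h :: "real ^ 'n \<Rightarrow> complex"
  assumes l: "l > 0" and R: "l * R < pi" and h: "continuous_on UNIV h" and supp: "\<And>x. norm x > R \<Longrightarrow> h x = 0"
    and \<epsilon>: "\<epsilon> > 0"
  obtains f where "trig_poly (lattice l \<theta>) f" "\<And>x. x \<in> cube l \<Longrightarrow> norm (h x - f x) < \<epsilon>"
proof -
  define H where "H = (\<lambda>x. h x * cis (- (l *\<^sub>R \<theta>) \<bullet> x))"
  have Hc: "continuous_on UNIV H" unfolding H_def by (intro continuous_intros h continuous_on_cis_inner)
  have H0: "H x = 0" if "norm x > R" for x using supp[OF that] by (simp add: H_def)
  obtain f1 where f1: "trig_poly (lattice l 0) f1" "\<And>x. x \<in> cube l \<Longrightarrow> norm (complex_of_real (Re (H x)) - f1 x) < \<epsilon> / 2"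
    by (rule trig_dense_real[OF l R, of "\<lambda>x. Re (H x)" "\<epsilon> / 2"]) (use \<epsilon> H0 in \<open>auto intro!: continuous_intros Hc\<close>)
  obtain f2 where f2: "trig_poly (lattice l 0) f2" "\<And>x. x \<in> cube l \<Longrightarrow> norm (complex_of_real (Im (H x)) - f2 x) < \<epsilon> / 2"
    by (rule trig_dense_real[OF l R, of "\<lambda>x. Im (H x)" "\<epsilon> / 2"]) (use \<epsilon> H0 in \<open>auto intro!: continuous_intros Hc\<close>)
  have 0: "0 \<in> lattice l (0 :: real ^ 'n)" by (auto simp: lattice_def int_vectors_def intro!: image_eqI[of _ _ 0])
  have th: "l *\<^sub>R \<theta> \<in> lattice l \<theta>" by (auto simp: lattice_def int_vectors_def intro!: image_eqI[of _ _ 0])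
  define F where "F = (\<lambda>x. (f1 x + (\<i> * cis (0 \<bullet> x)) * f2 x) * (1 * cis ((l *\<^sub>R \<theta>) \<bullet> x)))"
  show ?thesis
  proof (rule that)
    have "trig_poly (lattice l 0) (\<lambda>x. (\<i> * cis (0 \<bullet> x)) * f2 x)"
      by (rule trig_poly_mult[OF trig_poly_cis[OF 0] f2(1)]) (rule lattice_0_add)
    then show "trig_poly (lattice l \<theta>) F" unfolding F_def
      by (intro trig_poly_mult[OF trig_poly_add[OF f1(1)] trig_poly_cis[OF th]] lattice_0_add)
    fix x :: "real ^ 'n" assume x: "x \<in> cube l"
    have hx: "h x = H x * cis ((l *\<^sub>R \<theta>) \<bullet> x)" by (simp add: H_def cis_mult mult.assoc)
    have "h x - F x = (H x - (f1 x + \<i> * f2 x)) * cis ((l *\<^sub>R \<theta>) \<bullet> x)"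
      unfolding hx F_def by (simp add: algebra_simps)
    then have "norm (h x - F x) = norm (H x - (f1 x + \<i> * f2 x))" by (simp add: norm_mult)
    also have "H x - (f1 x + \<i> * f2 x) = (complex_of_real (Re (H x)) - f1 x) + \<i> * (complex_of_real (Im (H x)) - f2 x)"
      by (subst (1) complex_eq[of "H x"]) (simp add: algebra_simps)
    also have "norm \<dots> \<le> norm (complex_of_real (Re (H x)) - f1 x) + norm (complex_of_real (Im (H x)) - f2 x)"
      by (rule order_trans[OF norm_triangle_ineq]) (simp add: norm_mult)
    also have "\<dots> < \<epsilon>" using f1(2)[OF x] f2(2)[OF x] by simp
    finally show "norm (h x - F x) < \<epsilon>" .
  qed
qed

section \<open>Approximate solution of a Fourier multiplier equation\<close>

lemma norm_add_square_le:
  fixes a b :: "'a::real_normed_vector"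
  shows "(norm (a + b))\<^sup>2 \<le> 2 * (norm a)\<^sup>2 + 2 * (norm b)\<^sup>2"
proof -
  have "(norm (a + b))\<^sup>2 \<le> (norm a + norm b)\<^sup>2" by (intro power_mono norm_triangle_ineq) auto
  also have "\<dots> \<le> 2 * (norm a)\<^sup>2 + 2 * (norm b)\<^sup>2"
    using sum_squares_bound[of "norm a" "norm b"] by (simp add: power2_sum)
  finally show ?thesis .
qed

lemma lint_norm_add_square_le:
  fixes f g :: "'a::euclidean_space \<Rightarrow> complex"
  assumes S: "bounded_borel S" and f: "bcont S f" and g: "bcont S g"
  shows "lint S (\<lambda>x. (norm (f x + g x))\<^sup>2) \<le> 2 * lint S (\<lambda>x. (norm (f x))\<^sup>2) + 2 * lint S (\<lambda>x. (norm (g x))\<^sup>2)"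
proof -
  have "lint S (\<lambda>x. (norm (f x + g x))\<^sup>2) \<le> lint S (\<lambda>x. 2 * (norm (f x))\<^sup>2 + 2 * (norm (g x))\<^sup>2)"
    by (intro lint_mono S bcont_intros f g norm_add_square_le)
  also have "\<dots> = 2 * lint S (\<lambda>x. (norm (f x))\<^sup>2) + 2 * lint S (\<lambda>x. (norm (g x))\<^sup>2)"
    by (subst lint_add[OF S], (intro bcont_intros f g)[1], (intro bcont_intros f g)[1], simp only: lint_cmult)
  finally show ?thesis .
qed

lemma lint_norm_mult_square_le:
  fixes f g :: "'a::euclidean_space \<Rightarrow> complex"
  assumes S: "bounded_borel S" and f: "bcont S f" and g: "bcont S g" and B: "\<And>x. x \<in> S \<Longrightarrow> norm (g x) \<le> B"
  shows "lint S (\<lambda>x. (norm (g x * f x))\<^sup>2) \<le> B\<^sup>2 * lint S (\<lambda>x. (norm (f x))\<^sup>2)"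
proof -
  have "lint S (\<lambda>x. (norm (g x * f x))\<^sup>2) \<le> lint S (\<lambda>x. B\<^sup>2 * (norm (f x))\<^sup>2)"
    by (intro lint_mono S bcont_intros f g) (auto simp: norm_mult power_mult_distrib intro!: mult_right_mono power_mono B)
  then show ?thesis by (simp only: lint_cmult)
qed

text \<open>The Fourier multiplier \<open>\<sigma>\<close> can be inverted on the lattice: replacing r by
  \<open>\<sigma>\<close> inverse applied to a trigonometric approximation of \<open>Q (1 + r)\<close> halves the
  residual.\<close>
lemma correction_term:
  fixes Q :: "real ^ 'n \<Rightarrow> real"
  assumes l: "l > 0" and R: "l * R < pi" and Q: "continuous_on UNIV Q" and supp: "\<And>x. norm x > R \<Longrightarrow> Q x = 0"
  obtains M where "M > 0" "\<And>\<sigma> \<theta> \<mu> \<eta>. \<mu> \<ge> M \<Longrightarrow> (\<And>\<kappa>. \<kappa> \<in> lattice l \<theta> \<Longrightarrow> norm (\<sigma> \<kappa>) \<ge> \<mu>) \<Longrightarrow> \<eta> > 0 \<Longrightarrow>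
     \<exists>K c. finite K \<and> K \<subseteq> lattice l \<theta> \<and> lint (cube l) (\<lambda>x. (norm (trig_sum K c x))\<^sup>2) \<le> (M / \<mu>)\<^sup>2 \<and>
       lint (cube l) (\<lambda>x. (norm (trig_sum K (\<lambda>\<kappa>. \<sigma> \<kappa> * c \<kappa>) x - of_real (Q x) * (1 + trig_sum K c x)))\<^sup>2) \<le> \<eta>"
proof -
  note S = bounded_borel_cube[of l]
  define N where "N = (\<lambda>f :: real ^ 'n \<Rightarrow> complex. lint (cube l) (\<lambda>x. (norm (f x))\<^sup>2))"
  define V where "V = lint (cube l :: (real ^ 'n) set) (\<lambda>x. 1 :: real)"
  have V: "V \<ge> 0" unfolding V_def by (rule lint_nonneg) simp
  have Qb: "bcont (cube l) Q" by (rule bcont_cube[OF Q])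
  obtain B where B: "0 < B" "\<And>x. x \<in> cube l \<Longrightarrow> norm (Q x) \<le> B" using Qb by (rule bcontE) blast
  have Qcb: "bcont (cube l) (\<lambda>x. complex_of_real (Q x))" by (rule bcont_of_real[OF Qb])
  have B': "\<And>x. x \<in> cube l \<Longrightarrow> norm (complex_of_real (Q x)) \<le> B" using B by simp
  have tb: "bcont (cube l) (trig_sum K c)" for K c by (rule bcont_cube[OF continuous_on_trig_sum])
  note bi = tb Qcb bcont_intros
  have N0: "N f \<ge> 0" for f unfolding N_def by (rule lint_nonneg) simp
  have Nadd: "N (\<lambda>x. f x + g x) \<le> 2 * N f + 2 * N g" if "bcont (cube l) f" "bcont (cube l) g" for f g
    unfolding N_def by (rule lint_norm_add_square_le[OF S that])
  have NQ: "N (\<lambda>x. complex_of_real (Q x) * f x) \<le> B\<^sup>2 * N f" if "bcont (cube l) f" for f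
    unfolding N_def by (rule lint_norm_mult_square_le[OF S that Qcb B'])
  have N1: "N (\<lambda>x. 1) = V" by (simp add: N_def V_def)
  \<comment> \<open>\<open>24 * B\<^sup>2\<close> makes one correction halve the residual;
    \<open>8 * B\<^sup>2 * V + 4\<close> is what the a posteriori bound on the final sum
    produces.\<close>
  define M where "M = sqrt (24 * B\<^sup>2 + 8 * B\<^sup>2 * V + 4)"
  have M2: "M\<^sup>2 = 24 * B\<^sup>2 + 8 * B\<^sup>2 * V + 4" unfolding M_def using V by (simp add: add_nonneg_nonneg)
  have M: "M > 0" unfolding M_def using V by (simp add: add_nonneg_pos)
  show ?thesis
  proof (rule that[OF M])
    fix \<sigma> :: "real ^ 'n \<Rightarrow> complex" and \<theta> \<mu> and \<eta>0 :: real
    assume \<mu>: "\<mu> \<ge> M" and \<sigma>: "\<And>\<kappa>. \<kappa> \<in> lattice l \<theta> \<Longrightarrow> norm (\<sigma> \<kappa>) \<ge> \<mu>" and \<eta>0: "\<eta>0 > 0"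
    \<comment> \<open>Capped at 1 because the bound on the size of the final sum uses a residual of
      at most 1.\<close>
    define \<eta> where "\<eta> = min \<eta>0 1"
    have \<eta>: "\<eta> > 0" "\<eta> \<le> 1" "\<eta> \<le> \<eta>0" using \<eta>0 by (auto simp: \<eta>_def)
    have \<mu>0: "\<mu> > 0" using M \<mu> by linarith
    have \<mu>2: "\<mu>\<^sup>2 \<ge> 24 * B\<^sup>2 + 8 * B\<^sup>2 * V + 4" using M2 \<mu> M by (metis less_imp_le power_mono)
    have \<mu>24: "\<mu>\<^sup>2 \<ge> 24 * B\<^sup>2" using \<mu>2 V by (smt (verit) mult_nonneg_nonneg zero_le_power2)
    \<comment> \<open>Parseval turns the lower bound on the multiplier into a mean-square bound for
      its inverse.\<close>
    have Ninv: "N (trig_sum K c) \<le> N (trig_sum K (\<lambda>\<kappa>. \<sigma> \<kappa> * c \<kappa>)) / \<mu>\<^sup>2" if K: "finite K" "K \<subseteq> lattice l \<theta>" for K c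
    proof -
      have "(\<Sum>\<kappa>\<in>K. (norm (c \<kappa>))\<^sup>2) \<le> (\<Sum>\<kappa>\<in>K. (norm (\<sigma> \<kappa> * c \<kappa>))\<^sup>2 / \<mu>\<^sup>2)"
      proof (rule sum_mono)
        fix \<kappa> assume "\<kappa> \<in> K"
        then have "norm (\<sigma> \<kappa>) \<ge> \<mu>" using K \<sigma> by auto
        then have "\<mu>\<^sup>2 * (norm (c \<kappa>))\<^sup>2 \<le> (norm (\<sigma> \<kappa>))\<^sup>2 * (norm (c \<kappa>))\<^sup>2"
          using \<mu>0 by (intro mult_right_mono power_mono) auto
        then show "(norm (c \<kappa>))\<^sup>2 \<le> (norm (\<sigma> \<kappa> * c \<kappa>))\<^sup>2 / \<mu>\<^sup>2"
          using \<mu>0 by (simp add: norm_mult power_mult_distrib field_simps)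
      qed
      then show ?thesis unfolding N_def trig_sum_Parseval[OF l K] using V
        by (simp add: V_def mult_left_mono flip: sum_divide_distrib times_divide_eq_right)
    qed
    define res where "res = (\<lambda>K c x. complex_of_real (Q x) * (1 + trig_sum K c x) - trig_sum K (\<lambda>\<kappa>. \<sigma> \<kappa> * c \<kappa>) x)"
    have step: "\<exists>K' c'. finite K' \<and> K' \<subseteq> lattice l \<theta> \<and> N (res K' c') \<le> N (res K c) / 2"
      if K: "finite K" "K \<subseteq> lattice l \<theta>" and pos: "N (res K c) > 0" for K c
    proof -
      define E where "E = N (res K c)"
      have E: "E > 0" using pos by (simp add: E_def)
      define \<epsilon> where "\<epsilon> = sqrt (E / (16 * (V + 1)))"
      have \<epsilon>: "\<epsilon> > 0" "\<epsilon>\<^sup>2 * V \<le> E / 16" using E V by (auto simp: \<epsilon>_def field_simps)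
      obtain f where f: "trig_poly (lattice l \<theta>) f" "\<And>x. x \<in> cube l \<Longrightarrow> norm (complex_of_real (Q x) * (1 + trig_sum K c x) - f x) < \<epsilon>"
        by (rule trig_dense[OF l R _ _ \<epsilon>(1), of "\<lambda>x. complex_of_real (Q x) * (1 + trig_sum K c x)"])
          (use supp in \<open>auto intro!: continuous_intros Q continuous_on_trig_sum\<close>)
      obtain K1 c1 where K1: "finite K1" "K1 \<subseteq> lattice l \<theta>" "f = trig_sum K1 c1" using f(1) by (auto simp: trig_poly_def)
      define K2 where "K2 = K \<union> K1"
      have K2: "finite K2" "K2 \<subseteq> lattice l \<theta>" using K K1 by (auto simp: K2_def)
      define d where "d = (\<lambda>\<kappa>. if \<kappa> \<in> K then c \<kappa> else 0)"
      define d1 where "d1 = (\<lambda>\<kappa>. if \<kappa> \<in> K1 then c1 \<kappa> else 0)"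
      have tpK: "trig_sum K c = trig_sum K2 d" unfolding d_def by (rule trig_sum_extend) (use K2 in \<open>auto simp: K2_def\<close>)
      have tpK1: "f = trig_sum K2 d1" unfolding d1_def K1(3) by (rule trig_sum_extend) (use K2 in \<open>auto simp: K2_def\<close>)
      have tpKs: "trig_sum K (\<lambda>\<kappa>. \<sigma> \<kappa> * c \<kappa>) = trig_sum K2 (\<lambda>\<kappa>. \<sigma> \<kappa> * d \<kappa>)"
      proof -
        have "trig_sum K (\<lambda>\<kappa>. \<sigma> \<kappa> * c \<kappa>) = trig_sum K2 (\<lambda>\<kappa>. if \<kappa> \<in> K then \<sigma> \<kappa> * c \<kappa> else 0)"
          by (rule trig_sum_extend) (use K2 in \<open>auto simp: K2_def\<close>)
        also have "(\<lambda>\<kappa>. if \<kappa> \<in> K then \<sigma> \<kappa> * c \<kappa> else 0) = (\<lambda>\<kappa>. \<sigma> \<kappa> * d \<kappa>)" by (auto simp: d_def)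
        finally show ?thesis .
      qed
      have \<sigma>nz: "\<sigma> \<kappa> \<noteq> 0" if "\<kappa> \<in> K2" for \<kappa> using \<sigma>[of \<kappa>] K2 that \<mu>0 by auto
      \<comment> \<open>The new coefficients invert the multiplier on the approximation
        \<open>f\<close>, so the new residual is the approximation error \<open>A\<close> plus
        \<open>Q\<close> times the change \<open>D\<close> of the sum.\<close>
      define c' where "c' = (\<lambda>\<kappa>. d1 \<kappa> / \<sigma> \<kappa>)"
      have sc': "trig_sum K2 (\<lambda>\<kappa>. \<sigma> \<kappa> * c' \<kappa>) = f"
        unfolding tpK1 trig_sum_def c'_def using \<sigma>nz by (auto intro!: sum.cong ext)
      define A where "A = (\<lambda>x. complex_of_real (Q x) * (1 + trig_sum K c x) - f x)"
      have Ab: "bcont (cube l) A" unfolding A_def tpK1 by (intro bi)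
      have NA: "N A \<le> E / 16"
      proof -
        have "N A \<le> lint (cube l :: (real ^ 'n) set) (\<lambda>x. \<epsilon>\<^sup>2 * 1)" unfolding N_def
        proof (intro lint_mono S bcont_intros Ab)
          fix x :: "real ^ 'n" assume "x \<in> cube l"
          then have "norm (A x) \<le> \<epsilon>" using f(2) by (auto simp: A_def less_imp_le)
          then show "(norm (A x))\<^sup>2 \<le> \<epsilon>\<^sup>2 * 1" by (simp add: power_mono)
        qed
        also have "\<dots> = \<epsilon>\<^sup>2 * V" unfolding V_def by (rule lint_cmult)
        finally show ?thesis using \<epsilon> by simp
      qed
      define D where "D = trig_sum K2 (\<lambda>\<kappa>. c' \<kappa> - d \<kappa>)"
      have Deq: "trig_sum K2 c' x - trig_sum K c x = D x" for x
        unfolding D_def tpK trig_sum_def by (simp add: sum_subtractf left_diff_distrib)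
      have resb: "bcont (cube l) (res K c)" unfolding res_def by (intro bi)
      have sD: "trig_sum K2 (\<lambda>\<kappa>. \<sigma> \<kappa> * (c' \<kappa> - d \<kappa>)) = (\<lambda>x. (- 1) * A x + res K c x)"
      proof
        fix x
        have "trig_sum K2 (\<lambda>\<kappa>. \<sigma> \<kappa> * (c' \<kappa> - d \<kappa>)) x = trig_sum K2 (\<lambda>\<kappa>. \<sigma> \<kappa> * c' \<kappa>) x - trig_sum K2 (\<lambda>\<kappa>. \<sigma> \<kappa> * d \<kappa>) x"
          unfolding trig_sum_def by (simp add: sum_subtractf algebra_simps)
        then show "trig_sum K2 (\<lambda>\<kappa>. \<sigma> \<kappa> * (c' \<kappa> - d \<kappa>)) x = (- 1) * A x + res K c x"
          unfolding sc' tpKs[symmetric] by (simp add: A_def res_def)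
      qed
      have mA: "N (\<lambda>x. (- 1) * A x) = N A" by (simp add: N_def)
      have "N (\<lambda>x. (- 1) * A x + res K c x) \<le> 2 * N A + 2 * E"
        unfolding E_def using Nadd[of "\<lambda>x. (- 1) * A x" "res K c"] mA Ab resb by (auto intro!: bcont_intros)
      then have "N (\<lambda>x. (- 1) * A x + res K c x) \<le> 3 * E" using NA E by linarith
      then have "N (\<lambda>x. (- 1) * A x + res K c x) / \<mu>\<^sup>2 \<le> 3 * E / \<mu>\<^sup>2" by (rule divide_right_mono) simp
      then have ND: "N D \<le> 3 * E / \<mu>\<^sup>2"
        using Ninv[OF K2, of "\<lambda>\<kappa>. c' \<kappa> - d \<kappa>"] unfolding sD D_def[symmetric] by (rule order_trans[rotated])
      have Db: "bcont (cube l) D" unfolding D_def by (rule tb)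
      have "res K2 c' = (\<lambda>x. A x + complex_of_real (Q x) * D x)"
        unfolding res_def sc' A_def Deq[symmetric] by (auto simp: algebra_simps)
      then have "N (res K2 c') \<le> 2 * N A + 2 * N (\<lambda>x. complex_of_real (Q x) * D x)"
        using Nadd[OF Ab bcont_mult[OF Qcb Db]] by simp
      also have "\<dots> \<le> 2 * (E / 16) + 2 * (B\<^sup>2 * (3 * E / \<mu>\<^sup>2))"
        using NA order_trans[OF NQ[OF Db] mult_left_mono[OF ND, of "B\<^sup>2"]]
        by (intro add_mono mult_left_mono) auto
      also have "\<dots> \<le> E / 2"
      proof -
        have "24 * B\<^sup>2 * E \<le> \<mu>\<^sup>2 * E" using \<mu>24 E by (intro mult_right_mono) auto
        then have "B\<^sup>2 * (3 * E / \<mu>\<^sup>2) \<le> E / 8" using \<mu>0 by (simp add: field_simps)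
        then show ?thesis using E by linarith
      qed
      finally show ?thesis using K2 unfolding E_def by blast
    qed
    have "\<exists>K c. finite K \<and> K \<subseteq> lattice l \<theta> \<and> N (res K c) \<le> N (res {} (\<lambda>_. 0)) / 2 ^ n" for n
    proof (induction n)
      case 0
      then show ?case by (intro exI[of _ "{}"] exI[of _ "\<lambda>_. 0"]) auto
    next
      case (Suc n)
      then obtain K c where K: "finite K" "K \<subseteq> lattice l \<theta>" "N (res K c) \<le> N (res {} (\<lambda>_. 0)) / 2 ^ n" by blast
      show ?case
      proof (cases "N (res K c) > 0")
        case True
        then obtain K' c' where "finite K'" "K' \<subseteq> lattice l \<theta>" "N (res K' c') \<le> N (res K c) / 2" using step[OF K(1,2)] by blast
        moreover have "N (res K c) / 2 \<le> N (res {} (\<lambda>_. 0)) / 2 ^ n / 2" using K(3) by (rule divide_right_mono) simp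
        ultimately show ?thesis by (intro exI[of _ K'] exI[of _ c']) (auto simp: mult.commute)
      next
        case False
        then have "N (res K c) \<le> N (res {} (\<lambda>_. 0)) / 2 ^ Suc n" using N0[of "res {} (\<lambda>_. 0)"] by (smt (verit) divide_nonneg_pos zero_less_power)
        then show ?thesis using K by blast
      qed
    qed
    moreover obtain n where "N (res {} (\<lambda>_. 0)) / 2 ^ n < \<eta>"
    proof -
      have "(\<lambda>n. N (res {} (\<lambda>_. 0)) * (1 / 2) ^ n) \<longlonglongrightarrow> N (res {} (\<lambda>_. 0)) * 0" by (intro tendsto_intros LIMSEQ_power_zero) auto
      then have "eventually (\<lambda>n. N (res {} (\<lambda>_. 0)) * (1 / 2) ^ n < \<eta>) sequentially"
        using \<eta>(1) by (intro order_tendstoD) auto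
      then show ?thesis using that by (auto simp: eventually_sequentially power_divide)
    qed
    ultimately obtain K c where K: "finite K" "K \<subseteq> lattice l \<theta>" and r: "N (res K c) \<le> \<eta>" by (meson less_le_not_le order.trans)
    have rb: "bcont (cube l) (res K c)" unfolding res_def by (intro bi)
    \<comment> \<open>The size is read off from the final equation, not summed along the iteration:
      the term in \<open>N (trig_sum K c)\<close> on the right has at most half the coefficient
      \<open>\<mu>\<^sup>2\<close> that it has on the left, and is absorbed.\<close>
    have "N (trig_sum K (\<lambda>\<kappa>. \<sigma> \<kappa> * c \<kappa>)) = N (\<lambda>x. (- 1) * res K c x + complex_of_real (Q x) * (1 + trig_sum K c x))"
      by (simp add: res_def)
    also have "\<dots> \<le> 2 * N (\<lambda>x. (- 1) * res K c x) + 2 * N (\<lambda>x. complex_of_real (Q x) * (1 + trig_sum K c x))"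
      by (intro Nadd bi rb)
    also have "\<dots> \<le> 2 * 1 + 2 * (B\<^sup>2 * (2 * V + 2 * N (trig_sum K c)))"
    proof -
      have "N (\<lambda>x. (- 1) * res K c x) \<le> 1" using r \<eta> by (simp add: N_def)
      moreover have "N (\<lambda>x. complex_of_real (Q x) * (1 + trig_sum K c x)) \<le> B\<^sup>2 * N (\<lambda>x. 1 + trig_sum K c x)" by (intro NQ bi)
      moreover have "N (\<lambda>x. 1 + trig_sum K c x) \<le> 2 * V + 2 * N (trig_sum K c)" using Nadd[of "\<lambda>x. 1" "trig_sum K c"] N1 tb by auto
      then have "B\<^sup>2 * N (\<lambda>x. 1 + trig_sum K c x) \<le> B\<^sup>2 * (2 * V + 2 * N (trig_sum K c))" by (rule mult_left_mono) simp
      ultimately show ?thesis by linarith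
    qed
    finally have 1: "N (trig_sum K (\<lambda>\<kappa>. \<sigma> \<kappa> * c \<kappa>)) \<le> 2 + 4 * B\<^sup>2 * V + 4 * B\<^sup>2 * N (trig_sum K c)" by (simp add: algebra_simps)
    have "\<mu>\<^sup>2 * N (trig_sum K c) \<le> N (trig_sum K (\<lambda>\<kappa>. \<sigma> \<kappa> * c \<kappa>))" using Ninv[OF K, of c] \<mu>0 by (simp add: field_simps)
    moreover have "8 * B\<^sup>2 * N (trig_sum K c) \<le> \<mu>\<^sup>2 * N (trig_sum K c)" using order_trans[of "8 * B\<^sup>2" "24 * B\<^sup>2", OF _ \<mu>24] N0 by (intro mult_right_mono) auto
    ultimately have "\<mu>\<^sup>2 * N (trig_sum K c) \<le> 4 + 8 * B\<^sup>2 * V" using 1 by linarith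
    also have "\<dots> \<le> M\<^sup>2" unfolding M2 by simp
    finally have "N (trig_sum K c) \<le> (M / \<mu>)\<^sup>2" using \<mu>0 by (simp add: power_divide field_simps)
    moreover have "N (\<lambda>x. trig_sum K (\<lambda>\<kappa>. \<sigma> \<kappa> * c \<kappa>) x - complex_of_real (Q x) * (1 + trig_sum K c x)) = N (res K c)"
      by (simp add: N_def res_def norm_minus_commute)
    then have "N (\<lambda>x. trig_sum K (\<lambda>\<kappa>. \<sigma> \<kappa> * c \<kappa>) x - complex_of_real (Q x) * (1 + trig_sum K c x)) \<le> \<eta>0" using r \<eta> by linarith
    ultimately show "\<exists>K c. finite K \<and> K \<subseteq> lattice l \<theta> \<and> lint (cube l) (\<lambda>x. (norm (trig_sum K c x))\<^sup>2) \<le> (M / \<mu>)\<^sup>2 \<and>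
       lint (cube l) (\<lambda>x. (norm (trig_sum K (\<lambda>\<kappa>. \<sigma> \<kappa> * c \<kappa>) x - of_real (Q x) * (1 + trig_sum K c x)))\<^sup>2) \<le> \<eta>0"
      using K unfolding N_def by blast
  qed
qed

section \<open>Complex geometrical optics solutions\<close>

text \<open>Real parts of \<open>exp (a \<bullet> x)\<close> times a trigonometric polynomial; replacing c by \<open>- \<i> c\<close> gives
  the imaginary parts.\<close>
definition exp_trig_sum :: "(real ^ 'n) set \<Rightarrow> (real ^ 'n \<Rightarrow> complex) \<Rightarrow> real ^ 'n \<Rightarrow> real ^ 'n \<Rightarrow> real" where
  "exp_trig_sum K c a x = Re (of_real (exp (a \<bullet> x)) * trig_sum K c x)"

text \<open>Each summand is the real part of a multiple of
  \<open>exp ((a + i \<kappa>) \<bullet> x)\<close>, so differentiation in direction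
  \<open>h\<close> multiplies its coefficient by
  \<open>(a + i \<kappa>) \<bullet> h\<close>.\<close>

lemma exp_trig_sum_has_derivative:
  "(exp_trig_sum K c a has_derivative (\<lambda>h. exp_trig_sum K (\<lambda>\<kappa>. Complex (a \<bullet> h) (\<kappa> \<bullet> h) * c \<kappa>) a x)) (at x)"
proof -
  have 1: "((\<lambda>x. cis (\<kappa> \<bullet> x)) has_derivative (\<lambda>h. (\<kappa> \<bullet> h) *\<^sub>R (\<i> * cis (\<kappa> \<bullet> x)))) (at x)" for \<kappa>
    by (intro has_derivative_cis derivative_intros)
  have "((\<lambda>x. \<Sum>\<kappa>\<in>K. c \<kappa> * cis (\<kappa> \<bullet> x)) has_derivative (\<lambda>h. \<Sum>\<kappa>\<in>K. c \<kappa> * ((\<kappa> \<bullet> h) *\<^sub>R (\<i> * cis (\<kappa> \<bullet> x))))) (at x)"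
    by (intro has_derivative_sum has_derivative_mult_right 1)
  then have 2: "(trig_sum K c has_derivative (\<lambda>h. \<Sum>\<kappa>\<in>K. c \<kappa> * ((\<kappa> \<bullet> h) *\<^sub>R (\<i> * cis (\<kappa> \<bullet> x))))) (at x)"
    by (simp add: trig_sum_def[abs_def])
  have 3: "((\<lambda>x. complex_of_real (exp (a \<bullet> x))) has_derivative (\<lambda>h. complex_of_real ((a \<bullet> h) * exp (a \<bullet> x)))) (at x)"
    by (intro has_derivative_of_real) (auto intro!: derivative_eq_intros)
  have "((\<lambda>x. Re (complex_of_real (exp (a \<bullet> x)) * trig_sum K c x)) has_derivative
     (\<lambda>h. Re (complex_of_real (exp (a \<bullet> x)) * (\<Sum>\<kappa>\<in>K. c \<kappa> * ((\<kappa> \<bullet> h) *\<^sub>R (\<i> * cis (\<kappa> \<bullet> x))))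
       + complex_of_real ((a \<bullet> h) * exp (a \<bullet> x)) * trig_sum K c x))) (at x)"
    by (intro has_derivative_Re has_derivative_mult 2 3)
  moreover have "complex_of_real (exp (a \<bullet> x)) * (\<Sum>\<kappa>\<in>K. c \<kappa> * ((\<kappa> \<bullet> h) *\<^sub>R (\<i> * cis (\<kappa> \<bullet> x))))
       + complex_of_real ((a \<bullet> h) * exp (a \<bullet> x)) * trig_sum K c x
     = complex_of_real (exp (a \<bullet> x)) * trig_sum K (\<lambda>\<kappa>. Complex (a \<bullet> h) (\<kappa> \<bullet> h) * c \<kappa>) x" for h
  proof -
    have "(\<Sum>\<kappa>\<in>K. c \<kappa> * ((\<kappa> \<bullet> h) *\<^sub>R (\<i> * cis (\<kappa> \<bullet> x)))) + complex_of_real (a \<bullet> h) * (\<Sum>\<kappa>\<in>K. c \<kappa> * cis (\<kappa> \<bullet> x))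
       = (\<Sum>\<kappa>\<in>K. Complex (a \<bullet> h) (\<kappa> \<bullet> h) * c \<kappa> * cis (\<kappa> \<bullet> x))"
      unfolding sum_distrib_left sum.distrib[symmetric] Complex_eq
      by (intro sum.cong refl) (simp add: algebra_simps scaleR_conv_of_real)
    note eq = this
    have "E * S + complex_of_real (u * e) * T = E * (S + complex_of_real u * T)" if "E = complex_of_real e" for E S T e u
      using that by (simp add: algebra_simps)
    then show ?thesis unfolding trig_sum_def using eq by metis
  qed
  ultimately show ?thesis unfolding exp_trig_sum_def[abs_def] by (simp only: )
qed

lemma frechet_derivative_exp_trig_sum:
  "frechet_derivative (exp_trig_sum K c a) (at x) h = exp_trig_sum K (\<lambda>\<kappa>. Complex (a \<bullet> h) (\<kappa> \<bullet> h) * c \<kappa>) a x"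
  by (rule fun_cong[OF frechet_derivative_at[OF exp_trig_sum_has_derivative, symmetric]])

lemma pderivs_exp_trig_sum:
  "pderivs es (exp_trig_sum K c a) = exp_trig_sum K (\<lambda>\<kappa>. prod_list (map (\<lambda>e. Complex (a \<bullet> e) (\<kappa> \<bullet> e)) es) * c \<kappa>) a"
  by (induction es) (auto simp: frechet_derivative_exp_trig_sum mult.assoc)

text \<open>The multiplier is the bilinear, not Hermitian, square of
  \<open>a + i \<kappa>\<close>.\<close>

lemma laplacian_exp_trig_sum:
  "laplacian (exp_trig_sum K c a) = exp_trig_sum K (\<lambda>\<kappa>. Complex ((norm a)\<^sup>2 - (norm \<kappa>)\<^sup>2) (2 * (a \<bullet> \<kappa>)) * c \<kappa>) a"
proof
  fix x
  have sq: "(\<Sum>e\<in>Basis. Complex (a \<bullet> e) (\<kappa> \<bullet> e) * Complex (a \<bullet> e) (\<kappa> \<bullet> e)) = Complex ((norm a)\<^sup>2 - (norm \<kappa>)\<^sup>2) (2 * (a \<bullet> \<kappa>))" for \<kappa>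
    unfolding complex_eq_iff
    by (simp add: sum_subtractf sum.distrib euclidean_inner[of a \<kappa>] euclidean_inner[of a a] euclidean_inner[of \<kappa> \<kappa>] power2_norm_eq_inner sum_distrib_left mult.commute)
  have "laplacian (exp_trig_sum K c a) x = Re (of_real (exp (a \<bullet> x)) * (\<Sum>e\<in>Basis. \<Sum>\<kappa>\<in>K. (Complex (a \<bullet> e) (\<kappa> \<bullet> e) * Complex (a \<bullet> e) (\<kappa> \<bullet> e)) * (c \<kappa> * cis (\<kappa> \<bullet> x))))"
    unfolding laplacian_def pderivs_exp_trig_sum exp_trig_sum_def trig_sum_def by (simp add: sum_distrib_left mult.assoc)
  also have "(\<Sum>e\<in>Basis. \<Sum>\<kappa>\<in>K. (Complex (a \<bullet> e) (\<kappa> \<bullet> e) * Complex (a \<bullet> e) (\<kappa> \<bullet> e)) * (c \<kappa> * cis (\<kappa> \<bullet> x)))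
    = (\<Sum>\<kappa>\<in>K. (\<Sum>e\<in>Basis. Complex (a \<bullet> e) (\<kappa> \<bullet> e) * Complex (a \<bullet> e) (\<kappa> \<bullet> e)) * (c \<kappa> * cis (\<kappa> \<bullet> x)))"
    unfolding sum_distrib_right by (rule sum.swap)
  also have "\<dots> = trig_sum K (\<lambda>\<kappa>. Complex ((norm a)\<^sup>2 - (norm \<kappa>)\<^sup>2) (2 * (a \<bullet> \<kappa>)) * c \<kappa>) x"
    unfolding sq trig_sum_def by (simp add: mult.assoc)
  finally show "laplacian (exp_trig_sum K c a) x = exp_trig_sum K (\<lambda>\<kappa>. Complex ((norm a)\<^sup>2 - (norm \<kappa>)\<^sup>2) (2 * (a \<bullet> \<kappa>)) * c \<kappa>) a x"
    by (rule trans[OF _ exp_trig_sum_def[symmetric]])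
qed

lemma continuous_on_exp_trig_sum: "continuous_on S (exp_trig_sum K c a)"
  by (rule has_derivative_continuous_on) (rule has_derivative_at_withinI[OF exp_trig_sum_has_derivative])

lemma bcont_exp_trig_sum: "bounded S \<Longrightarrow> bcont S (exp_trig_sum K c a)"
  by (rule bcont_compact[of "closure S"]) (auto simp: continuous_on_exp_trig_sum closure_subset)

lemma bounded_Ck_exp_trig_sum: "bounded S \<Longrightarrow> bounded_Ck k S (exp_trig_sum K c a)"
  unfolding bounded_Ck_def pderivs_exp_trig_sum differentiable_def
  by (blast intro: bcont_exp_trig_sum exp_trig_sum_has_derivative)

text \<open>Up to distance 1 the Lipschitz bound is the stronger one since
  \<open>\<alpha> \<le> 1\<close>; beyond it, twice the supremum suffices.\<close>

lemma Lipschitz_imp_Hoelder: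
  fixes f :: "'a::metric_space \<Rightarrow> real"
  assumes \<alpha>: "0 < \<alpha>" "\<alpha> \<le> 1" and L: "\<And>x y. x \<in> S \<Longrightarrow> y \<in> S \<Longrightarrow> \<bar>f x - f y\<bar> \<le> L * dist x y" "L \<ge> 0"
    and M: "\<And>x. x \<in> S \<Longrightarrow> \<bar>f x\<bar> \<le> M" "M \<ge> 0"
  shows "\<exists>C. \<forall>x\<in>S. \<forall>y\<in>S. \<bar>f x - f y\<bar> \<le> C * dist x y powr \<alpha>"
proof (intro exI[of _ "L + 2 * M"] ballI)
  fix x y assume xy: "x \<in> S" "y \<in> S"
  show "\<bar>f x - f y\<bar> \<le> (L + 2 * M) * dist x y powr \<alpha>"
  proof (cases "dist x y \<le> 1")
    case True
    have "dist x y \<le> dist x y powr \<alpha>"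
      using powr_mono'[of \<alpha> 1 "dist x y"] True \<alpha> by (cases "x = y") auto
    then have "L * dist x y \<le> (L + 2 * M) * dist x y powr \<alpha>" using L M by (intro mult_mono) auto
    then show ?thesis using L(1)[OF xy] by linarith
  next
    case False
    then have "1 \<le> dist x y powr \<alpha>" using \<alpha> by (simp add: ge_one_powr_ge_zero)
    have "\<bar>f x - f y\<bar> \<le> 2 * M" using M(1)[OF xy(1)] M(1)[OF xy(2)] by linarith
    also have "\<dots> \<le> (L + 2 * M) * 1" using L by simp
    also have "\<dots> \<le> (L + 2 * M) * dist x y powr \<alpha>" using \<open>1 \<le> _\<close> L M by (intro mult_left_mono) auto
    finally show ?thesis .
  qed
qed

lemma exp_trig_sum_Hoelder:
  assumes "bounded S" and \<alpha>: "0 < \<alpha>" "\<alpha> \<le> 1"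
  shows "\<exists>C. \<forall>x\<in>S. \<forall>y\<in>S. \<bar>exp_trig_sum K c a x - exp_trig_sum K c a y\<bar> \<le> C * dist x y powr \<alpha>"
proof -
  obtain R where R: "R > 0" "\<And>x. x \<in> S \<Longrightarrow> norm x \<le> R" using assms(1) by (auto simp: bounded_pos)
  define L where "L = exp (norm a * R) * (\<Sum>\<kappa>\<in>K. (norm a + norm \<kappa>) * norm (c \<kappa>))"
  have L0: "L \<ge> 0" unfolding L_def by (intro mult_nonneg_nonneg sum_nonneg) auto
  have D: "\<bar>exp_trig_sum K (\<lambda>\<kappa>. Complex (a \<bullet> h) (\<kappa> \<bullet> h) * c \<kappa>) a z\<bar> \<le> L * norm h" if z: "norm z \<le> R" for z h
  proof -
    have "a \<bullet> z \<le> norm a * R" using z by (intro order_trans[OF norm_cauchy_schwarz] mult_left_mono) auto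
    then have 1: "exp (a \<bullet> z) \<le> exp (norm a * R)" by simp
    have "norm (trig_sum K (\<lambda>\<kappa>. Complex (a \<bullet> h) (\<kappa> \<bullet> h) * c \<kappa>) z) \<le> (\<Sum>\<kappa>\<in>K. (norm a + norm \<kappa>) * norm (c \<kappa>) * norm h)"
      unfolding trig_sum_def
    proof (rule sum_norm_le)
      fix \<kappa>
      have "norm (Complex (a \<bullet> h) (\<kappa> \<bullet> h)) \<le> \<bar>a \<bullet> h\<bar> + \<bar>\<kappa> \<bullet> h\<bar>" using cmod_le[of "Complex (a \<bullet> h) (\<kappa> \<bullet> h)"] by simp
      also have "\<dots> \<le> norm a * norm h + norm \<kappa> * norm h" by (intro add_mono Cauchy_Schwarz_ineq2)
      finally have "norm (Complex (a \<bullet> h) (\<kappa> \<bullet> h)) * norm (c \<kappa>) \<le> (norm a * norm h + norm \<kappa> * norm h) * norm (c \<kappa>)"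
        by (rule mult_right_mono) simp
      then show "norm (Complex (a \<bullet> h) (\<kappa> \<bullet> h) * c \<kappa> * cis (\<kappa> \<bullet> z)) \<le> (norm a + norm \<kappa>) * norm (c \<kappa>) * norm h"
        by (simp add: norm_mult algebra_simps)
    qed
    then have 2: "norm (trig_sum K (\<lambda>\<kappa>. Complex (a \<bullet> h) (\<kappa> \<bullet> h) * c \<kappa>) z) \<le> (\<Sum>\<kappa>\<in>K. (norm a + norm \<kappa>) * norm (c \<kappa>)) * norm h"
      by (simp add: sum_distrib_right)
    have "\<bar>exp_trig_sum K (\<lambda>\<kappa>. Complex (a \<bullet> h) (\<kappa> \<bullet> h) * c \<kappa>) a z\<bar> \<le> exp (a \<bullet> z) * norm (trig_sum K (\<lambda>\<kappa>. Complex (a \<bullet> h) (\<kappa> \<bullet> h) * c \<kappa>) z)"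
      unfolding exp_trig_sum_def by (rule order_trans[OF abs_Re_le_cmod]) (simp add: norm_mult)
    also have "\<dots> \<le> exp (norm a * R) * ((\<Sum>\<kappa>\<in>K. (norm a + norm \<kappa>) * norm (c \<kappa>)) * norm h)"
      using 1 2 by (intro mult_mono) auto
    finally show ?thesis by (simp add: L_def mult.assoc)
  qed
  have Lip: "\<bar>exp_trig_sum K c a x - exp_trig_sum K c a y\<bar> \<le> L * dist x y" if xy: "x \<in> S" "y \<in> S" for x y
  proof -
    have "\<exists>s>0. s < 1 \<and> exp_trig_sum K c a (x + 1 *\<^sub>R (y - x)) - exp_trig_sum K c a (x + 0 *\<^sub>R (y - x))
       = (1 - 0) * exp_trig_sum K (\<lambda>\<kappa>. Complex (a \<bullet> (y - x)) (\<kappa> \<bullet> (y - x)) * c \<kappa>) a (x + s *\<^sub>R (y - x))"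
      by (rule MVT2) (auto intro!: has_real_derivative_along_line[OF exp_trig_sum_has_derivative])
    then obtain s where s: "0 < s" "s < 1" "exp_trig_sum K c a y - exp_trig_sum K c a x = exp_trig_sum K (\<lambda>\<kappa>. Complex (a \<bullet> (y - x)) (\<kappa> \<bullet> (y - x)) * c \<kappa>) a (x + s *\<^sub>R (y - x))"
      by auto
    \<comment> \<open>The segment may leave \<open>S\<close>; for this reason the gradient bound
      \<open>D\<close> was proved on the whole enclosing ball.\<close>
    have "x + s *\<^sub>R (y - x) \<in> cball 0 R"
      using convexD_alt[OF convex_cball[of 0 R], of x y s] R(2)[OF xy(1)] R(2)[OF xy(2)] s by (simp add: algebra_simps)
    then have "norm (x + s *\<^sub>R (y - x)) \<le> R" by (simp only: mem_cball_0)
    from D[OF this, of "y - x"] show ?thesis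
      unfolding s(3)[symmetric] by (simp only: dist_norm norm_minus_commute[of x y] abs_minus_commute[of "exp_trig_sum K c a x"])
  qed
  obtain M where M: "M > 0" "\<And>x. x \<in> S \<Longrightarrow> norm (exp_trig_sum K c a x) \<le> M" using bcont_exp_trig_sum[OF assms(1)] by (rule bcontE) blast
  show ?thesis
    by (rule Lipschitz_imp_Hoelder[OF \<alpha> Lip L0, of S M]) (use M in auto)
qed

lemma holder_on_exp_trig_sum:
  fixes \<Omega> :: "(real ^ 'n) set"
  assumes "bounded \<Omega>" "0 < \<alpha>" "\<alpha> \<le> 1"
  shows "holder_on k \<alpha> \<Omega> (exp_trig_sum K c a)"
  unfolding holder_on_def pderivs_exp_trig_sum
proof (intro conjI allI impI ballI)
  fix es :: "(real ^ 'n) list"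
  let ?c = "\<lambda>\<kappa>. prod_list (map (\<lambda>e. Complex (a \<bullet> e) (\<kappa> \<bullet> e)) es) * c \<kappa>"
  show "\<exists>g. continuous_on (closure \<Omega>) g \<and> (\<forall>x\<in>\<Omega>. g x = exp_trig_sum K ?c a x)"
    by (rule exI[of _ "exp_trig_sum K ?c a"]) (simp add: continuous_on_exp_trig_sum)
  show "bounded (exp_trig_sum K ?c a ` \<Omega>)" using bcont_exp_trig_sum[OF assms(1)] by (simp add: bcont_def)
  show "\<exists>C. \<forall>x\<in>\<Omega>. \<forall>y\<in>\<Omega>. \<bar>exp_trig_sum K ?c a x - exp_trig_sum K ?c a y\<bar> \<le> C * dist x y powr \<alpha>"
    by (rule exp_trig_sum_Hoelder[OF assms])
  show "exp_trig_sum K ?c a differentiable at x" for x unfolding differentiable_def by (rule exI, rule exp_trig_sum_has_derivative)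
qed (rule continuous_on_exp_trig_sum)

text \<open>Tietze's theorem on the disjoint union of the closure and the exterior of a slightly
  larger ball. Support strictly inside a period cube is what trigonometric approximation asks
  for.\<close>

lemma continuous_extension_compact_support:
  fixes g :: "'a::euclidean_space \<Rightarrow> real"
  assumes g: "continuous_on (closure \<Omega>) g" and R: "closure \<Omega> \<subseteq> cball 0 R"
  obtains F where "continuous_on UNIV F" "\<And>x. x \<in> closure \<Omega> \<Longrightarrow> F x = g x" "\<And>x. norm x > R + 1 \<Longrightarrow> F x = 0"
proof -
  define Z :: "'a set" where "Z = - ball 0 (R + 1)"
  define h where "h = (\<lambda>x. if x \<in> closure \<Omega> then g x else 0)"
  have disj: "x \<notin> Z" if "x \<in> closure \<Omega>" for x using that R by (auto simp: Z_def)
  have "continuous_on (closure \<Omega> \<union> Z) h"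
  proof (rule continuous_on_closed_Un)
    show "continuous_on (closure \<Omega>) h" using g by (rule continuous_on_eq) (simp add: h_def)
    show "continuous_on Z h" by (rule continuous_on_eq[OF continuous_on_const[of Z 0]]) (use disj in \<open>auto simp: h_def\<close>)
  qed (auto simp: Z_def)
  then obtain F where F: "continuous_on UNIV F" "\<And>x. x \<in> closure \<Omega> \<union> Z \<Longrightarrow> F x = h x"
    by (rule Tietze_unbounded[of "closure \<Omega> \<union> Z" h UNIV]) (auto simp: Z_def intro!: closed_Un)
  show ?thesis
  proof (rule that[OF F(1)])
    show "F x = g x" if "x \<in> closure \<Omega>" for x using F(2)[of x] that by (simp add: h_def)
    show "F x = 0" if "norm x > R + 1" for x using F(2)[of x] that disj[of x] by (auto simp: h_def Z_def)
  qed
qed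

lemma lint_subset_le:
  fixes f :: "'a::euclidean_space \<Rightarrow> real"
  assumes "bounded_borel S" "bounded_borel T" "S \<subseteq> T" "bcont T f" "\<And>x. 0 \<le> f x"
  shows "lint S f \<le> lint T f"
proof -
  have m: "S \<in> sets borel" "T \<in> sets borel" using assms by (auto simp: bounded_borel_def)
  have i: "integrable lborel (\<lambda>x. indicat_real S x *\<^sub>R f x)" if "bounded_borel S" "bcont S f" for S
    using integrable_lb[OF that] that by (subst (asm) integrable_restrict_space) (auto simp: bounded_borel_def)
  show ?thesis unfolding lint_indicator[OF m(1)] lint_indicator[OF m(2)]
    by (intro integral_mono i assms bcont_subset[OF assms(4,3)]) (use assms in \<open>auto simp: indicator_def\<close>)
qed

lemma subset_cube:
  assumes l: "l > 0" "l * (R + 1) < pi" and R: "closure \<Omega> \<subseteq> cball 0 R"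
  shows "\<Omega> \<subseteq> cube l"
proof
  fix x assume "x \<in> \<Omega>"
  then have "norm x \<le> R" using R closure_subset by fastforce
  moreover have "R < pi / l" using l by (simp add: field_simps)
  ultimately show "x \<in> cube l" unfolding cube_def mem_Collect_eq
    using component_le_norm_cart[of x] by (smt (verit, best))
qed

text \<open>\<open>W\<close> stands for the true solutions; \<open>approx\<close> replaces an
  approximate solution by a true one at the cost of its residual. The order of quantifiers matters:
  the size of \<open>r\<close> is governed by \<open>\<mu>\<close> alone, whereas
  \<open>\<delta>\<close> comes after \<open>a\<close> and \<open>b\<close>, and the residual is
  made small enough to beat the exponential weight.\<close>

lemma CGO_solutions:
  fixes \<Omega> :: "(real ^ 'n) set"
  assumes \<Omega>: "open \<Omega>" "bounded \<Omega>" and R: "closure \<Omega> \<subseteq> cball 0 R" and l: "l > 0" "l * (R + 1) < pi"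
    and q: "continuous_on (closure \<Omega>) q"
    and W: "\<And>w. w \<in> W \<Longrightarrow> bcont \<Omega> w"
    and C: "C > 0"
    and approx: "\<And>K c a. finite K \<Longrightarrow> \<exists>w\<in>W. lint \<Omega> (\<lambda>x. (exp_trig_sum K c a x - w x)\<^sup>2) \<le>
        C * lint \<Omega> (\<lambda>x. (laplacian (exp_trig_sum K c a) x - q x * exp_trig_sum K c a x)\<^sup>2)"
  obtains M where "M > 0"
    "\<And>a b \<theta> \<mu> \<delta>. M \<le> \<mu> \<Longrightarrow> norm a = norm b \<Longrightarrow> a \<bullet> b = 0 \<Longrightarrow> (\<And>\<kappa>. \<kappa> \<in> lattice l \<theta> \<Longrightarrow> \<mu> \<le> \<bar>2 * (a \<bullet> \<kappa>)\<bar>) \<Longrightarrow> \<delta> > 0 \<Longrightarrow>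
      \<exists>r w1 w2. w1 \<in> W \<and> w2 \<in> W \<and> continuous_on UNIV r \<and> lint \<Omega> (\<lambda>x. (norm (r x))\<^sup>2) \<le> (M / \<mu>)\<^sup>2 \<and>
        lint \<Omega> (\<lambda>x. (norm (of_real (exp (a \<bullet> x)) * cis (b \<bullet> x) * (1 + r x) - Complex (w1 x) (w2 x)))\<^sup>2) \<le> \<delta>\<^sup>2"
proof -
  have S: "bounded_borel \<Omega>" using \<Omega> by (simp add: bounded_borel_def)
  obtain Q where Q: "continuous_on UNIV Q" "\<And>x. x \<in> closure \<Omega> \<Longrightarrow> Q x = q x" "\<And>x. norm x > R + 1 \<Longrightarrow> Q x = 0"
    using continuous_extension_compact_support[OF q R] by blast
  have sub: "\<Omega> \<subseteq> cube l" by (rule subset_cube[OF l R])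
  have qb: "bcont \<Omega> q" by (rule bcont_compact[OF _ q closure_subset]) (use \<Omega> in auto)
  obtain M where M: "M > 0" and corr: "\<And>\<sigma> \<theta> \<mu> \<eta>. \<mu> \<ge> M \<Longrightarrow> (\<And>\<kappa>. \<kappa> \<in> lattice l \<theta> \<Longrightarrow> norm (\<sigma> \<kappa>) \<ge> \<mu>) \<Longrightarrow> \<eta> > 0 \<Longrightarrow>
     \<exists>K c. finite K \<and> K \<subseteq> lattice l \<theta> \<and> lint (cube l) (\<lambda>x. (norm (trig_sum K c x))\<^sup>2) \<le> (M / \<mu>)\<^sup>2 \<and>
       lint (cube l) (\<lambda>x. (norm (trig_sum K (\<lambda>\<kappa>. \<sigma> \<kappa> * c \<kappa>) x - of_real (Q x) * (1 + trig_sum K c x)))\<^sup>2) \<le> \<eta>"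
    by (rule correction_term[OF l Q(1,3)]) blast+
  show ?thesis
  proof (rule that[OF M])
    fix a b \<theta> :: "real ^ 'n" and \<mu> \<delta> :: real
    assume \<mu>: "M \<le> \<mu>" and ab: "norm a = norm b" "a \<bullet> b = 0" and lat: "\<And>\<kappa>. \<kappa> \<in> lattice l \<theta> \<Longrightarrow> \<mu> \<le> \<bar>2 * (a \<bullet> \<kappa>)\<bar>" and \<delta>: "\<delta> > 0"
    \<comment> \<open>With \<open>\<zeta> = a + i b\<close> this is the symbol of
      \<open>\<Delta> + 2 \<zeta> \<bullet> \<nabla>\<close> at frequency \<open>\<kappa>\<close>;
      its imaginary part is the one bounded below on the lattice.\<close>
    define \<sigma> where "\<sigma> = (\<lambda>\<kappa>. Complex (- (norm \<kappa>)\<^sup>2 - 2 * (b \<bullet> \<kappa>)) (2 * (a \<bullet> \<kappa>)))"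
    have \<sigma>: "norm (\<sigma> \<kappa>) \<ge> \<mu>" if "\<kappa> \<in> lattice l \<theta>" for \<kappa>
      using lat[OF that] abs_Im_le_cmod[of "\<sigma> \<kappa>"] by (simp add: \<sigma>_def)
    define B where "B = exp (norm a * R)"
    have B: "B > 0" by (simp add: B_def)
    \<comment> \<open>Compensates the constant \<open>C\<close> and the square of the bound
      \<open>B\<close> for the weight \<open>exp (a \<bullet> x)\<close> on the domain.\<close>
    define \<eta> where "\<eta> = \<delta>\<^sup>2 / (C * B\<^sup>2)"
    have \<eta>: "\<eta> > 0" using \<delta> B C by (simp add: \<eta>_def)
    obtain K c where K: "finite K" "K \<subseteq> lattice l \<theta>" and r: "lint (cube l) (\<lambda>x. (norm (trig_sum K c x))\<^sup>2) \<le> (M / \<mu>)\<^sup>2"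
      and res: "lint (cube l) (\<lambda>x. (norm (trig_sum K (\<lambda>\<kappa>. \<sigma> \<kappa> * c \<kappa>) x - of_real (Q x) * (1 + trig_sum K c x)))\<^sup>2) \<le> \<eta>"
      using corr[where \<sigma> = \<sigma> and \<theta> = \<theta>, OF \<mu> _ \<eta>, simplified atomize_imp atomize_all] \<sigma>
      by (elim impE exE conjE) (auto intro: that)
    define K0 where "K0 = insert 0 K"
    have K0: "finite K0" using K by (simp add: K0_def)
    \<comment> \<open>Coefficients of \<open>1 + r\<close>. The frequency 0 is added although it may
      lie outside the shifted lattice; it does not disturb the equation because
      \<open>\<sigma> 0 = 0\<close>.\<close>
    define d where "d = (\<lambda>\<kappa>. (if \<kappa> = 0 then 1 else 0) + (if \<kappa> \<in> K then c \<kappa> else 0))"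
    define K' where "K' = (\<lambda>\<kappa>. b + \<kappa>) ` K0"
    define c' where "c' = (\<lambda>\<kappa>. d (\<kappa> - b))"
    have shift: "trig_sum K' (\<lambda>\<kappa>. f (\<kappa> - b)) x = cis (b \<bullet> x) * trig_sum K0 f x" for f x
      unfolding K'_def trig_sum_def
      by (subst sum.reindex) (auto simp: inj_on_def inner_add_left cis_mult[symmetric] sum_distrib_left mult_ac intro!: sum.cong)
    have e1: "trig_sum K0 d x = 1 + trig_sum K c x" for x
    proof -
      have "trig_sum K0 d x = (\<Sum>\<kappa>\<in>K0. (if \<kappa> = 0 then 1 else 0) * cis (\<kappa> \<bullet> x)) + trig_sum K0 (\<lambda>\<kappa>. if \<kappa> \<in> K then c \<kappa> else 0) x"
        unfolding trig_sum_def d_def by (simp only: sum.distrib distrib_right)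
      also have "(\<Sum>\<kappa>\<in>K0. (if \<kappa> = 0 then 1 else 0) * cis (\<kappa> \<bullet> x)) = 1"
        using K0 by (simp add: if_distrib[of "\<lambda>z. z * _"] sum.delta K0_def cong: if_cong)
      also have "trig_sum K0 (\<lambda>\<kappa>. if \<kappa> \<in> K then c \<kappa> else 0) = trig_sum K c" by (rule trig_sum_extend[symmetric]) (use K0 in \<open>auto simp: K0_def\<close>)
      finally show ?thesis .
    qed
    have e2: "trig_sum K0 (\<lambda>\<kappa>. \<sigma> \<kappa> * d \<kappa>) x = trig_sum K (\<lambda>\<kappa>. \<sigma> \<kappa> * c \<kappa>) x" for x
    proof -
      have "(\<lambda>\<kappa>. \<sigma> \<kappa> * d \<kappa>) = (\<lambda>\<kappa>. if \<kappa> \<in> K then \<sigma> \<kappa> * c \<kappa> else 0)"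
        by (auto simp: d_def \<sigma>_def fun_eq_iff complex_eq_iff)
      moreover have "trig_sum K0 (\<lambda>\<kappa>. if \<kappa> \<in> K then \<sigma> \<kappa> * c \<kappa> else 0) = trig_sum K (\<lambda>\<kappa>. \<sigma> \<kappa> * c \<kappa>)"
        by (rule trig_sum_extend[symmetric]) (use K0 in \<open>auto simp: K0_def\<close>)
      ultimately show ?thesis by simp
    qed
    define v where "v = (\<lambda>x. of_real (exp (a \<bullet> x)) * cis (b \<bullet> x) * (1 + trig_sum K c x))"
    define L where "L = (\<lambda>x. of_real (exp (a \<bullet> x)) * cis (b \<bullet> x) * (trig_sum K (\<lambda>\<kappa>. \<sigma> \<kappa> * c \<kappa>) x))"
    have v: "v x = of_real (exp (a \<bullet> x)) * trig_sum K' c' x" for x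
      unfolding v_def c'_def shift e1 by (simp add: mult.assoc)
    \<comment> \<open>Conjugation of the Laplacian with \<open>exp (\<zeta> \<bullet> x)\<close>;
      \<open>norm a = norm b\<close> and \<open>a \<bullet> b = 0\<close>, that is
      \<open>\<zeta> \<bullet> \<zeta> = 0\<close>, remove the constant term.\<close>
    have sym: "Complex ((norm a)\<^sup>2 - (norm \<kappa>)\<^sup>2) (2 * (a \<bullet> \<kappa>)) = \<sigma> (\<kappa> - b)" for \<kappa>
    proof -
      have "(norm (\<kappa> - b))\<^sup>2 = (norm \<kappa>)\<^sup>2 + (norm b)\<^sup>2 - 2 * (b \<bullet> \<kappa>)"
        by (simp add: power2_norm_eq_inner inner_diff_left inner_diff_right inner_commute)
      moreover have "b \<bullet> (\<kappa> - b) = b \<bullet> \<kappa> - (norm b)\<^sup>2" by (simp add: inner_diff_right power2_norm_eq_inner)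
      ultimately show ?thesis using ab by (simp add: \<sigma>_def inner_diff_right)
    qed
    have L: "L x = of_real (exp (a \<bullet> x)) * trig_sum K' (\<lambda>\<kappa>. Complex ((norm a)\<^sup>2 - (norm \<kappa>)\<^sup>2) (2 * (a \<bullet> \<kappa>)) * c' \<kappa>) x" for x
      unfolding L_def c'_def sym shift[of "\<lambda>\<kappa>. \<sigma> \<kappa> * d \<kappa>"] e2 by (simp add: mult.assoc)
    define ci where "ci = (\<lambda>\<kappa>. - \<i> * c' \<kappa>)"
    have tpi: "trig_sum K' (\<lambda>\<kappa>. f \<kappa> * ci \<kappa>) x = - \<i> * trig_sum K' (\<lambda>\<kappa>. f \<kappa> * c' \<kappa>) x" for f x
      unfolding ci_def trig_sum_def by (simp add: sum_distrib_left mult_ac sum_negf)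
    have vRe: "exp_trig_sum K' c' a x = Re (v x)" for x by (simp add: exp_trig_sum_def v)
    have vIm: "exp_trig_sum K' ci a x = Im (v x)" for x using tpi[of "\<lambda>_. 1"] by (simp add: exp_trig_sum_def v)
    have LRe: "laplacian (exp_trig_sum K' c' a) x = Re (L x)" for x unfolding laplacian_exp_trig_sum by (simp add: exp_trig_sum_def L)
    have LIm: "laplacian (exp_trig_sum K' ci a) x = Im (L x)" for x unfolding laplacian_exp_trig_sum exp_trig_sum_def L tpi by simp
    have K': "finite K'" using K0 by (simp add: K'_def)
    obtain w1 where w1: "w1 \<in> W" "lint \<Omega> (\<lambda>x. (Re (v x) - w1 x)\<^sup>2) \<le> C * lint \<Omega> (\<lambda>x. (Re (L x) - q x * Re (v x))\<^sup>2)"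
      using approx[OF K', of c' a] unfolding vRe LRe by blast
    obtain w2 where w2: "w2 \<in> W" "lint \<Omega> (\<lambda>x. (Im (v x) - w2 x)\<^sup>2) \<le> C * lint \<Omega> (\<lambda>x. (Im (L x) - q x * Im (v x))\<^sup>2)"
      using approx[OF K', of ci a] unfolding vIm LIm by blast
    have cv: "continuous_on UNIV v" unfolding v by (intro continuous_intros continuous_on_trig_sum)
    have cL: "continuous_on UNIV L" unfolding L by (intro continuous_intros continuous_on_trig_sum)
    have cb: "bcont \<Omega> f" if "continuous_on UNIV f" for f :: "real ^ 'n \<Rightarrow> complex"
      by (rule bcont_compact[OF _ _ closure_subset]) (use \<Omega> continuous_on_subset[OF that] in auto)
    note bi = cb[OF cv] cb[OF cL] qb W[OF w1(1)] W[OF w2(1)] bcont_intros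
    define P where "P = (\<lambda>x. trig_sum K (\<lambda>\<kappa>. \<sigma> \<kappa> * c \<kappa>) x - of_real (Q x) * (1 + trig_sum K c x))"
    have cP: "continuous_on UNIV P" unfolding P_def by (intro continuous_intros continuous_on_trig_sum Q)
    have "lint \<Omega> (\<lambda>x. (norm (v x - Complex (w1 x) (w2 x)))\<^sup>2) = lint \<Omega> (\<lambda>x. (Re (v x) - w1 x)\<^sup>2 + (Im (v x) - w2 x)\<^sup>2)"
      by (rule lint_cong) (simp add: cmod_power2)
    also have "\<dots> = lint \<Omega> (\<lambda>x. (Re (v x) - w1 x)\<^sup>2) + lint \<Omega> (\<lambda>x. (Im (v x) - w2 x)\<^sup>2)"
      by (rule lint_add[OF S]) (intro bi)+
    also have "\<dots> \<le> C * (lint \<Omega> (\<lambda>x. (Re (L x) - q x * Re (v x))\<^sup>2) + lint \<Omega> (\<lambda>x. (Im (L x) - q x * Im (v x))\<^sup>2))"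
      using w1 w2 by (simp add: distrib_left)
    also have "lint \<Omega> (\<lambda>x. (Re (L x) - q x * Re (v x))\<^sup>2) + lint \<Omega> (\<lambda>x. (Im (L x) - q x * Im (v x))\<^sup>2) =
       lint \<Omega> (\<lambda>x. (Re (L x) - q x * Re (v x))\<^sup>2 + (Im (L x) - q x * Im (v x))\<^sup>2)"
      by (rule lint_add[OF S, symmetric]) (intro bi)+
    also have "\<dots> \<le> lint \<Omega> (\<lambda>x. B\<^sup>2 * (norm (P x))\<^sup>2)"
    proof (intro lint_mono S)
      fix x assume x: "x \<in> \<Omega>"
      have "L x - of_real (q x) * v x = of_real (exp (a \<bullet> x)) * cis (b \<bullet> x) * P x"
        using Q(2)[OF subsetD[OF closure_subset x]] by (auto simp: L_def v_def P_def algebra_simps)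
      then have n: "norm (L x - of_real (q x) * v x) = exp (a \<bullet> x) * norm (P x)" by (simp add: norm_mult)
      have "norm x \<le> R" using subsetD[OF R subsetD[OF closure_subset x]] by simp
      then have "a \<bullet> x \<le> norm a * R" by (intro order_trans[OF norm_cauchy_schwarz] mult_left_mono) auto
      then have "(exp (a \<bullet> x) * norm (P x))\<^sup>2 \<le> (B * norm (P x))\<^sup>2"
        by (intro power_mono mult_right_mono) (auto simp: B_def)
      moreover have "(Re (L x) - q x * Re (v x))\<^sup>2 + (Im (L x) - q x * Im (v x))\<^sup>2 = (norm (L x - of_real (q x) * v x))\<^sup>2"
        by (simp add: cmod_power2)
      ultimately show "(Re (L x) - q x * Re (v x))\<^sup>2 + (Im (L x) - q x * Im (v x))\<^sup>2 \<le> B\<^sup>2 * (norm (P x))\<^sup>2"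
        using n by (simp add: power_mult_distrib)
    qed (intro bi cb[OF cP])+
    also have "\<dots> = B\<^sup>2 * lint \<Omega> (\<lambda>x. (norm (P x))\<^sup>2)" by (rule lint_cmult)
    also have "lint \<Omega> (\<lambda>x. (norm (P x))\<^sup>2) \<le> lint (cube l) (\<lambda>x. (norm (P x))\<^sup>2)"
      by (intro lint_subset_le S bounded_borel_cube sub bcont_intros bcont_cube[OF cP]) simp
    also have "\<dots> \<le> \<eta>" using res by (simp add: P_def)
    finally have "lint \<Omega> (\<lambda>x. (norm (v x - Complex (w1 x) (w2 x)))\<^sup>2) \<le> C * (B\<^sup>2 * \<eta>)" using C B by simp
    also have "\<dots> = \<delta>\<^sup>2" using C B by (simp add: \<eta>_def)
    finally have 1: "lint \<Omega> (\<lambda>x. (norm (v x - Complex (w1 x) (w2 x)))\<^sup>2) \<le> \<delta>\<^sup>2" .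
    have 2: "lint \<Omega> (\<lambda>x. (norm (trig_sum K c x))\<^sup>2) \<le> (M / \<mu>)\<^sup>2"
      by (rule order_trans[OF lint_subset_le r]) (auto intro!: S bounded_borel_cube sub bcont_cube continuous_intros continuous_on_trig_sum)
    show "\<exists>r w1 w2. w1 \<in> W \<and> w2 \<in> W \<and> continuous_on UNIV r \<and> lint \<Omega> (\<lambda>x. (norm (r x))\<^sup>2) \<le> (M / \<mu>)\<^sup>2 \<and>
        lint \<Omega> (\<lambda>x. (norm (of_real (exp (a \<bullet> x)) * cis (b \<bullet> x) * (1 + r x) - Complex (w1 x) (w2 x)))\<^sup>2) \<le> \<delta>\<^sup>2"
      by (rule exI[of _ "trig_sum K c"], rule exI[of _ w1], rule exI[of _ w2])
        (use 1 2 w1 w2 continuous_on_trig_sum in \<open>simp add: v_def\<close>)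
  qed
qed

section \<open>Density of products of solutions\<close>

lemma norm_triangle3:
  fixes a b c :: "'a::real_normed_vector"
  shows "norm (a + (b + c)) \<le> norm a + (norm b + norm c)" "norm (a + (b - c)) \<le> norm a + (norm b + norm c)"
  using norm_triangle_ineq[of a "b + c"] norm_triangle_ineq[of b c] norm_triangle_ineq[of a "b - c"] norm_triangle_ineq4[of b c]
  by linarith+

lemma lint_complex_of_real:
  "lint S (\<lambda>x. complex_of_real (f x)) = complex_of_real (lint S f)"
  by (rule integral_complex_of_real)

lemma lint_complex_product_eq_0:
  fixes f p1 q1 p2 q2 :: "'a::euclidean_space \<Rightarrow> real"
  assumes S: "bounded_borel S" and b: "bcont S f" "bcont S p1" "bcont S q1" "bcont S p2" "bcont S q2"
    and 0: "lint S (\<lambda>x. f x * (p1 x * p2 x)) = 0" "lint S (\<lambda>x. f x * (p1 x * q2 x)) = 0"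
      "lint S (\<lambda>x. f x * (q1 x * p2 x)) = 0" "lint S (\<lambda>x. f x * (q1 x * q2 x)) = 0"
  shows "lint S (\<lambda>x. of_real (f x) * (Complex (p1 x) (q1 x) * Complex (p2 x) (q2 x))) = 0"
proof -
  have "lint S (\<lambda>x. of_real (f x) * (Complex (p1 x) (q1 x) * Complex (p2 x) (q2 x))) =
    lint S (\<lambda>x. complex_of_real (f x * (p1 x * p2 x)) + (\<i> * complex_of_real (f x * (p1 x * q2 x))
      + (\<i> * complex_of_real (f x * (q1 x * p2 x)) + (- 1) * complex_of_real (f x * (q1 x * q2 x)))))"
    by (rule lint_cong) (simp add: complex_eq_iff algebra_simps)
  also have "\<dots> = 0"
    by (subst lint_add[OF S], (intro bcont_intros b)[1], (intro bcont_intros b)[1])+ (simp only: lint_cmult lint_complex_of_real 0 of_real_0 mult_zero_right add_0)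
  finally show ?thesis .
qed

text \<open>Write \<open>v1 * v2 - w1 * w2\<close> as
  \<open>(v1 - w1) * v2 + v1 * (v2 - w2) - (v1 - w1) * (v2 - w2)\<close> and apply Cauchy-Schwarz to
  each term, so that mean-square bounds on \<open>v1\<close> and \<open>v2\<close> suffice.\<close>

lemma lint_product_perturbation:
  fixes f :: "'a::euclidean_space \<Rightarrow> real" and v1 v2 w1 w2 :: "'a \<Rightarrow> complex"
  assumes S: "bounded_borel S" and b: "bcont S f" "bcont S v1" "bcont S v2" "bcont S w1" "bcont S w2"
    and B: "\<And>x. x \<in> S \<Longrightarrow> \<bar>f x\<bar> \<le> B" "B \<ge> 0"
    and d1: "lint S (\<lambda>x. (norm (v1 x - w1 x))\<^sup>2) \<le> \<delta>\<^sup>2" and d2: "lint S (\<lambda>x. (norm (v2 x - w2 x))\<^sup>2) \<le> \<delta>\<^sup>2"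
    and g1: "lint S (\<lambda>x. (norm (v1 x))\<^sup>2) \<le> G\<^sup>2" and g2: "lint S (\<lambda>x. (norm (v2 x))\<^sup>2) \<le> G\<^sup>2"
    and pos: "\<delta> \<ge> 0" "G \<ge> 0"
    and 0: "lint S (\<lambda>x. of_real (f x) * (w1 x * w2 x)) = 0"
  shows "norm (lint S (\<lambda>x. of_real (f x) * (v1 x * v2 x))) \<le> B * (\<delta> * (2 * G + \<delta>))"
proof -
  note bi = b bcont_intros
  have "lint S (\<lambda>x. of_real (f x) * (v1 x * v2 x)) = lint S (\<lambda>x. of_real (f x) * (v1 x * v2 x) - of_real (f x) * (w1 x * w2 x))"
    by (subst lint_diff[OF S], (intro bi)[1], (intro bi)[1], simp only: 0 diff_0_right)
  also have "norm \<dots> \<le> lint S (\<lambda>x. norm (of_real (f x) * (v1 x * v2 x) - of_real (f x) * (w1 x * w2 x)))"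
    by (rule lint_norm_le)
  also have "\<dots> \<le> lint S (\<lambda>x. B * (norm (v1 x - w1 x) * norm (v2 x) + (norm (v1 x) * norm (v2 x - w2 x) + norm (v1 x - w1 x) * norm (v2 x - w2 x))))"
  proof (intro lint_mono S)
    fix x assume x: "x \<in> S"
    have "of_real (f x) * (v1 x * v2 x) - of_real (f x) * (w1 x * w2 x) =
       of_real (f x) * ((v1 x - w1 x) * v2 x + (v1 x * (v2 x - w2 x) - (v1 x - w1 x) * (v2 x - w2 x)))"
      by (simp add: algebra_simps)
    then have "norm (of_real (f x) * (v1 x * v2 x) - of_real (f x) * (w1 x * w2 x)) = \<bar>f x\<bar> * norm ((v1 x - w1 x) * v2 x + (v1 x * (v2 x - w2 x) - (v1 x - w1 x) * (v2 x - w2 x)))"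
      by (simp only: norm_mult[of "of_real (f x)"] norm_of_real)
    also have "\<dots> \<le> B * (norm ((v1 x - w1 x) * v2 x) + (norm (v1 x * (v2 x - w2 x)) + norm ((v1 x - w1 x) * (v2 x - w2 x))))"
      by (rule mult_mono[OF B(1)[OF x] norm_triangle3(2) B(2)]) (rule norm_ge_zero)
    finally show "norm (of_real (f x) * (v1 x * v2 x) - of_real (f x) * (w1 x * w2 x)) \<le>
      B * (norm (v1 x - w1 x) * norm (v2 x) + (norm (v1 x) * norm (v2 x - w2 x) + norm (v1 x - w1 x) * norm (v2 x - w2 x)))"
      by (simp only: norm_mult)
  qed (intro bi)+
  also have "\<dots> = B * (lint S (\<lambda>x. norm (v1 x - w1 x) * norm (v2 x)) + (lint S (\<lambda>x. norm (v1 x) * norm (v2 x - w2 x)) +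
       lint S (\<lambda>x. norm (v1 x - w1 x) * norm (v2 x - w2 x))))"
    by (subst lint_cmult, (subst lint_add[OF S], (intro bi)[1], (intro bi)[1])+, rule refl)
  also have "\<dots> \<le> B * (\<delta> * G + (G * \<delta> + \<delta> * \<delta>))"
    by (intro mult_left_mono add_mono lint_norm_mult_le S bi d1 d2 g1 g2 pos B)
  also have "\<dots> = B * (\<delta> * (2 * G + \<delta>))" by (simp add: algebra_simps)
  finally show ?thesis .
qed

section \<open>Directions adapted to the lattice\<close>

lemma int_vectors_inner: "k \<in> int_vectors \<Longrightarrow> N \<in> int_vectors \<Longrightarrow> N \<bullet> k \<in> \<int>"
  unfolding inner_vec_def int_vectors_def by (auto intro!: Ints_sum Ints_mult)

text \<open>\<open>2 * (N \<bullet> \<kappa>)\<close> is \<open>l\<close> times an odd integer,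
  because the shift contributes one half to \<open>N \<bullet> \<kappa> / l\<close>.\<close>

lemma lattice_inner_ge:
  fixes N :: "real ^ 'n"
  assumes l: "l > 0" and N: "N \<in> int_vectors" and \<theta>: "N \<bullet> \<theta> = 1 / 2" and \<kappa>: "\<kappa> \<in> lattice l \<theta>"
  shows "l \<le> \<bar>2 * (N \<bullet> \<kappa>)\<bar>"
proof -
  obtain k where k: "k \<in> int_vectors" "\<kappa> = l *\<^sub>R (k + \<theta>)" using \<kappa> by (auto simp: lattice_def)
  obtain z where z: "N \<bullet> k = of_int z" using int_vectors_inner[OF k(1) N] by (auto elim: Ints_cases)
  have "2 * (N \<bullet> \<kappa>) = l * of_int (2 * z + 1)" by (simp add: k inner_add_right z \<theta> algebra_simps)
  moreover have "\<bar>real_of_int (2 * z + 1)\<bar> \<ge> 1"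
  proof -
    have "2 * z + 1 \<noteq> 0" by presburger
    then show ?thesis by linarith
  qed
  ultimately show ?thesis using l by (simp add: abs_mult)
qed

text \<open>Two coordinates suffice: an axis on which \<open>k\<close> has no component, otherwise
  the projection of \<open>k\<close> to a coordinate plane turned by a right angle, which keeps
  integer entries.\<close>

lemma orthogonal_int_vectors_exists:
  assumes "CARD('n::finite) \<ge> 2" and k: "(k :: real ^ 'n) \<in> int_vectors"
  obtains N where "N \<in> int_vectors" "N \<noteq> 0" "N \<bullet> k = 0"
proof -
  obtain i j :: 'n where ij: "i \<noteq> j"
    using assms(1) card_2_iff' by (metis UNIV_I card_le_Suc0_iff_eq finite_class.finite_UNIV not_less_eq_eq numeral_2_eq_2)
  show ?thesis
  proof (cases "k $ i = 0")
    case True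
    show ?thesis
    proof (rule that[of "axis i 1"])
      show "axis i 1 \<in> int_vectors" by (auto simp: int_vectors_def axis_def)
      show "axis i 1 \<bullet> k = 0" using True by (simp add: inner_axis')
    qed (simp add: axis_eq_0_iff)
  next
    case False
    show ?thesis
    proof (rule that[of "axis i (k $ j) - axis j (k $ i)"])
      show "axis i (k $ j) - axis j (k $ i) \<in> int_vectors" using k by (auto simp: int_vectors_def axis_def)
      have "(axis i (k $ j) - axis j (k $ i)) $ j \<noteq> 0" using False ij by (simp add: axis_def)
      then show "axis i (k $ j) - axis j (k $ i) \<noteq> 0" by (metis zero_index)
      show "(axis i (k $ j) - axis j (k $ i)) \<bullet> k = 0" by (simp add: inner_diff_left inner_axis')
    qed
  qed
qed

lemma orthogonal_unit_exists:
  fixes u v :: "real ^ 'n"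
  assumes "CARD('n) \<ge> 3"
  obtains \<beta> where "norm \<beta> = 1" "u \<bullet> \<beta> = 0" "v \<bullet> \<beta> = 0"
proof -
  have "dim {u, v} \<le> card {u, v}" by (rule dim_le_card) (auto intro: span_base)
  also have "\<dots> \<le> 2" by (simp add: card_insert_if)
  finally have "dim {u, v} < DIM(real ^ 'n)" using assms by simp
  then obtain y where y: "y \<noteq> 0" "\<And>x. x \<in> span {u, v} \<Longrightarrow> orthogonal y x"
    using orthogonal_to_subspace_exists[of "{u, v}"] by blast
  have "u \<bullet> y = 0" "v \<bullet> y = 0" using y(2)[of u] y(2)[of v] by (auto simp: orthogonal_def inner_commute span_base)
  then show ?thesis using y(1) by (intro that[of "y /\<^sub>R norm y"]) auto
qed

text \<open>Two geometrical optics solutions with opposite growth \<open>a\<close>,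
  \<open>- a\<close> and oscillations adding up to \<open>\<xi>\<close> have a product close to
  \<open>cis (\<xi> \<bullet> x)\<close>. So the Fourier coefficients of \<open>f\<close> on the
  unshifted lattice vanish, and these determine \<open>f\<close> on a cube containing the
  domain.\<close>

lemma product_density:
  fixes \<Omega> :: "(real ^ 'n) set"
  assumes n: "CARD('n) \<ge> 3" and \<Omega>: "open \<Omega>" "bounded \<Omega>"
    and q: "continuous_on (closure \<Omega>) q1" "continuous_on (closure \<Omega>) q2" and f: "continuous_on (closure \<Omega>) f"
    and W: "\<And>w. w \<in> W1 \<Longrightarrow> bcont \<Omega> w" "\<And>w. w \<in> W2 \<Longrightarrow> bcont \<Omega> w"
    and C: "C > 0"
    and approx1: "\<And>K c a. finite K \<Longrightarrow> \<exists>w\<in>W1. lint \<Omega> (\<lambda>x. (exp_trig_sum K c a x - w x)\<^sup>2) \<le>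
        C * lint \<Omega> (\<lambda>x. (laplacian (exp_trig_sum K c a) x - q1 x * exp_trig_sum K c a x)\<^sup>2)"
    and approx2: "\<And>K c a. finite K \<Longrightarrow> \<exists>w\<in>W2. lint \<Omega> (\<lambda>x. (exp_trig_sum K c a x - w x)\<^sup>2) \<le>
        C * lint \<Omega> (\<lambda>x. (laplacian (exp_trig_sum K c a) x - q2 x * exp_trig_sum K c a x)\<^sup>2)"
    and orth: "\<And>w1 w2. w1 \<in> W1 \<Longrightarrow> w2 \<in> W2 \<Longrightarrow> lint \<Omega> (\<lambda>x. f x * (w1 x * w2 x)) = 0"
    and x0: "x0 \<in> \<Omega>"
  shows "f x0 = 0"
proof -
  have S: "bounded_borel \<Omega>" using \<Omega> by (simp add: bounded_borel_def)
  obtain R where R0: "R > 0" and R: "closure \<Omega> \<subseteq> cball 0 R"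
    using \<Omega>(2) by (metis bounded_closure bounded_pos mem_cball_0 subsetI)
  define l where "l = 1 / (R + 1)"
  have l: "l > 0" "l * (R + 1) < pi" using R0 pi_gt3 by (auto simp: l_def)
  obtain M1 where M1: "M1 > 0" and S1: "\<And>a b \<theta> \<mu> \<delta>. M1 \<le> \<mu> \<Longrightarrow> norm a = norm b \<Longrightarrow> a \<bullet> b = 0 \<Longrightarrow> (\<And>\<kappa>. \<kappa> \<in> lattice l \<theta> \<Longrightarrow> \<mu> \<le> \<bar>2 * (a \<bullet> \<kappa>)\<bar>) \<Longrightarrow> \<delta> > 0 \<Longrightarrow>
      \<exists>r w1 w2. w1 \<in> W1 \<and> w2 \<in> W1 \<and> continuous_on UNIV r \<and> lint \<Omega> (\<lambda>x. (norm (r x))\<^sup>2) \<le> (M1 / \<mu>)\<^sup>2 \<and>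
        lint \<Omega> (\<lambda>x. (norm (of_real (exp (a \<bullet> x)) * cis (b \<bullet> x) * (1 + r x) - Complex (w1 x) (w2 x)))\<^sup>2) \<le> \<delta>\<^sup>2"
    by (rule CGO_solutions[OF \<Omega> R l q(1) W(1) C approx1]) auto
  obtain M2 where M2: "M2 > 0" and S2: "\<And>a b \<theta> \<mu> \<delta>. M2 \<le> \<mu> \<Longrightarrow> norm a = norm b \<Longrightarrow> a \<bullet> b = 0 \<Longrightarrow> (\<And>\<kappa>. \<kappa> \<in> lattice l \<theta> \<Longrightarrow> \<mu> \<le> \<bar>2 * (a \<bullet> \<kappa>)\<bar>) \<Longrightarrow> \<delta> > 0 \<Longrightarrow>
      \<exists>r w1 w2. w1 \<in> W2 \<and> w2 \<in> W2 \<and> continuous_on UNIV r \<and> lint \<Omega> (\<lambda>x. (norm (r x))\<^sup>2) \<le> (M2 / \<mu>)\<^sup>2 \<and>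
        lint \<Omega> (\<lambda>x. (norm (of_real (exp (a \<bullet> x)) * cis (b \<bullet> x) * (1 + r x) - Complex (w1 x) (w2 x)))\<^sup>2) \<le> \<delta>\<^sup>2"
    by (rule CGO_solutions[OF \<Omega> R l q(2) W(2) C approx2]) auto
  have fb: "bcont \<Omega> f" by (rule bcont_compact[OF _ f closure_subset]) (use \<Omega> in auto)
  obtain B where B: "B > 0" "\<And>x. x \<in> \<Omega> \<Longrightarrow> \<bar>f x\<bar> \<le> B" using fb by (rule bcontE) (auto simp: real_norm_def)
  have cb: "bcont \<Omega> g" if "continuous_on UNIV g" for g :: "real ^ 'n \<Rightarrow> complex"
    by (rule bcont_compact[OF _ _ closure_subset]) (use \<Omega> continuous_on_subset[OF that] in auto)
  define V where "V = lint \<Omega> (\<lambda>x. 1 :: real)"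
  have V: "V \<ge> 0" unfolding V_def by (rule lint_nonneg) simp
  have Fourier: "lint \<Omega> (\<lambda>x. of_real (f x) * cis (\<xi> \<bullet> x)) = 0" if \<xi>: "\<xi> \<in> lattice l 0" for \<xi>
  proof -
    obtain k where k: "k \<in> int_vectors" "\<xi> = l *\<^sub>R k" using \<xi> by (auto simp: lattice_def)
    obtain N where N: "N \<in> int_vectors" "N \<noteq> 0" "N \<bullet> k = 0" using orthogonal_int_vectors_exists[OF _ k(1)] n by auto
    have N\<xi>: "N \<bullet> \<xi> = 0" by (simp add: k N)
    obtain \<beta> where \<beta>: "norm \<beta> = 1" "\<xi> \<bullet> \<beta> = 0" "N \<bullet> \<beta> = 0" using orthogonal_unit_exists[OF n] by blast
    define \<theta> where "\<theta> = (1 / (2 * (N \<bullet> N))) *\<^sub>R N"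
    have \<theta>: "N \<bullet> \<theta> = 1 / 2" using N by (simp add: \<theta>_def)
    define I where "I = lint \<Omega> (\<lambda>x. of_real (f x) * cis (\<xi> \<bullet> x))"
    \<comment> \<open>The three terms bound the contributions of \<open>r1\<close>,
      \<open>r2\<close> and \<open>r1 * r2\<close>, where each remainder has size at most
      \<open>M1 / (s * l)\<close> or \<open>M2 / (s * l)\<close> in mean square.\<close>
    define D where "D = (\<lambda>s. B * (M1 / (s * l) * sqrt V + (M2 / (s * l) * sqrt V + M1 / (s * l) * (M2 / (s * l)))))"
    have bound: "norm I \<le> D s" if s: "s > 0" "s * l \<ge> M1" "s * l \<ge> M2" "s * norm N \<ge> norm \<xi>" for s
    \<comment> \<open>Two limits in this order: \<open>\<delta> \<rightarrow> 0\<close> at fixed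
      \<open>s\<close> removes the error between approximate and true solutions; afterwards
      \<open>s \<rightarrow> \<infinity>\<close> removes \<open>r1\<close> and
      \<open>r2\<close>.\<close>
    proof (rule field_le_epsilon)
      fix \<epsilon> :: real assume \<epsilon>: "\<epsilon> > 0"
      \<comment> \<open>Chosen so that \<open>b1\<close> and \<open>b2\<close> have the norm of
        \<open>a\<close>; \<open>s * norm N \<ge> norm \<xi>\<close> keeps the radicand
        nonnegative.\<close>
      define t where "t = sqrt ((s * norm N)\<^sup>2 - (norm \<xi>)\<^sup>2 / 4)"
      have "(norm \<xi>)\<^sup>2 \<le> (s * norm N)\<^sup>2" using s by (intro power_mono) auto
      then have "(s * norm N)\<^sup>2 - (norm \<xi>)\<^sup>2 / 4 \<ge> 0" using zero_le_power2[of "norm \<xi>"] by linarith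
      then have t: "t\<^sup>2 = (s * norm N)\<^sup>2 - (norm \<xi>)\<^sup>2 / 4" unfolding t_def by (rule real_sqrt_pow2)
      define a where "a = s *\<^sub>R N"
      define b1 where "b1 = (1/2) *\<^sub>R \<xi> + t *\<^sub>R \<beta>"
      define b2 where "b2 = (1/2) *\<^sub>R \<xi> - t *\<^sub>R \<beta>"
      have na: "norm a = s * norm N" using s by (simp add: a_def)
      have \<beta>\<beta>: "\<beta> \<bullet> \<beta> = 1" "\<beta> \<bullet> \<xi> = 0" using \<beta> by (auto simp: inner_commute power2_norm_eq_inner[symmetric])
      have nsq: "(norm ((1/2) *\<^sub>R \<xi> + r *\<^sub>R \<beta>))\<^sup>2 = (norm \<xi>)\<^sup>2 / 4 + r\<^sup>2" for r
        unfolding power2_norm_eq_inner inner_add_left inner_add_right inner_scaleR_left inner_scaleR_right \<beta>\<beta> \<beta>(2)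
        by (simp add: power2_eq_square)
      have "(norm b1)\<^sup>2 = (s * norm N)\<^sup>2" "(norm b2)\<^sup>2 = (s * norm N)\<^sup>2"
        using nsq[of t] nsq[of "- t"] t by (simp_all add: b1_def b2_def)
      then have nb: "norm b1 = s * norm N" "norm b2 = s * norm N"
        using s by (auto dest!: power2_eq_imp_eq)
      have ab: "a \<bullet> b1 = 0" "a \<bullet> b2 = 0" using N\<xi> \<beta> by (auto simp: a_def b1_def b2_def inner_add_right inner_diff_right)
      have lat: "s * l \<le> \<bar>2 * (a \<bullet> \<kappa>)\<bar>" if "\<kappa> \<in> lattice l \<theta>" for \<kappa>
      proof -
        have "s * l \<le> s * \<bar>2 * (N \<bullet> \<kappa>)\<bar>" using lattice_inner_ge[OF l(1) N(1) \<theta> that] s by (intro mult_left_mono) auto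
        also have "\<dots> = \<bar>2 * (a \<bullet> \<kappa>)\<bar>" using s by (simp add: a_def abs_mult)
        finally show ?thesis .
      qed
      have lat': "s * l \<le> \<bar>2 * (- a \<bullet> \<kappa>)\<bar>" if "\<kappa> \<in> lattice l \<theta>" for \<kappa> using lat[OF that] by simp
      define \<rho>1 where "\<rho>1 = M1 / (s * l)"
      define \<rho>2 where "\<rho>2 = M2 / (s * l)"
      have \<rho>: "\<rho>1 \<ge> 0" "\<rho>2 \<ge> 0" using M1 M2 s l by (auto simp: \<rho>1_def \<rho>2_def)
      define E where "E = exp (norm a * R)"
      \<comment> \<open>A common mean-square bound for \<open>v1\<close> and \<open>v2\<close>. It
        grows with \<open>s\<close>, but \<open>\<delta>\<close> is chosen after it.\<close>
      define G where "G = E * sqrt (2 * V + 2 * \<rho>1\<^sup>2 + 2 * \<rho>2\<^sup>2)"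
      have E: "E > 0" by (simp add: E_def)
      have G: "G \<ge> 0" using V E by (auto simp: G_def)
      define \<delta> where "\<delta> = min 1 (\<epsilon> / (B * (2 * G + 1)))"
      have \<delta>: "\<delta> > 0" "\<delta> \<le> 1" "\<delta> \<le> \<epsilon> / (B * (2 * G + 1))" using \<epsilon> B G by (auto simp: \<delta>_def intro!: divide_pos_pos mult_pos_pos add_nonneg_pos)
      have \<delta>B: "B * (\<delta> * (2 * G + \<delta>)) \<le> \<epsilon>"
      proof -
        have "B * (\<delta> * (2 * G + \<delta>)) \<le> B * (\<delta> * (2 * G + 1))" using B \<delta> G by (intro mult_left_mono) auto
        also have "\<dots> = \<delta> * (B * (2 * G + 1))" by simp
        also have "\<dots> \<le> \<epsilon>" using \<delta>(3) B(1) G by (simp add: pos_le_divide_eq add_nonneg_pos)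
        finally show ?thesis .
      qed
      obtain r1 p1 p1' where 1: "p1 \<in> W1" "p1' \<in> W1" "continuous_on UNIV r1" "lint \<Omega> (\<lambda>x. (norm (r1 x))\<^sup>2) \<le> \<rho>1\<^sup>2"
        "lint \<Omega> (\<lambda>x. (norm (of_real (exp (a \<bullet> x)) * cis (b1 \<bullet> x) * (1 + r1 x) - Complex (p1 x) (p1' x)))\<^sup>2) \<le> \<delta>\<^sup>2"
        using S1[of "s * l" a b1 \<theta> \<delta>] s na nb ab lat \<delta> unfolding \<rho>1_def by auto
      obtain r2 p2 p2' where 2: "p2 \<in> W2" "p2' \<in> W2" "continuous_on UNIV r2" "lint \<Omega> (\<lambda>x. (norm (r2 x))\<^sup>2) \<le> \<rho>2\<^sup>2"
        "lint \<Omega> (\<lambda>x. (norm (of_real (exp (- a \<bullet> x)) * cis (b2 \<bullet> x) * (1 + r2 x) - Complex (p2 x) (p2' x)))\<^sup>2) \<le> \<delta>\<^sup>2"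
        using S2[of "s * l" "- a" b2 \<theta> \<delta>] s na nb ab lat' \<delta> unfolding \<rho>2_def by auto
      define v1 where "v1 = (\<lambda>x. of_real (exp (a \<bullet> x)) * cis (b1 \<bullet> x) * (1 + r1 x))"
      define v2 where "v2 = (\<lambda>x. of_real (exp (- a \<bullet> x)) * cis (b2 \<bullet> x) * (1 + r2 x))"
      have v1c: "continuous_on UNIV v1" and v2c: "continuous_on UNIV v2"
        unfolding v1_def v2_def by (intro continuous_intros continuous_on_cis_inner 1 2)+
      have Cb: "bcont \<Omega> (\<lambda>x. Complex (p x) (p' x))" if "bcont \<Omega> p" "bcont \<Omega> p'" for p p'
      proof -
        have "bcont \<Omega> (\<lambda>x. of_real (p x) + \<i> * of_real (p' x))" by (intro bcont_intros that)
        then show ?thesis by (simp add: Complex_eq)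
      qed
      note bi = fb cb[OF v1c] cb[OF v2c] cb[OF 1(3)] cb[OF 2(3)] Cb[OF W(1)[OF 1(1)] W(1)[OF 1(2)]] Cb[OF W(2)[OF 2(1)] W(2)[OF 2(2)]]
        W(1)[OF 1(1)] W(1)[OF 1(2)] W(2)[OF 2(1)] W(2)[OF 2(2)] cb[OF continuous_on_cis_inner] bcont_intros
      have Gv: "lint \<Omega> (\<lambda>x. (norm (of_real (exp (a' \<bullet> x)) * cis (b \<bullet> x) * (1 + r x)))\<^sup>2) \<le> G\<^sup>2"
        if a': "norm a' = norm a" and r: "continuous_on UNIV r" and r2: "lint \<Omega> (\<lambda>x. (norm (r x))\<^sup>2) \<le> \<rho>1\<^sup>2 + \<rho>2\<^sup>2" for a' b r
      proof -
        have c: "continuous_on UNIV (\<lambda>x. of_real (exp (a' \<bullet> x)) * cis (b \<bullet> x))" by (intro continuous_intros continuous_on_cis_inner)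
        have "lint \<Omega> (\<lambda>x. (norm ((of_real (exp (a' \<bullet> x)) * cis (b \<bullet> x)) * (1 + r x)))\<^sup>2) \<le> E\<^sup>2 * lint \<Omega> (\<lambda>x. (norm (1 + r x))\<^sup>2)"
        proof (rule lint_norm_mult_square_le[OF S])
          fix x assume x: "x \<in> \<Omega>"
          have "norm x \<le> R" using subsetD[OF R subsetD[OF closure_subset x]] by simp
          then have "a' \<bullet> x \<le> norm a' * R" by (intro order_trans[OF norm_cauchy_schwarz] mult_left_mono) auto
          then show "norm (of_real (exp (a' \<bullet> x)) * cis (b \<bullet> x)) \<le> E" by (simp add: norm_mult E_def a')
        qed (intro bcont_intros cb r c)+
        also have "\<dots> \<le> E\<^sup>2 * (2 * lint \<Omega> (\<lambda>x. (norm (1::complex))\<^sup>2) + 2 * lint \<Omega> (\<lambda>x. (norm (r x))\<^sup>2))"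
          by (intro mult_left_mono lint_norm_add_square_le S bcont_intros cb r) simp
        also have "\<dots> \<le> E\<^sup>2 * (2 * V + 2 * (\<rho>1\<^sup>2 + \<rho>2\<^sup>2))"
          using r2 by (intro mult_left_mono) (auto simp: V_def)
        also have "\<dots> = G\<^sup>2" using V by (simp add: G_def power_mult_distrib add_nonneg_nonneg)
        finally show ?thesis .
      qed
      have v12: "v1 x * v2 x = cis (\<xi> \<bullet> x) * ((1 + r1 x) * (1 + r2 x))" for x
      proof -
        have "cis (b1 \<bullet> x) * cis (b2 \<bullet> x) = cis (\<xi> \<bullet> x)"
          by (simp add: cis_mult b1_def b2_def inner_add_left inner_diff_left)
        moreover have "complex_of_real (exp (a \<bullet> x)) * complex_of_real (exp (- a \<bullet> x)) = 1"
          by (simp flip: of_real_mult exp_add)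
        moreover have "v1 x * v2 x = (complex_of_real (exp (a \<bullet> x)) * complex_of_real (exp (- a \<bullet> x))) * (cis (b1 \<bullet> x) * cis (b2 \<bullet> x)) * ((1 + r1 x) * (1 + r2 x))"
          unfolding v1_def v2_def by (simp only: mult_ac)
        ultimately show ?thesis by simp
      qed
      have A1: "norm (lint \<Omega> (\<lambda>x. of_real (f x) * (v1 x * v2 x))) \<le> B * (\<delta> * (2 * G + \<delta>))"
      proof (rule lint_product_perturbation[OF S _ _ _ _ _ B(2)])
        show "lint \<Omega> (\<lambda>x. of_real (f x) * (Complex (p1 x) (p1' x) * Complex (p2 x) (p2' x))) = 0"
          by (intro lint_complex_product_eq_0 S bi orth 1 2)
        show "lint \<Omega> (\<lambda>x. (norm (v1 x))\<^sup>2) \<le> G\<^sup>2" unfolding v1_def using 1 by (intro Gv) (auto intro: order_trans)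
        show "lint \<Omega> (\<lambda>x. (norm (v2 x))\<^sup>2) \<le> G\<^sup>2" unfolding v2_def using 2 by (intro Gv) (auto intro: order_trans)
        show "lint \<Omega> (\<lambda>x. (norm (v1 x - Complex (p1 x) (p1' x)))\<^sup>2) \<le> \<delta>\<^sup>2" using 1 by (simp add: v1_def)
        show "lint \<Omega> (\<lambda>x. (norm (v2 x - Complex (p2 x) (p2' x)))\<^sup>2) \<le> \<delta>\<^sup>2" using 2 by (simp add: v2_def)
      qed (use B \<delta> G in \<open>auto intro!: bi\<close>)
      have A2: "norm (lint \<Omega> (\<lambda>x. of_real (f x) * (cis (\<xi> \<bullet> x) * (r1 x + (r2 x + r1 x * r2 x))))) \<le> D s"
      proof -
        have "norm (lint \<Omega> (\<lambda>x. of_real (f x) * (cis (\<xi> \<bullet> x) * (r1 x + (r2 x + r1 x * r2 x))))) \<le>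
            lint \<Omega> (\<lambda>x. norm (of_real (f x) * (cis (\<xi> \<bullet> x) * (r1 x + (r2 x + r1 x * r2 x)))))" by (rule lint_norm_le)
        also have "\<dots> \<le> lint \<Omega> (\<lambda>x. B * (norm (r1 x) * norm (1::complex) + (norm (r2 x) * norm (1::complex) + norm (r1 x) * norm (r2 x))))"
        proof (intro lint_mono S)
          fix x assume x: "x \<in> \<Omega>"
          have "norm (of_real (f x) * (cis (\<xi> \<bullet> x) * (r1 x + (r2 x + r1 x * r2 x)))) = \<bar>f x\<bar> * norm (r1 x + (r2 x + r1 x * r2 x))"
            by (simp add: norm_mult)
          also have "\<dots> \<le> B * (norm (r1 x) + (norm (r2 x) + norm (r1 x * r2 x)))"
            by (rule mult_mono[OF B(2)[OF x] norm_triangle3(1) less_imp_le[OF B(1)]]) (rule norm_ge_zero)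
          finally show "norm (of_real (f x) * (cis (\<xi> \<bullet> x) * (r1 x + (r2 x + r1 x * r2 x)))) \<le>
             B * (norm (r1 x) * norm (1::complex) + (norm (r2 x) * norm (1::complex) + norm (r1 x) * norm (r2 x)))"
            by (simp add: norm_mult)
        qed (intro bi)+
        also have "\<dots> = B * (lint \<Omega> (\<lambda>x. norm (r1 x) * norm (1::complex)) + (lint \<Omega> (\<lambda>x. norm (r2 x) * norm (1::complex)) + lint \<Omega> (\<lambda>x. norm (r1 x) * norm (r2 x))))"
          by (subst lint_cmult, (subst lint_add[OF S], (intro bi)[1], (intro bi)[1])+, rule refl)
        also have "\<dots> \<le> B * (\<rho>1 * sqrt V + (\<rho>2 * sqrt V + \<rho>1 * \<rho>2))"
          using V B by (intro mult_left_mono add_mono lint_norm_mult_le S bi 1 2 \<rho>) (auto simp: V_def)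
        finally show ?thesis by (simp add: D_def \<rho>1_def \<rho>2_def)
      qed
      have "I = lint \<Omega> (\<lambda>x. of_real (f x) * (v1 x * v2 x) - of_real (f x) * (cis (\<xi> \<bullet> x) * (r1 x + (r2 x + r1 x * r2 x))))"
        unfolding I_def by (rule lint_cong) (simp add: v12 algebra_simps)
      also have "\<dots> = lint \<Omega> (\<lambda>x. of_real (f x) * (v1 x * v2 x)) - lint \<Omega> (\<lambda>x. of_real (f x) * (cis (\<xi> \<bullet> x) * (r1 x + (r2 x + r1 x * r2 x))))"
        by (intro lint_diff S bi)
      also have "norm \<dots> \<le> D s + \<epsilon>"
        using A1 A2 \<delta>B by (intro order_trans[OF norm_triangle_ineq4]) linarith
      finally show "norm I \<le> D s + \<epsilon>" .
    qed
    have lim: "(D \<longlongrightarrow> 0) at_top"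
    proof -
      have z: "((\<lambda>s. M / (s * l)) \<longlongrightarrow> 0) at_top" for M :: real
      proof -
        have "((\<lambda>s. (M / l) * inverse s) \<longlongrightarrow> (M / l) * 0) at_top"
          by (intro tendsto_intros tendsto_inverse_0_at_top filterlim_ident)
        then show ?thesis by (simp add: divide_inverse mult_ac)
      qed
      have "(D \<longlongrightarrow> B * (0 * sqrt V + (0 * sqrt V + 0 * 0))) at_top"
        unfolding D_def by (intro tendsto_intros z)
      then show ?thesis by simp
    qed
    have "eventually (\<lambda>s. norm I \<le> D s) at_top"
    proof -
      have nN: "norm N > 0" using N by simp
      have "eventually (\<lambda>s::real. s > 0 \<and> s \<ge> M1 / l \<and> s \<ge> M2 / l \<and> s \<ge> norm \<xi> / norm N) at_top"
        by (intro eventually_conj eventually_gt_at_top eventually_ge_at_top)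
      then show ?thesis
        by eventually_elim (use l nN in \<open>intro bound; simp add: field_simps\<close>)
    qed
    then have "norm I \<le> 0" by (rule tendsto_lowerbound[OF lim]) simp
    then show ?thesis by (simp add: I_def)
  qed
  obtain F where F: "continuous_on UNIV F" "\<And>x. x \<in> closure \<Omega> \<Longrightarrow> F x = f x" "\<And>x. norm x > R + 1 \<Longrightarrow> F x = 0"
    using continuous_extension_compact_support[OF f R] by blast
  have sub: "\<Omega> \<subseteq> cube l" by (rule subset_cube[OF l R])
  have "lint \<Omega> (\<lambda>x. (f x)\<^sup>2) \<le> 0"
  proof (rule field_le_epsilon)
    fix \<epsilon> :: real assume \<epsilon>: "\<epsilon> > 0"
    \<comment> \<open>\<open>V + 1\<close> in place of \<open>V\<close>, so that the case
      \<open>V = 0\<close> need not be excluded.\<close>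
    define \<epsilon>' where "\<epsilon>' = \<epsilon> / (B * (V + 1))"
    have \<epsilon>': "\<epsilon>' > 0" using \<epsilon> B V by (simp add: \<epsilon>'_def)
    obtain p where p: "trig_poly (lattice l 0) p" "\<And>x. x \<in> cube l \<Longrightarrow> norm (complex_of_real (F x) - p x) < \<epsilon>'"
      using trig_dense_real[OF l F(1,3) \<epsilon>'] by blast
    have pb: "bcont \<Omega> p" by (rule cb[OF trig_poly_continuous[OF p(1)]])
    note bi = fb pb cb[OF continuous_on_cis_inner] bcont_intros
    obtain K c where K: "finite K" "K \<subseteq> lattice l 0" "p = trig_sum K c" using p(1) by (auto simp: trig_poly_def)
    have "lint \<Omega> (\<lambda>x. of_real (f x) * p x) = lint \<Omega> (\<lambda>x. \<Sum>\<kappa>\<in>K. c \<kappa> * (of_real (f x) * cis (\<kappa> \<bullet> x)))"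
      by (rule lint_cong) (simp add: K trig_sum_def sum_distrib_left mult_ac)
    also have "\<dots> = (\<Sum>\<kappa>\<in>K. c \<kappa> * lint \<Omega> (\<lambda>x. of_real (f x) * cis (\<kappa> \<bullet> x)))"
      by (subst lint_sum[OF S], (intro bi)[1], simp only: lint_cmult)
    also have "\<dots> = 0" using Fourier K by (intro sum.neutral) auto
    finally have p0: "lint \<Omega> (\<lambda>x. of_real (f x) * p x) = 0" .
    have "complex_of_real (lint \<Omega> (\<lambda>x. (f x)\<^sup>2)) = lint \<Omega> (\<lambda>x. of_real ((f x)\<^sup>2))"
      by (rule lint_complex_of_real[symmetric])
    also have "\<dots> = lint \<Omega> (\<lambda>x. of_real (f x) * (of_real (f x) - p x) + of_real (f x) * p x)"
      by (rule lint_cong) (simp add: algebra_simps power2_eq_square)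
    also have "\<dots> = lint \<Omega> (\<lambda>x. of_real (f x) * (of_real (f x) - p x))"
      by (subst lint_add[OF S], (intro bi)[1], (intro bi)[1], simp only: p0 add_0_right)
    finally have "norm (complex_of_real (lint \<Omega> (\<lambda>x. (f x)\<^sup>2))) = norm (lint \<Omega> (\<lambda>x. of_real (f x) * (of_real (f x) - p x)))" by (rule arg_cong)
    also have "\<dots> \<le> lint \<Omega> (\<lambda>x. norm (of_real (f x) * (of_real (f x) - p x)))" by (rule lint_norm_le)
    also have "\<dots> \<le> lint \<Omega> (\<lambda>x. (B * \<epsilon>') * 1)"
    proof (intro lint_mono S bi)
      fix x assume x: "x \<in> \<Omega>"
      have "norm (complex_of_real (f x) - p x) \<le> \<epsilon>'"
        using p(2)[of x] F(2)[OF subsetD[OF closure_subset x]] subsetD[OF sub x] by simp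
      then show "norm (of_real (f x) * (of_real (f x) - p x)) \<le> (B * \<epsilon>') * 1"
        using B(2)[OF x] B(1) by (simp add: norm_mult mult_mono)
    qed
    also have "\<dots> = B * \<epsilon>' * V" unfolding V_def by (rule lint_cmult)
    also have "\<dots> = \<epsilon> * (V / (V + 1))" using B by (simp add: \<epsilon>'_def)
    also have "\<dots> \<le> 0 + \<epsilon>" using \<epsilon> V by (simp add: field_simps)
    finally show "lint \<Omega> (\<lambda>x. (f x)\<^sup>2) \<le> 0 + \<epsilon>" by simp
  qed
  moreover have "lint \<Omega> (\<lambda>x. (f x)\<^sup>2) \<ge> 0" by (rule lint_nonneg) simp
  ultimately have "lint \<Omega> (\<lambda>x. (f x)\<^sup>2) = 0" by linarith
  then show ?thesis by (rule lint_square_eq_0[OF \<Omega> fb _ x0])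
qed

section \<open>Hoelder spaces and derivatives along lines\<close>

lemma holder_on_cong:
  assumes "open \<Omega>" "\<And>x. x \<in> closure \<Omega> \<Longrightarrow> f x = g x" "holder_on k \<alpha> \<Omega> f"
  shows "holder_on k \<alpha> \<Omega> g"
proof -
  have eq: "\<And>x. x \<in> \<Omega> \<Longrightarrow> pderivs es g x = pderivs es f x" for es
    by (rule pderivs_cong_open[OF assms(1) assms(2)[OF subsetD[OF closure_subset], symmetric]])
  have d: "(pderivs es g) differentiable (at x)" if "pderivs es f differentiable (at x)" "x \<in> \<Omega>" for es x
    using that eq has_derivative_transform_within_open[OF _ assms(1) that(2), of "pderivs es f" _ UNIV "pderivs es g"]
    unfolding differentiable_def by metis
  have c: "continuous_on (closure \<Omega>) g"
    using assms(2,3) continuous_on_cong[of "closure \<Omega>" "closure \<Omega>" f g] by (simp add: holder_on_def)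
  have im: "pderivs es g ` \<Omega> = pderivs es f ` \<Omega>" for es using eq by (rule image_cong[OF refl])
  show ?thesis unfolding holder_on_def
  proof (intro conjI allI impI ballI c)
    show "pderivs es g differentiable at x" if "set es \<subseteq> Basis \<and> length es < k" "x \<in> \<Omega>" for es x
      using d that assms(3) unfolding holder_on_def by blast
    show "\<exists>h. continuous_on (closure \<Omega>) h \<and> (\<forall>x\<in>\<Omega>. h x = pderivs es g x)" if es: "set es \<subseteq> Basis \<and> length es \<le> k" for es
    proof -
      obtain h where "continuous_on (closure \<Omega>) h" "\<forall>x\<in>\<Omega>. h x = pderivs es f x" using es assms(3) unfolding holder_on_def by blast
      then show ?thesis using eq by (intro exI[of _ h]) auto
    qed
    show "bounded (pderivs es g ` \<Omega>)" if "set es \<subseteq> Basis \<and> length es \<le> k" for es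
      unfolding im using that assms(3) unfolding holder_on_def by blast
    show "\<exists>C. \<forall>x\<in>\<Omega>. \<forall>y\<in>\<Omega>. \<bar>pderivs es g x - pderivs es g y\<bar> \<le> C * dist x y powr \<alpha>" if es: "set es \<subseteq> Basis \<and> length es = k" for es
    proof -
      obtain C where "\<forall>x\<in>\<Omega>. \<forall>y\<in>\<Omega>. \<bar>pderivs es f x - pderivs es f y\<bar> \<le> C * dist x y powr \<alpha>" using es assms(3) unfolding holder_on_def by blast
      then show ?thesis using eq by (intro exI[of _ C]) auto
    qed
  qed
qed

lemma holder_on_ext:
  assumes "holder_on k \<alpha> \<Omega> f" "set es \<subseteq> Basis" "length es \<le> k"
  obtains g where "continuous_on (closure \<Omega>) g" "\<And>x. x \<in> \<Omega> \<Longrightarrow> g x = pderivs es f x"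
proof -
  have "\<exists>g. continuous_on (closure \<Omega>) g \<and> (\<forall>x\<in>\<Omega>. g x = pderivs es f x)"
    using assms unfolding holder_on_def by blast
  then show ?thesis using that by auto
qed

lemma holder_on_linear_combination:
  assumes \<Omega>: "open \<Omega>" and f: "holder_on k \<alpha> \<Omega> f" and g: "holder_on k \<alpha> \<Omega> g"
  shows "holder_on k \<alpha> \<Omega> (\<lambda>x. a * f x + b * g x)"
proof -
  note C = bounded_Ck_linear_combination[OF \<Omega> holder_on_bounded_Ck[OF f] holder_on_bounded_Ck[OF g], of a b]
  note eq = pderivs_linear_combination[OF \<Omega> holder_on_bounded_Ck[OF f] holder_on_bounded_Ck[OF g], of _ _ a b]
  show ?thesis unfolding holder_on_def
  proof (intro conjI allI impI ballI)
    show "continuous_on (closure \<Omega>) (\<lambda>x. a * f x + b * g x)"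
      using f g by (auto simp: holder_on_def intro!: continuous_intros)
    show "pderivs es (\<lambda>x. a * f x + b * g x) differentiable at x" if "set es \<subseteq> Basis \<and> length es < k" "x \<in> \<Omega>" for es x
      using C that unfolding bounded_Ck_def by blast
    show "bounded (pderivs es (\<lambda>x. a * f x + b * g x) ` \<Omega>)" if "set es \<subseteq> Basis \<and> length es \<le> k" for es
      using C that unfolding bounded_Ck_def bcont_def by blast
  next
    fix es :: "'a list" assume es: "set es \<subseteq> Basis \<and> length es \<le> k"
    obtain f' where f': "continuous_on (closure \<Omega>) f'" "\<And>x. x \<in> \<Omega> \<Longrightarrow> f' x = pderivs es f x" using holder_on_ext[OF f] es by blast
    obtain g' where g': "continuous_on (closure \<Omega>) g'" "\<And>x. x \<in> \<Omega> \<Longrightarrow> g' x = pderivs es g x" using holder_on_ext[OF g] es by blast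
    show "\<exists>h. continuous_on (closure \<Omega>) h \<and> (\<forall>x\<in>\<Omega>. h x = pderivs es (\<lambda>x. a * f x + b * g x) x)"
      by (rule exI[of _ "\<lambda>x. a * f' x + b * g' x"]) (use es f' g' in \<open>auto simp: eq intro!: continuous_intros\<close>)
  next
    fix es :: "'a list" assume es: "set es \<subseteq> Basis \<and> length es = k"
    obtain F where F: "\<forall>x\<in>\<Omega>. \<forall>y\<in>\<Omega>. \<bar>pderivs es f x - pderivs es f y\<bar> \<le> F * dist x y powr \<alpha>" using f es unfolding holder_on_def by blast
    obtain G where G: "\<forall>x\<in>\<Omega>. \<forall>y\<in>\<Omega>. \<bar>pderivs es g x - pderivs es g y\<bar> \<le> G * dist x y powr \<alpha>" using g es unfolding holder_on_def by blast
    show "\<exists>C. \<forall>x\<in>\<Omega>. \<forall>y\<in>\<Omega>. \<bar>pderivs es (\<lambda>x. a * f x + b * g x) x - pderivs es (\<lambda>x. a * f x + b * g x) y\<bar> \<le> C * dist x y powr \<alpha>"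
    proof (intro exI[of _ "\<bar>a\<bar> * F + \<bar>b\<bar> * G"] ballI)
      fix x y assume xy: "x \<in> \<Omega>" "y \<in> \<Omega>"
      have "pderivs es (\<lambda>x. a * f x + b * g x) x - pderivs es (\<lambda>x. a * f x + b * g x) y =
         a * (pderivs es f x - pderivs es f y) + b * (pderivs es g x - pderivs es g y)"
        using es xy by (simp add: eq algebra_simps)
      also have "\<bar>\<dots>\<bar> \<le> \<bar>a\<bar> * \<bar>pderivs es f x - pderivs es f y\<bar> + \<bar>b\<bar> * \<bar>pderivs es g x - pderivs es g y\<bar>"
        by (metis abs_mult abs_triangle_ineq)
      also have "\<dots> \<le> \<bar>a\<bar> * (F * dist x y powr \<alpha>) + \<bar>b\<bar> * (G * dist x y powr \<alpha>)"
        using F G xy by (intro add_mono mult_left_mono) auto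
      finally show "\<bar>pderivs es (\<lambda>x. a * f x + b * g x) x - pderivs es (\<lambda>x. a * f x + b * g x) y\<bar> \<le> (\<bar>a\<bar> * F + \<bar>b\<bar> * G) * dist x y powr \<alpha>"
        by (simp add: algebra_simps)
    qed
  qed
qed

lemma holder_space_linear_combination:
  assumes "open \<Omega>" "f \<in> holder_space k \<alpha> \<Omega>" "g \<in> holder_space k \<alpha> \<Omega>"
  shows "(\<lambda>x. a * f x + b * g x) \<in> holder_space k \<alpha> \<Omega>"
  using assms holder_on_linear_combination unfolding holder_space_def by auto

lemma on_set_holder_space:
  assumes "open \<Omega>" "holder_on k \<alpha> \<Omega> f" shows "on_set (closure \<Omega>) f \<in> holder_space k \<alpha> \<Omega>"
  unfolding holder_space_def
  using holder_on_cong[OF assms(1) _ assms(2), of "on_set (closure \<Omega>) f"] by (auto simp: on_set_def)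

section \<open>Hoelder norms and the quotient norm on the boundary\<close>

lemma finite_multi_indices:
  "finite {es :: 'a::euclidean_space list. set es \<subseteq> Basis \<and> length es \<le> k}"
  "finite {es :: 'a::euclidean_space list. set es \<subseteq> Basis \<and> length es = k}"
  by (rule finite_lists_length_le finite_lists_length_eq, rule finite_Basis)+

text \<open>Names the index set of the Hoelder quotients, so that their supremum can be treated by
  the \<open>cSUP\<close> rules, which ask for nonemptiness and boundedness.\<close>

definition offdiag :: "'a set \<Rightarrow> ('a \<times> 'a) set" where
  "offdiag D = {(x, y). x \<in> D \<and> y \<in> D \<and> x \<noteq> y}"

lemma offdiag_nonempty:
  fixes \<Omega> :: "'a::euclidean_space set"
  assumes "open \<Omega>" "\<Omega> \<noteq> {}" shows "offdiag \<Omega> \<noteq> {}"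
proof -
  obtain x where x: "x \<in> \<Omega>" using assms by auto
  have "\<not> \<Omega> \<subseteq> {x}" using assms(1) x not_open_singleton[of x] by (metis subset_singletonD empty_iff)
  then show ?thesis using x by (auto simp: offdiag_def)
qed

lemma bdd_sup_seminorm:
  assumes "holder_on k \<alpha> \<Omega> f" "set es \<subseteq> Basis" "length es \<le> k"
  shows "bdd_above ((\<lambda>x. \<bar>pderivs es f x\<bar>) ` \<Omega>)"
proof -
  obtain B where "\<And>x. x \<in> \<Omega> \<Longrightarrow> norm (pderivs es f x) \<le> B" using bounded_Ck_bcont[OF holder_on_bounded_Ck[OF assms(1)] assms(2,3)] by (rule bcontE) blast
  then show ?thesis by (intro bdd_aboveI2[of _ _ B]) auto
qed

lemma bdd_hoelder_seminorm:
  assumes "holder_on k \<alpha> \<Omega> f" "set es \<subseteq> Basis" "length es = k"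
  shows "bdd_above ((\<lambda>(x, y). \<bar>pderivs es f x - pderivs es f y\<bar> / dist x y powr \<alpha>) ` offdiag \<Omega>)"
proof -
  obtain C where "\<forall>x\<in>\<Omega>. \<forall>y\<in>\<Omega>. \<bar>pderivs es f x - pderivs es f y\<bar> \<le> C * dist x y powr \<alpha>" using assms unfolding holder_on_def by blast
  then show ?thesis by (intro bdd_aboveI2[of _ _ C]) (auto simp: offdiag_def divide_le_eq powr_nonneg_iff)
qed

lemma holder_norm_offdiag: "holder_norm k \<alpha> D f =
     (\<Sum>es | set es \<subseteq> Basis \<and> length es \<le> k. SUP x\<in>D. \<bar>pderivs es f x\<bar>) +
     (\<Sum>es | set es \<subseteq> Basis \<and> length es = k. SUP (x, y)\<in>offdiag D. \<bar>pderivs es f x - pderivs es f y\<bar> / dist x y powr \<alpha>)"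
  unfolding holder_norm_def offdiag_def ..

lemma sup_seminorm_nonneg:
  assumes "holder_on k \<alpha> \<Omega> f" "\<Omega> \<noteq> {}" "set es \<subseteq> Basis" "length es \<le> k"
  shows "0 \<le> (SUP x\<in>\<Omega>. \<bar>pderivs es f x\<bar>)"
proof -
  obtain x where "x \<in> \<Omega>" using assms by auto
  then show ?thesis using cSUP_upper2[OF bdd_sup_seminorm[OF assms(1,3,4)], of x 0] by simp
qed

lemma hoelder_seminorm_nonneg:
  assumes "holder_on k \<alpha> \<Omega> f" "open \<Omega>" "\<Omega> \<noteq> {}" "set es \<subseteq> Basis" "length es = k"
  shows "0 \<le> (SUP (x, y)\<in>offdiag \<Omega>. \<bar>pderivs es f x - pderivs es f y\<bar> / dist x y powr \<alpha>)"
proof -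
  obtain p where "p \<in> offdiag \<Omega>" using offdiag_nonempty[OF assms(2,3)] by auto
  then show ?thesis using cSUP_upper2[OF bdd_hoelder_seminorm[OF assms(1,4,5)], of p 0] by (auto split: prod.splits)
qed

lemma holder_norm_nonneg:
  assumes "holder_on k \<alpha> \<Omega> f" "open \<Omega>" "\<Omega> \<noteq> {}" shows "0 \<le> holder_norm k \<alpha> \<Omega> f"
  unfolding holder_norm_offdiag
  by (intro add_nonneg_nonneg sum_nonneg sup_seminorm_nonneg[OF assms(1,3)] hoelder_seminorm_nonneg[OF assms]) auto

lemma pderivs_le_holder_norm:
  assumes f: "holder_on k \<alpha> \<Omega> f" and \<Omega>: "open \<Omega>" and es: "set es \<subseteq> Basis" "length es \<le> k" and x: "x \<in> \<Omega>"
  shows "\<bar>pderivs es f x\<bar> \<le> holder_norm k \<alpha> \<Omega> f"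
proof -
  have ne: "\<Omega> \<noteq> {}" using x by auto
  have "\<bar>pderivs es f x\<bar> \<le> (SUP x\<in>\<Omega>. \<bar>pderivs es f x\<bar>)"
    by (rule cSUP_upper[OF x bdd_sup_seminorm[OF f es]])
  also have "\<dots> \<le> (\<Sum>es | set es \<subseteq> Basis \<and> length es \<le> k. SUP x\<in>\<Omega>. \<bar>pderivs es f x\<bar>)"
    by (rule member_le_sum[where f = "\<lambda>es. SUP x\<in>\<Omega>. \<bar>pderivs es f x\<bar>"])
      (use es finite_multi_indices sup_seminorm_nonneg[OF f ne] in auto)
  also have "\<dots> \<le> holder_norm k \<alpha> \<Omega> f" unfolding holder_norm_offdiag
    by (simp only: le_add_same_cancel1, rule sum_nonneg, rule hoelder_seminorm_nonneg[OF f \<Omega> ne]) auto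
  finally show ?thesis .
qed

lemma holder_norm_cmult_le:
  assumes f: "holder_on k \<alpha> \<Omega> f" and \<Omega>: "open \<Omega>" "\<Omega> \<noteq> {}"
  shows "holder_norm k \<alpha> \<Omega> (\<lambda>x. c * f x) \<le> \<bar>c\<bar> * holder_norm k \<alpha> \<Omega> f"
proof -
  have eq: "pderivs es (\<lambda>x. c * f x) x = c * pderivs es f x" if "set es \<subseteq> Basis" "length es \<le> k" "x \<in> \<Omega>" for es x
    using pderivs_linear_combination[OF \<Omega>(1) holder_on_bounded_Ck[OF f] holder_on_bounded_Ck[OF f] that, of c 0] by simp
  have 1: "(SUP x\<in>\<Omega>. \<bar>pderivs es (\<lambda>x. c * f x) x\<bar>) \<le> \<bar>c\<bar> * (SUP x\<in>\<Omega>. \<bar>pderivs es f x\<bar>)"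
    if es: "set es \<subseteq> Basis" "length es \<le> k" for es
    by (rule cSUP_least[OF \<Omega>(2)])
      (use es in \<open>auto simp: eq abs_mult intro!: mult_left_mono cSUP_upper bdd_sup_seminorm[OF f]\<close>)
  have 2: "(SUP (x, y)\<in>offdiag \<Omega>. \<bar>pderivs es (\<lambda>x. c * f x) x - pderivs es (\<lambda>x. c * f x) y\<bar> / dist x y powr \<alpha>)
     \<le> \<bar>c\<bar> * (SUP (x, y)\<in>offdiag \<Omega>. \<bar>pderivs es f x - pderivs es f y\<bar> / dist x y powr \<alpha>)"
    if es: "set es \<subseteq> Basis" "length es = k" for es
  proof (rule cSUP_least[OF offdiag_nonempty[OF \<Omega>]], clarify)
    fix x y assume xy: "(x, y) \<in> offdiag \<Omega>"
    then have 1: "\<bar>pderivs es (\<lambda>x. c * f x) x - pderivs es (\<lambda>x. c * f x) y\<bar> = \<bar>c\<bar> * \<bar>pderivs es f x - pderivs es f y\<bar>"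
      using es by (simp add: eq offdiag_def flip: right_diff_distrib abs_mult)
    have 2: "\<bar>pderivs es f x - pderivs es f y\<bar> / dist x y powr \<alpha> \<le> (SUP (x, y)\<in>offdiag \<Omega>. \<bar>pderivs es f x - pderivs es f y\<bar> / dist x y powr \<alpha>)"
      using cSUP_upper[OF xy bdd_hoelder_seminorm[OF f es]] by simp
    show "\<bar>pderivs es (\<lambda>x. c * f x) x - pderivs es (\<lambda>x. c * f x) y\<bar> / dist x y powr \<alpha> \<le>
      \<bar>c\<bar> * (SUP (x, y)\<in>offdiag \<Omega>. \<bar>pderivs es f x - pderivs es f y\<bar> / dist x y powr \<alpha>)"
      unfolding 1 times_divide_eq_right[symmetric] by (rule mult_left_mono[OF 2]) simp
  qed
  show ?thesis unfolding holder_norm_offdiag distrib_left sum_distrib_left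
    by (intro add_mono sum_mono 1 2) auto
qed

lemma on_set_linear_combination: "on_set S (\<lambda>x. a * f x + b * g x) = (\<lambda>x. a * on_set S f x + b * on_set S g x)"
  by (auto simp: on_set_def)

lemma bdry_space_linear_combination:
  assumes "open \<Omega>" "f \<in> bdry_space k \<alpha> \<Omega>" "g \<in> bdry_space k \<alpha> \<Omega>"
  shows "(\<lambda>x. a * f x + b * g x) \<in> bdry_space k \<alpha> \<Omega>"
proof -
  obtain F G where FG: "F \<in> holder_space k \<alpha> \<Omega>" "f = on_set (frontier \<Omega>) F" "G \<in> holder_space k \<alpha> \<Omega>" "g = on_set (frontier \<Omega>) G"
    using assms by (auto simp: bdry_space_def)
  show ?thesis unfolding bdry_space_def FG(2,4) on_set_linear_combination[symmetric]
    by (rule imageI, rule holder_space_linear_combination[OF assms(1) FG(1,3)])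
qed

lemma bdry_norm_bounds:
  assumes \<Omega>: "open \<Omega>" "\<Omega> \<noteq> {}" and F: "F \<in> holder_space k \<alpha> \<Omega>"
  shows "0 \<le> bdry_norm k \<alpha> \<Omega> (on_set (frontier \<Omega>) F)" "bdry_norm k \<alpha> \<Omega> (on_set (frontier \<Omega>) F) \<le> holder_norm k \<alpha> \<Omega> F"
proof -
  let ?A = "holder_norm k \<alpha> \<Omega> ` {f \<in> holder_space k \<alpha> \<Omega>. on_set (frontier \<Omega>) f = on_set (frontier \<Omega>) F}"
  have 0: "0 \<le> a" if "a \<in> ?A" for a using that \<Omega> by (auto simp: holder_space_def intro!: holder_norm_nonneg)
  show "0 \<le> bdry_norm k \<alpha> \<Omega> (on_set (frontier \<Omega>) F)" unfolding bdry_norm_def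
    by (rule cInf_greatest) (use F 0 in auto)
  show "bdry_norm k \<alpha> \<Omega> (on_set (frontier \<Omega>) F) \<le> holder_norm k \<alpha> \<Omega> F" unfolding bdry_norm_def
    by (rule cInf_lower) (use F 0 in \<open>auto intro!: bdd_belowI[of _ 0]\<close>)
qed

text \<open>A single extension of \<open>h\<close> controls the whole line: the infimum defining the
  quotient norm is at most the norm of \<open>\<tau>\<close> times that extension. The added 1 makes
  the constant positive.\<close>

lemma bdry_norm_cmult_bound:
  assumes \<Omega>: "open \<Omega>" "\<Omega> \<noteq> {}" and h: "h \<in> bdry_space k \<alpha> \<Omega>"
  obtains N where "N > 0" "\<And>\<tau>. bdry_norm k \<alpha> \<Omega> (\<lambda>x. \<tau> * h x) \<le> \<bar>\<tau>\<bar> * N"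
proof -
  obtain F where F: "F \<in> holder_space k \<alpha> \<Omega>" "h = on_set (frontier \<Omega>) F" using h by (auto simp: bdry_space_def)
  have Fh: "holder_on k \<alpha> \<Omega> F" using F by (simp add: holder_space_def)
  define N where "N = holder_norm k \<alpha> \<Omega> F + 1"
  have "bdry_norm k \<alpha> \<Omega> (\<lambda>x. \<tau> * h x) \<le> \<bar>\<tau>\<bar> * N" for \<tau>
  proof -
    have "(\<lambda>x. \<tau> * F x) \<in> holder_space k \<alpha> \<Omega>" using holder_space_linear_combination[OF \<Omega>(1) F(1) F(1), of \<tau> 0] by simp
    moreover have "(\<lambda>x. \<tau> * h x) = on_set (frontier \<Omega>) (\<lambda>x. \<tau> * F x)" by (auto simp: F on_set_def)
    ultimately have "bdry_norm k \<alpha> \<Omega> (\<lambda>x. \<tau> * h x) \<le> holder_norm k \<alpha> \<Omega> (\<lambda>x. \<tau> * F x)" using bdry_norm_bounds(2)[OF \<Omega>] by metis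
    also have "\<dots> \<le> \<bar>\<tau>\<bar> * holder_norm k \<alpha> \<Omega> F" by (rule holder_norm_cmult_le[OF Fh \<Omega>])
    also have "\<dots> \<le> \<bar>\<tau>\<bar> * N" by (simp add: N_def mult_left_mono)
    finally show ?thesis .
  qed
  then show ?thesis using holder_norm_nonneg[OF Fh \<Omega>] by (intro that[of N]) (auto simp: N_def)
qed

section \<open>Frechet derivatives along a line, tested by bounded functionals\<close>

definition frechet_derivs where
  "frechet_derivs k X NX Y NY U F D \<longleftrightarrow>
        (\<forall>x\<in>U. D 0 x [] = F x) \<and>
        (\<forall>j\<le>k. \<forall>x\<in>U. bounded_multilinear X NX Y NY j (D j x)) \<and>
        (\<forall>j<k. \<forall>x\<in>U. \<forall>\<epsilon>>0. \<exists>r>0. \<forall>h\<in>X. NX h < r \<and> (\<lambda>s. x s + h s) \<in> U \<longrightarrow>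
           (\<forall>hs. set hs \<subseteq> X \<and> length hs = j \<longrightarrow>
              NY (\<lambda>y. D j (\<lambda>s. x s + h s) hs y - D j x hs y - D (Suc j) x (h # hs) y)
                \<le> \<epsilon> * NX h * prod_list (map NX hs))) \<and>
        (\<forall>x\<in>U. \<forall>\<epsilon>>0. \<exists>r>0. \<forall>h\<in>X. NX h < r \<and> (\<lambda>s. x s + h s) \<in> U \<longrightarrow>
           (\<forall>hs. set hs \<subseteq> X \<and> length hs = k \<longrightarrow>
              NY (\<lambda>y. D k (\<lambda>s. x s + h s) hs y - D k x hs y) \<le> \<epsilon> * prod_list (map NX hs)))"

lemma frechet_Ck_on_iff: "frechet_Ck_on k X NX Y NY U F \<longleftrightarrow> (\<exists>D. frechet_derivs k X NX Y NY U F D)"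
  unfolding frechet_Ck_on_def frechet_derivs_def ..

lemma frechet_derivs_multilinear:
  "frechet_derivs k X NX Y NY U F D \<Longrightarrow> j \<le> k \<Longrightarrow> x \<in> U \<Longrightarrow> bounded_multilinear X NX Y NY j (D j x)"
  unfolding frechet_derivs_def by blast

lemma bounded_multilinear_in:
  "bounded_multilinear X NX Y NY j T \<Longrightarrow> set hs \<subseteq> X \<Longrightarrow> length hs = j \<Longrightarrow> T hs \<in> Y"
  unfolding bounded_multilinear_def by blast

lemma bounded_multilinear_update:
  "bounded_multilinear X NX Y NY j T \<Longrightarrow> set hs \<subseteq> X \<Longrightarrow> length hs = j \<Longrightarrow> i < j \<Longrightarrow> f \<in> X \<Longrightarrow> g \<in> X \<Longrightarrow>
    T (hs[i := (\<lambda>x. b * f x + c * g x)]) = (\<lambda>y. b * T (hs[i := f]) y + c * T (hs[i := g]) y)"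
  unfolding bounded_multilinear_def by blast

lemma frechet_derivs_step:
  "frechet_derivs k X NX Y NY U F D \<Longrightarrow> j < k \<Longrightarrow> x \<in> U \<Longrightarrow> \<epsilon> > 0 \<Longrightarrow>
    \<exists>r>0. \<forall>h\<in>X. NX h < r \<and> (\<lambda>s. x s + h s) \<in> U \<longrightarrow>
           (\<forall>hs. set hs \<subseteq> X \<and> length hs = j \<longrightarrow>
              NY (\<lambda>y. D j (\<lambda>s. x s + h s) hs y - D j x hs y - D (Suc j) x (h # hs) y)
                \<le> \<epsilon> * NX h * prod_list (map NX hs))"
  unfolding frechet_derivs_def by blast

lemma frechet_derivs_last:
  "frechet_derivs k X NX Y NY U F D \<Longrightarrow> x \<in> U \<Longrightarrow> \<epsilon> > 0 \<Longrightarrow>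
    \<exists>r>0. \<forall>h\<in>X. NX h < r \<and> (\<lambda>s. x s + h s) \<in> U \<longrightarrow>
           (\<forall>hs. set hs \<subseteq> X \<and> length hs = k \<longrightarrow>
              NY (\<lambda>y. D k (\<lambda>s. x s + h s) hs y - D k x hs y) \<le> \<epsilon> * prod_list (map NX hs))"
  unfolding frechet_derivs_def by blast

text \<open>Linear functionals of norm at most one. Testing with them turns a Frechet derivative
  with values in a function space into an ordinary real derivative.\<close>

definition functional_on :: "('b \<Rightarrow> real) set \<Rightarrow> (('b \<Rightarrow> real) \<Rightarrow> real) \<Rightarrow> (('b \<Rightarrow> real) \<Rightarrow> real) \<Rightarrow> bool" where
  "functional_on Y NY \<Lambda> \<longleftrightarrow> (\<forall>f\<in>Y. \<forall>g\<in>Y. \<forall>a b. \<Lambda> (\<lambda>y. a * f y + b * g y) = a * \<Lambda> f + b * \<Lambda> g) \<and>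
     (\<forall>f\<in>Y. \<bar>\<Lambda> f\<bar> \<le> NY f)"

lemma functional_on_linear:
  "functional_on Y NY \<Lambda> \<Longrightarrow> f \<in> Y \<Longrightarrow> g \<in> Y \<Longrightarrow> \<Lambda> (\<lambda>y. a * f y + b * g y) = a * \<Lambda> f + b * \<Lambda> g"
  unfolding functional_on_def by blast

lemma functional_on_bound: "functional_on Y NY \<Lambda> \<Longrightarrow> f \<in> Y \<Longrightarrow> \<bar>\<Lambda> f\<bar> \<le> NY f"
  unfolding functional_on_def by blast

context
  fixes k and X :: "('a \<Rightarrow> real) set" and NX and Y :: "('b \<Rightarrow> real) set" and NY U F D
    and \<phi> h :: "'a \<Rightarrow> real" and N \<rho> :: real
  assumes D: "frechet_derivs k X NX Y NY U F D"
    and Y: "\<And>f g a b. f \<in> Y \<Longrightarrow> g \<in> Y \<Longrightarrow> (\<lambda>y. a * f y + b * g y) \<in> Y"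
    and X: "\<And>f g a b. f \<in> X \<Longrightarrow> g \<in> X \<Longrightarrow> (\<lambda>y. a * f y + b * g y) \<in> X"
    and NX: "\<And>f. f \<in> X \<Longrightarrow> 0 \<le> NX f"
    and h: "h \<in> X" and N: "N > 0" "\<And>\<tau>. NX (\<lambda>s. \<tau> * h s) \<le> \<bar>\<tau>\<bar> * N"
    and U: "\<And>t. \<bar>t\<bar> < \<rho> \<Longrightarrow> (\<lambda>s. \<phi> s + t * h s) \<in> U"
begin

lemma frechet_line_in_space: "j \<le> k \<Longrightarrow> \<bar>t\<bar> < \<rho> \<Longrightarrow> D j (\<lambda>s. \<phi> s + t * h s) (replicate j h) \<in> Y"
  by (rule bounded_multilinear_in[OF frechet_derivs_multilinear[OF D _ U]]) (use h in auto)

text \<open>The increment along the line is \<open>\<tau> * h\<close>: linearity in the first slot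
  pulls \<open>\<tau>\<close> out of \<open>D (Suc j)\<close>, and the bound
  \<open>\<bar>\<tau>\<bar> * N\<close> on its norm makes the Frechet remainder small compared with
  \<open>\<tau>\<close>.\<close>

lemma frechet_line_deriv:
  assumes \<Lambda>: "functional_on Y NY \<Lambda>" and j: "j < k" and t: "\<bar>t\<bar> < \<rho>"
  shows "((\<lambda>t. \<Lambda> (D j (\<lambda>s. \<phi> s + t * h s) (replicate j h))) has_real_derivative
    \<Lambda> (D (Suc j) (\<lambda>s. \<phi> s + t * h s) (replicate (Suc j) h))) (at t)"
proof -
  define x where "x = (\<lambda>s. \<phi> s + t * h s)"
  define hs where "hs = replicate j h"
  define P where "P = prod_list (map NX hs)"
  have P: "P \<ge> 0" unfolding P_def hs_def using NX[OF h] by (induction j) auto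
  have hs: "set hs \<subseteq> X" "length hs = j" using h by (auto simp: hs_def)
  have xU: "x \<in> U" unfolding x_def by (rule U[OF t])
  define A where "A = (\<lambda>t. D j (\<lambda>s. \<phi> s + t * h s) hs)"
  define B where "B = D (Suc j) x (h # hs)"
  have AY: "A t \<in> Y" if "\<bar>t\<bar> < \<rho>" for t unfolding A_def hs_def by (rule frechet_line_in_space) (use j that in auto)
  have bm: "bounded_multilinear X NX Y NY (Suc j) (D (Suc j) x)" using frechet_derivs_multilinear[OF D _ xU] j by auto
  have BY: "B \<in> Y" unfolding B_def by (rule bounded_multilinear_in[OF bm]) (use hs h in auto)
  have Bl: "D (Suc j) x ((\<lambda>s. \<tau> * h s) # hs) = (\<lambda>y. \<tau> * B y)" for \<tau>
  proof -
    have "D (Suc j) x ((h # hs)[0 := (\<lambda>s. \<tau> * h s + 0 * h s)]) = (\<lambda>y. \<tau> * D (Suc j) x ((h # hs)[0 := h]) y + 0 * D (Suc j) x ((h # hs)[0 := h]) y)"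
      by (rule bounded_multilinear_update[OF bm]) (use hs h in auto)
    then show ?thesis by (simp add: B_def)
  qed
  have "((\<lambda>\<tau>. (\<Lambda> (A (t + \<tau>)) - \<Lambda> (A t)) / \<tau>) \<longlongrightarrow> \<Lambda> B) (at 0)"
  proof (rule LIM_I)
    fix e :: real assume epos: "e > 0"
    \<comment> \<open>Distributes half of the tolerance over the factor \<open>N * P\<close>; the 1
      keeps the denominator positive, and the half makes the final inequality strict.\<close>
    define \<epsilon> where "\<epsilon> = e / (2 * (N * P + 1))"
    have NP: "N * P + 1 > 0" using N P by (simp add: add_nonneg_pos)
    have \<epsilon>: "\<epsilon> > 0" using epos NP by (simp add: \<epsilon>_def)
    obtain r where r: "r > 0" and est: "\<forall>g\<in>X. NX g < r \<and> (\<lambda>s. x s + g s) \<in> U \<longrightarrow> (\<forall>hs. set hs \<subseteq> X \<and> length hs = j \<longrightarrow>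
       NY (\<lambda>y. D j (\<lambda>s. x s + g s) hs y - D j x hs y - D (Suc j) x (g # hs) y) \<le> \<epsilon> * NX g * prod_list (map NX hs))"
      using frechet_derivs_step[OF D j xU \<epsilon>] by (elim exE conjE) (rule that)
    show "\<exists>s>0. \<forall>\<tau>. \<tau> \<noteq> 0 \<and> norm (\<tau> - 0) < s \<longrightarrow> norm ((\<Lambda> (A (t + \<tau>)) - \<Lambda> (A t)) / \<tau> - \<Lambda> B) < e"
    proof (intro exI[of _ "min (\<rho> - \<bar>t\<bar>) (r / N)"] conjI allI impI)
      show "0 < min (\<rho> - \<bar>t\<bar>) (r / N)" using t r N by simp
      fix \<tau> :: real assume \<tau>: "\<tau> \<noteq> 0 \<and> norm (\<tau> - 0) < min (\<rho> - \<bar>t\<bar>) (r / N)"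
      then have t\<tau>: "\<bar>t + \<tau>\<bar> < \<rho>" by auto
      have gX: "(\<lambda>s. \<tau> * h s) \<in> X" using X[OF h h, of \<tau> 0] by simp
      have "\<bar>\<tau>\<bar> * N < r" using \<tau> N by (simp add: field_simps)
      then have gr: "NX (\<lambda>s. \<tau> * h s) < r" using N(2)[of \<tau>] by linarith
      have eqx: "(\<lambda>s. x s + \<tau> * h s) = (\<lambda>s. \<phi> s + (t + \<tau>) * h s)" by (auto simp: x_def algebra_simps)
      have "NY (\<lambda>y. A (t + \<tau>) y - A t y - \<tau> * B y) \<le> \<epsilon> * NX (\<lambda>s. \<tau> * h s) * P"
        using est[rule_format, of _ hs, OF gX conjI[OF gr]] hs U[OF t\<tau>] unfolding eqx Bl P_def A_def x_def[symmetric] by simp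
      also have "\<dots> \<le> \<epsilon> * (\<bar>\<tau>\<bar> * N) * P" using N(2) \<epsilon> P by (intro mult_right_mono mult_left_mono) auto
      finally have 1: "NY (\<lambda>y. A (t + \<tau>) y - A t y - \<tau> * B y) \<le> \<bar>\<tau>\<bar> * (\<epsilon> * (N * P))" by (simp add: mult_ac)
      have Y1: "(\<lambda>y. 1 * A (t + \<tau>) y + (- 1) * A t y) \<in> Y" by (intro Y AY t t\<tau>)
      have e: "(\<lambda>y. A (t + \<tau>) y - A t y - \<tau> * B y) = (\<lambda>y. 1 * (1 * A (t + \<tau>) y + (- 1) * A t y) + (- \<tau>) * B y)" by auto
      have v: "\<Lambda> (\<lambda>y. 1 * (1 * A (t + \<tau>) y + (- 1) * A t y) + (- \<tau>) * B y) = \<Lambda> (A (t + \<tau>)) - \<Lambda> (A t) - \<tau> * \<Lambda> B"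
        using functional_on_linear[OF \<Lambda> Y1 BY, of 1 "- \<tau>"] functional_on_linear[OF \<Lambda> AY[OF t\<tau>] AY[OF t], of 1 "- 1"] by simp
      have "\<bar>\<Lambda> (A (t + \<tau>)) - \<Lambda> (A t) - \<tau> * \<Lambda> B\<bar> \<le> NY (\<lambda>y. A (t + \<tau>) y - A t y - \<tau> * B y)"
        unfolding e v[symmetric] by (rule functional_on_bound[OF \<Lambda> Y[OF Y1 BY]])
      then have 2: "\<bar>\<Lambda> (A (t + \<tau>)) - \<Lambda> (A t) - \<tau> * \<Lambda> B\<bar> \<le> \<bar>\<tau>\<bar> * (\<epsilon> * (N * P))" using 1 by linarith
      have "(\<Lambda> (A (t + \<tau>)) - \<Lambda> (A t)) / \<tau> - \<Lambda> B = (\<Lambda> (A (t + \<tau>)) - \<Lambda> (A t) - \<tau> * \<Lambda> B) / \<tau>"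
        using \<tau> by (simp add: field_simps)
      then have "\<bar>(\<Lambda> (A (t + \<tau>)) - \<Lambda> (A t)) / \<tau> - \<Lambda> B\<bar> \<le> \<epsilon> * (N * P)" using 2 \<tau> by (simp add: field_simps)
      also have "\<dots> < e"
      proof -
        have "\<epsilon> * (N * P) \<le> \<epsilon> * (N * P + 1)" using \<epsilon> by simp
        also have "\<dots> = e / 2" unfolding \<epsilon>_def using less_imp_neq[OF NP] by (subst times_divide_eq_left, subst mult_divide_mult_cancel_right) auto
        finally show ?thesis using epos by linarith
      qed
      finally show "norm ((\<Lambda> (A (t + \<tau>)) - \<Lambda> (A t)) / \<tau> - \<Lambda> B) < e" by simp
    qed
  qed
  then show ?thesis unfolding DERIV_def A_def B_def x_def hs_def by simp
qed

text \<open>At the top order continuity is all that class C^k provides, and it is enough for the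
  last derivative in a Taylor limit.\<close>

lemma frechet_line_isCont:
  assumes \<Lambda>: "functional_on Y NY \<Lambda>" and t: "\<bar>t\<bar> < \<rho>"
  shows "isCont (\<lambda>t. \<Lambda> (D k (\<lambda>s. \<phi> s + t * h s) (replicate k h))) t"
proof -
  define x where "x = (\<lambda>s. \<phi> s + t * h s)"
  define hs where "hs = replicate k h"
  define P where "P = prod_list (map NX hs)"
  have P: "P \<ge> 0" unfolding P_def hs_def using NX[OF h] by (induction k) auto
  have hs: "set hs \<subseteq> X" "length hs = k" using h by (auto simp: hs_def)
  have xU: "x \<in> U" unfolding x_def by (rule U[OF t])
  define A where "A = (\<lambda>t. D k (\<lambda>s. \<phi> s + t * h s) hs)"
  have AY: "A t \<in> Y" if "\<bar>t\<bar> < \<rho>" for t unfolding A_def hs_def by (rule frechet_line_in_space) (use that in auto)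
  have "((\<lambda>\<tau>. \<Lambda> (A (t + \<tau>))) \<longlongrightarrow> \<Lambda> (A t)) (at 0)"
  proof (rule LIM_I)
    fix e :: real assume epos: "e > 0"
    define \<epsilon> where "\<epsilon> = e / (2 * (P + 1))"
    have NP: "P + 1 > 0" using P by (simp add: add_nonneg_pos)
    have \<epsilon>: "\<epsilon> > 0" using epos NP by (simp add: \<epsilon>_def)
    obtain r where r: "r > 0" and est: "\<forall>g\<in>X. NX g < r \<and> (\<lambda>s. x s + g s) \<in> U \<longrightarrow> (\<forall>hs. set hs \<subseteq> X \<and> length hs = k \<longrightarrow>
       NY (\<lambda>y. D k (\<lambda>s. x s + g s) hs y - D k x hs y) \<le> \<epsilon> * prod_list (map NX hs))"
      using frechet_derivs_last[OF D xU \<epsilon>] by (elim exE conjE) (rule that)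
    show "\<exists>s>0. \<forall>\<tau>. \<tau> \<noteq> 0 \<and> norm (\<tau> - 0) < s \<longrightarrow> norm (\<Lambda> (A (t + \<tau>)) - \<Lambda> (A t)) < e"
    proof (intro exI[of _ "min (\<rho> - \<bar>t\<bar>) (r / N)"] conjI allI impI)
      show "0 < min (\<rho> - \<bar>t\<bar>) (r / N)" using t r N by simp
      fix \<tau> :: real assume \<tau>: "\<tau> \<noteq> 0 \<and> norm (\<tau> - 0) < min (\<rho> - \<bar>t\<bar>) (r / N)"
      then have t\<tau>: "\<bar>t + \<tau>\<bar> < \<rho>" by auto
      have gX: "(\<lambda>s. \<tau> * h s) \<in> X" using X[OF h h, of \<tau> 0] by simp
      have "\<bar>\<tau>\<bar> * N < r" using \<tau> N by (simp add: field_simps)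
      then have gr: "NX (\<lambda>s. \<tau> * h s) < r" using N(2)[of \<tau>] by linarith
      have eqx: "(\<lambda>s. x s + \<tau> * h s) = (\<lambda>s. \<phi> s + (t + \<tau>) * h s)" by (auto simp: x_def algebra_simps)
      have 1: "NY (\<lambda>y. A (t + \<tau>) y - A t y) \<le> \<epsilon> * P"
        using est[rule_format, of _ hs, OF gX conjI[OF gr]] hs U[OF t\<tau>] unfolding eqx P_def A_def x_def[symmetric] by simp
      have Y1: "(\<lambda>y. 1 * A (t + \<tau>) y + (- 1) * A t y) \<in> Y" by (intro Y AY t t\<tau>)
      have e: "(\<lambda>y. A (t + \<tau>) y - A t y) = (\<lambda>y. 1 * A (t + \<tau>) y + (- 1) * A t y)" by auto
      have v: "\<Lambda> (\<lambda>y. 1 * A (t + \<tau>) y + (- 1) * A t y) = \<Lambda> (A (t + \<tau>)) - \<Lambda> (A t)"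
        using functional_on_linear[OF \<Lambda> AY[OF t\<tau>] AY[OF t], of 1 "- 1"] by simp
      have "\<bar>\<Lambda> (A (t + \<tau>)) - \<Lambda> (A t)\<bar> \<le> NY (\<lambda>y. A (t + \<tau>) y - A t y)"
        unfolding e v[symmetric] by (rule functional_on_bound[OF \<Lambda> Y1])
      also have "\<dots> \<le> \<epsilon> * (P + 1)" using 1 \<epsilon> by (simp add: algebra_simps)
      also have "\<dots> = e / 2" unfolding \<epsilon>_def using less_imp_neq[OF NP] by (subst times_divide_eq_left, subst mult_divide_mult_cancel_right) auto
      finally show "norm (\<Lambda> (A (t + \<tau>)) - \<Lambda> (A t)) < e" using epos by simp
    qed
  qed
  then show ?thesis unfolding isCont_iff A_def hs_def by simp
qed

end

section \<open>Point evaluations and boundary limits as bounded functionals\<close>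

lemma functional_on_pderivs:
  assumes "open \<Omega>" "set es \<subseteq> Basis" "length es \<le> k" "x \<in> \<Omega>"
  shows "functional_on (holder_space k \<alpha> \<Omega>) (holder_norm k \<alpha> \<Omega>) (\<lambda>f. pderivs es f x)"
  unfolding functional_on_def
proof (intro conjI ballI allI)
  fix f g a b assume fg: "f \<in> holder_space k \<alpha> \<Omega>" "g \<in> holder_space k \<alpha> \<Omega>"
  then show "pderivs es (\<lambda>y. a * f y + b * g y) x = a * pderivs es f x + b * pderivs es g x"
    by (intro pderivs_linear_combination[OF assms(1) _ _ assms(2-4)]) (auto simp: holder_space_def intro!: holder_on_bounded_Ck)
next
  fix f assume "f \<in> holder_space k \<alpha> \<Omega>"
  then show "\<bar>pderivs es f x\<bar> \<le> holder_norm k \<alpha> \<Omega> f"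
    by (intro pderivs_le_holder_norm[OF _ assms]) (auto simp: holder_space_def)
qed

text \<open>The norm sees interior points only; continuity carries the bound to the closure.\<close>

lemma functional_on_eval_closure:
  assumes "open \<Omega>" "x \<in> closure \<Omega>"
  shows "functional_on (holder_space k \<alpha> \<Omega>) (holder_norm k \<alpha> \<Omega>) (\<lambda>f. f x)"
  unfolding functional_on_def
proof (intro conjI ballI allI)
  fix f assume f: "f \<in> holder_space k \<alpha> \<Omega>"
  have "norm (f x) \<le> holder_norm k \<alpha> \<Omega> f"
  proof (rule continuous_on_closure_norm_le[OF _ _ assms(2)])
    show "continuous_on (closure \<Omega>) f" using f by (simp add: holder_space_def holder_on_def)
    show "\<forall>y\<in>\<Omega>. norm (f y) \<le> holder_norm k \<alpha> \<Omega> f"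
      using pderivs_le_holder_norm[OF _ assms(1), of k \<alpha> f "[]"] f by (auto simp: holder_space_def)
  qed
  then show "\<bar>f x\<bar> \<le> holder_norm k \<alpha> \<Omega> f" by simp
qed simp

lemma frontier_at_within_ne_bot:
  assumes "open \<Omega>" "x \<in> frontier \<Omega>" shows "at x within \<Omega> \<noteq> bot"
proof -
  have "x \<notin> \<Omega>" "x \<in> closure \<Omega>" using assms by (auto simp: frontier_def interior_open)
  then have "x islimpt \<Omega>" by (auto simp: closure_def)
  then show ?thesis by (simp add: trivial_limit_within)
qed

lemma holder_boundary_limit:
  assumes f: "holder_on k \<alpha> \<Omega> f" and es: "set es \<subseteq> Basis" "length es \<le> k" and \<Omega>: "open \<Omega>" and x: "x \<in> frontier \<Omega>"
  shows "(pderivs es f \<longlongrightarrow> Lim (at x within \<Omega>) (pderivs es f)) (at x within \<Omega>)"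
proof -
  obtain g where g: "continuous_on (closure \<Omega>) g" "\<And>x. x \<in> \<Omega> \<Longrightarrow> g x = pderivs es f x" using holder_on_ext[OF f es] by blast
  have "x \<in> closure \<Omega>" using x by (simp add: frontier_def)
  then have "(g \<longlongrightarrow> g x) (at x within closure \<Omega>)" using g(1) by (simp add: continuous_on_def)
  then have "(g \<longlongrightarrow> g x) (at x within \<Omega>)" by (rule tendsto_within_subset) (rule closure_subset)
  then have "(pderivs es f \<longlongrightarrow> g x) (at x within \<Omega>)"
    by (rule Lim_transform_within[OF _ zero_less_one]) (use g(2) in auto)
  then show ?thesis using tendsto_Lim[OF frontier_at_within_ne_bot[OF \<Omega> x]] by metis
qed

text \<open>Derivatives extend continuously to the closure, so the limit exists, \<open>Lim\<close>
  has its intended value, and linearity and the bound pass to the limit.\<close>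

lemma functional_on_boundary_limit:
  assumes \<Omega>: "open \<Omega>" and es: "set es \<subseteq> Basis" "length es \<le> k" and x: "x \<in> frontier \<Omega>"
  shows "functional_on (holder_space k \<alpha> \<Omega>) (holder_norm k \<alpha> \<Omega>) (\<lambda>f. Lim (at x within \<Omega>) (pderivs es f))"
  unfolding functional_on_def
proof (intro conjI ballI allI)
  note nb = frontier_at_within_ne_bot[OF \<Omega> x]
  fix f assume "f \<in> holder_space k \<alpha> \<Omega>"
  then have f: "holder_on k \<alpha> \<Omega> f" by (simp add: holder_space_def)
  note lf = holder_boundary_limit[OF f es \<Omega> x]
  show "\<bar>Lim (at x within \<Omega>) (pderivs es f)\<bar> \<le> holder_norm k \<alpha> \<Omega> f"
  proof (rule tendsto_upperbound[OF tendsto_rabs[OF lf] _ nb])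
    show "\<forall>\<^sub>F y in at x within \<Omega>. \<bar>pderivs es f y\<bar> \<le> holder_norm k \<alpha> \<Omega> f"
      unfolding eventually_at_filter using pderivs_le_holder_norm[OF f \<Omega> es] by (auto intro!: always_eventually)
  qed
  fix g a b assume "g \<in> holder_space k \<alpha> \<Omega>"
  then have g: "holder_on k \<alpha> \<Omega> g" by (simp add: holder_space_def)
  note lg = holder_boundary_limit[OF g es \<Omega> x]
  have "((\<lambda>y. a * pderivs es f y + b * pderivs es g y) \<longlongrightarrow> a * Lim (at x within \<Omega>) (pderivs es f) + b * Lim (at x within \<Omega>) (pderivs es g)) (at x within \<Omega>)"
    by (intro tendsto_intros lf lg)
  then have "(pderivs es (\<lambda>y. a * f y + b * g y) \<longlongrightarrow> a * Lim (at x within \<Omega>) (pderivs es f) + b * Lim (at x within \<Omega>) (pderivs es g)) (at x within \<Omega>)"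
    by (rule Lim_transform_within[OF _ zero_less_one])
      (use pderivs_linear_combination[OF \<Omega> holder_on_bounded_Ck[OF f] holder_on_bounded_Ck[OF g] es] in auto)
  then show "Lim (at x within \<Omega>) (pderivs es (\<lambda>y. a * f y + b * g y)) = a * Lim (at x within \<Omega>) (pderivs es f) + b * Lim (at x within \<Omega>) (pderivs es g)"
    by (rule tendsto_Lim[OF nb])
qed

section \<open>The exterior normal and Cauchy data at the boundary\<close>

lemma isCont_in_ball:
  fixes c :: "real \<Rightarrow> 'a::metric_space"
  assumes "isCont c 0" "\<rho> > 0" obtains d where "d > 0" "\<And>t. \<bar>t\<bar> < d \<Longrightarrow> c t \<in> ball (c 0) \<rho>"
proof -
  obtain d where d: "d > 0" "\<And>t. t \<noteq> 0 \<and> dist t 0 < d \<Longrightarrow> dist (c t) (c 0) < \<rho>"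
    using assms unfolding isCont_def LIM_def by blast
  show ?thesis
  proof (rule that[OF d(1)])
    fix t assume "\<bar>t\<bar> < d"
    then show "c t \<in> ball (c 0) \<rho>" using d(2)[of t] assms(2) by (cases "t = 0") (auto simp: dist_commute)
  qed
qed

locale boundary_chart =
  fixes \<Omega> :: "'a::euclidean_space set" and x0 e :: 'a and r :: real and \<gamma> :: "'a \<Rightarrow> real"
    and k :: nat and \<alpha> :: real
  assumes \<Omega>: "open \<Omega>" and x0: "x0 \<in> frontier \<Omega>" and r: "r > 0" and e: "norm e = 1"
    and \<gamma>: "holder_on (Suc k) \<alpha> UNIV \<gamma>" and \<gamma>e: "\<And>x t. \<gamma> (x + t *\<^sub>R e) = \<gamma> x"
    and chart: "\<Omega> \<inter> ball x0 r = {x \<in> ball x0 r. \<gamma> x < x \<bullet> e}"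
begin

lemma ee: "e \<bullet> e = 1" using e by (simp add: power2_norm_eq_inner[symmetric])

lemma \<gamma>_deriv: "(\<gamma> has_derivative frechet_derivative \<gamma> (at x)) (at x)"
  using bounded_Ck_has_derivative[OF holder_on_bounded_Ck[OF \<gamma>], of "[]" x] by simp

lemma \<gamma>_cont: "isCont \<gamma> x"
  using \<gamma>_deriv has_derivative_continuous by blast

lemma \<gamma>_deriv_sum: "frechet_derivative \<gamma> (at x) v = (\<Sum>b\<in>Basis. (v \<bullet> b) * pderivs [b] \<gamma> x)"
proof -
  have "linear (frechet_derivative \<gamma> (at x))" using \<gamma>_deriv has_derivative_linear by blast
  then have "frechet_derivative \<gamma> (at x) (\<Sum>b\<in>Basis. (v \<bullet> b) *\<^sub>R b) = (\<Sum>b\<in>Basis. (v \<bullet> b) *\<^sub>R frechet_derivative \<gamma> (at x) b)"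
    by (simp add: linear_sum linear_scale)
  then show ?thesis by (simp add: euclidean_representation)
qed

lemma \<gamma>_deriv_cont: "isCont (\<lambda>x. frechet_derivative \<gamma> (at x) v) x"
proof -
  have "isCont (pderivs [b] \<gamma>) x" if "b \<in> Basis" for b
    using bounded_Ck_bcont[OF holder_on_bounded_Ck[OF \<gamma>], of "[b]"] that
    by (auto simp: bcont_def continuous_on_eq_continuous_at)
  then show ?thesis unfolding \<gamma>_deriv_sum by (intro continuous_intros)
qed

lemma chartD: "y \<in> \<Omega> \<Longrightarrow> y \<in> ball x0 r \<Longrightarrow> \<gamma> y < y \<bullet> e"
  using chart by blast

lemma above_not_closure: assumes "y \<in> ball x0 r" "\<gamma> y > y \<bullet> e" shows "y \<notin> closure \<Omega>"
proof -
  have "continuous_on UNIV \<gamma>" using \<gamma>_cont by (simp add: continuous_on_eq_continuous_at)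
  then have "open {x. x \<bullet> e < \<gamma> x}" by (intro open_Collect_less continuous_intros)
  then have "open (ball x0 r \<inter> {x. x \<bullet> e < \<gamma> x})" by auto
  moreover have "(ball x0 r \<inter> {x. x \<bullet> e < \<gamma> x}) \<inter> \<Omega> = {}" using chartD less_asym by blast
  ultimately have "(ball x0 r \<inter> {x. x \<bullet> e < \<gamma> x}) \<inter> closure \<Omega> = {}" using open_Int_closure_eq_empty by blast
  then show ?thesis using assms by auto
qed

lemma below_in: assumes "y \<in> ball x0 r" "\<gamma> y < y \<bullet> e" shows "y \<in> \<Omega>"
  using chart assms by blast

text \<open>Points strictly below the graph have a neighbourhood disjoint from the domain, points
  strictly above it lie in the domain, and a graph point is the limit of points moved up along
  \<open>e\<close>.\<close>

lemma frontier_graph: assumes "y \<in> ball x0 r" shows "y \<in> frontier \<Omega> \<longleftrightarrow> \<gamma> y = y \<bullet> e"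
proof
  assume y: "y \<in> frontier \<Omega>"
  then have "y \<notin> \<Omega>" "y \<in> closure \<Omega>" using \<Omega> by (auto simp: frontier_def interior_open)
  then show "\<gamma> y = y \<bullet> e" using above_not_closure[OF assms] below_in[OF assms] by linarith
next
  assume y: "\<gamma> y = y \<bullet> e"
  then have "y \<notin> \<Omega>" using chartD assms by fastforce
  moreover have "y \<in> closure \<Omega>"
  proof (rule Lim_in_closed_set[of "closure \<Omega>" "\<lambda>s. y + s *\<^sub>R e" "at_right 0"])
    have l: "((\<lambda>s. y + s *\<^sub>R e) \<longlongrightarrow> y + 0 *\<^sub>R e) (at_right 0)" by (intro tendsto_intros)
    then show "((\<lambda>s. y + s *\<^sub>R e) \<longlongrightarrow> y) (at_right 0)" by simp
    have "\<forall>\<^sub>F s in at_right 0. y + s *\<^sub>R e \<in> ball x0 r"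
      using l assms by (intro topological_tendstoD[OF l]) auto
    moreover have "\<forall>\<^sub>F s in at_right (0::real). 0 < s" by (simp add: eventually_at_right_less)
    ultimately show "\<forall>\<^sub>F s in at_right 0. y + s *\<^sub>R e \<in> closure \<Omega>"
    proof eventually_elim
      case (elim s)
      then have "y + s *\<^sub>R e \<in> \<Omega>" by (intro below_in) (auto simp: \<gamma>e y inner_add_left ee)
      then show ?case using closure_subset by auto
    qed
  qed auto
  ultimately show "y \<in> frontier \<Omega>" using \<Omega> by (simp add: frontier_def interior_open)
qed

lemma \<gamma>x0: "\<gamma> x0 = x0 \<bullet> e" using frontier_graph[of x0] x0 r by simp

text \<open>The gradient at \<open>x0\<close> of the defining function
  \<open>\<gamma> x - x \<bullet> e\<close>, which is negative in the domain near \<open>x0\<close>;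
  so it points outwards.\<close>

definition n0 :: 'a where "n0 = (\<Sum>b\<in>Basis. pderivs [b] \<gamma> x0 *\<^sub>R b) - e"

lemma n0: "n0 \<bullet> v = frechet_derivative \<gamma> (at x0) v - v \<bullet> e"
  unfolding \<gamma>_deriv_sum n0_def inner_diff_left inner_sum_left inner_scaleR_left
  by (simp add: inner_commute mult.commute del: pderivs.simps)

lemma d\<gamma>_e: "frechet_derivative \<gamma> (at x) e = 0"
proof -
  have "((\<lambda>t. \<gamma> (x + t *\<^sub>R e)) has_real_derivative frechet_derivative \<gamma> (at x) e) (at 0)"
    by (rule has_real_derivative_along_line) (use \<gamma>_deriv in simp)
  then have "((\<lambda>t. \<gamma> x) has_real_derivative frechet_derivative \<gamma> (at x) e) (at (0::real))" by (simp add: \<gamma>e)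
  then show ?thesis using DERIV_unique DERIV_const by blast
qed

lemma n0_nz: "n0 \<noteq> 0" using n0[of e] d\<gamma>_e[of x0] ee by auto

text \<open>The line through \<open>x0\<close> in direction \<open>w\<close>, lifted along
  \<open>e\<close>. As \<open>\<gamma>\<close> is constant in direction \<open>e\<close>, the lift
  stays on the graph when \<open>w \<bullet> e = 0\<close>.\<close>

definition curve :: "'a \<Rightarrow> real \<Rightarrow> 'a" where
  "curve w t = x0 + t *\<^sub>R w + (\<gamma> (x0 + t *\<^sub>R w) - \<gamma> x0) *\<^sub>R e"

lemma curve_0: "curve w 0 = x0" by (simp add: curve_def)

lemma curve_deriv:
  "(curve w has_vector_derivative w + frechet_derivative \<gamma> (at (x0 + t *\<^sub>R w)) w *\<^sub>R e) (at t)"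
proof -
  have "((\<lambda>t. \<gamma> (x0 + t *\<^sub>R w)) has_real_derivative frechet_derivative \<gamma> (at (x0 + t *\<^sub>R w)) w) (at t)"
    by (rule has_real_derivative_along_line[OF \<gamma>_deriv])
  then have "((\<lambda>t. \<gamma> (x0 + t *\<^sub>R w)) has_vector_derivative frechet_derivative \<gamma> (at (x0 + t *\<^sub>R w)) w) (at t)"
    by (simp add: has_real_derivative_iff_has_vector_derivative)
  then show ?thesis unfolding curve_def[abs_def]
    by (auto intro!: derivative_eq_intros simp: has_real_derivative_iff_has_vector_derivative)
qed

lemma curve_graph: assumes "w \<bullet> e = 0" shows "\<gamma> (curve w t) = curve w t \<bullet> e"
  using assms by (simp add: curve_def \<gamma>e inner_add_left ee \<gamma>x0)

lemma curve_in_ball: assumes "\<rho> > 0" obtains d where "d > 0" "\<And>t. \<bar>t\<bar> < d \<Longrightarrow> curve w t \<in> ball x0 \<rho>"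
proof -
  have "isCont (curve w) 0" using has_vector_derivative_continuous[OF curve_deriv] by blast
  from isCont_in_ball[OF this assms] show ?thesis using that by (metis curve_0)
qed

text \<open>On a frontier curve \<open>\<gamma> (c t) - c t \<bullet> e\<close> is 0 near
  \<open>t = 0\<close>, and its derivative there is \<open>n0 \<bullet> v\<close>. Conversely,
  lifting the part of \<open>v\<close> orthogonal to \<open>e\<close> gives a curve with velocity
  \<open>v\<close>.\<close>

lemma tangent_vectors_eq: "tangent_vectors (frontier \<Omega>) x0 = {v. n0 \<bullet> v = 0}"
proof (intro equalityI subsetI)
  fix v assume "v \<in> tangent_vectors (frontier \<Omega>) x0"
  then obtain c where c: "c 0 = x0" "\<And>t. c t \<in> frontier \<Omega>" "(c has_vector_derivative v) (at 0)"
    by (auto simp: tangent_vectors_def)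
  have cd: "(c has_derivative (\<lambda>t. t *\<^sub>R v)) (at 0)" using c(3) by (simp add: has_vector_derivative_def)
  have g: "(\<gamma> has_derivative frechet_derivative \<gamma> (at x0)) (at (c 0))" using \<gamma>_deriv by (simp add: c)
  have d1: "((\<lambda>t. \<gamma> (c t) - c t \<bullet> e) has_derivative (\<lambda>t. frechet_derivative \<gamma> (at x0) (t *\<^sub>R v) - (t *\<^sub>R v) \<bullet> e)) (at 0)"
    by (intro has_derivative_diff has_derivative_compose[OF cd g] has_derivative_inner_left cd)
  have "isCont c 0" using cd has_derivative_continuous by blast
  from isCont_in_ball[OF this r] obtain d where d: "d > 0" "\<And>t. \<bar>t\<bar> < d \<Longrightarrow> c t \<in> ball x0 r" by (metis c(1))
  define U where "U = {- d<..<d}"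
  have U: "open U" "0 \<in> U" "\<And>t. t \<in> U \<Longrightarrow> c t \<in> ball x0 r" using d by (auto simp: U_def)
  have "((\<lambda>t. 0) has_derivative (\<lambda>t. frechet_derivative \<gamma> (at x0) (t *\<^sub>R v) - (t *\<^sub>R v) \<bullet> e)) (at 0)"
  proof (rule has_derivative_transform_within_open[OF d1 U(1,2)])
    fix t assume "t \<in> U"
    then show "\<gamma> (c t) - c t \<bullet> e = 0" using frontier_graph[OF U(3)] c(2) by simp
  qed
  then have "(\<lambda>t. frechet_derivative \<gamma> (at x0) (t *\<^sub>R v) - (t *\<^sub>R v) \<bullet> e) = (\<lambda>t. 0)"
    using has_derivative_unique has_derivative_const by blast
  from fun_cong[OF this, of 1] show "v \<in> {v. n0 \<bullet> v = 0}" by (simp add: n0)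
next
  fix v assume "v \<in> {v. n0 \<bullet> v = 0}"
  then have v: "frechet_derivative \<gamma> (at x0) v = v \<bullet> e" by (simp add: n0)
  define w where "w = v - (v \<bullet> e) *\<^sub>R e"
  have we: "w \<bullet> e = 0" by (simp add: w_def inner_diff_left ee)
  have lin: "linear (frechet_derivative \<gamma> (at x0))" using \<gamma>_deriv has_derivative_linear by blast
  have dw: "w + frechet_derivative \<gamma> (at x0) w *\<^sub>R e = v"
    by (simp add: w_def linear_diff[OF lin] linear_scale[OF lin] d\<gamma>_e v)
  obtain d where d: "d > 0" "\<And>t. \<bar>t\<bar> < d \<Longrightarrow> curve w t \<in> ball x0 r" using curve_in_ball[OF r] by blast
  \<comment> \<open>\<open>tangent_vectors\<close> demands \<open>c t\<close> on the frontier for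
    every real t, so the curve is frozen at \<open>x0\<close> where it could leave the chart; only
    its germ at 0 matters.\<close>
  define c where "c = (\<lambda>t. if \<bar>t\<bar> < d then curve w t else x0)"
  have "(curve w has_vector_derivative v) (at 0)" using curve_deriv[of w 0] dw by simp
  then have "(c has_vector_derivative v) (at 0)"
    by (rule has_vector_derivative_transform_within_open[of _ _ _ "{-d<..<d}"]) (use d in \<open>auto simp: c_def\<close>)
  moreover have "c t \<in> frontier \<Omega>" for t
    using frontier_graph[OF d(2), of t] curve_graph[OF we] x0 by (auto simp: c_def)
  ultimately show "v \<in> tangent_vectors (frontier \<Omega>) x0"
    unfolding tangent_vectors_def using d by (auto intro!: exI[of _ c] simp: c_def curve_0)
qed

definition \<nu>0 :: 'a where "\<nu>0 = n0 /\<^sub>R norm n0"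

text \<open>At \<open>x0\<close> the defining function is 0 and its derivative along
  \<open>\<nu>0\<close> is \<open>norm n0\<close>, which is positive.\<close>

lemma \<nu>0_exterior: "\<exists>\<epsilon>>0. \<forall>t. 0 < t \<and> t < \<epsilon> \<longrightarrow> x0 + t *\<^sub>R \<nu>0 \<notin> closure \<Omega> \<and> x0 - t *\<^sub>R \<nu>0 \<in> \<Omega>"
proof -
  have n\<nu>: "norm \<nu>0 = 1" using n0_nz by (simp add: \<nu>0_def)
  define h where "h = (\<lambda>t. \<gamma> (x0 + t *\<^sub>R \<nu>0) - (x0 + t *\<^sub>R \<nu>0) \<bullet> e)"
  have h0: "h 0 = 0" by (simp add: h_def \<gamma>x0)
  have "((\<lambda>t. \<gamma> (x0 + t *\<^sub>R \<nu>0)) has_real_derivative frechet_derivative \<gamma> (at x0) \<nu>0) (at 0)"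
    by (rule has_real_derivative_along_line) (use \<gamma>_deriv in simp)
  moreover have "((\<lambda>t. (x0 + t *\<^sub>R \<nu>0) \<bullet> e) has_real_derivative \<nu>0 \<bullet> e) (at 0)"
    unfolding inner_add_left inner_scaleR_left by (auto intro!: derivative_eq_intros)
  ultimately have "(h has_real_derivative frechet_derivative \<gamma> (at x0) \<nu>0 - \<nu>0 \<bullet> e) (at 0)"
    unfolding h_def by (rule DERIV_diff)
  moreover have "frechet_derivative \<gamma> (at x0) \<nu>0 - \<nu>0 \<bullet> e > 0"
    unfolding n0[symmetric] using n0_nz by (simp add: \<nu>0_def)
  ultimately obtain d1 d2 where d1: "d1 > 0" "\<And>t. 0 < t \<Longrightarrow> t < d1 \<Longrightarrow> h 0 < h (0 + t)"
    and d2: "d2 > 0" "\<And>t. 0 < t \<Longrightarrow> t < d2 \<Longrightarrow> h (0 - t) < h 0"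
    using DERIV_pos_inc_right DERIV_pos_inc_left by metis
  show ?thesis
  proof (intro exI[of _ "min r (min d1 d2)"] conjI allI impI)
    show "0 < min r (min d1 d2)" using r d1 d2 by simp
    fix t assume t: "0 < t \<and> t < min r (min d1 d2)"
    have b: "x0 + t *\<^sub>R \<nu>0 \<in> ball x0 r" "x0 - t *\<^sub>R \<nu>0 \<in> ball x0 r"
      using t n\<nu> by (auto simp: dist_norm)
    show "x0 + t *\<^sub>R \<nu>0 \<notin> closure \<Omega>"
      using d1(2)[of t] t by (intro above_not_closure b) (simp add: h0, simp add: h_def)
    show "x0 - t *\<^sub>R \<nu>0 \<in> \<Omega>"
      using d2(2)[of t] t by (intro below_in b) (simp add: h0, simp add: h_def)
  qed
qed

text \<open>A unit vector orthogonal to the tangent hyperplane is \<open>\<nu>0\<close> or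
  \<open>- \<nu>0\<close>; the one-sided exterior condition rules out the second.\<close>

lemma ext_normal_eq: "ext_normal \<Omega> x0 = \<nu>0"
  unfolding ext_normal_def
proof (rule the_equality)
  show "norm \<nu>0 = 1 \<and> (\<forall>v\<in>tangent_vectors (frontier \<Omega>) x0. \<nu>0 \<bullet> v = 0) \<and>
        (\<exists>\<epsilon>>0. \<forall>t. 0 < t \<and> t < \<epsilon> \<longrightarrow> x0 + t *\<^sub>R \<nu>0 \<notin> closure \<Omega> \<and> x0 - t *\<^sub>R \<nu>0 \<in> \<Omega>)"
    using \<nu>0_exterior n0_nz by (auto simp: tangent_vectors_eq \<nu>0_def)
next
  fix \<nu> assume \<nu>: "norm \<nu> = 1 \<and> (\<forall>v\<in>tangent_vectors (frontier \<Omega>) x0. \<nu> \<bullet> v = 0) \<and>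
        (\<exists>\<epsilon>>0. \<forall>t. 0 < t \<and> t < \<epsilon> \<longrightarrow> x0 + t *\<^sub>R \<nu> \<notin> closure \<Omega> \<and> x0 - t *\<^sub>R \<nu> \<in> \<Omega>)"
  have n\<nu>0: "norm \<nu>0 = 1" using n0_nz by (simp add: \<nu>0_def)
  have sq: "\<nu>0 \<bullet> \<nu>0 = 1" using n\<nu>0 by (simp add: power2_norm_eq_inner[symmetric])
  define p where "p = \<nu> - (\<nu> \<bullet> \<nu>0) *\<^sub>R \<nu>0"
  have p0: "\<nu>0 \<bullet> p = 0" by (simp add: p_def inner_diff_right sq inner_commute)
  then have "n0 \<bullet> p = 0" using n0_nz by (simp add: \<nu>0_def)
  then have "\<nu> \<bullet> p = 0" using \<nu> by (simp add: tangent_vectors_eq)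
  moreover have "p \<bullet> p = \<nu> \<bullet> p - (\<nu> \<bullet> \<nu>0) * (\<nu>0 \<bullet> p)" unfolding p_def by (simp add: inner_diff_left)
  ultimately have "p = 0" using p0 by simp
  then have eq: "\<nu> = (\<nu> \<bullet> \<nu>0) *\<^sub>R \<nu>0" by (simp add: p_def)
  then have "norm ((\<nu> \<bullet> \<nu>0) *\<^sub>R \<nu>0) = 1" using \<nu> by simp
  then have "\<bar>\<nu> \<bullet> \<nu>0\<bar> = 1" using n\<nu>0 by simp
  moreover have "\<nu> \<bullet> \<nu>0 \<noteq> - 1"
  proof
    assume "\<nu> \<bullet> \<nu>0 = - 1"
    then have m: "\<nu> = - \<nu>0" using eq by simp
    obtain \<epsilon>1 where "\<epsilon>1 > 0" "\<And>t. 0 < t \<and> t < \<epsilon>1 \<Longrightarrow> x0 + t *\<^sub>R \<nu> \<notin> closure \<Omega>" using \<nu> by blast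
    moreover obtain \<epsilon>2 where "\<epsilon>2 > 0" "\<And>t. 0 < t \<and> t < \<epsilon>2 \<Longrightarrow> x0 - t *\<^sub>R \<nu>0 \<in> \<Omega>" using \<nu>0_exterior by blast
    ultimately have "x0 + (min \<epsilon>1 \<epsilon>2 / 2) *\<^sub>R \<nu> \<notin> closure \<Omega>" "x0 - (min \<epsilon>1 \<epsilon>2 / 2) *\<^sub>R \<nu>0 \<in> \<Omega>" by auto
    then show False using closure_subset by (auto simp: m)
  qed
  ultimately have "\<nu> \<bullet> \<nu>0 = 1" by linarith
  then show "\<nu> = \<nu>0" using eq by simp
qed

text \<open>Tangential derivatives: the mean value theorem on the boundary curve shifted into the domain.\<close>
lemma tangential_limit_0:
  assumes f: "holder_on (Suc j) \<beta> \<Omega> f" and f0: "\<And>y. y \<in> frontier \<Omega> \<Longrightarrow> f y = 0" and v: "n0 \<bullet> v = 0"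
    and lim: "\<And>b. b \<in> Basis \<Longrightarrow> (pderivs [b] f \<longlongrightarrow> G b) (at x0 within \<Omega>)"
  shows "(\<Sum>b\<in>Basis. (v \<bullet> b) * G b) = 0"
proof -
  have v: "frechet_derivative \<gamma> (at x0) v = v \<bullet> e" using v by (simp add: n0)
  define w where "w = v - (v \<bullet> e) *\<^sub>R e"
  have we: "w \<bullet> e = 0" by (simp add: w_def inner_diff_left ee)
  have lin: "linear (frechet_derivative \<gamma> (at x0))" using \<gamma>_deriv has_derivative_linear by blast
  define c' where "c' = (\<lambda>t. w + frechet_derivative \<gamma> (at (x0 + t *\<^sub>R w)) w *\<^sub>R e)"
  have c'0: "c' 0 = v"
    by (simp add: c'_def w_def linear_diff[OF lin] linear_scale[OF lin] d\<gamma>_e v)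
  have c'c: "isCont c' 0" unfolding c'_def
    by (intro continuous_intros isCont_o2[where f = "\<lambda>t. x0 + t *\<^sub>R w" and g = "\<lambda>x. frechet_derivative \<gamma> (at x) w"] \<gamma>_deriv_cont)
  obtain d where d: "d > 0" "\<And>t. \<bar>t\<bar> < d \<Longrightarrow> curve w t \<in> ball x0 (r / 2)" using curve_in_ball[of "r / 2"] r by auto
  have inn: "curve w t + s *\<^sub>R e \<in> \<Omega>" if "\<bar>t\<bar> < d" "0 < s" "s < r / 2" for t s
  proof (rule below_in)
    have "dist x0 (curve w t + s *\<^sub>R e) \<le> dist x0 (curve w t) + dist (curve w t) (curve w t + s *\<^sub>R e)" by (rule dist_triangle)
    also have "\<dots> < r / 2 + r / 2" using d(2)[OF that(1)] that e by (intro add_strict_mono) (auto simp: dist_norm)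
    finally show "curve w t + s *\<^sub>R e \<in> ball x0 r" by simp
    show "\<gamma> (curve w t + s *\<^sub>R e) < (curve w t + s *\<^sub>R e) \<bullet> e"
      using that by (simp add: \<gamma>e curve_graph[OF we] inner_add_left ee)
  qed
  have fr: "curve w t \<in> frontier \<Omega>" if "\<bar>t\<bar> < d" for t
    using frontier_graph[of "curve w t"] d(2)[OF that] curve_graph[OF we] r by auto
  have fl: "((\<lambda>s. f (curve w t + s *\<^sub>R e)) \<longlongrightarrow> 0) (at_right 0)" if t: "\<bar>t\<bar> < d" for t
  proof -
    have "continuous_on (closure \<Omega>) f" using f by (simp add: holder_on_def)
    moreover have "curve w t \<in> closure \<Omega>" using fr[OF t] by (simp add: frontier_def)
    ultimately have l: "(f \<longlongrightarrow> f (curve w t)) (at (curve w t) within closure \<Omega>)" by (simp add: continuous_on_def)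
    have "filterlim (\<lambda>s. curve w t + s *\<^sub>R e) (at (curve w t) within closure \<Omega>) (at_right 0)"
      unfolding filterlim_at
    proof
      have "\<forall>\<^sub>F s in at_right 0. s \<in> {0<..<r/2}" using r by (intro eventually_at_right_real) auto
      then show "\<forall>\<^sub>F s in at_right 0. curve w t + s *\<^sub>R e \<in> closure \<Omega> \<and> curve w t + s *\<^sub>R e \<noteq> curve w t"
        by eventually_elim (use inn[OF t] closure_subset e in auto)
      have "((\<lambda>s. curve w t + s *\<^sub>R e) \<longlongrightarrow> curve w t + 0 *\<^sub>R e) (at_right 0)" by (intro tendsto_intros)
      then show "((\<lambda>s. curve w t + s *\<^sub>R e) \<longlongrightarrow> curve w t) (at_right 0)" by simp
    qed
    from filterlim_compose[OF l this] show ?thesis using f0[OF fr[OF t]] by simp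
  qed
  have fd: "(f has_derivative frechet_derivative f (at x)) (at x)" if "x \<in> \<Omega>" for x
    using bounded_Ck_has_derivative[OF holder_on_bounded_Ck[OF f], of "[]" x] that by simp
  have fsum: "frechet_derivative f (at x) u = (\<Sum>b\<in>Basis. (u \<bullet> b) * pderivs [b] f x)" if "x \<in> \<Omega>" for x u
  proof -
    have "linear (frechet_derivative f (at x))" using fd[OF that] has_derivative_linear by blast
    then have "frechet_derivative f (at x) (\<Sum>b\<in>Basis. (u \<bullet> b) *\<^sub>R b) = (\<Sum>b\<in>Basis. (u \<bullet> b) *\<^sub>R frechet_derivative f (at x) b)"
      by (simp add: linear_sum linear_scale)
    then show ?thesis by (simp add: euclidean_representation)
  qed
  have ex: "\<exists>\<theta> s. 0 < \<theta> \<and> \<theta> < \<epsilon> \<and> \<theta> < d \<and> 0 < s \<and> s < \<epsilon> \<and> s < r / 2 \<and> \<bar>\<Sum>b\<in>Basis. (c' \<theta> \<bullet> b) * pderivs [b] f (curve w \<theta> + s *\<^sub>R e)\<bar> \<le> \<epsilon>"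
    if \<epsilon>: "\<epsilon> > 0" for \<epsilon>
  proof -
    \<comment> \<open>\<open>t\<close> is fixed before \<open>s\<close>: the increment of
      \<open>f\<close> along the shifted curve tends to 0 with \<open>s\<close>, so it can be made
      smaller than \<open>t * \<epsilon>\<close>, and division by \<open>t\<close> leaves a
      directional derivative below \<open>\<epsilon>\<close>.\<close>
    define t where "t = min d \<epsilon> / 2"
    have t: "0 < t" "t < d" "t < \<epsilon>" using d \<epsilon> by (auto simp: t_def)
    have "((\<lambda>s. f (curve w t + s *\<^sub>R e) - f (curve w 0 + s *\<^sub>R e)) \<longlongrightarrow> 0 - 0) (at_right 0)"
      using t d by (intro tendsto_diff fl) auto
    then have "((\<lambda>s. \<bar>f (curve w t + s *\<^sub>R e) - f (curve w 0 + s *\<^sub>R e)\<bar>) \<longlongrightarrow> \<bar>0 - 0\<bar>) (at_right 0)"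
      by (rule tendsto_rabs)
    then have "\<forall>\<^sub>F s in at_right 0. \<bar>f (curve w t + s *\<^sub>R e) - f (curve w 0 + s *\<^sub>R e)\<bar> < t * \<epsilon>"
      by (rule order_tendstoD(2)) (use t \<epsilon> in simp)
    moreover have "\<forall>\<^sub>F s in at_right 0. s \<in> {0<..<min \<epsilon> (r/2)}" using r \<epsilon> by (intro eventually_at_right_real) auto
    ultimately have "\<forall>\<^sub>F s in at_right 0. \<bar>f (curve w t + s *\<^sub>R e) - f (curve w 0 + s *\<^sub>R e)\<bar> < t * \<epsilon> \<and> s \<in> {0<..<min \<epsilon> (r/2)}"
      by (rule eventually_conj)
    then obtain s where s: "\<bar>f (curve w t + s *\<^sub>R e) - f (curve w 0 + s *\<^sub>R e)\<bar> < t * \<epsilon>" "0 < s" "s < \<epsilon>" "s < r / 2"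
      using eventually_happens[of _ "at_right (0::real)"] by fastforce
    have "\<exists>\<theta>>0. \<theta> < t \<and> f (curve w t + s *\<^sub>R e) - f (curve w 0 + s *\<^sub>R e) = (t - 0) * frechet_derivative f (at (curve w \<theta> + s *\<^sub>R e)) (c' \<theta>)"
    proof (rule MVT2[OF t(1)])
      fix \<theta> assume \<theta>: "0 \<le> \<theta>" "\<theta> \<le> t"
      have i: "curve w \<theta> + s *\<^sub>R e \<in> \<Omega>" using \<theta> t s by (intro inn) auto
      have "((\<lambda>\<theta>. curve w \<theta> + s *\<^sub>R e) has_derivative (\<lambda>h. h *\<^sub>R c' \<theta>)) (at \<theta>)"
        using has_derivative_add[OF curve_deriv[of w \<theta>, unfolded has_vector_derivative_def] has_derivative_const[of "s *\<^sub>R e"]]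
        by (simp add: c'_def)
      from has_derivative_compose[OF this fd[OF i]]
      show "((\<lambda>\<theta>. f (curve w \<theta> + s *\<^sub>R e)) has_real_derivative frechet_derivative f (at (curve w \<theta> + s *\<^sub>R e)) (c' \<theta>)) (at \<theta>)"
        using linear_scale[OF has_derivative_linear[OF fd[OF i]]] by (simp add: has_field_derivative_def mult_commute_abs)
    qed
    then obtain \<theta> where \<theta>: "0 < \<theta>" "\<theta> < t" "f (curve w t + s *\<^sub>R e) - f (curve w 0 + s *\<^sub>R e) = t * frechet_derivative f (at (curve w \<theta> + s *\<^sub>R e)) (c' \<theta>)" by auto
    have "\<bar>t * frechet_derivative f (at (curve w \<theta> + s *\<^sub>R e)) (c' \<theta>)\<bar> < t * \<epsilon>" using s(1) \<theta>(3) by simp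
    then have "\<bar>frechet_derivative f (at (curve w \<theta> + s *\<^sub>R e)) (c' \<theta>)\<bar> < \<epsilon>" using t by (simp add: abs_mult)
    moreover have "curve w \<theta> + s *\<^sub>R e \<in> \<Omega>" using \<theta> t s by (intro inn) auto
    ultimately have "\<bar>\<Sum>b\<in>Basis. (c' \<theta> \<bullet> b) * pderivs [b] f (curve w \<theta> + s *\<^sub>R e)\<bar> \<le> \<epsilon>" by (simp only: fsum less_imp_le)
    then show ?thesis using \<theta> s t by (intro exI[of _ \<theta>] exI[of _ s]) auto
  qed
  \<comment> \<open>Along the resulting sequences the points tend to \<open>x0\<close> and the
    velocities \<open>c'\<close> tend to \<open>v\<close>, so the small directional derivatives
    converge to the claimed sum.\<close>
  define \<epsilon> where "\<epsilon> = (\<lambda>n. inverse (real (Suc n)))"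
  have \<epsilon>: "\<epsilon> n > 0" "\<epsilon> \<longlonglongrightarrow> 0" for n unfolding \<epsilon>_def by (simp, rule LIMSEQ_inverse_real_of_nat)
  define P where "P = (\<lambda>\<epsilon> \<theta> s. 0 < \<theta> \<and> \<theta> < \<epsilon> \<and> \<theta> < d \<and> 0 < s \<and> s < \<epsilon> \<and> s < r / 2 \<and> \<bar>\<Sum>b\<in>Basis. (c' \<theta> \<bullet> b) * pderivs [b] f (curve w \<theta> + s *\<^sub>R e)\<bar> \<le> \<epsilon>)"
  have "\<exists>\<theta> s. P (\<epsilon> n) \<theta> s" for n using ex[OF \<epsilon>(1)] unfolding P_def .
  then obtain \<theta> s where "\<And>n. P (\<epsilon> n) (\<theta> n) (s n)" by metis
  note \<theta>s = this[unfolded P_def]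
  have \<theta>0: "\<theta> \<longlonglongrightarrow> 0" by (rule tendsto_sandwich[OF _ _ tendsto_const \<epsilon>(2)]) (use \<theta>s in \<open>auto intro!: always_eventually less_imp_le\<close>)
  have s0: "s \<longlonglongrightarrow> 0" by (rule tendsto_sandwich[OF _ _ tendsto_const \<epsilon>(2)]) (use \<theta>s in \<open>auto intro!: always_eventually less_imp_le\<close>)
  define y where "y = (\<lambda>n. curve w (\<theta> n) + s n *\<^sub>R e)"
  have y\<Omega>: "y n \<in> \<Omega>" for n unfolding y_def using \<theta>s[of n] by (intro inn) auto
  have "isCont (curve w) 0" using has_vector_derivative_continuous[OF curve_deriv] by blast
  then have "(\<lambda>n. curve w (\<theta> n)) \<longlonglongrightarrow> x0" using isCont_tendsto_compose[OF _ \<theta>0, of "curve w"] by (simp add: curve_0)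
  then have "y \<longlonglongrightarrow> x0 + 0 *\<^sub>R e" unfolding y_def by (intro tendsto_intros s0)
  then have y0: "y \<longlonglongrightarrow> x0" by simp
  have "x0 \<notin> \<Omega>" using x0 \<Omega> by (auto simp: frontier_def interior_open)
  then have "filterlim y (at x0 within \<Omega>) sequentially" unfolding filterlim_at using y0 y\<Omega> by (auto intro!: always_eventually)
  then have "(\<lambda>n. pderivs [b] f (y n)) \<longlonglongrightarrow> G b" if "b \<in> Basis" for b by (rule filterlim_compose[OF lim[OF that]])
  moreover have "(\<lambda>n. c' (\<theta> n)) \<longlonglongrightarrow> v" using isCont_tendsto_compose[OF c'c \<theta>0] by (simp add: c'0)
  ultimately have "(\<lambda>n. \<Sum>b\<in>Basis. (c' (\<theta> n) \<bullet> b) * pderivs [b] f (y n)) \<longlonglongrightarrow> (\<Sum>b\<in>Basis. (v \<bullet> b) * G b)"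
    by (intro tendsto_intros) auto
  moreover have "(\<lambda>n. \<Sum>b\<in>Basis. (c' (\<theta> n) \<bullet> b) * pderivs [b] f (y n)) \<longlonglongrightarrow> 0"
    by (rule Lim_null_comparison[OF always_eventually \<epsilon>(2)]) (use \<theta>s in \<open>simp add: y_def del: pderivs.simps\<close>)
  ultimately show ?thesis by (rule LIMSEQ_unique)
qed

end

text \<open>The boundary gradient \<open>g\<close> is orthogonal to the normal by hypothesis, hence
  tangential; the vanishing of tangential derivatives, applied to the vector \<open>g\<close>
  itself, gives \<open>g \<bullet> g = 0\<close>.\<close>

lemma gradient_vanishes_at_frontier:
  fixes \<Omega> :: "'a::euclidean_space set"
  assumes \<Omega>: "open \<Omega>" and bd: "holder_boundary (Suc k) \<alpha> \<Omega>"
    and f: "holder_on (Suc j) \<beta> \<Omega> f" and f0: "\<And>y. y \<in> frontier \<Omega> \<Longrightarrow> f y = 0"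
    and x: "x \<in> frontier \<Omega>" and nd: "(\<Sum>b\<in>Basis. (ext_normal \<Omega> x \<bullet> b) * Lim (at x within \<Omega>) (pderivs [b] f)) = 0"
    and b: "b \<in> Basis"
  shows "Lim (at x within \<Omega>) (pderivs [b] f) = 0"
proof -
  obtain r e \<gamma> where ch: "r > 0" "norm e = 1" "holder_on (Suc k) \<alpha> UNIV \<gamma>" "\<forall>x t. \<gamma> (x + t *\<^sub>R e) = \<gamma> x"
    "\<Omega> \<inter> ball x r = {y \<in> ball x r. \<gamma> y < y \<bullet> e}"
    using bd x unfolding holder_boundary_def by blast
  interpret boundary_chart \<Omega> x e r \<gamma> k \<alpha>
    by unfold_locales (use \<Omega> x ch in auto)
  define G where "G = (\<lambda>b. Lim (at x within \<Omega>) (pderivs [b] f))"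
  define g where "g = (\<Sum>b\<in>Basis. G b *\<^sub>R b)"
  have gi: "g \<bullet> v = (\<Sum>b\<in>Basis. (v \<bullet> b) * G b)" for v
    unfolding g_def inner_sum_left inner_scaleR_left by (simp add: inner_commute mult.commute)
  have lim: "(pderivs [b] f \<longlongrightarrow> G b) (at x within \<Omega>)" if "b \<in> Basis" for b
    unfolding G_def by (rule holder_boundary_limit[OF f _ _ \<Omega> x]) (use that in auto)
  have "g \<bullet> \<nu>0 = 0" using nd unfolding gi ext_normal_eq G_def .
  then have "n0 \<bullet> g = 0" using n0_nz by (simp add: \<nu>0_def inner_commute)
  from tangential_limit_0[OF f f0 this lim] have "g \<bullet> g = 0" unfolding gi .
  then have "g = 0" by simp
  then have "g \<bullet> b = 0" by simp
  moreover have "g \<bullet> b = G b" using b by (simp add: g_def inner_sum_left inner_Basis if_distrib sum.delta cong: if_cong)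
  ultimately show ?thesis by (simp add: G_def)
qed

section \<open>Asymptotic expansions\<close>

text \<open>Lagrange's remainder, with the intermediate point chosen as a function \<open>s\<close>
  of the increment so that it can enter a limit.\<close>

lemma Taylor_remainder:
  fixes B :: "nat \<Rightarrow> real \<Rightarrow> real"
  assumes D: "\<And>i z. i < k \<Longrightarrow> \<bar>z - z0\<bar> < \<rho> \<Longrightarrow> (B i has_real_derivative B (Suc i) z) (at z)"
    and 0: "\<And>i. i < k \<Longrightarrow> B i z0 = 0"
  obtains s where "\<And>w. \<bar>w\<bar> < \<rho> \<Longrightarrow> \<bar>s w\<bar> \<le> \<bar>w\<bar>" "\<And>w. \<bar>w\<bar> < \<rho> \<Longrightarrow> B 0 (z0 + w) = B k (z0 + s w) / fact k * w ^ k"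
proof -
  have "\<exists>s. \<bar>s\<bar> \<le> \<bar>w\<bar> \<and> B 0 (z0 + w) = B k (z0 + s) / fact k * w ^ k" if w: "\<bar>w\<bar> < \<rho>" for w
  proof -
    have "\<exists>t. \<bar>t\<bar> \<le> \<bar>w\<bar> \<and> B 0 (z0 + w) = (\<Sum>m<k. (\<lambda>i w. B i (z0 + w)) m 0 / fact m * w ^ m) + (\<lambda>i w. B i (z0 + w)) k t / fact k * w ^ k"
    proof (rule Maclaurin_bi_le[where f = "\<lambda>w. B 0 (z0 + w)" and diff = "\<lambda>i w. B i (z0 + w)"])
      show "\<forall>m t. m < k \<and> \<bar>t\<bar> \<le> \<bar>w\<bar> \<longrightarrow> ((\<lambda>w. B m (z0 + w)) has_real_derivative B (Suc m) (z0 + t)) (at t)"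
      proof (intro allI impI)
        fix m t assume mt: "m < k \<and> \<bar>t\<bar> \<le> \<bar>w\<bar>"
        then have "(B m has_real_derivative B (Suc m) (z0 + t)) (at (z0 + t))" using w by (intro D) auto
        then show "((\<lambda>w. B m (z0 + w)) has_real_derivative B (Suc m) (z0 + t)) (at t)"
          using DERIV_shift[of "B m" "B (Suc m) (z0 + t)" t z0] by (simp add: add.commute)
      qed
    qed simp
    then show ?thesis using 0 by simp
  qed
  then obtain s where "\<forall>w. \<bar>w\<bar> < \<rho> \<longrightarrow> \<bar>s w\<bar> \<le> \<bar>w\<bar> \<and> B 0 (z0 + w) = B k (z0 + s w) / fact k * w ^ k" by metis
  then show ?thesis using that by blast
qed

text \<open>The vanishing lower derivatives make \<open>B 0\<close> of order \<open>k\<close> at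
  \<open>z0\<close>, so only the first-order behaviour of \<open>u\<close> enters the limit.\<close>

lemma Taylor_limit_compose:
  fixes B :: "nat \<Rightarrow> real \<Rightarrow> real" and u :: "real \<Rightarrow> real"
  assumes \<rho>: "\<rho> > 0" and D: "\<And>i z. i < k \<Longrightarrow> \<bar>z - z0\<bar> < \<rho> \<Longrightarrow> (B i has_real_derivative B (Suc i) z) (at z)"
    and 0: "\<And>i. i < k \<Longrightarrow> B i z0 = 0" and c: "isCont (B k) z0"
    and u: "((\<lambda>t. (u t - z0) / t) \<longlongrightarrow> v) (at 0)"
  shows "((\<lambda>t. B 0 (u t) / t ^ k) \<longlongrightarrow> B k z0 / fact k * v ^ k) (at 0)"
proof -
  obtain s where s: "\<And>w. \<bar>w\<bar> < \<rho> \<Longrightarrow> \<bar>s w\<bar> \<le> \<bar>w\<bar>" "\<And>w. \<bar>w\<bar> < \<rho> \<Longrightarrow> B 0 (z0 + w) = B k (z0 + s w) / fact k * w ^ k"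
    by (rule Taylor_remainder[where B = B and k = k and \<rho> = \<rho> and ?z0.0 = z0]) (use D 0 in blast)+
  define w where "w = (\<lambda>t. u t - z0)"
  have "((\<lambda>t. (u t - z0) / t * t) \<longlongrightarrow> v * 0) (at 0)" by (intro tendsto_intros u)
  then have "(w \<longlongrightarrow> v * 0) (at 0)"
    by (rule Lim_transform_within[OF _ zero_less_one]) (auto simp: w_def)
  then have w0: "(w \<longlongrightarrow> 0) (at 0)" by simp
  then have wr: "\<forall>\<^sub>F t in at 0. \<bar>w t\<bar> < \<rho>" using \<rho> by (metis order_tendstoD(2) tendsto_rabs_zero)
  have s0: "((\<lambda>t. s (w t)) \<longlongrightarrow> 0) (at 0)"
  proof (rule Lim_null_comparison[OF _ tendsto_rabs_zero[OF w0]])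
    show "\<forall>\<^sub>F t in at 0. norm (s (w t)) \<le> \<bar>w t\<bar>" using wr by eventually_elim (use s(1) in auto)
  qed
  have "((\<lambda>t. z0 + s (w t)) \<longlongrightarrow> z0 + 0) (at 0)" by (intro tendsto_intros s0)
  then have "((\<lambda>t. B k (z0 + s (w t))) \<longlongrightarrow> B k z0) (at 0)" using isCont_tendsto_compose[OF c] by simp
  then have lim: "((\<lambda>t. B k (z0 + s (w t)) / fact k * ((u t - z0) / t) ^ k) \<longlongrightarrow> B k z0 / fact k * v ^ k) (at 0)"
    by (intro tendsto_intros u) auto
  have "\<forall>\<^sub>F t in at 0. B k (z0 + s (w t)) / fact k * ((u t - z0) / t) ^ k = B 0 (u t) / t ^ k"
    using wr
  proof eventually_elim
    case (elim t)
    then show ?case using s(2)[of "w t"] by (simp add: w_def power_divide)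
  qed
  then show ?thesis by (rule Lim_transform_eventually[OF lim])
qed

lemma Taylor_limit:
  fixes G :: "nat \<Rightarrow> real \<Rightarrow> real"
  assumes \<rho>: "\<rho> > 0" and D: "\<And>i t. i < k \<Longrightarrow> \<bar>t\<bar> < \<rho> \<Longrightarrow> (G i has_real_derivative G (Suc i) t) (at t)"
    and 0: "\<And>i. i < k \<Longrightarrow> G i 0 = 0" and c: "isCont (G k) 0"
  shows "((\<lambda>t. G 0 t / t ^ k) \<longlongrightarrow> G k 0 / fact k) (at 0)"
proof -
  have u: "((\<lambda>t::real. (t - 0) / t) \<longlongrightarrow> 1) (at 0)"
    by (rule Lim_transform_within[OF tendsto_const[of 1] zero_less_one]) auto
  show ?thesis using Taylor_limit_compose[of \<rho> k 0 G "\<lambda>t. t" 1, OF \<rho> _ 0 c u] D by simp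
qed

text \<open>The product rule for difference quotients with an arbitrary scale \<open>g t\<close>, so
  that powers of \<open>t\<close> can serve as denominators.\<close>

lemma prod_difference_limit:
  fixes a b :: "'i \<Rightarrow> real \<Rightarrow> real"
  assumes "finite S" and a: "\<And>s. s \<in> S \<Longrightarrow> (a s \<longlongrightarrow> \<alpha> s) F" and b: "\<And>s. s \<in> S \<Longrightarrow> (b s \<longlongrightarrow> \<alpha> s) F"
    and d: "\<And>s. s \<in> S \<Longrightarrow> ((\<lambda>t. (a s t - b s t) / g t) \<longlongrightarrow> e s) F"
  shows "((\<lambda>t. ((\<Prod>s\<in>S. a s t) - (\<Prod>s\<in>S. b s t)) / g t) \<longlongrightarrow> (\<Sum>s\<in>S. e s * (\<Prod>r\<in>S - {s}. \<alpha> r))) F"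
  using assms
proof (induction S)
  case (insert x S)
  have IH: "((\<lambda>t. ((\<Prod>s\<in>S. a s t) - (\<Prod>s\<in>S. b s t)) / g t) \<longlongrightarrow> (\<Sum>s\<in>S. e s * (\<Prod>r\<in>S - {s}. \<alpha> r))) F"
    by (rule insert.IH) (use insert.prems in auto)
  have pa: "((\<lambda>t. \<Prod>s\<in>S. a s t) \<longlongrightarrow> (\<Prod>s\<in>S. \<alpha> s)) F" by (intro tendsto_prod) (use insert.prems in auto)
  have "((\<lambda>t. (a x t - b x t) / g t * (\<Prod>s\<in>S. a s t) + b x t * (((\<Prod>s\<in>S. a s t) - (\<Prod>s\<in>S. b s t)) / g t))
     \<longlongrightarrow> e x * (\<Prod>s\<in>S. \<alpha> s) + \<alpha> x * (\<Sum>s\<in>S. e s * (\<Prod>r\<in>S - {s}. \<alpha> r))) F"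
    by (intro tendsto_intros IH pa) (use insert.prems in auto)
  moreover have "(a x t - b x t) / g t * (\<Prod>s\<in>S. a s t) + b x t * (((\<Prod>s\<in>S. a s t) - (\<Prod>s\<in>S. b s t)) / g t)
     = ((\<Prod>s\<in>insert x S. a s t) - (\<Prod>s\<in>insert x S. b s t)) / g t" for t
    using insert.hyps by (cases "g t = 0") (simp_all add: field_simps)
  moreover have "e x * (\<Prod>s\<in>S. \<alpha> s) + \<alpha> x * (\<Sum>s\<in>S. e s * (\<Prod>r\<in>S - {s}. \<alpha> r)) = (\<Sum>s\<in>insert x S. e s * (\<Prod>r\<in>insert x S - {s}. \<alpha> r))"
  proof -
    have "insert x S - {s} = insert x (S - {s})" if "s \<in> S" for s using insert.hyps that by auto
    then have "(\<Sum>s\<in>S. e s * (\<Prod>r\<in>insert x S - {s}. \<alpha> r)) = (\<Sum>s\<in>S. \<alpha> x * (e s * (\<Prod>r\<in>S - {s}. \<alpha> r)))"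
      using insert.hyps by (intro sum.cong) auto
    moreover have "insert x S - {x} = S" using insert.hyps by auto
    ultimately show ?thesis using insert.hyps by (simp add: sum_distrib_left)
  qed
  ultimately show ?case by simp
qed simp

text \<open>The derivative of the determinant at the identity is the trace: a permutation other than
  \<open>id\<close> moves at least two indices, so each term of its product rule retains an
  off-diagonal zero.\<close>

lemma det_difference_limit:
  fixes A B :: "real \<Rightarrow> real ^ 'n ^ 'n"
  assumes A: "\<And>i j. ((\<lambda>t. A t $ i $ j) \<longlongrightarrow> mat 1 $ i $ j) F" and B: "\<And>i j. ((\<lambda>t. B t $ i $ j) \<longlongrightarrow> mat 1 $ i $ j) F"
    and d: "\<And>i j. ((\<lambda>t. (A t $ i $ j - B t $ i $ j) / g t) \<longlongrightarrow> E i j) F"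
  shows "((\<lambda>t. (det (A t) - det (B t)) / g t) \<longlongrightarrow> (\<Sum>i\<in>UNIV. E i i)) F"
proof -
  let ?P = "{p. p permutes (UNIV :: 'n set)}"
  define I :: "real ^ 'n ^ 'n" where "I = mat 1"
  have I: "I $ i $ j = (if i = j then 1 else 0)" for i j by (simp add: I_def mat_def)
  have fP: "finite ?P" by (simp add: finite_permutations)
  have "((\<lambda>t. \<Sum>p\<in>?P. of_int (sign p) * (((\<Prod>i\<in>UNIV. A t $ i $ p i) - (\<Prod>i\<in>UNIV. B t $ i $ p i)) / g t))
     \<longlongrightarrow> (\<Sum>p\<in>?P. of_int (sign p) * (\<Sum>i\<in>UNIV. E i (p i) * (\<Prod>r\<in>UNIV - {i}. I $ r $ p r)))) F"
    by (intro tendsto_sum tendsto_mult tendsto_const prod_difference_limit) (use A B d in \<open>auto simp: I_def\<close>)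
  moreover have "(\<Sum>p\<in>?P. of_int (sign p) * (((\<Prod>i\<in>UNIV. A t $ i $ p i) - (\<Prod>i\<in>UNIV. B t $ i $ p i)) / g t)) = (det (A t) - det (B t)) / g t" for t
    unfolding det_def sum_subtractf[symmetric] right_diff_distrib[symmetric] by (simp add: sum_divide_distrib)
  moreover have "(\<Sum>p\<in>?P. of_int (sign p) * (\<Sum>i\<in>UNIV. E i (p i) * (\<Prod>r\<in>UNIV - {i}. I $ r $ p r))) = (\<Sum>i\<in>UNIV. E i i)"
  proof -
    have z: "(\<Sum>i\<in>UNIV. E i (p i) * (\<Prod>r\<in>UNIV - {i}. I $ r $ p r)) = 0" if p: "p permutes UNIV" "p \<noteq> id" for p :: "'n \<Rightarrow> 'n"
    proof (rule sum.neutral, rule ballI)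
      fix i :: 'n
      have "\<exists>r. r \<noteq> i \<and> p r \<noteq> r"
      proof (rule ccontr)
        assume *: "\<not> ?thesis"
        obtain j where j: "p j \<noteq> j" using p(2) by (auto simp: fun_eq_iff)
        then have "j = i" using * by auto
        moreover have "p (p j) \<noteq> p j" using j permutes_inj[OF p(1)] by (metis injD)
        ultimately show False using * j by auto
      qed
      then obtain r where r: "r \<noteq> i" "p r \<noteq> r" by blast
      have "(\<Prod>r\<in>UNIV - {i}. I $ r $ p r) = 0"
        by (rule prod_zero) (use r in \<open>auto simp: I intro!: bexI[of _ r]\<close>)
      then show "E i (p i) * (\<Prod>r\<in>UNIV - {i}. I $ r $ p r) = 0" by simp
    qed
    have "(\<Sum>p\<in>?P. of_int (sign p) * (\<Sum>i\<in>UNIV. E i (p i) * (\<Prod>r\<in>UNIV - {i}. I $ r $ p r))) =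
       (\<Sum>p\<in>{id}. of_int (sign p) * (\<Sum>i\<in>UNIV. E i (p i) * (\<Prod>r\<in>UNIV - {i}. I $ r $ p r)))"
      by (rule sum.mono_neutral_right[OF fP]) (use z in \<open>auto simp: permutes_id\<close>)
    then show ?thesis by (simp add: I)
  qed
  ultimately show ?thesis by simp
qed

text \<open>Mean value theorem with an intermediate point controlled by
  \<open>\<bar>a - z0\<bar> + \<bar>b - z0\<bar>\<close>, a bound that is symmetric and also covers
  \<open>a = b\<close>.\<close>

lemma difference_limit_compose:
  fixes \<alpha> \<alpha>' :: "real \<Rightarrow> real"
  assumes D: "\<And>z. (\<alpha> has_real_derivative \<alpha>' z) (at z)" and c: "isCont \<alpha>' z0"
    and u: "(u \<longlongrightarrow> z0) F" and v: "(v \<longlongrightarrow> z0) F" and d: "((\<lambda>t. (u t - v t) / g t) \<longlongrightarrow> e) F"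
  shows "((\<lambda>t. (\<alpha> (u t) - \<alpha> (v t)) / g t) \<longlongrightarrow> \<alpha>' z0 * e) F"
proof -
  have "\<exists>\<xi>. \<alpha> a - \<alpha> b = \<alpha>' \<xi> * (a - b) \<and> \<bar>\<xi> - z0\<bar> \<le> \<bar>a - z0\<bar> + \<bar>b - z0\<bar>" for a b
  proof (cases "a = b")
    case False
    then consider "a < b" | "b < a" by linarith
    then show ?thesis
    proof cases
      case 1
      then obtain z where "z > a" "z < b" "\<alpha> b - \<alpha> a = (b - a) * \<alpha>' z" using MVT2[of a b \<alpha> \<alpha>'] D by auto
      then show ?thesis by (intro exI[of _ z]) (auto simp: algebra_simps)
    next
      case 2
      then obtain z where "z > b" "z < a" "\<alpha> a - \<alpha> b = (a - b) * \<alpha>' z" using MVT2[of b a \<alpha> \<alpha>'] D by auto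
      then show ?thesis by (intro exI[of _ z]) (auto simp: algebra_simps)
    qed
  qed (auto intro!: exI[of _ z0])
  then obtain \<xi> where \<xi>: "\<And>a b. \<alpha> a - \<alpha> b = \<alpha>' (\<xi> a b) * (a - b)" "\<And>a b. \<bar>\<xi> a b - z0\<bar> \<le> \<bar>a - z0\<bar> + \<bar>b - z0\<bar>" by metis
  have "((\<lambda>t. \<bar>u t - z0\<bar> + \<bar>v t - z0\<bar>) \<longlongrightarrow> \<bar>z0 - z0\<bar> + \<bar>z0 - z0\<bar>) F" by (intro tendsto_intros u v)
  then have "((\<lambda>t. \<bar>u t - z0\<bar> + \<bar>v t - z0\<bar>) \<longlongrightarrow> 0) F" by simp
  then have "((\<lambda>t. \<xi> (u t) (v t) - z0) \<longlongrightarrow> 0) F" by (rule Lim_null_comparison[rotated]) (use \<xi>(2) in auto)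
  then have "((\<lambda>t. \<xi> (u t) (v t)) \<longlongrightarrow> z0) F" by (rule LIM_zero_cancel)
  then have "((\<lambda>t. \<alpha>' (\<xi> (u t) (v t)) * ((u t - v t) / g t)) \<longlongrightarrow> \<alpha>' z0 * e) F"
    by (intro tendsto_mult d isCont_tendsto_compose[OF c])
  then show ?thesis unfolding \<xi>(1) by simp
qed

text \<open>Split \<open>a1 (z1 t) - a2 (z2 t)\<close> at \<open>a1 (z2 t)\<close>: the first part
  contributes \<open>a1' z0 * d\<close>, the second the mismatch \<open>L\<close> of the
  nonlinearities. With the background as second solution this yields the linearised equation; with
  two solutions, the equation for the first order at which they can differ.\<close>

lemma MA_difference_limit:
  fixes H1 H2 :: "real \<Rightarrow> real ^ 'n ^ 'n" and a1 a2 a1' :: "real \<Rightarrow> real"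
  assumes eq: "\<forall>\<^sub>F t in at 0. det (H1 t) = a1 (z1 t)" "\<forall>\<^sub>F t in at 0. det (H2 t) = a2 (z2 t)"
    and H: "\<And>i j. ((\<lambda>t. H1 t $ i $ j) \<longlongrightarrow> mat 1 $ i $ j) (at 0)" "\<And>i j. ((\<lambda>t. H2 t $ i $ j) \<longlongrightarrow> mat 1 $ i $ j) (at 0)"
    and E: "\<And>i j. ((\<lambda>t. (H1 t $ i $ j - H2 t $ i $ j) / t ^ l) \<longlongrightarrow> E i j) (at 0)"
    and z: "(z1 \<longlongrightarrow> z0) (at 0)" "(z2 \<longlongrightarrow> z0) (at 0)" and d: "((\<lambda>t. (z1 t - z2 t) / t ^ l) \<longlongrightarrow> d) (at 0)"
    and a1: "\<And>z. (a1 has_real_derivative a1' z) (at z)" "isCont a1' z0"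
    and L: "((\<lambda>t. (a1 (z2 t) - a2 (z2 t)) / t ^ l) \<longlongrightarrow> L) (at (0::real))"
  shows "(\<Sum>i\<in>UNIV. E i i) = a1' z0 * d + L"
proof -
  have 1: "((\<lambda>t. (det (H1 t) - det (H2 t)) / t ^ l) \<longlongrightarrow> (\<Sum>i\<in>UNIV. E i i)) (at 0)"
    by (rule det_difference_limit[OF H E])
  have 2: "((\<lambda>t. (a1 (z1 t) - a1 (z2 t)) / t ^ l + (a1 (z2 t) - a2 (z2 t)) / t ^ l) \<longlongrightarrow> a1' z0 * d + L) (at 0)"
    by (intro tendsto_add L difference_limit_compose[OF a1 z d])
  have "\<forall>\<^sub>F t in at 0. (a1 (z1 t) - a1 (z2 t)) / t ^ l + (a1 (z2 t) - a2 (z2 t)) / t ^ l = (det (H1 t) - det (H2 t)) / t ^ l"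
    using eq by eventually_elim (simp add: diff_divide_distrib)
  then show ?thesis by (rule tendsto_unique[OF at_neq_bot 1 Lim_transform_eventually[OF 2]])
qed

lemma derivs_zero:
  fixes G :: "nat \<Rightarrow> real \<Rightarrow> real"
  assumes \<rho>: "\<rho> > 0" and D: "\<And>i t. i < k \<Longrightarrow> \<bar>t\<bar> < \<rho> \<Longrightarrow> (G i has_real_derivative G (Suc i) t) (at t)"
    and 0: "\<And>t. \<bar>t\<bar> < \<rho> \<Longrightarrow> G 0 t = 0"
  shows "i \<le> k \<Longrightarrow> \<bar>t\<bar> < \<rho> \<Longrightarrow> G i t = 0"
proof (induction i arbitrary: t)
  case (Suc i)
  have "(G i has_real_derivative G (Suc i) t) (at t)" using D Suc.prems by auto
  then have "((\<lambda>t. 0) has_real_derivative G (Suc i) t) (at t)"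
    by (rule DERIV_cong_ev[THEN iffD1, rotated 3, OF _ refl _ refl])
      (use Suc in \<open>auto simp: eventually_nhds intro!: exI[of _ "{-\<rho><..<\<rho>}"]\<close>)
  then show ?case using DERIV_unique DERIV_const by blast
qed (use 0 in auto)

section \<open>Derivatives in the z-variable\<close>

definition ez :: "(real ^ 'n) \<times> real \<times> (real ^ 'n)" where "ez = (0, 1, 0)"

lemma ez_Basis: "ez \<in> Basis"
  by (auto simp: ez_def Basis_prod_def)

lemma replicate_ez: "set (replicate k ez) \<subseteq> Basis"
  by (auto simp: ez_Basis)

text \<open>Expressed through \<open>pderivs\<close>, so that \<open>holder_on\<close> supplies
  differentiability and continuity; \<open>dz_eq_deriv\<close> identifies it with the iterated
  \<open>deriv\<close> of the theorem.\<close>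

definition dz :: "nat \<Rightarrow> ((real ^ 'n) \<times> real \<times> (real ^ 'n) \<Rightarrow> real) \<Rightarrow> real ^ 'n \<Rightarrow> real \<Rightarrow> real ^ 'n \<Rightarrow> real" where
  "dz k a x z p = pderivs (replicate k ez) a (x, z, p)"

lemma dz_deriv:
  assumes a: "holder_on K \<alpha> (\<Omega> \<times> UNIV \<times> UNIV) a" and k: "k < K" and x: "x \<in> \<Omega>"
  shows "((\<lambda>z. dz k a x z p) has_real_derivative dz (Suc k) a x z p) (at z)"
proof -
  have pt: "(x, 0, p) + z *\<^sub>R ez = (x, z, p)" for z by (simp add: ez_def)
  have "(pderivs (replicate k ez) a has_derivative frechet_derivative (pderivs (replicate k ez) a) (at (x, z, p))) (at (x, z, p))"
    by (rule bounded_Ck_has_derivative[OF holder_on_bounded_Ck[OF a]]) (use k x replicate_ez in auto)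
  then have "((\<lambda>s. pderivs (replicate k ez) a ((x, 0, p) + s *\<^sub>R ez)) has_real_derivative frechet_derivative (pderivs (replicate k ez) a) (at (x, z, p)) ez) (at z)"
    by (intro has_real_derivative_along_line) (simp only: pt)
  then show ?thesis by (simp only: pt dz_def replicate.simps pderivs.simps)
qed

lemma dz_eq_deriv:
  assumes a: "holder_on K \<alpha> (\<Omega> \<times> UNIV \<times> UNIV) a" and x: "x \<in> \<Omega>"
  shows "k \<le> K \<Longrightarrow> (deriv ^^ k) (\<lambda>z. a (x, z, p)) = (\<lambda>z. dz k a x z p)"
proof (induction k)
  case (Suc k)
  then have "(deriv ^^ Suc k) (\<lambda>z. a (x, z, p)) = deriv (\<lambda>z. dz k a x z p)" by simp
  also have "\<dots> = (\<lambda>z. dz (Suc k) a x z p)"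
    using DERIV_imp_deriv[OF dz_deriv[OF a _ x]] Suc.prems by (intro ext) auto
  finally show ?case .
qed (simp add: dz_def)

lemma dz_isCont:
  assumes \<Omega>: "open \<Omega>" and a: "holder_on K \<alpha> (\<Omega> \<times> UNIV \<times> UNIV) a" and k: "k \<le> K" and x: "x \<in> \<Omega>"
  shows "isCont (\<lambda>z. dz k a x z p) z"
proof -
  have "continuous_on (\<Omega> \<times> UNIV \<times> UNIV) (pderivs (replicate k ez) a)"
    using bounded_Ck_bcont[OF holder_on_bounded_Ck[OF a] replicate_ez, of k] k by (simp add: bcont_def)
  moreover have "open (\<Omega> \<times> (UNIV :: real set) \<times> (UNIV :: (real ^ 'a) set))" using \<Omega> by (intro open_Times) auto
  ultimately have c: "isCont (pderivs (replicate k ez) a) (x, z, p)" using x by (simp add: continuous_on_eq_continuous_at)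
  show ?thesis unfolding dz_def
    by (rule isCont_o2[where f = "\<lambda>z. (x, z, p)" and g = "pderivs (replicate k ez) a", OF _ c]) (intro continuous_intros)
qed

text \<open>The continuous extension of the derivative to the closure of the cylinder is composed
  with \<open>x \<mapsto> (x, \<Phi> x, 0)\<close>.\<close>

lemma dz_extension:
  assumes a: "holder_on K \<alpha> (\<Omega> \<times> UNIV \<times> UNIV) a" and k: "k \<le> K"
  obtains F where "continuous_on (closure \<Omega>) F" "\<And>x. x \<in> \<Omega> \<Longrightarrow> F x = dz k a x (\<Phi> x) 0"
proof -
  obtain g where g: "continuous_on (closure (\<Omega> \<times> UNIV \<times> UNIV)) g" "\<And>y. y \<in> \<Omega> \<times> UNIV \<times> UNIV \<Longrightarrow> g y = pderivs (replicate k ez) a y"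
    using holder_on_ext[OF a replicate_ez, of k] k by (metis length_replicate)
  show ?thesis
  proof (rule that[of "\<lambda>x. g (x, \<Phi> x, 0)"])
    show "continuous_on (closure \<Omega>) (\<lambda>x. g (x, \<Phi> x, 0))"
      by (rule continuous_on_compose2[OF g(1)]) (auto simp: closure_Times \<Phi>_def intro!: continuous_intros)
    show "g (x, \<Phi> x, 0) = dz k a x (\<Phi> x) 0" if "x \<in> \<Omega>" for x using g(2) that by (simp add: dz_def)
  qed
qed

section \<open>The background \<open>\<Phi>\<close>\<close>

lemma \<Phi>_has_derivative: "(\<Phi> has_derivative (\<lambda>h. x \<bullet> h)) (at x)"
  unfolding \<Phi>_def[abs_def] power2_norm_eq_inner
  by (auto intro!: derivative_eq_intros simp: inner_commute)

lemma pderivs_\<Phi>_1: "pderivs [b] \<Phi> = (\<lambda>x. x \<bullet> b)"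
  using frechet_derivative_at[OF \<Phi>_has_derivative] by (metis pderivs.simps)

lemma inner_has_derivative: "((\<lambda>x. x \<bullet> b) has_derivative (\<lambda>h. h \<bullet> b)) (at x)"
  by (auto intro!: derivative_eq_intros)

lemma pderivs_\<Phi>_2: "pderivs [c, b] \<Phi> = (\<lambda>x. c \<bullet> b)"
proof -
  have "pderivs [c, b] \<Phi> = (\<lambda>x. frechet_derivative (\<lambda>x. x \<bullet> b) (at x) c)" using pderivs_\<Phi>_1[of b] by simp
  then show ?thesis using frechet_derivative_at[OF inner_has_derivative] by metis
qed

lemma pderivs_\<Phi>_const: "length es \<ge> 2 \<Longrightarrow> \<exists>c. pderivs es \<Phi> = (\<lambda>x. c)"
proof (induction es)
  case (Cons e es)
  show ?case
  proof (cases "length es \<ge> 2")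
    case True
    then obtain c where "pderivs es \<Phi> = (\<lambda>x. c)" using Cons by blast
    then have "pderivs (e # es) \<Phi> = (\<lambda>x. 0)" by simp
    then show ?thesis by blast
  next
    case False
    then have "length es = 1" using Cons.prems by simp
    then obtain b where "es = [b]" by (auto simp: length_Suc_conv)
    then show ?thesis using pderivs_\<Phi>_2 by metis
  qed
qed simp

lemma pderivs_\<Phi>_cases:
  obtains "es = []" | b where "es = [b]" | c where "pderivs es \<Phi> = (\<lambda>x. c)"
proof (cases "length es \<ge> 2")
  case True
  then show ?thesis using pderivs_\<Phi>_const that(3) by blast
next
  case False
  then have "length es = 0 \<or> length es = 1" by linarith
  then show ?thesis using that(1,2) by (auto simp: length_Suc_conv)
qed

lemma holder_on_\<Phi>:
  fixes \<Omega> :: "(real ^ 'n) set"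
  assumes "bounded \<Omega>" "0 < \<alpha>" "\<alpha> \<le> 1"
  shows "holder_on k \<alpha> \<Omega> \<Phi>"
proof -
  have c: "continuous_on S (pderivs es \<Phi>)" for S :: "(real ^ 'n) set" and es
  proof (rule pderivs_\<Phi>_cases[of es])
    assume "es = []"
    moreover have "continuous_on S \<Phi>" unfolding \<Phi>_def[abs_def] by (intro continuous_intros) auto
    ultimately show ?thesis by simp
  next
    fix b assume es: "es = [b]"
    show ?thesis unfolding es pderivs_\<Phi>_1 by (intro continuous_intros)
  qed auto
  have d: "pderivs es \<Phi> differentiable (at x)" for x :: "real ^ 'n" and es
  proof (rule pderivs_\<Phi>_cases[of es])
    assume "es = []" then show ?thesis using \<Phi>_has_derivative by (auto simp: differentiable_def)
  next
    fix b assume "es = [b]" then show ?thesis using inner_has_derivative by (auto simp: differentiable_def pderivs_\<Phi>_1 simp del: pderivs.simps(2))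
  qed auto
  have bd: "bcont \<Omega> (pderivs es \<Phi>)" for es
    by (rule bcont_compact[of "closure \<Omega>"]) (use assms c closure_subset in auto)
  obtain R where R: "R > 0" "\<And>x. x \<in> \<Omega> \<Longrightarrow> norm x \<le> R" using assms(1) by (auto simp: bounded_pos)
  have lip: "\<exists>L\<ge>0. \<forall>x\<in>\<Omega>. \<forall>y\<in>\<Omega>. \<bar>pderivs es \<Phi> x - pderivs es \<Phi> y\<bar> \<le> L * dist x y" for es
  proof (rule pderivs_\<Phi>_cases[of es])
    assume es: "es = []"
    have "\<bar>\<Phi> x - \<Phi> y\<bar> \<le> R * dist x y" if "x \<in> \<Omega>" "y \<in> \<Omega>" for x y
    proof -
      have "\<Phi> x - \<Phi> y = (norm x + norm y) / 2 * (norm x - norm y)" by (simp add: \<Phi>_def power2_eq_square field_simps)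
      also have "\<bar>\<dots>\<bar> = (norm x + norm y) / 2 * \<bar>norm x - norm y\<bar>" by (simp add: abs_mult)
      also have "\<dots> \<le> R * norm (x - y)"
        using R(2)[OF that(1)] R(2)[OF that(2)] R(1) by (intro mult_mono norm_triangle_ineq3) auto
      finally show ?thesis by (simp add: dist_norm)
    qed
    then show ?thesis using es R by (intro exI[of _ R]) auto
  next
    fix b assume es: "es = [b]"
    have "\<bar>x \<bullet> b - y \<bullet> b\<bar> \<le> norm b * dist x y" for x y
      using Cauchy_Schwarz_ineq2[of "x - y" b] by (simp add: inner_diff_left dist_norm mult.commute)
    then show ?thesis using es by (intro exI[of _ "norm b"]) (auto simp: pderivs_\<Phi>_1 simp del: pderivs.simps(2))
  next
    fix c assume "pderivs es \<Phi> = (\<lambda>x. c)" then show ?thesis by (intro exI[of _ 0]) auto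
  qed
  show ?thesis unfolding holder_on_def
  proof (intro conjI allI impI ballI)
    show "continuous_on (closure \<Omega>) \<Phi>" using c[of "closure \<Omega>" "[]"] by simp
  next
    fix es
    show "\<exists>g. continuous_on (closure \<Omega>) g \<and> (\<forall>x\<in>\<Omega>. g x = pderivs es \<Phi> x)" using c by blast
    show "bounded (pderivs es \<Phi> ` \<Omega>)" using bd[of es] by (simp add: bcont_def)
    obtain L where L: "L \<ge> 0" "\<forall>x\<in>\<Omega>. \<forall>y\<in>\<Omega>. \<bar>pderivs es \<Phi> x - pderivs es \<Phi> y\<bar> \<le> L * dist x y" using lip by blast
    obtain M where M: "M > 0" "\<And>x. x \<in> \<Omega> \<Longrightarrow> norm (pderivs es \<Phi> x) \<le> M" using bd[of es] by (rule bcontE) blast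
    show "\<exists>C. \<forall>x\<in>\<Omega>. \<forall>y\<in>\<Omega>. \<bar>pderivs es \<Phi> x - pderivs es \<Phi> y\<bar> \<le> C * dist x y powr \<alpha>"
      by (rule Lipschitz_imp_Hoelder[of _ _ _ L M]) (use assms L M in auto)
  qed (rule d)
qed

section \<open>Uniqueness of the Taylor coefficients\<close>

lemma laplacian_vec: "laplacian u x = (\<Sum>i\<in>UNIV. pderivs [axis i 1, axis i 1] u (x :: real ^ 'n))"
proof -
  have B: "(Basis :: (real ^ 'n) set) = range (\<lambda>i. axis i 1)" by (auto simp: Basis_vec_def)
  have "inj (\<lambda>i. axis i 1 :: real ^ 'n)" by (auto simp: inj_on_def axis_eq_axis)
  then show ?thesis unfolding laplacian_def B by (simp add: sum.reindex del: pderivs.simps)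
qed

lemma axis_Basis: "axis i 1 \<in> (Basis :: (real ^ 'n) set)"
  by (auto simp: Basis_vec_def)

lemma vanishes_at_frontier_zero:
  assumes "continuous_on (closure \<Omega>) z" "\<And>x. x \<in> frontier \<Omega> \<Longrightarrow> z x = 0"
  shows "vanishes_at_frontier \<Omega> z"
  unfolding vanishes_at_frontier_def
proof
  fix x assume x: "x \<in> frontier \<Omega>"
  then have "x \<in> closure \<Omega>" by (simp add: frontier_def)
  then have "(z \<longlongrightarrow> z x) (at x within closure \<Omega>)" using assms(1) by (simp add: continuous_on_def)
  then have "(z \<longlongrightarrow> z x) (at x within \<Omega>)" by (rule tendsto_within_subset) (rule closure_subset)
  then show "(z \<longlongrightarrow> 0) (at x within \<Omega>)" using assms(2)[OF x] by simp
qed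

section \<open>One nonlinearity: solution curves and the linearised equation\<close>

locale MA_problem =
  fixes \<Omega> :: "(real ^ 'n) set" and m :: nat and \<alpha> :: real
    and a :: "(real ^ 'n) \<times> real \<times> (real ^ 'n) \<Rightarrow> real" and \<delta> :: real and V :: "(real ^ 'n \<Rightarrow> real) set"
    and \<epsilon> :: real and D :: "nat \<Rightarrow> (real ^ 'n \<Rightarrow> real) \<Rightarrow> (real ^ 'n \<Rightarrow> real) list \<Rightarrow> real ^ 'n \<Rightarrow> real"
  assumes \<Omega>: "open \<Omega>" "bounded \<Omega>" "\<Omega> \<noteq> {}" and \<alpha>: "0 < \<alpha>" "\<alpha> < 1"
    and a: "holder_on (2 * m + 1) \<alpha> (\<Omega> \<times> UNIV \<times> UNIV) a"
    and ap: "\<And>x z p p'. x \<in> closure \<Omega> \<Longrightarrow> a (x, z, p) = a (x, z, p')"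
    and a\<Phi>: "\<And>x p. x \<in> \<Omega> \<Longrightarrow> a (x, \<Phi> x, p) = 1"
    and a_mono: "\<And>x p. x \<in> \<Omega> \<Longrightarrow> deriv (\<lambda>z. a (x, z, p)) (\<Phi> x) \<ge> 0"
    and V: "V \<subseteq> holder_space (m + 2) \<alpha> \<Omega>"
    and ex1: "\<And>\<eta>. \<eta> \<in> bdry_ball (m + 2) \<alpha> \<Omega> \<delta> \<Longrightarrow> \<exists>!u. u \<in> V \<and> MA_solves \<Omega> a \<eta> u"
    and sol\<Phi>: "MA_solution \<Omega> a V (on_set (frontier \<Omega>) \<Phi>) = on_set (closure \<Omega>) \<Phi>"
    and \<epsilon>: "0 < \<epsilon>" "\<epsilon> \<le> \<delta>"
    and D: "frechet_derivs (m + 1) (bdry_space (m + 2) \<alpha> \<Omega>) (bdry_norm (m + 2) \<alpha> \<Omega>)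
          (holder_space (m + 2) \<alpha> \<Omega>) (holder_norm (m + 2) \<alpha> \<Omega>) (bdry_ball (m + 2) \<alpha> \<Omega> \<epsilon>) (MA_solution \<Omega> a V) D"
begin

abbreviation "X \<equiv> bdry_space (m + 2) \<alpha> \<Omega>"
abbreviation "NX \<equiv> bdry_norm (m + 2) \<alpha> \<Omega>"
abbreviation "Y \<equiv> holder_space (m + 2) \<alpha> \<Omega>"
abbreviation "NY \<equiv> holder_norm (m + 2) \<alpha> \<Omega>"
abbreviation "\<phi> \<equiv> on_set (frontier \<Omega>) \<Phi>"

lemma Y_linear: "f \<in> Y \<Longrightarrow> g \<in> Y \<Longrightarrow> (\<lambda>x. c * f x + d * g x) \<in> Y"
  by (rule holder_space_linear_combination[OF \<Omega>(1)])

lemma X_linear: "f \<in> X \<Longrightarrow> g \<in> X \<Longrightarrow> (\<lambda>x. c * f x + d * g x) \<in> X"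
  by (rule bdry_space_linear_combination[OF \<Omega>(1)])

lemma Y_holder: "f \<in> Y \<Longrightarrow> holder_on (m + 2) \<alpha> \<Omega> f"
  by (simp add: holder_space_def)

lemma Y_bounded_Ck: "f \<in> Y \<Longrightarrow> bounded_Ck 2 \<Omega> f"
  by (rule bounded_Ck_mono[OF holder_on_bounded_Ck[OF Y_holder]]) auto

lemma Y_cont: "f \<in> Y \<Longrightarrow> continuous_on (closure \<Omega>) f"
  by (simp add: holder_space_def holder_on_def)

lemma NX_nonneg: "f \<in> X \<Longrightarrow> 0 \<le> NX f"
  using bdry_norm_bounds(1)[OF \<Omega>(1,3)] by (auto simp: bdry_space_def)

lemma trace_X: assumes "holder_on (m + 2) \<alpha> \<Omega> g" shows "on_set (frontier \<Omega>) g \<in> X"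
proof -
  have "on_set (frontier \<Omega>) g = on_set (frontier \<Omega>) (on_set (closure \<Omega>) g)"
    by (auto simp: on_set_def frontier_def)
  then show ?thesis unfolding bdry_space_def using on_set_holder_space[OF \<Omega>(1) assms] by blast
qed

lemma \<phi>_X: "\<phi> \<in> X"
  by (rule trace_X[OF holder_on_\<Phi>]) (use \<Omega> \<alpha> in auto)

lemma line_ex:
  assumes h: "h \<in> X"
  shows "\<exists>\<rho>>0. \<forall>t. \<bar>t\<bar> < \<rho> \<longrightarrow> (\<lambda>s. \<phi> s + t * h s) \<in> bdry_ball (m + 2) \<alpha> \<Omega> \<epsilon>"
proof -
  obtain N where N: "N > 0" "\<And>\<tau>. NX (\<lambda>x. \<tau> * h x) \<le> \<bar>\<tau>\<bar> * N" using bdry_norm_cmult_bound[OF \<Omega>(1,3) h] by blast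
  show ?thesis
  proof (intro exI[of _ "\<epsilon> / N"] conjI allI impI)
    show "0 < \<epsilon> / N" using \<epsilon> N by simp
    fix t assume t: "\<bar>t\<bar> < \<epsilon> / N"
    have "(\<lambda>s. \<phi> s + t * h s) \<in> X" using X_linear[OF \<phi>_X h, of 1 t] by simp
    moreover have "\<bar>t\<bar> * N < \<epsilon>" using t N by (simp add: field_simps)
    then have "NX (\<lambda>x. t * h x) < \<epsilon>" using N(2)[of t] by linarith
    ultimately show "(\<lambda>s. \<phi> s + t * h s) \<in> bdry_ball (m + 2) \<alpha> \<Omega> \<epsilon>" by (simp add: bdry_ball_def)
  qed
qed

definition rad :: "(real ^ 'n \<Rightarrow> real) \<Rightarrow> real" where
  "rad h = (SOME \<rho>. \<rho> > 0 \<and> (\<forall>t. \<bar>t\<bar> < \<rho> \<longrightarrow> (\<lambda>s. \<phi> s + t * h s) \<in> bdry_ball (m + 2) \<alpha> \<Omega> \<epsilon>))"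

lemma rad: assumes "h \<in> X" shows "rad h > 0" "\<bar>t\<bar> < rad h \<Longrightarrow> (\<lambda>s. \<phi> s + t * h s) \<in> bdry_ball (m + 2) \<alpha> \<Omega> \<epsilon>"
  using someI_ex[OF line_ex[OF assms]] unfolding rad_def by auto

text \<open>The i-th derivative in t of the solution with boundary values \<open>\<phi> + t h\<close>.\<close>
definition E :: "(real ^ 'n \<Rightarrow> real) \<Rightarrow> nat \<Rightarrow> real \<Rightarrow> real ^ 'n \<Rightarrow> real" where
  "E h i t = D i (\<lambda>s. \<phi> s + t * h s) (replicate i h)"

lemma E_Y: "h \<in> X \<Longrightarrow> i \<le> m + 1 \<Longrightarrow> \<bar>t\<bar> < rad h \<Longrightarrow> E h i t \<in> Y"
  unfolding E_def by (rule bounded_multilinear_in[OF frechet_derivs_multilinear[OF D _ rad(2)]]) auto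

lemma E_deriv:
  assumes h: "h \<in> X" and \<Lambda>: "functional_on Y NY \<Lambda>" and i: "i < m + 1" and t: "\<bar>t\<bar> < rad h"
  shows "((\<lambda>t. \<Lambda> (E h i t)) has_real_derivative \<Lambda> (E h (Suc i) t)) (at t)"
proof -
  obtain N where N: "N > 0" "\<And>\<tau>. NX (\<lambda>x. \<tau> * h x) \<le> \<bar>\<tau>\<bar> * N" using bdry_norm_cmult_bound[OF \<Omega>(1,3) h] by blast
  show ?thesis unfolding E_def
    by (rule frechet_line_deriv[OF D Y_linear X_linear NX_nonneg h N rad(2)[OF h] \<Lambda> i t])
qed

lemma E_isCont:
  assumes h: "h \<in> X" and \<Lambda>: "functional_on Y NY \<Lambda>" and i: "i \<le> m + 1"
  shows "isCont (\<lambda>t. \<Lambda> (E h i t)) 0"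
proof (cases "i < m + 1")
  case True
  then show ?thesis using DERIV_isCont[OF E_deriv[OF h \<Lambda> True, of 0]] rad(1)[OF h] by simp
next
  case False
  then have i: "i = m + 1" using i by simp
  obtain N where N: "N > 0" "\<And>\<tau>. NX (\<lambda>x. \<tau> * h x) \<le> \<bar>\<tau>\<bar> * N" using bdry_norm_cmult_bound[OF \<Omega>(1,3) h] by blast
  show ?thesis unfolding E_def i
    by (rule frechet_line_isCont[OF D Y_linear X_linear NX_nonneg h N rad(2)[OF h] \<Lambda>]) (use rad(1)[OF h] in auto)
qed

lemma E_0: assumes h: "h \<in> X" and t: "\<bar>t\<bar> < rad h" shows "E h 0 t = MA_solution \<Omega> a V (\<lambda>s. \<phi> s + t * h s)"
  using D rad(2)[OF h t] unfolding frechet_derivs_def E_def by auto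

lemma E_00: assumes h: "h \<in> X" shows "E h 0 0 = on_set (closure \<Omega>) \<Phi>"
  using E_0[OF h, of 0] rad(1)[OF h] sol\<Phi> by simp

lemma ball_subset: "bdry_ball (m + 2) \<alpha> \<Omega> \<epsilon> \<subseteq> bdry_ball (m + 2) \<alpha> \<Omega> \<delta>"
  using \<epsilon> by (auto simp: bdry_ball_def)

lemma E_solves: assumes h: "h \<in> X" and t: "\<bar>t\<bar> < rad h"
  shows "MA_solves \<Omega> a (\<lambda>s. \<phi> s + t * h s) (E h 0 t)"
  using theI'[OF ex1[OF subsetD[OF ball_subset rad(2)[OF h t]]]] unfolding E_0[OF h t] MA_solution_def by blast

lemma E_frontier: "h \<in> X \<Longrightarrow> \<bar>t\<bar> < rad h \<Longrightarrow> x \<in> frontier \<Omega> \<Longrightarrow> E h 0 t x = \<Phi> x + t * h x"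
  using E_solves unfolding MA_solves_def by (auto simp: on_set_def)

text \<open>Evaluation at a frontier point is a bounded functional, so the boundary condition
  \<open>\<Phi> x + t * h x\<close> may be differentiated in t.\<close>

lemma E1_frontier: assumes h: "h \<in> X" and x: "x \<in> frontier \<Omega>" shows "E h 1 0 x = h x"
proof -
  have xc: "x \<in> closure \<Omega>" using x by (simp add: frontier_def)
  have "((\<lambda>t. E h 0 t x) has_real_derivative E h (Suc 0) 0 x) (at 0)"
    using E_deriv[OF h functional_on_eval_closure[OF \<Omega>(1) xc], of 0 0] rad(1)[OF h] by simp
  then have "((\<lambda>t. \<Phi> x + t * h x) has_real_derivative E h (Suc 0) 0 x) (at 0)"
    by (rule DERIV_cong_ev[THEN iffD1, rotated 3, OF _ refl _ refl])
      (use E_frontier[OF h _ x] rad(1)[OF h] in \<open>auto simp: eventually_nhds intro!: exI[of _ "{- rad h<..<rad h}"]\<close>)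
  moreover have "((\<lambda>t. \<Phi> x + t * h x) has_real_derivative h x) (at 0)" by (auto intro!: derivative_eq_intros)
  ultimately show ?thesis using DERIV_unique by fastforce
qed

abbreviation q :: "real ^ 'n \<Rightarrow> real" where "q x \<equiv> dz 1 a x (\<Phi> x) 0"

lemma q_nonneg: "x \<in> \<Omega> \<Longrightarrow> q x \<ge> 0"
  using a_mono[of x 0] dz_eq_deriv[OF a, of x 1 0] by simp

lemma functional_pderivs: "set es \<subseteq> Basis \<Longrightarrow> length es \<le> m + 2 \<Longrightarrow> x \<in> \<Omega> \<Longrightarrow> functional_on Y NY (\<lambda>f. pderivs es f x)"
  by (rule functional_on_pderivs[OF \<Omega>(1)])

text \<open>Independence of \<open>p\<close> allows the gradient slot to be filled with 0, which
  leaves a function of \<open>z\<close> alone at each \<open>x\<close>.\<close>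

lemma E_equation: assumes h: "h \<in> X" and t: "\<bar>t\<bar> < rad h" and x: "x \<in> \<Omega>"
  shows "det (hessian (E h 0 t) x) = dz 0 a x (E h 0 t x) 0"
proof -
  have "det (hessian (E h 0 t) x) = a (x, E h 0 t x, gradient (E h 0 t) x)"
    using E_solves[OF h t] x by (simp add: MA_solves_def)
  also have "\<dots> = a (x, E h 0 t x, 0)" by (rule ap[OF subsetD[OF closure_subset x]])
  finally show ?thesis by (simp add: dz_def)
qed

lemma eventually_rad: "h \<in> X \<Longrightarrow> \<forall>\<^sub>F t in at 0. \<bar>t\<bar> < rad h"
  using rad(1)[of h] by (auto simp: eventually_at dist_real_def)

lemma pderivs_background: "x \<in> \<Omega> \<Longrightarrow> pderivs es (on_set (closure \<Omega>) \<Phi>) x = pderivs es \<Phi> x"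
  by (rule pderivs_cong_open[OF \<Omega>(1)]) (use closure_subset in \<open>auto simp: on_set_def\<close>)

lemma E_tendsto:
  assumes h: "h \<in> X" and es: "set es \<subseteq> Basis" "length es \<le> m + 2" and x: "x \<in> \<Omega>"
  shows "((\<lambda>t. pderivs es (E h 0 t) x) \<longlongrightarrow> pderivs es \<Phi> x) (at 0)"
  using E_isCont[OF h functional_pderivs[OF es x], of 0] by (simp add: isCont_def E_00[OF h] pderivs_background[OF x])

lemma hessian_tendsto:
  assumes h: "h \<in> X" and x: "x \<in> \<Omega>"
  shows "((\<lambda>t. hessian (E h 0 t) x $ i $ j) \<longlongrightarrow> mat 1 $ i $ j) (at 0)"
proof -
  have "pderivs [axis i 1, axis j 1] \<Phi> x = mat 1 $ i $ j" unfolding pderivs_\<Phi>_2 by (simp add: inner_axis_axis mat_def)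
  then show ?thesis using E_tendsto[OF h _ _ x, of "[axis i 1, axis j 1]"] axis_Basis by (simp add: hessian_def del: pderivs.simps)
qed

lemma E_tendsto0: assumes h: "h \<in> X" and x: "x \<in> \<Omega>" shows "((\<lambda>t. E h 0 t x) \<longlongrightarrow> \<Phi> x) (at 0)"
  using E_tendsto[OF h _ _ x, of "[]"] by simp

lemma E_quotient:
  assumes h: "h \<in> X" and es: "set es \<subseteq> Basis" "length es \<le> m + 2" and x: "x \<in> \<Omega>"
  shows "((\<lambda>t. (pderivs es (E h 0 t) x - pderivs es \<Phi> x) / t) \<longlongrightarrow> pderivs es (E h 1 0) x) (at 0)"
  using E_deriv[OF h functional_pderivs[OF es x], of 0 0] rad(1)[OF h]
  by (simp add: DERIV_def E_00[OF h] pderivs_background[OF x])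

lemma dz0_deriv: "x \<in> \<Omega> \<Longrightarrow> ((\<lambda>z. dz 0 a x z 0) has_real_derivative dz 1 a x z 0) (at z)"
  using dz_deriv[OF a, of 0 x 0 z] by simp

lemma linearized_equation:
  assumes h: "h \<in> X" and x: "x \<in> \<Omega>" shows "laplacian (E h 1 0) x = q x * E h 1 0 x"
proof -
  have "(\<Sum>i\<in>UNIV. pderivs [axis i 1, axis i 1] (E h 1 0) x) = q x * E h 1 0 x + 0"
  \<comment> \<open>The second solution is the background itself, with constant Hessian
    \<open>mat 1\<close> and right-hand side 1.\<close>
  proof (rule MA_difference_limit[where ?H1.0 = "\<lambda>t. hessian (E h 0 t) x" and ?H2.0 = "\<lambda>t. mat 1" and ?a2.0 = "\<lambda>z. 1"
        and ?a1.0 = "\<lambda>z. dz 0 a x z 0" and ?z1.0 = "\<lambda>t. E h 0 t x" and ?z2.0 = "\<lambda>t. \<Phi> x" and ?z0.0 = "\<Phi> x" and l = 1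
        and E = "\<lambda>i j. pderivs [axis i 1, axis j 1] (E h 1 0) x" and ?a1' = "\<lambda>z. dz 1 a x z 0"])
    show "\<forall>\<^sub>F t in at 0. det (hessian (E h 0 t) x) = dz 0 a x (E h 0 t x) 0"
      using eventually_rad[OF h] by eventually_elim (rule E_equation[OF h _ x])
    show "((\<lambda>t. hessian (E h 0 t) x $ i $ j) \<longlongrightarrow> mat 1 $ i $ j) (at 0)" for i j by (rule hessian_tendsto[OF h x])
    show "((\<lambda>t. (hessian (E h 0 t) x $ i $ j - mat 1 $ i $ j) / t ^ 1) \<longlongrightarrow> pderivs [axis i 1, axis j 1] (E h 1 0) x) (at 0)" for i j
    proof -
      have "pderivs [axis i 1, axis j 1] \<Phi> x = mat 1 $ i $ j" unfolding pderivs_\<Phi>_2 by (simp add: inner_axis_axis mat_def)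
      then show ?thesis using E_quotient[OF h _ _ x, of "[axis i 1, axis j 1]"] axis_Basis by (simp add: hessian_def del: pderivs.simps)
    qed
    show "((\<lambda>t. (E h 0 t x - \<Phi> x) / t ^ 1) \<longlongrightarrow> E h 1 0 x) (at 0)" using E_quotient[OF h _ _ x, of "[]"] by simp
    show "((\<lambda>t. (dz 0 a x (\<Phi> x) 0 - 1) / t ^ 1) \<longlongrightarrow> 0) (at 0)" using a\<Phi>[OF x] by (simp add: dz_def)
    show "isCont (\<lambda>z. dz 1 a x z 0) (\<Phi> x)" by (rule dz_isCont[OF \<Omega>(1) a _ x]) simp
    show "((\<lambda>z. dz 0 a x z 0) has_real_derivative dz 1 a x z 0) (at z)" for z by (rule dz0_deriv[OF x])
  qed (auto intro: E_tendsto0[OF h x])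
  then show ?thesis by (simp add: laplacian_vec del: pderivs.simps)
qed

text \<open>The solutions of the linearised equation that arise from boundary data in
  \<open>X\<close>: their existence is inherited from the differentiability of the solution
  map.\<close>

definition Sol :: "(real ^ 'n \<Rightarrow> real) set" where "Sol = (\<lambda>h. E h 1 0) ` X"

lemma E1: "E h 1 0 = D 1 \<phi> [h]" by (simp add: E_def)

lemma Sol_Y: "w \<in> Sol \<Longrightarrow> w \<in> Y"
  unfolding Sol_def using E_Y[of _ 1 0] rad(1) by auto

lemma Sol_bcont: "w \<in> Sol \<Longrightarrow> bcont \<Omega> w"
  by (rule bounded_Ck_bcont0[OF Y_bounded_Ck[OF Sol_Y]])

text \<open>Comes from the linearity of the first Frechet derivative at \<open>\<phi>\<close> in its
  direction.\<close>

lemma Sol_linear: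
  assumes "w1 \<in> Sol" "w2 \<in> Sol" shows "(\<lambda>x. c * w1 x + d * w2 x) \<in> Sol"
proof -
  obtain h1 h2 where h: "h1 \<in> X" "w1 = E h1 1 0" "h2 \<in> X" "w2 = E h2 1 0" using assms by (auto simp: Sol_def)
  have \<phi>: "\<phi> \<in> bdry_ball (m + 2) \<alpha> \<Omega> \<epsilon>" using rad(2)[OF h(1), of 0] rad(1)[OF h(1)] by simp
  have "D 1 \<phi> ([h1][0 := \<lambda>x. c * h1 x + d * h2 x]) = (\<lambda>y. c * D 1 \<phi> ([h1][0 := h1]) y + d * D 1 \<phi> ([h1][0 := h2]) y)"
    by (rule bounded_multilinear_update[OF frechet_derivs_multilinear[OF D _ \<phi>, of 1]]) (use h in auto)
  then have "E (\<lambda>x. c * h1 x + d * h2 x) 1 0 = (\<lambda>x. c * w1 x + d * w2 x)" unfolding h(2,4) E1 by simp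
  then show ?thesis unfolding Sol_def by (rule image_eqI[OF sym X_linear[OF h(1,3)]])
qed

lemma q_extension: obtains F where "continuous_on (closure \<Omega>) F" "\<And>x. x \<in> \<Omega> \<Longrightarrow> F x = q x"
  using dz_extension[OF a, of 1] by auto

lemma q_bcont: "bcont \<Omega> q"
proof -
  obtain F where F: "continuous_on (closure \<Omega>) F" "\<And>x. x \<in> \<Omega> \<Longrightarrow> F x = q x" using q_extension by blast
  have "bcont \<Omega> F" by (rule bcont_compact[OF _ F(1) closure_subset]) (use \<Omega> in auto)
  then show ?thesis using bcont_cong[of \<Omega> F q] F(2) by simp
qed

text \<open>Take \<open>w\<close> with the boundary values of the given function: the difference
  vanishes at the frontier and has the same residual, which the energy estimate converts into an
  \<open>L\<^sup>2\<close> distance.\<close>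

lemma Sol_approximation:
  assumes C: "\<And>u q. bounded_Ck 2 \<Omega> u \<Longrightarrow> vanishes_at_frontier \<Omega> u \<Longrightarrow> bcont \<Omega> q \<Longrightarrow> (\<And>x. x \<in> \<Omega> \<Longrightarrow> 0 \<le> q x) \<Longrightarrow>
      lint \<Omega> (\<lambda>x. (u x)\<^sup>2) \<le> C * lint \<Omega> (\<lambda>x. (laplacian u x - q x * u x)\<^sup>2)"
  shows "\<exists>w\<in>Sol. lint \<Omega> (\<lambda>x. (exp_trig_sum K c b x - w x)\<^sup>2) \<le> C * lint \<Omega> (\<lambda>x. (laplacian (exp_trig_sum K c b) x - q x * exp_trig_sum K c b x)\<^sup>2)"
proof -
  define g where "g = exp_trig_sum K c b"
  have gh: "holder_on (m + 2) \<alpha> \<Omega> g" unfolding g_def by (rule holder_on_exp_trig_sum) (use \<Omega> \<alpha> in auto)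
  define h where "h = on_set (frontier \<Omega>) g"
  have h: "h \<in> X" unfolding h_def by (rule trace_X[OF gh])
  define w where "w = E h 1 0"
  have w: "w \<in> Sol" using h by (auto simp: w_def Sol_def)
  have g2: "bounded_Ck 2 \<Omega> g" unfolding g_def by (rule bounded_Ck_exp_trig_sum[OF \<Omega>(2)])
  note w2 = Y_bounded_Ck[OF Sol_Y[OF w]]
  define z where "z = (\<lambda>x. 1 * g x + (- 1) * w x)"
  have z2: "bounded_Ck 2 \<Omega> z" unfolding z_def by (rule bounded_Ck_linear_combination[OF \<Omega>(1) g2 w2])
  have "vanishes_at_frontier \<Omega> z"
  proof (rule vanishes_at_frontier_zero)
    show "continuous_on (closure \<Omega>) z" unfolding z_def g_def by (intro continuous_intros continuous_on_exp_trig_sum Y_cont[OF Sol_Y[OF w]])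
    show "z x = 0" if "x \<in> frontier \<Omega>" for x using E1_frontier[OF h that] that by (simp add: z_def w_def h_def on_set_def)
  qed
  from C[OF z2 this q_bcont q_nonneg]
  have "lint \<Omega> (\<lambda>x. (z x)\<^sup>2) \<le> C * lint \<Omega> (\<lambda>x. (laplacian z x - q x * z x)\<^sup>2)" .
  also have "lint \<Omega> (\<lambda>x. (laplacian z x - q x * z x)\<^sup>2) = lint \<Omega> (\<lambda>x. (laplacian g x - q x * g x)\<^sup>2)"
  proof (rule lint_cong)
    fix x assume x: "x \<in> \<Omega>"
    have "laplacian z x = 1 * laplacian g x + (- 1) * laplacian w x" unfolding z_def by (rule laplacian_linear_combination[OF \<Omega>(1) g2 w2 x])
    then show "(laplacian z x - q x * z x)\<^sup>2 = (laplacian g x - q x * g x)\<^sup>2"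
      using linearized_equation[OF h x] by (simp add: z_def w_def algebra_simps)
  qed
  finally show ?thesis using w by (intro bexI[of _ w]) (auto simp: z_def g_def)
qed

end

section \<open>Two nonlinearities with the same Cauchy data\<close>

locale MA_pair = A: MA_problem \<Omega> m \<alpha> a1 \<delta>1 V1 \<epsilon>1 D1 + B: MA_problem \<Omega> m \<alpha> a2 \<delta>2 V2 \<epsilon>2 D2
  for \<Omega> :: "(real ^ 'n) set" and m \<alpha> a1 \<delta>1 V1 \<epsilon>1 D1 a2 \<delta>2 V2 \<epsilon>2 D2 +
  assumes n3: "CARD('n) \<ge> 3" and bd: "holder_boundary (m + 2) \<alpha> \<Omega>"
    and cauchy: "cauchy_data m \<alpha> \<Omega> a1 \<delta>1 V1 = cauchy_data m \<alpha> \<Omega> a2 \<delta>2 V2"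
begin

lemmas \<Omega> = A.\<Omega>

definition r :: "(real ^ 'n \<Rightarrow> real) \<Rightarrow> real" where "r h = min (A.rad h) (B.rad h)"

lemma r: "h \<in> A.X \<Longrightarrow> r h > 0" "\<bar>t\<bar> < r h \<Longrightarrow> \<bar>t\<bar> < A.rad h" "\<bar>t\<bar> < r h \<Longrightarrow> \<bar>t\<bar> < B.rad h"
  using A.rad(1) B.rad(1) by (auto simp: r_def)

definition d :: "(real ^ 'n \<Rightarrow> real) \<Rightarrow> nat \<Rightarrow> real ^ 'n \<Rightarrow> real" where
  "d h i = (\<lambda>x. 1 * A.E h i 0 x + (- 1) * B.E h i 0 x)"

lemma d_Y: "h \<in> A.X \<Longrightarrow> i \<le> m + 1 \<Longrightarrow> d h i \<in> A.Y"
  unfolding d_def using A.rad(1)[of h] B.rad(1)[of h] by (intro A.Y_linear A.E_Y B.E_Y) auto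

lemma functional_d: "functional_on A.Y A.NY \<Lambda> \<Longrightarrow> h \<in> A.X \<Longrightarrow> i \<le> m + 1 \<Longrightarrow> \<Lambda> (d h i) = \<Lambda> (A.E h i 0) - \<Lambda> (B.E h i 0)"
  unfolding d_def using A.rad(1)[of h] B.rad(1)[of h]
  by (subst functional_on_linear[where \<Lambda> = \<Lambda>, OF _ A.E_Y B.E_Y]) auto

lemma difference_deriv:
  assumes "h \<in> A.X" "functional_on A.Y A.NY \<Lambda>" "i < m + 1" "\<bar>t\<bar> < r h"
  shows "((\<lambda>t. \<Lambda> (A.E h i t) - \<Lambda> (B.E h i t)) has_real_derivative \<Lambda> (A.E h (Suc i) t) - \<Lambda> (B.E h (Suc i) t)) (at t)"
  using assms r by (intro DERIV_diff A.E_deriv B.E_deriv) auto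

text \<open>Transfers an identity between the two solution curves, valid for all small t, to every
  t-derivative at 0.\<close>

lemma functional_d_zero:
  assumes h: "h \<in> A.X" and \<Lambda>: "functional_on A.Y A.NY \<Lambda>" and i: "i \<le> m + 1"
    and 0: "\<And>t. \<bar>t\<bar> < r h \<Longrightarrow> \<Lambda> (A.E h 0 t) = \<Lambda> (B.E h 0 t)"
  shows "\<Lambda> (d h i) = 0"
  using derivs_zero[of "r h" "m + 1" "\<lambda>i t. \<Lambda> (A.E h i t) - \<Lambda> (B.E h i t)" i 0] difference_deriv[OF h \<Lambda>] r(1)[OF h] 0 i
  by (simp add: functional_d[OF \<Lambda> h i])

lemma d_frontier: assumes h: "h \<in> A.X" and i: "i \<le> m + 1" and x: "x \<in> frontier \<Omega>" shows "d h i x = 0"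
proof (rule functional_d_zero[OF h _ i, of "\<lambda>f. f x"])
  show "functional_on A.Y A.NY (\<lambda>f. f x)" by (rule functional_on_eval_closure[OF \<Omega>(1)]) (use x in \<open>simp add: frontier_def\<close>)
  show "A.E h 0 t x = B.E h 0 t x" if "\<bar>t\<bar> < r h" for t using A.E_frontier[OF h _ x] B.E_frontier[OF h _ x] r(2,3)[OF that] by simp
qed

text \<open>A Cauchy data set is a graph over the boundary value, so equality of the sets forces
  equal normal derivatives for the same \<open>\<eta>\<close>.\<close>

lemma normal_derivatives_agree:
  assumes h: "h \<in> A.X" and t: "\<bar>t\<bar> < r h"
  shows "normal_deriv \<Omega> (A.E h 0 t) = normal_deriv \<Omega> (B.E h 0 t)"
proof -
  define \<eta> where "\<eta> = (\<lambda>s. A.\<phi> s + t * h s)"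
  have "\<eta> \<in> bdry_ball (m + 2) \<alpha> \<Omega> \<delta>1" unfolding \<eta>_def by (rule subsetD[OF A.ball_subset A.rad(2)[OF h r(2)[OF t]]])
  then have "(\<eta>, normal_deriv \<Omega> (MA_solution \<Omega> a1 V1 \<eta>)) \<in> cauchy_data m \<alpha> \<Omega> a1 \<delta>1 V1"
    unfolding cauchy_data_def by (rule imageI)
  then have "(\<eta>, normal_deriv \<Omega> (MA_solution \<Omega> a1 V1 \<eta>)) \<in> cauchy_data m \<alpha> \<Omega> a2 \<delta>2 V2"
    by (simp only: cauchy)
  then have "normal_deriv \<Omega> (MA_solution \<Omega> a1 V1 \<eta>) = normal_deriv \<Omega> (MA_solution \<Omega> a2 V2 \<eta>)"
    unfolding cauchy_data_def by auto
  then show ?thesis using A.E_0[OF h r(2)[OF t]] B.E_0[OF h r(3)[OF t]] by (simp add: \<eta>_def)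
qed

text \<open>The full gradients of the two solutions agree at the frontier for every small t: normal
  parts by the Cauchy data, tangential parts by the common boundary values. Differentiation in t
  then passes through the bounded functional \<open>Lim\<close>.\<close>

lemma d_gradient_frontier:
  assumes h: "h \<in> A.X" and i: "i \<le> m + 1" and b: "b \<in> Basis" shows "vanishes_at_frontier \<Omega> (pderivs [b] (d h i))"
  unfolding vanishes_at_frontier_def
proof
  fix x assume x: "x \<in> frontier \<Omega>"
  have \<Lambda>: "functional_on A.Y A.NY (\<lambda>f. Lim (at x within \<Omega>) (pderivs [b] f))" if "b \<in> Basis" for b
    by (rule functional_on_boundary_limit[OF \<Omega>(1) _ _ x]) (use that in auto)
  have "Lim (at x within \<Omega>) (pderivs [b] (d h i)) = 0"
  proof (rule functional_d_zero[OF h \<Lambda>[OF b] i])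
    fix t assume t: "\<bar>t\<bar> < r h"
    note AY = A.E_Y[OF h _ r(2)[OF t], of 0] and BY = B.E_Y[OF h _ r(3)[OF t], of 0]
    define f where "f = (\<lambda>y. 1 * A.E h 0 t y + (- 1) * B.E h 0 t y)"
    have fY: "f \<in> A.Y" unfolding f_def by (rule A.Y_linear[OF AY BY]) auto
    have Lf: "Lim (at x within \<Omega>) (pderivs [b] f) = Lim (at x within \<Omega>) (pderivs [b] (A.E h 0 t)) - Lim (at x within \<Omega>) (pderivs [b] (B.E h 0 t))" if "b \<in> Basis" for b
      unfolding f_def using functional_on_linear[OF \<Lambda>[OF that] AY BY, of 1 "- 1"] by simp
    have nd: "(\<Sum>b\<in>Basis. (ext_normal \<Omega> x \<bullet> b) * Lim (at x within \<Omega>) (pderivs [b] (A.E h 0 t))) = (\<Sum>b\<in>Basis. (ext_normal \<Omega> x \<bullet> b) * Lim (at x within \<Omega>) (pderivs [b] (B.E h 0 t)))"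
      using fun_cong[OF normal_derivatives_agree[OF h t], of x] x by (simp add: normal_deriv_def on_set_def del: pderivs.simps)
    have "Lim (at x within \<Omega>) (pderivs [b] f) = 0"
    proof (rule gradient_vanishes_at_frontier[OF \<Omega>(1), of "Suc m" \<alpha> "Suc m" \<alpha> f x b])
      show "holder_boundary (Suc (Suc m)) \<alpha> \<Omega>" using bd by simp
      show "holder_on (Suc (Suc m)) \<alpha> \<Omega> f" using A.Y_holder[OF fY] by simp
      show "f y = 0" if y: "y \<in> frontier \<Omega>" for y
        using A.E_frontier[OF h r(2)[OF t] y] B.E_frontier[OF h r(3)[OF t] y] by (simp add: f_def)
      have "(\<Sum>b\<in>Basis. (ext_normal \<Omega> x \<bullet> b) * Lim (at x within \<Omega>) (pderivs [b] f)) =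
        (\<Sum>b\<in>Basis. (ext_normal \<Omega> x \<bullet> b) * Lim (at x within \<Omega>) (pderivs [b] (A.E h 0 t)) - (ext_normal \<Omega> x \<bullet> b) * Lim (at x within \<Omega>) (pderivs [b] (B.E h 0 t)))"
        by (intro sum.cong refl) (simp only: Lf right_diff_distrib)
      then show "(\<Sum>b\<in>Basis. (ext_normal \<Omega> x \<bullet> b) * Lim (at x within \<Omega>) (pderivs [b] f)) = 0"
        by (simp only: sum_subtractf nd diff_self)
    qed (use x b in auto)
    then show "Lim (at x within \<Omega>) (pderivs [b] (A.E h 0 t)) = Lim (at x within \<Omega>) (pderivs [b] (B.E h 0 t))" using Lf[OF b] by simp
  qed
  then show "(pderivs [b] (d h i) \<longlongrightarrow> 0) (at x within \<Omega>)"
    using holder_boundary_limit[OF A.Y_holder[OF d_Y[OF h i]] _ _ \<Omega>(1) x, of "[b]"] b by simp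
qed

lemma d_0: "h \<in> A.X \<Longrightarrow> d h 0 x = 0"
  by (simp add: d_def A.E_00 B.E_00)

text \<open>Taylor's formula in t for the scalar difference of the derivatives
  \<open>pderivs es\<close> at \<open>x\<close>. Its lower coefficients vanish because
  \<open>d h i\<close> is zero on an open set, and so are its spatial derivatives.\<close>

lemma difference_quotient_limit:
  assumes h: "h \<in> A.X" and es: "set es \<subseteq> Basis" "length es \<le> m + 2" and x: "x \<in> \<Omega>" and l: "l \<le> m + 1"
    and 0: "\<And>i y. i < l \<Longrightarrow> y \<in> \<Omega> \<Longrightarrow> d h i y = 0"
  shows "((\<lambda>t. (pderivs es (A.E h 0 t) x - pderivs es (B.E h 0 t) x) / t ^ l) \<longlongrightarrow> pderivs es (d h l) x / fact l) (at 0)"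
proof -
  note \<Lambda> = A.functional_pderivs[OF es x]
  define G where "G = (\<lambda>i t. pderivs es (A.E h i t) x - pderivs es (B.E h i t) x)"
  have Gd: "G i 0 = pderivs es (d h i) x" if "i \<le> m + 1" for i using functional_d[OF \<Lambda> h that] by (simp add: G_def)
  have "((\<lambda>t. G 0 t / t ^ l) \<longlongrightarrow> G l 0 / fact l) (at 0)"
  proof (rule Taylor_limit[OF r(1)[OF h]])
    show "(G i has_real_derivative G (Suc i) t) (at t)" if "i < l" "\<bar>t\<bar> < r h" for i t
      unfolding G_def using difference_deriv[OF h \<Lambda> _ that(2), of i] that l by simp
    show "G i 0 = 0" if i: "i < l" for i
    proof -
      have Y: "d h i \<in> A.Y" using d_Y[OF h] i l by simp
      \<comment> \<open>The zero function is written as a trivial linear combination, so that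
        linearity of the functional evaluates it.\<close>
      have "pderivs es (d h i) x = pderivs es (\<lambda>y. 0 * d h i y + 0 * d h i y) x"
        by (rule pderivs_cong_open[OF \<Omega>(1) _ x]) (simp add: 0[OF i])
      also have "\<dots> = 0" using functional_on_linear[OF \<Lambda> Y Y, of 0 0] by simp
      finally show ?thesis using Gd i l by simp
    qed
    show "isCont (G l) 0" unfolding G_def by (intro continuous_diff A.E_isCont[OF h \<Lambda> l] B.E_isCont[OF h \<Lambda> l])
  qed
  then show ?thesis using Gd[OF l] by (simp add: G_def)
qed

text \<open>Serves twice: for \<open>l < k\<close> the equation is homogeneous and leads to
  \<open>d h l = 0\<close>; at \<open>l = k\<close> its source carries the mismatch of the k-th
  coefficients.\<close>

lemma difference_equation:
  assumes h: "h \<in> A.X" and x: "x \<in> \<Omega>" and lk: "1 \<le> l" "l \<le> k" "k \<le> m + 1"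
    and 0: "\<And>i y. i < l \<Longrightarrow> y \<in> \<Omega> \<Longrightarrow> d h i y = 0"
    and eq: "\<And>i. i < k \<Longrightarrow> dz i a1 x (\<Phi> x) 0 = dz i a2 x (\<Phi> x) 0"
  shows "laplacian (d h l) x = A.q x * d h l x +
    (if l = k then (dz k a1 x (\<Phi> x) 0 - dz k a2 x (\<Phi> x) 0) * B.E h 1 0 x ^ k else 0)"
proof -
  define B where "B = (\<lambda>i z. dz i a1 x z 0 - dz i a2 x z 0)"
  define v where "v = B.E h 1 0 x"
  \<comment> \<open>The mismatch of the nonlinearities along the second solution is of order
    \<open>t ^ k\<close>; divided by \<open>t ^ l\<close> it survives only for
    \<open>l = k\<close>.\<close>
  define L where "L = (if l = k then B k (\<Phi> x) / fact k * v ^ k else 0)"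
  have "((\<lambda>t. B 0 (B.E h 0 t x) / t ^ k) \<longlongrightarrow> B k (\<Phi> x) / fact k * v ^ k) (at 0)"
  proof (rule Taylor_limit_compose[where B = B and k = k and ?z0.0 = "\<Phi> x" and u = "\<lambda>t. B.E h 0 t x" and v = v, OF zero_less_one])
    show "(B i has_real_derivative B (Suc i) z) (at z)" if "i < k" for i z
      unfolding B_def by (intro DERIV_diff dz_deriv[OF A.a _ x] dz_deriv[OF B.a _ x]) (use that lk in auto)
    show "B i (\<Phi> x) = 0" if "i < k" for i using eq[OF that] by (simp add: B_def)
    show "isCont (B k) (\<Phi> x)" unfolding B_def
      by (intro continuous_diff dz_isCont[OF \<Omega>(1) A.a _ x] dz_isCont[OF \<Omega>(1) B.a _ x]) (use lk in auto)
    show "((\<lambda>t. (B.E h 0 t x - \<Phi> x) / t) \<longlongrightarrow> v) (at 0)" using B.E_quotient[OF h _ _ x, of "[]"] by (simp add: v_def)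
  qed
  note lim = this
  have L: "((\<lambda>t. (dz 0 a1 x (B.E h 0 t x) 0 - dz 0 a2 x (B.E h 0 t x) 0) / t ^ l) \<longlongrightarrow> L) (at 0)"
  proof (cases "l = k")
    case True
    then show ?thesis using lim by (simp add: L_def B_def)
  next
    case False
    then obtain j where j: "k = l + Suc j" using lk by (metis add_Suc_right le_neq_implies_less less_imp_Suc_add)
    have "((\<lambda>t. B 0 (B.E h 0 t x) / t ^ k * t ^ Suc j) \<longlongrightarrow> B k (\<Phi> x) / fact k * v ^ k * 0 ^ Suc j) (at 0)"
      by (intro tendsto_intros lim)
    moreover have "\<forall>\<^sub>F t in at 0. B 0 (B.E h 0 t x) / t ^ k * t ^ Suc j = B 0 (B.E h 0 t x) / t ^ l"
      unfolding eventually_at_filter by (rule always_eventually) (simp add: j power_add)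
    ultimately have "((\<lambda>t. B 0 (B.E h 0 t x) / t ^ l) \<longlongrightarrow> B k (\<Phi> x) / fact k * v ^ k * 0 ^ Suc j) (at 0)"
      by (rule Lim_transform_eventually)
    then show ?thesis using False by (simp add: L_def B_def)
  qed
  have "(\<Sum>i\<in>UNIV. pderivs [axis i 1, axis i 1] (d h l) x / fact l) = A.q x * (d h l x / fact l) + L"
  proof (rule MA_difference_limit[where ?H1.0 = "\<lambda>t. hessian (A.E h 0 t) x" and ?H2.0 = "\<lambda>t. hessian (B.E h 0 t) x" and ?a2.0 = "\<lambda>z. dz 0 a2 x z 0"
        and ?a1.0 = "\<lambda>z. dz 0 a1 x z 0" and ?z1.0 = "\<lambda>t. A.E h 0 t x" and ?z2.0 = "\<lambda>t. B.E h 0 t x" and ?z0.0 = "\<Phi> x" and l = l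
        and E = "\<lambda>i j. pderivs [axis i 1, axis j 1] (d h l) x / fact l" and ?a1' = "\<lambda>z. dz 1 a1 x z 0"])
    show "\<forall>\<^sub>F t in at 0. det (hessian (A.E h 0 t) x) = dz 0 a1 x (A.E h 0 t x) 0"
      using A.eventually_rad[OF h] by eventually_elim (rule A.E_equation[OF h _ x])
    show "\<forall>\<^sub>F t in at 0. det (hessian (B.E h 0 t) x) = dz 0 a2 x (B.E h 0 t x) 0"
      using B.eventually_rad[OF h] by eventually_elim (rule B.E_equation[OF h _ x])
    show "((\<lambda>t. (hessian (A.E h 0 t) x $ i $ j - hessian (B.E h 0 t) x $ i $ j) / t ^ l) \<longlongrightarrow> pderivs [axis i 1, axis j 1] (d h l) x / fact l) (at 0)" for i j
      using difference_quotient_limit[OF h _ _ x _ 0, of "[axis i 1, axis j 1]" l] axis_Basis lk by (simp add: hessian_def del: pderivs.simps)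
    show "((\<lambda>t. (A.E h 0 t x - B.E h 0 t x) / t ^ l) \<longlongrightarrow> d h l x / fact l) (at 0)"
      using difference_quotient_limit[OF h _ _ x _ 0, of "[]" l] lk by simp
    show "isCont (\<lambda>z. dz 1 a1 x z 0) (\<Phi> x)" by (rule dz_isCont[OF \<Omega>(1) A.a _ x]) simp
    show "((\<lambda>z. dz 0 a1 x z 0) has_real_derivative dz 1 a1 x z 0) (at z)" for z by (rule A.dz0_deriv[OF x])
  qed (auto intro: A.E_tendsto0[OF h x] B.E_tendsto0[OF h x] A.hessian_tendsto[OF h x] B.hessian_tendsto[OF h x] L)
  then have "laplacian (d h l) x / fact l = A.q x * (d h l x / fact l) + L"
    by (simp add: laplacian_vec sum_divide_distrib del: pderivs.simps)
  then have "laplacian (d h l) x = A.q x * d h l x + L * fact l" by (simp add: field_simps)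
  then show ?thesis by (auto simp: L_def B_def v_def)
qed

text \<open>Uniqueness for the linearised Dirichlet problem: the energy estimate is applied with
  zero residual, at each order in turn.\<close>

lemma d_zero:
  assumes h: "h \<in> A.X" and k: "k \<le> m + 1" and eq: "\<And>i x. i < k \<Longrightarrow> x \<in> \<Omega> \<Longrightarrow> dz i a1 x (\<Phi> x) 0 = dz i a2 x (\<Phi> x) 0"
  shows "l < k \<Longrightarrow> x \<in> \<Omega> \<Longrightarrow> d h l x = 0"
proof (induction l arbitrary: x rule: less_induct)
  case (less l)
  show ?case
  proof (cases "l = 0")
    case False
    have pde: "laplacian (d h l) y = A.q y * d h l y" if "y \<in> \<Omega>" for y
      using difference_equation[OF h that, of l k] False less k eq that by auto
    have Y: "d h l \<in> A.Y" using d_Y[OF h] less k by simp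
    obtain C where C: "0 < C"
      "\<And>u q. bounded_Ck 2 \<Omega> u \<Longrightarrow> vanishes_at_frontier \<Omega> u \<Longrightarrow> bcont \<Omega> q \<Longrightarrow> (\<And>x. x \<in> \<Omega> \<Longrightarrow> 0 \<le> q x) \<Longrightarrow>
      lint \<Omega> (\<lambda>x. (u x)\<^sup>2) \<le> C * lint \<Omega> (\<lambda>x. (laplacian u x - q x * u x)\<^sup>2)" using energy_estimate[OF \<Omega>(1,2)] by blast
    have "vanishes_at_frontier \<Omega> (d h l)"
      by (rule vanishes_at_frontier_zero[OF A.Y_cont[OF Y]]) (use d_frontier[OF h] less k in auto)
    from C(2)[OF A.Y_bounded_Ck[OF Y] this A.q_bcont A.q_nonneg]
    have "lint \<Omega> (\<lambda>x. (d h l x)\<^sup>2) \<le> C * lint \<Omega> (\<lambda>x. (laplacian (d h l) x - A.q x * d h l x)\<^sup>2)" .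
    also have "lint \<Omega> (\<lambda>x. (laplacian (d h l) x - A.q x * d h l x)\<^sup>2) = lint \<Omega> (\<lambda>x. 0)"
      by (rule lint_cong) (simp add: pde)
    finally have "lint \<Omega> (\<lambda>x. (d h l x)\<^sup>2) \<le> 0" by simp
    moreover have "lint \<Omega> (\<lambda>x. (d h l x)\<^sup>2) \<ge> 0" by (rule lint_nonneg) simp
    ultimately have "lint \<Omega> (\<lambda>x. (d h l x)\<^sup>2) = 0" by simp
    then show ?thesis using lint_square_eq_0[OF \<Omega>(1,2) bounded_Ck_bcont0[OF A.Y_bounded_Ck[OF Y]]] less by blast
  qed (use d_0[OF h] in simp)
qed

text \<open>Green's identity tested with \<open>v\<close>: the terms with \<open>A.q\<close> cancel
  because \<open>v\<close> solves the linearised equation of the first nonlinearity, and the source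
  remains. The factor \<open>w\<close> belongs to the second one, since the mismatch is expanded
  along its solution.\<close>

lemma integral_identity:
  assumes k: "1 \<le> k" "k \<le> m + 1" and eq: "\<And>i x. i < k \<Longrightarrow> x \<in> \<Omega> \<Longrightarrow> dz i a1 x (\<Phi> x) 0 = dz i a2 x (\<Phi> x) 0"
    and F: "bcont \<Omega> F" "\<And>x. x \<in> \<Omega> \<Longrightarrow> F x = dz k a1 x (\<Phi> x) 0 - dz k a2 x (\<Phi> x) 0"
    and w: "w \<in> B.Sol" and v: "v \<in> A.Sol"
  shows "lint \<Omega> (\<lambda>x. F x * (w x ^ k * v x)) = 0"
proof -
  have S: "bounded_borel \<Omega>" using \<Omega> by (simp add: bounded_borel_def)
  obtain h where h: "h \<in> A.X" "w = B.E h 1 0" using w by (auto simp: B.Sol_def)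
  obtain g where g: "g \<in> A.X" "v = A.E g 1 0" using v by (auto simp: A.Sol_def)
  define u where "u = d h k"
  have uY: "u \<in> A.Y" unfolding u_def by (rule d_Y[OF h(1) k(2)])
  have Lu: "laplacian u x = A.q x * u x + F x * w x ^ k" if x: "x \<in> \<Omega>" for x
    unfolding u_def using difference_equation[OF h(1) x k(1) order_refl k(2) d_zero[OF h(1) k(2) eq] eq] x
    by (simp add: F(2)[OF x] h(2))
  have Lv: "laplacian v x = A.q x * v x" if "x \<in> \<Omega>" for x using A.linearized_equation[OF g(1) that] by (simp add: g(2))
  have "lint \<Omega> (\<lambda>x. v x * laplacian u x) = lint \<Omega> (\<lambda>x. u x * laplacian v x)"
  proof (rule Green_identity_vanishing_Cauchy_data[OF \<Omega>(1,2) A.Y_bounded_Ck[OF uY] A.Y_bounded_Ck[OF A.Sol_Y[OF v]]])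
    show "vanishes_at_frontier \<Omega> u"
      by (rule vanishes_at_frontier_zero[OF A.Y_cont[OF uY]]) (use d_frontier[OF h(1) k(2)] in \<open>auto simp: u_def\<close>)
    show "vanishes_at_frontier \<Omega> (pderivs [b] u)" if "b \<in> Basis" for b
      unfolding u_def by (rule d_gradient_frontier[OF h(1) k(2) that])
  qed
  moreover have "lint \<Omega> (\<lambda>x. v x * laplacian u x) = lint \<Omega> (\<lambda>x. v x * (A.q x * u x) + F x * (w x ^ k * v x))"
    by (rule lint_cong) (simp add: Lu algebra_simps)
  moreover have "lint \<Omega> (\<lambda>x. u x * laplacian v x) = lint \<Omega> (\<lambda>x. v x * (A.q x * u x))"
    by (rule lint_cong) (simp add: Lv algebra_simps)
  moreover have "lint \<Omega> (\<lambda>x. v x * (A.q x * u x) + F x * (w x ^ k * v x)) = lint \<Omega> (\<lambda>x. v x * (A.q x * u x)) + lint \<Omega> (\<lambda>x. F x * (w x ^ k * v x))"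
    by (intro lint_add S bcont_mult bcont_power F(1) A.q_bcont A.Sol_bcont[OF v] B.Sol_bcont[OF w] bounded_Ck_bcont0[OF A.Y_bounded_Ck[OF uY]])
  ultimately show ?thesis by simp
qed

text \<open>Insert \<open>s * w + w0\<close>: the integral is a polynomial in \<open>s\<close> that
  vanishes identically, and its coefficient of \<open>s\<close> is \<open>k\<close> times the
  claimed integral.\<close>

lemma polarized_identity:
  assumes k: "1 \<le> k" and bF: "bcont \<Omega> F" and id: "\<And>w v. w \<in> B.Sol \<Longrightarrow> v \<in> A.Sol \<Longrightarrow> lint \<Omega> (\<lambda>x. F x * (w x ^ k * v x)) = 0"
    and w: "w0 \<in> B.Sol" "w \<in> B.Sol" and v: "v \<in> A.Sol"
  shows "lint \<Omega> (\<lambda>x. (F x * w0 x ^ (k - 1)) * (w x * v x)) = 0"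
proof -
  have S: "bounded_borel \<Omega>" using \<Omega> by (simp add: bounded_borel_def)
  note bi = bF B.Sol_bcont[OF w(1)] B.Sol_bcont[OF w(2)] A.Sol_bcont[OF v] bcont_intros
  define c where "c = (\<lambda>i. of_nat (k choose i) * lint \<Omega> (\<lambda>x. F x * (w x ^ i * w0 x ^ (k - i) * v x)))"
  have "(\<Sum>i\<le>k. c i * s ^ i) = 0" for s
  proof -
    have "(\<lambda>x. s * w x + 1 * w0 x) \<in> B.Sol" by (rule B.Sol_linear[OF w(2,1)])
    from id[OF this v] have "0 = lint \<Omega> (\<lambda>x. F x * ((s * w x + w0 x) ^ k * v x))" by simp
    also have "\<dots> = lint \<Omega> (\<lambda>x. \<Sum>i\<le>k. (of_nat (k choose i) * s ^ i) * (F x * (w x ^ i * w0 x ^ (k - i) * v x)))"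
      by (rule lint_cong) (simp add: binomial_ring power_mult_distrib sum_distrib_left sum_distrib_right mult_ac)
    also have "\<dots> = (\<Sum>i\<le>k. (of_nat (k choose i) * s ^ i) * lint \<Omega> (\<lambda>x. F x * (w x ^ i * w0 x ^ (k - i) * v x)))"
      by (subst lint_sum[OF S], (intro bi)[1], simp only: lint_cmult)
    finally show ?thesis by (simp add: c_def mult_ac)
  qed
  then have "c 1 = 0" using polyfun_eq_0[of c k] k by blast
  moreover have "(\<lambda>x. F x * (w x ^ 1 * w0 x ^ (k - 1) * v x)) = (\<lambda>x. (F x * w0 x ^ (k - 1)) * (w x * v x))" by (auto simp: mult_ac)
  ultimately show ?thesis using k by (simp add: c_def)
qed

lemma density:
  assumes F: "continuous_on (closure \<Omega>) F" and orth: "\<And>w v. w \<in> B.Sol \<Longrightarrow> v \<in> A.Sol \<Longrightarrow> lint \<Omega> (\<lambda>x. F x * (w x * v x)) = 0"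
    and x: "x \<in> \<Omega>"
  shows "F x = 0"
proof -
  obtain C where C: "0 < C"
      "\<And>u q. bounded_Ck 2 \<Omega> u \<Longrightarrow> vanishes_at_frontier \<Omega> u \<Longrightarrow> bcont \<Omega> q \<Longrightarrow> (\<And>x. x \<in> \<Omega> \<Longrightarrow> 0 \<le> q x) \<Longrightarrow>
      lint \<Omega> (\<lambda>x. (u x)\<^sup>2) \<le> C * lint \<Omega> (\<lambda>x. (laplacian u x - q x * u x)\<^sup>2)" using energy_estimate[OF \<Omega>(1,2)] by blast
  \<comment> \<open>\<open>product_density\<close> asks for potentials continuous on the closure,
    whereas \<open>A.q\<close> and \<open>B.q\<close> carry information only inside.\<close>
  obtain p1 where p1: "continuous_on (closure \<Omega>) p1" "\<And>x. x \<in> \<Omega> \<Longrightarrow> p1 x = A.q x" using A.q_extension by blast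
  obtain p2 where p2: "continuous_on (closure \<Omega>) p2" "\<And>x. x \<in> \<Omega> \<Longrightarrow> p2 x = B.q x" using B.q_extension by blast
  have e1: "lint \<Omega> (\<lambda>x. (laplacian u x - p1 x * u x)\<^sup>2) = lint \<Omega> (\<lambda>x. (laplacian u x - A.q x * u x)\<^sup>2)" for u
    by (rule lint_cong) (simp add: p1(2))
  have e2: "lint \<Omega> (\<lambda>x. (laplacian u x - p2 x * u x)\<^sup>2) = lint \<Omega> (\<lambda>x. (laplacian u x - B.q x * u x)\<^sup>2)" for u
    by (rule lint_cong) (simp add: p2(2))
  show ?thesis
  proof (rule product_density[OF n3 \<Omega>(1,2) p2(1) p1(1) F B.Sol_bcont A.Sol_bcont C(1) _ _ orth x])
    show "\<exists>w\<in>B.Sol. lint \<Omega> (\<lambda>x. (exp_trig_sum K c b x - w x)\<^sup>2) \<le> C * lint \<Omega> (\<lambda>x. (laplacian (exp_trig_sum K c b) x - p2 x * exp_trig_sum K c b x)\<^sup>2)" for K c b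
      unfolding e2 by (rule B.Sol_approximation[OF C(2)])
    show "\<exists>w\<in>A.Sol. lint \<Omega> (\<lambda>x. (exp_trig_sum K c b x - w x)\<^sup>2) \<le> C * lint \<Omega> (\<lambda>x. (laplacian (exp_trig_sum K c b) x - p1 x * exp_trig_sum K c b x)\<^sup>2)" for K c b
      unfolding e1 by (rule A.Sol_approximation[OF C(2)])
  qed
qed

lemma dz_agree: "k \<le> m + 1 \<Longrightarrow> x \<in> \<Omega> \<Longrightarrow> dz k a1 x (\<Phi> x) 0 = dz k a2 x (\<Phi> x) 0"
proof (induction k arbitrary: x rule: less_induct)
  case (less k)
  show ?case
  proof (cases "k = 0")
    case True
    then show ?thesis using A.a\<Phi>[OF less.prems(2)] B.a\<Phi>[OF less.prems(2)] by (simp add: dz_def)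
  next
    case False
    then have k: "1 \<le> k" "k \<le> m + 1" using less by auto
    have eq: "dz i a1 y (\<Phi> y) 0 = dz i a2 y (\<Phi> y) 0" if "i < k" "y \<in> \<Omega>" for i y using less.IH[OF that(1) _ that(2)] that k by simp
    obtain F1 where F1: "continuous_on (closure \<Omega>) F1" "\<And>x. x \<in> \<Omega> \<Longrightarrow> F1 x = dz k a1 x (\<Phi> x) 0"
      using dz_extension[OF A.a, of k] k by auto
    obtain F2 where F2: "continuous_on (closure \<Omega>) F2" "\<And>x. x \<in> \<Omega> \<Longrightarrow> F2 x = dz k a2 x (\<Phi> x) 0"
      using dz_extension[OF B.a, of k] k by auto
    define F where "F = (\<lambda>x. F1 x - F2 x)"
    have Fc: "continuous_on (closure \<Omega>) F" unfolding F_def by (intro continuous_intros F1 F2)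
    have Fb: "bcont \<Omega> F" by (rule bcont_compact[OF _ Fc closure_subset]) (use \<Omega> in auto)
    have F: "F x = dz k a1 x (\<Phi> x) 0 - dz k a2 x (\<Phi> x) 0" if "x \<in> \<Omega>" for x using F1(2) F2(2) that by (simp add: F_def)
    have id: "lint \<Omega> (\<lambda>x. F x * (w x ^ k * v x)) = 0" if "w \<in> B.Sol" "v \<in> A.Sol" for w v
      by (rule integral_identity[OF k eq Fb F that])
    have z: "F y * w0 y ^ (k - 1) = 0" if w0: "w0 \<in> B.Sol" and y: "y \<in> \<Omega>" for w0 y
    proof (rule density[OF _ _ y])
      show "continuous_on (closure \<Omega>) (\<lambda>y. F y * w0 y ^ (k - 1))"
        by (intro continuous_intros Fc B.Y_cont[OF B.Sol_Y[OF w0]])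
      show "lint \<Omega> (\<lambda>x. F x * w0 x ^ (k - 1) * (w x * v x)) = 0" if "w \<in> B.Sol" "v \<in> A.Sol" for w v
        by (rule polarized_identity[OF k(1) Fb id w0 that])
    qed
    have "F x = 0"
    proof (rule density[OF Fc _ less.prems(2)])
      fix w v assume w: "w \<in> B.Sol" and v: "v \<in> A.Sol"
      show "lint \<Omega> (\<lambda>x. F x * (w x * v x)) = 0"
      proof (cases "k = 1")
        case True
        then show ?thesis using id[OF w v] by simp
      next
        case False
        \<comment> \<open>As \<open>k - 1 > 0\<close>, a zero of \<open>w y ^ (k - 1)\<close> is a
          zero of \<open>w y\<close>; if it is not zero, then \<open>F y = 0\<close>.\<close>
        have "F y * (w y * v y) = 0" if "y \<in> \<Omega>" for y using z[OF w that] False by auto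
        then have "lint \<Omega> (\<lambda>x. F x * (w x * v x)) = lint \<Omega> (\<lambda>x. 0)" by (intro lint_cong) auto
        then show ?thesis by simp
      qed
    qed
    then show ?thesis using F[OF less.prems(2)] by simp
  qed
qed

end

theorem theorem7p10:
  fixes \<Omega> :: "(real ^ 'n) set"
    and m :: nat
    and \<alpha> \<delta>1 \<delta>2 :: real
    and a1 a2 :: "(real ^ 'n) \<times> real \<times> (real ^ 'n) \<Rightarrow> real"
    and V1 V2 :: "(real ^ 'n \<Rightarrow> real) set"
  assumes "CARD('n) \<ge> 3"
    and "0 < \<alpha>" and "\<alpha> < 1"
    and "open \<Omega>" and "connected \<Omega>" and "bounded \<Omega>" and "\<Omega> \<noteq> {}"
    and "holder_boundary (m + 2) \<alpha> \<Omega>"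
    and "holder_on (2 * m + 1) \<alpha> (\<Omega> \<times> UNIV \<times> UNIV) a1"
    and "holder_on (2 * m + 1) \<alpha> (\<Omega> \<times> UNIV \<times> UNIV) a2"
    and "\<And>x z p. x \<in> closure \<Omega> \<Longrightarrow> a1 (x, z, p) > 0"
    and "\<And>x z p. x \<in> closure \<Omega> \<Longrightarrow> a2 (x, z, p) > 0"
    and "\<And>x z p p'. x \<in> closure \<Omega> \<Longrightarrow> a1 (x, z, p) = a1 (x, z, p')"
    and "\<And>x z p p'. x \<in> closure \<Omega> \<Longrightarrow> a2 (x, z, p) = a2 (x, z, p')"
    and "\<And>x p. x \<in> \<Omega> \<Longrightarrow> a1 (x, (norm x)\<^sup>2 / 2, p) = 1"
    and "\<And>x p. x \<in> \<Omega> \<Longrightarrow> a2 (x, (norm x)\<^sup>2 / 2, p) = 1"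
    and "\<And>x p. x \<in> \<Omega> \<Longrightarrow> deriv (\<lambda>z. a1 (x, z, p)) ((norm x)\<^sup>2 / 2) \<ge> 0"
    and "\<And>x p. x \<in> \<Omega> \<Longrightarrow> deriv (\<lambda>z. a2 (x, z, p)) ((norm x)\<^sup>2 / 2) \<ge> 0"
    and "locally_wellposed m \<alpha> \<Omega> a1 \<delta>1 V1"
    and "locally_wellposed m \<alpha> \<Omega> a2 \<delta>2 V2"
    and "cauchy_data m \<alpha> \<Omega> a1 \<delta>1 V1 = cauchy_data m \<alpha> \<Omega> a2 \<delta>2 V2"
  shows "\<forall>k. 1 \<le> k \<and> k \<le> m + 1 \<longrightarrow>
    (\<forall>x\<in>\<Omega>. \<forall>p. (deriv ^^ k) (\<lambda>z. a1 (x, z, p)) ((norm x)\<^sup>2 / 2) =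
                (deriv ^^ k) (\<lambda>z. a2 (x, z, p)) ((norm x)\<^sup>2 / 2))"
proof -
  obtain \<epsilon>1 D1 where 1: "0 < \<epsilon>1" "\<epsilon>1 \<le> \<delta>1" "frechet_derivs (m + 1) (bdry_space (m + 2) \<alpha> \<Omega>) (bdry_norm (m + 2) \<alpha> \<Omega>)
          (holder_space (m + 2) \<alpha> \<Omega>) (holder_norm (m + 2) \<alpha> \<Omega>) (bdry_ball (m + 2) \<alpha> \<Omega> \<epsilon>1) (MA_solution \<Omega> a1 V1) D1"
    using assms(19) unfolding locally_wellposed_def frechet_Ck_on_iff by (elim conjE exE) (rule that)
  obtain \<epsilon>2 D2 where 2: "0 < \<epsilon>2" "\<epsilon>2 \<le> \<delta>2" "frechet_derivs (m + 1) (bdry_space (m + 2) \<alpha> \<Omega>) (bdry_norm (m + 2) \<alpha> \<Omega>)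
          (holder_space (m + 2) \<alpha> \<Omega>) (holder_norm (m + 2) \<alpha> \<Omega>) (bdry_ball (m + 2) \<alpha> \<Omega> \<epsilon>2) (MA_solution \<Omega> a2 V2) D2"
    using assms(20) unfolding locally_wellposed_def frechet_Ck_on_iff by (elim conjE exE) (rule that)
  have \<Phi>: "\<Phi> x = (norm x)\<^sup>2 / 2" for x :: "real ^ 'n" by (simp add: \<Phi>_def)
  interpret MA_pair \<Omega> m \<alpha> a1 \<delta>1 V1 \<epsilon>1 D1 a2 \<delta>2 V2 \<epsilon>2 D2
  proof unfold_locales
    show "V1 \<subseteq> holder_space (m + 2) \<alpha> \<Omega>" "V2 \<subseteq> holder_space (m + 2) \<alpha> \<Omega>"
      "MA_solution \<Omega> a1 V1 (on_set (frontier \<Omega>) \<Phi>) = on_set (closure \<Omega>) \<Phi>"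
      "MA_solution \<Omega> a2 V2 (on_set (frontier \<Omega>) \<Phi>) = on_set (closure \<Omega>) \<Phi>"
      using assms(19,20) unfolding locally_wellposed_def by blast+
    show "\<exists>!u. u \<in> V1 \<and> MA_solves \<Omega> a1 \<eta> u" if "\<eta> \<in> bdry_ball (m + 2) \<alpha> \<Omega> \<delta>1" for \<eta>
      using assms(19) that unfolding locally_wellposed_def by blast
    show "\<exists>!u. u \<in> V2 \<and> MA_solves \<Omega> a2 \<eta> u" if "\<eta> \<in> bdry_ball (m + 2) \<alpha> \<Omega> \<delta>2" for \<eta>
      using assms(20) that unfolding locally_wellposed_def by blast
  qed (fact 1 2 | simp only: \<Phi>, fact | fact)+
  show ?thesis
  proof (intro allI impI ballI)
    fix k x and p :: "real ^ 'n" assume k: "1 \<le> k \<and> k \<le> m + 1" and x: "x \<in> \<Omega>"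
    have xc: "x \<in> closure \<Omega>" using x closure_subset by blast
    \<comment> \<open>The comparison was carried out at \<open>p = 0\<close>; independence of
      \<open>p\<close> transports it to every \<open>p\<close>.\<close>
    have "(\<lambda>z. a1 (x, z, p)) = (\<lambda>z. a1 (x, z, 0))" "(\<lambda>z. a2 (x, z, p)) = (\<lambda>z. a2 (x, z, 0))"
      using A.ap[OF xc, of _ p 0] B.ap[OF xc, of _ p 0] by auto
    then show "(deriv ^^ k) (\<lambda>z. a1 (x, z, p)) ((norm x)\<^sup>2 / 2) = (deriv ^^ k) (\<lambda>z. a2 (x, z, p)) ((norm x)\<^sup>2 / 2)"
      using dz_eq_deriv[OF A.a x, of k 0] dz_eq_deriv[OF B.a x, of k 0] dz_agree[OF _ x, of k] k by (simp add: \<Phi>)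
  qed
qed

end
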